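(* Let $\mathcal Y_n$ be the eigenspace of the Laplacian on the round unit sphere $S^2$ corresponding to the eigenvalue $\lambda_n=n(n+1)$, and let $\mu(\mathcal Y_n)$ be the expected number of critical points of a random function in $\mathcal Y_n$. Then $$\mu(\mathcal Y_n)\sim\frac{2}{\sqrt3}\,n^2\qquad\text{as }n\to\infty .$$
   Context: $\mathcal Y_n$ is equipped with the $L^2$ inner product on $S^2$ (round metric of radius $1$). By definition $\mu(\mathcal Y_n)=\frac{1}{\mathrm{area}(S(\mathcal Y_n))}\int_{S(\mathcal Y_n)}\mu(v)\,|dS(v)|$, where $S(\mathcal Y_n)$ is the unit sphere of $\mathcal Y_n$ with its area measure and $\mu(v)$ is the number of critical points of $v:S^2\to\mathbb R$. $a_n\sim b_n$ means $a_n/b_n\to1$. *)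

theory Defs
  imports "HOL-Analysis.Analysis" "HOL-Library.Landau_Symbols"
begin

text \<open>
  The round sphere $S^2$ is \<^term>\<open>sphere 0 1 :: (real^3) set\<close>.  A function on $S^2$ is represented by
  a function on the ambient space of which only the values on the sphere matter; members of function
  spaces are normalised to vanish off the sphere, so that equal functions on $S^2$ are equal in HOL.
\<close>

section \<open>Differential calculus on the sphere\<close>

text \<open>
  The extension of a function from the sphere to the punctured space that is constant along rays
  (\<^term>\<open>sgn x\<close> is \<^term>\<open>x /\<^sub>R norm x\<close>).
\<close>

definition radial_ext :: "(real^3 \<Rightarrow> 'b) \<Rightarrow> real^3 \<Rightarrow> 'b" where
  "radial_ext f = (\<lambda>x. f (sgn x))"

fun C_k_on :: "nat \<Rightarrow> (real^3) set \<Rightarrow> (real^3 \<Rightarrow> real) \<Rightarrow> bool" where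
  "C_k_on 0 U F \<longleftrightarrow> continuous_on U F"
| "C_k_on (Suc k) U F \<longleftrightarrow>
     (\<forall>x\<in>U. F differentiable (at x)) \<and> (\<forall>e. C_k_on k U (\<lambda>x. frechet_derivative F (at x) e))"

definition smooth_on_S2 :: "(real^3 \<Rightarrow> real) \<Rightarrow> bool" where
  "smooth_on_S2 f \<longleftrightarrow> (\<forall>k. C_k_on k (- {0}) (radial_ext f))"

text \<open>
  At a point of the sphere the Euclidean gradient of the radially constant extension is tangent to
  the sphere, so it is the Riemannian gradient.
\<close>

definition grad_S2 :: "(real^3 \<Rightarrow> real) \<Rightarrow> real^3 \<Rightarrow> real^3" where
  "grad_S2 f p = (\<Sum>e\<in>Basis. frechet_derivative (radial_ext f) (at p) e *\<^sub>R e)"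

text \<open>
  For a tangent field the Riemannian divergence at \<open>p\<close> is the trace over the tangent plane of the
  tangential part of the derivative.  The trace over the whole ambient space gives the same value,
  as the derivative of the radially constant extension vanishes in the direction \<open>p\<close>.
\<close>

definition div_S2 :: "(real^3 \<Rightarrow> real^3) \<Rightarrow> real^3 \<Rightarrow> real" where
  "div_S2 X p = (\<Sum>e\<in>Basis. frechet_derivative (radial_ext X) (at p) e \<bullet> e)"

text \<open>The sign is chosen such that the spectrum is nonnegative.\<close>

definition laplacian_S2 :: "(real^3 \<Rightarrow> real) \<Rightarrow> real^3 \<Rightarrow> real" where
  "laplacian_S2 f p = - div_S2 (grad_S2 f) p"

definition laplace_eigenspace :: "real \<Rightarrow> (real^3 \<Rightarrow> real) set" where
  "laplace_eigenspace l =
     {f. smooth_on_S2 f \<and> (\<forall>x. x \<notin> sphere 0 1 \<longrightarrow> f x = 0) \<and>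
         (\<forall>p\<in>sphere 0 1. laplacian_S2 f p = l * f p)}"

definition num_critical_points :: "(real^3 \<Rightarrow> real) \<Rightarrow> ennreal" where
  "num_critical_points f =
     emeasure (count_space UNIV) {p \<in> sphere 0 1. grad_S2 f p = 0}"

section \<open>The $L^2$ inner product\<close>

text \<open>
  The area of a set \<open>A\<close> on the unit sphere of a \<open>d\<close>-dimensional Euclidean space is \<open>d\<close> times the
  volume of the cone \<open>{x. 0 < norm x \<le> 1 \<and> x /\<^sub>R norm x \<in> A}\<close>.
\<close>

definition area_S2 :: "(real^3) measure" where
  "area_S2 = scale_measure 3
     (distr (restrict_space lborel (cball 0 1 - {0})) (restrict_space borel (sphere 0 1)) sgn)"

definition inner_S2 :: "(real^3 \<Rightarrow> real) \<Rightarrow> (real^3 \<Rightarrow> real) \<Rightarrow> real" where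
  "inner_S2 f g = (\<integral>p. f p * g p \<partial>area_S2)"

section \<open>Averages over the unit sphere of a space of functions\<close>

text \<open>
  Area measure on the unit sphere of the Euclidean space of functions \<open>I \<Rightarrow> real\<close>, for a finite set
  \<open>I\<close> (the dimension is not a type parameter, so \<open>PiM\<close> is used).
\<close>

definition area_coord_sphere :: "'i set \<Rightarrow> ('i \<Rightarrow> real) measure" where
  "area_coord_sphere I = scale_measure (of_nat (card I))
     (distr (restrict_space (PiM I (\<lambda>_. lborel)) {x. 0 < L2_set x I \<and> L2_set x I \<le> 1})
            (restrict_space (PiM I (\<lambda>_. borel)) {x. L2_set x I = 1})
            (\<lambda>x. \<lambda>i\<in>I. x i / L2_set x I))"

definition lin_comb :: "(real^3 \<Rightarrow> real) set \<Rightarrow> ((real^3 \<Rightarrow> real) \<Rightarrow> real) \<Rightarrow> real^3 \<Rightarrow> real" where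
  "lin_comb B c = (\<lambda>p. \<Sum>b\<in>B. c b * b p)"

definition orthonormal_basis :: "(real^3 \<Rightarrow> real) set \<Rightarrow> (real^3 \<Rightarrow> real) set \<Rightarrow> bool" where
  "orthonormal_basis V B \<longleftrightarrow> finite B \<and>
     (\<forall>b\<in>B. \<forall>b'\<in>B. inner_S2 b b' = (if b = b' then 1 else 0)) \<and>
     V = range (lin_comb B)"

text \<open>
  The area measure on the unit sphere of a finite-dimensional space \<open>V\<close>, transported from coordinate
  space by an orthonormal basis; by rotation invariance it does not depend on the basis.
\<close>

definition area_unit_sphere :: "(real^3 \<Rightarrow> real) set \<Rightarrow> (real^3 \<Rightarrow> real) measure" where
  "area_unit_sphere V =
     (let B = (SOME B. orthonormal_basis V B) in embed_measure (area_coord_sphere B) (lin_comb B))"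

text \<open>
  A function with infinitely many critical points counts as \<open>\<infinity>\<close>, so the mean is an extended real
  number.  For the constant functions it is \<open>\<infinity>\<close>, which \<^const>\<open>enn2real\<close> maps to \<open>0\<close>; a ratio of
  such real parts to a positive sequence can tend to \<open>1\<close> only if the means are eventually finite.
\<close>

definition mean_critical_points :: "(real^3 \<Rightarrow> real) set \<Rightarrow> ennreal" where
  "mean_critical_points V =
     (\<integral>\<^sup>+ v. num_critical_points v \<partial>area_unit_sphere V) /
     emeasure (area_unit_sphere V) (space (area_unit_sphere V))"

end

theory Submission
  imports Defs "HOL-Probability.Probability" "HOL-Real_Asymp.Real_Asymp"
begin

text \<open>
  For $n \ge 2$ and $\lambda = n(n+1)$ the mean number of critical points has the closed form
  $2 + 2(\lambda-2)\sqrt{(\lambda-2)/(3\lambda-2)}$ (\<open>mean_critical_points_eigenspace\<close>), and the theorem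
  is its leading term.  The closed form comes from a Kac--Rice computation; three ideas carry it.

  \<^item> \<^emph>\<open>From the sphere of functions to Gaussian coefficients.\<close>  The number of critical points of
    $v = \sum_b c_b b$ does not change when $c$ is scaled, so its average over the unit sphere of
    coefficients is the average for independent standard Gaussian coefficients
    (\<open>ball_average_eq_gauss_average\<close>).  For this there must be a finite orthonormal basis:
    $|x|^n v(x/|x|)$ is harmonic, so by the mean value property point evaluations are bounded in
    the $L^2$ norm, which bounds the size of orthonormal sets (\<open>eigenspace_sup_bound\<close>,
    \<open>orthonormal_basis_eigenspace_exists\<close>).

  \<^item> \<^emph>\<open>Kac--Rice.\<close>  In a chart the critical points are the zeros of a planar field that is linear in
    $c$.  Fix all coefficients but two, $c_a$ and $c_b$.  Where the corresponding minor does not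
    vanish, \<open>x\<close> is a zero exactly if $(c_a, c_b)$ is the solution of a linear system depending on
    \<open>x\<close>; counting zeros is thus counting preimages under a smooth map of the plane, and the area
    formula (\<open>nn_integral_card_preimage\<close>) turns the mean into the integral over \<open>x\<close> of the
    absolute Jacobian, conditioned on a zero at \<open>x\<close> (\<open>linear_field.expected_zeros\<close>).

  \<^item> \<^emph>\<open>Symmetry.\<close>  The kernel $\sum_b b(p) b(q)$ is invariant under rotations, so infinitesimal
    rotations act on coefficient space by antisymmetric matrices that satisfy the commutation
    relations of $so(3)$.  These relations alone determine all inner products of the vectors
    $b(p)$, $\nabla b(p)$, $\nabla^2 b(p)$ indexed by the basis (\<open>so3_action.zonal_vector_gram\<close>,
    \<open>eigenbasis.jet_gram\<close>): with $\tau = \sum_b b(p)^2$, the value, the gradient and the trace-free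
    Hessian are independent, the gradient components have variance $\lambda\tau/2$, and the two
    components of the trace-free Hessian, $\partial_{11} - \partial_{22}$ and $2\partial_{12}$,
    have variance $\lambda(\lambda-2)\tau/2$.  At a critical point the trace of the Hessian is
    $-\lambda v(p)$, so its determinant is $(\lambda^2 v(p)^2 - P^2 - Q^2)/4$ with $P$, $Q$ those
    two components, and the mean of its absolute value is elementary
    (\<open>nn_integral_gauss_quadratic\<close>).

  The stereographic chart misses one point, which is critical with probability zero.
\<close>

section \<open>The area formula with multiplicity\<close>

text \<open>
  The change of variables for absolutely integrable functions, applied to \<open>f\<close> as a function with
  values in the vector space $\mathbb R^1$.
\<close>

lemma nn_integral_change_of_variables_inj:
  fixes g :: "real^'n::{finite,wellorder} \<Rightarrow> real^'n::{finite,wellorder}" and f :: "real^'n::{finite,wellorder} \<Rightarrow> real"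
  assumes A: "A \<in> sets lebesgue" and inj: "inj_on g A"
    and der: "\<And>x. x \<in> A \<Longrightarrow> (g has_derivative g' x) (at x within A)"
    and f: "\<And>y. 0 \<le> f y" "integrable lborel f"
  shows "g ` A \<in> sets lebesgue"
    and "(\<integral>\<^sup>+ y. ennreal (f y) * indicator (g ` A) y \<partial>lborel) =
         (\<integral>\<^sup>+ x. ennreal (\<bar>det (matrix (g' x))\<bar> * f (g x)) * indicator A x \<partial>lborel)"
proof -
  show gA: "g ` A \<in> sets lebesgue"
    by (rule differentiable_image_in_sets_lebesgue[OF A])
       (use der in \<open>auto simp: differentiable_on_def differentiable_def\<close>)
  have "integrable lebesgue f"
    using f(2) by (simp add: integrable_completion)
  then have "f absolutely_integrable_on UNIV"
    by (simp add: set_integrable_def)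
  then have fi: "f absolutely_integrable_on (g ` A)"
    by (rule set_integrable_subset) (use gA in auto)
  define F :: "real^'n::{finite,wellorder} \<Rightarrow> real^1" where "F = (\<lambda>y. vec (f y))"
  have Fi: "F absolutely_integrable_on (g ` A)"
    using fi by (simp add: absolutely_integrable_on_1_iff F_def)
  define b where "b = integral (g ` A) F"
  have cov: "(\<lambda>x. \<bar>det (matrix (g' x))\<bar> *\<^sub>R F (g x)) absolutely_integrable_on A \<and>
      integral A (\<lambda>x. \<bar>det (matrix (g' x))\<bar> *\<^sub>R F (g x)) = b"
    using has_absolute_integral_change_of_variables[OF A der inj, of F b] Fi by (auto simp: b_def)
  have i1: "(f has_integral b $ 1) (g ` A)"
    using Fi fi by (auto simp: b_def absolutely_integrable_on_def integral_on_1_eq F_def has_integral_integral)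
  have "(\<lambda>x. \<bar>det (matrix (g' x))\<bar> *\<^sub>R F (g x)) integrable_on A"
    using cov by (simp add: absolutely_integrable_on_def)
  then have "(\<lambda>x. \<bar>det (matrix (g' x))\<bar> * f (g x)) integrable_on A"
    by (simp add: integrable_on_1_iff F_def)
  moreover have "integral A (\<lambda>x. \<bar>det (matrix (g' x))\<bar> * f (g x)) = b $ 1"
    using cov by (auto simp: integral_on_1_eq F_def vec_eq_iff)
  ultimately have i2: "((\<lambda>x. \<bar>det (matrix (g' x))\<bar> * f (g x)) has_integral b $ 1) A"
    by (simp add: has_integral_iff)
  show "(\<integral>\<^sup>+ y. ennreal (f y) * indicator (g ` A) y \<partial>lborel) =
         (\<integral>\<^sup>+ x. ennreal (\<bar>det (matrix (g' x))\<bar> * f (g x)) * indicator A x \<partial>lborel)"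
    using nn_integral_has_integral_lebesgue'[OF _ i1] nn_integral_has_integral_lebesgue'[OF _ i2] f
    by simp
qed

text \<open>
  A left inverse of the derivative at \<open>a\<close> and continuity of the derivative in the operator norm
  are what the inverse function theorem needs; the norm is controlled on the basis vectors.
\<close>

lemma locally_injective_nonsingular:
  fixes g :: "real^'n::{finite,wellorder} \<Rightarrow> real^'n::{finite,wellorder}"
  assumes W: "open W" "a \<in> W"
    and der: "\<And>x. x \<in> W \<Longrightarrow> (g has_derivative g' x) (at x)"
    and cont: "\<And>e. continuous_on W (\<lambda>x. g' x e)"
    and det: "det (matrix (g' a)) \<noteq> 0"
  obtains r where "r > 0" "ball a r \<subseteq> W" "inj_on g (ball a r)"
proof -
  have lin: "linear (g' x)" if "x \<in> W" for x
    using der[OF that] has_derivative_linear by blast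
  have "inj (g' a)"
    using det lin[OF W(2)] det_nz_iff_inj by blast
  then obtain h where h: "linear h" "h \<circ> g' a = id"
    using linear_injective_left_inverse[OF lin[OF W(2)]] by blast
  have on: "\<exists>d>0. \<forall>x. dist a x < d \<longrightarrow> onorm (\<lambda>v. g' x v - g' a v) < e" if e: "e > 0" for e
  proof -
    have "continuous (at a) (\<lambda>x. \<Sum>i\<in>Basis. norm (g' x i - g' a i))"
      using cont W by (intro continuous_intros) (auto simp: continuous_on_eq_continuous_at)
    then have "((\<lambda>x. \<Sum>i\<in>Basis. norm (g' x i - g' a i)) \<longlongrightarrow> (\<Sum>i\<in>Basis. norm (g' a i - g' a i))) (at a)"
      by (simp add: continuous_at)
    then have "\<forall>\<^sub>F x in at a. (\<Sum>i\<in>Basis. norm (g' x i - g' a i)) < e"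
      using e by (auto intro: order_tendstoD(2))
    then obtain d where d: "d > 0" "\<And>x. x \<noteq> a \<Longrightarrow> dist x a < d \<Longrightarrow> (\<Sum>i\<in>Basis. norm (g' x i - g' a i)) < e"
      unfolding eventually_at by auto
    obtain d' where d': "d' > 0" "ball a d' \<subseteq> W"
      using W openE by blast
    have "onorm (\<lambda>v. g' x v - g' a v) < e" if "dist a x < min d d'" for x
    proof -
      have x: "x \<in> W" using that d' by auto
      have "bounded_linear (\<lambda>v. g' x v - g' a v)"
        using lin[OF x] lin[OF W(2)] by (intro bounded_linear_sub) (auto simp: linear_conv_bounded_linear)
      then have "onorm (\<lambda>v. g' x v - g' a v) \<le> (\<Sum>i\<in>Basis. norm (g' x i - g' a i))"
        by (rule onorm_componentwise)
      also have "\<dots> < e"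
        using d(2)[of x] that e by (cases "x = a") (auto simp: dist_commute)
      finally show ?thesis .
    qed
    then show ?thesis
      using d d' by (intro exI[of _ "min d d'"]) auto
  qed
  show ?thesis
    by (rule has_derivative_locally_injective[OF W(2) W(1) _ h(2) der on])
       (use h that in \<open>auto simp: linear_conv_bounded_linear\<close>)
qed

text \<open>
  Critical points of \<open>g\<close> have a null image by Sard's theorem and contribute nothing on the right.
  The remaining points are covered by countably many balls on which \<open>g\<close> is injective; on the
  disjoint pieces that these cut out, the claim is the usual change of variables, and the number of
  preimages of a value is the number of pieces whose image contains it.
\<close>

lemma nn_integral_card_preimage:
  fixes g :: "real^'n::{finite,wellorder} \<Rightarrow> real^'n::{finite,wellorder}" and f :: "real^'n::{finite,wellorder} \<Rightarrow> real"
  assumes W: "open W" and U: "U \<in> sets borel" "U \<subseteq> W"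
    and der: "\<And>x. x \<in> W \<Longrightarrow> (g has_derivative g' x) (at x)"
    and cont: "\<And>e. continuous_on W (\<lambda>x. g' x e)"
    and f: "\<And>y. 0 \<le> f y" "integrable lborel f"
  shows "(\<integral>\<^sup>+ y. emeasure (count_space UNIV) {x \<in> U. g x = y} * ennreal (f y) \<partial>lborel) =
         (\<integral>\<^sup>+ x. ennreal (\<bar>det (matrix (g' x))\<bar> * f (g x)) * indicator U x \<partial>lborel)"
proof -
  let ?D = "\<lambda>x. det (matrix (g' x))"
  define C where "C = {x \<in> U. ?D x = 0}"
  define W1 where "W1 = {x \<in> W. ?D x \<noteq> 0}"
  have contD: "continuous_on W ?D"
    unfolding det_def matrix_def
    by (intro continuous_intros) (auto intro!: continuous_intros cont)
  have "open (W \<inter> ?D -` (- {0}))"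
    using continuous_open_preimage[OF contD W, of "-{0}"] by auto
  moreover have "W1 = W \<inter> ?D -` (- {0})" by (auto simp: W1_def)
  ultimately have W1: "open W1" by simp
  have "\<exists>r>0. ball a r \<subseteq> W1 \<and> inj_on g (ball a r)" if "a \<in> W1" for a
    by (rule locally_injective_nonsingular[OF W1 that, of g g'])
       (use that der cont in \<open>auto simp: W1_def intro: continuous_on_subset\<close>)
  then obtain r where r: "\<And>a. a \<in> W1 \<Longrightarrow> r a > 0 \<and> ball a (r a) \<subseteq> W1 \<and> inj_on g (ball a (r a))"
    by metis
  obtain \<F> where F: "\<F> \<subseteq> (\<lambda>a. ball a (r a)) ` W1" "countable \<F>" "\<Union>\<F> = (\<Union>a\<in>W1. ball a (r a))"
    using Lindelof[of "(\<lambda>a. ball a (r a)) ` W1"] by auto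
  have UW1: "\<Union>\<F> = W1"
    using r F(3) by fastforce
  \<comment> \<open>The empty set makes the cover nonempty, so that it can be enumerated.\<close>
  define \<G> where "\<G> = insert {} \<F>"
  have G: "countable \<G>" "\<G> \<noteq> {}" "\<Union>\<G> = W1"
    using F UW1 by (auto simp: \<G>_def)
  define V where "V = from_nat_into \<G>"
  have rV: "range V = \<G>"
    unfolding V_def using G by (simp add: range_from_nat_into)
  have VG: "V i \<in> \<G>" for i using rV by auto
  have V: "open (V i)" "inj_on g (V i)" for i
    using VG[of i] F(1) r by (auto simp: \<G>_def)
  define A where "A i = U \<inter> disjointed V i" for i
  have dV: "disjointed V i \<in> sets borel" for i
    unfolding disjointed_def using V by auto
  have A: "A i \<in> sets borel" for i
    using U dV by (auto simp: A_def)
  have A_leb: "A i \<in> sets lebesgue" for i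
    using A by (simp add: sets_completionI_sets)
  have sub: "disjointed V i \<subseteq> V i" for i by (simp add: disjointed_subset)
  have A_inj: "inj_on g (A i)" for i
    using sub[of i] by (intro inj_on_subset[OF V(2)[of i]]) (auto simp: A_def)
  have AW: "A i \<subseteq> W1" for i
    using sub[of i] VG[of i] G(3) unfolding A_def by blast
  have UA: "(\<Union>i. A i) = U - C"
  proof -
    have "(\<Union>i. A i) = U \<inter> (\<Union>i. disjointed V i)" by (auto simp: A_def)
    also have "(\<Union>i. disjointed V i) = W1" using UN_disjointed_eq[of V] rV G(3) by simp
    finally show ?thesis using U(2) by (auto simp: C_def W1_def)
  qed
  have disjA: "disjoint_family A"
    using disjoint_family_disjointed[of V] by (auto simp: A_def disjoint_family_on_def)
  have derA: "(g has_derivative g' x) (at x within A i)" if "x \<in> A i" for x i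
    by (rule has_derivative_at_withinI, rule der) (use AW[of i] that W1_def in blast)
  note cv = nn_integral_change_of_variables_inj[OF A_leb A_inj derA f]
  \<comment> \<open>Sard: the critical values do not matter.\<close>
  have "negligible (g ` C)"
  proof (rule baby_Sard[where f' = g'])
    show "(g has_derivative g' x) (at x within C)" if "x \<in> C" for x
      by (rule has_derivative_at_withinI, rule der) (use U(2) that C_def in blast)
    show "rank (matrix (g' x)) < CARD('n)" if "x \<in> C" for x
      using that unfolding C_def by (simp add: det_eq_0_rank)
  qed simp
  then have nC: "g ` C \<in> null_sets lebesgue"
    by (simp add: negligible_iff_null_sets)
  have count: "emeasure (count_space UNIV) {x \<in> U. g x = y} = (\<Sum>i. indicator (g ` A i) y)"
    if "y \<notin> g ` C" for y
  proof -
    have eq: "{x \<in> U. g x = y} = (\<Union>i. {x \<in> A i. g x = y})"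
      using UA that by blast
    have "(\<Sum>i. emeasure (count_space UNIV) {x \<in> A i. g x = y}) = emeasure (count_space UNIV) {x \<in> U. g x = y}"
      unfolding eq using disjA
      by (intro suminf_emeasure) (auto simp: disjoint_family_on_def)
    moreover have "emeasure (count_space UNIV) {x \<in> A i. g x = y} = indicator (g ` A i) y" for i
    proof (cases "y \<in> g ` A i")
      case True
      then obtain x where "x \<in> A i" "g x = y" by auto
      then have "{x \<in> A i. g x = y} = {x}"
        using A_inj[of i] by (auto dest: inj_onD)
      then show ?thesis using True by simp
    next
      case False
      then have e: "{x \<in> A i. g x = y} = {}" by auto
      show ?thesis unfolding e using False by simp
    qed
    ultimately show ?thesis by simp
  qed
  have gA: "g ` A i \<in> sets lebesgue" for i using cv(1) .
  have fm: "f \<in> borel_measurable lebesgue"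
    using f(2) by (auto intro: measurable_completion)
  have Dm: "(\<lambda>x. ennreal (\<bar>?D x\<bar> * f (g x)) * indicator (A i) x) \<in> borel_measurable lborel" for i
  proof -
    have gc: "continuous_on W g"
      by (meson W continuous_at_imp_continuous_on der has_derivative_continuous)
    have "(\<lambda>x. \<bar>?D x\<bar> * f (g x)) \<in> borel_measurable (restrict_space borel W)"
    proof (intro borel_measurable_times borel_measurable_abs)
      show "?D \<in> borel_measurable (restrict_space borel W)"
        by (rule borel_measurable_continuous_on_restrict[OF contD])
      have "g \<in> borel_measurable (restrict_space borel W)"
        by (rule borel_measurable_continuous_on_restrict[OF gc])
      moreover have "f \<in> borel_measurable borel" using f(2) by simp
      ultimately show "(\<lambda>x. f (g x)) \<in> borel_measurable (restrict_space borel W)"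
        by (rule measurable_compose)
    qed
    then have "(\<lambda>x. \<bar>?D x\<bar> * f (g x)) \<in> borel_measurable (restrict_space borel (A i))"
      by (rule measurable_restrict_mono) (use AW[of i] W1_def in blast)
    then have "(\<lambda>x. indicator (A i) x *\<^sub>R (\<bar>?D x\<bar> * f (g x))) \<in> borel_measurable borel"
      using A[of i] by (subst (asm) borel_measurable_restrict_space_iff) auto
    then have "(\<lambda>x. ennreal (indicator (A i) x *\<^sub>R (\<bar>?D x\<bar> * f (g x)))) \<in> borel_measurable lborel"
      by simp
    also have "(\<lambda>x. ennreal (indicator (A i) x *\<^sub>R (\<bar>?D x\<bar> * f (g x)))) = (\<lambda>x. ennreal (\<bar>?D x\<bar> * f (g x)) * indicator (A i) x)"
      by (auto simp: indicator_def)
    finally show ?thesis .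
  qed
  have "(\<integral>\<^sup>+ y. emeasure (count_space UNIV) {x \<in> U. g x = y} * ennreal (f y) \<partial>lborel) =
        (\<integral>\<^sup>+ y. emeasure (count_space UNIV) {x \<in> U. g x = y} * ennreal (f y) \<partial>lebesgue)"
    by (simp add: nn_integral_completion)
  also have "\<dots> = (\<integral>\<^sup>+ y. (\<Sum>i. ennreal (f y) * indicator (g ` A i) y) \<partial>lebesgue)"
  proof (rule nn_integral_cong_AE, rule AE_I'[OF nC], rule subsetI, rule ccontr)
    fix y
    assume *: "y \<in> {y \<in> space lebesgue. emeasure (count_space UNIV) {x \<in> U. g x = y} * ennreal (f y)
        \<noteq> (\<Sum>i. ennreal (f y) * indicator (g ` A i) y)}" and "y \<notin> g ` C"
    have "emeasure (count_space UNIV) {x \<in> U. g x = y} * ennreal (f y) = (\<Sum>i. ennreal (f y) * indicator (g ` A i) y)"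
      unfolding count[OF \<open>y \<notin> g ` C\<close>] by (simp add: ennreal_suminf_cmult mult.commute)
    with * show False by blast
  qed
  also have "\<dots> = (\<Sum>i. \<integral>\<^sup>+ y. ennreal (f y) * indicator (g ` A i) y \<partial>lebesgue)"
    using fm gA by (intro nn_integral_suminf) auto
  also have "\<dots> = (\<Sum>i. \<integral>\<^sup>+ x. ennreal (\<bar>?D x\<bar> * f (g x)) * indicator (A i) x \<partial>lborel)"
    using cv(2) by (simp add: nn_integral_completion)
  also have "\<dots> = (\<integral>\<^sup>+ x. (\<Sum>i. ennreal (\<bar>?D x\<bar> * f (g x)) * indicator (A i) x) \<partial>lborel)"
    using Dm by (intro nn_integral_suminf[symmetric])
  also have "\<dots> = (\<integral>\<^sup>+ x. ennreal (\<bar>?D x\<bar> * f (g x)) * indicator U x \<partial>lborel)"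
  proof (intro nn_integral_cong)
    fix x
    have "(\<Sum>i. ennreal (\<bar>?D x\<bar> * f (g x)) * indicator (A i) x) = ennreal (\<bar>?D x\<bar> * f (g x)) * indicator (\<Union>i. A i) x"
      using suminf_indicator[OF disjA, of x] by simp
    also have "\<dots> = ennreal (\<bar>?D x\<bar> * f (g x)) * indicator U x"
      unfolding UA by (auto simp: indicator_def C_def)
    finally show "(\<Sum>i. ennreal (\<bar>?D x\<bar> * f (g x)) * indicator (A i) x) = \<dots>" .
  qed
  finally show ?thesis .
qed

section \<open>Measurability of the number of zeros\<close>

lemma finite_card_le_emeasure_count_space:
  assumes "\<And>T. finite T \<Longrightarrow> T \<subseteq> Z \<Longrightarrow> of_nat (card T) \<le> (s::ennreal)"
  shows "emeasure (count_space UNIV) Z \<le> s"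
proof (cases "finite Z")
  case True
  then show ?thesis using assms[of Z] by simp
next
  case False
  have "of_nat n \<le> s" for n
  proof -
    obtain T where "T \<subseteq> Z" "finite T" "card T = n"
      using infinite_arbitrarily_large[OF False] by blast
    then show ?thesis using assms[of T] by auto
  qed
  then have "(SUP n. of_nat n :: ennreal) \<le> s" by (intro SUP_least)
  then show ?thesis by (simp add: ennreal_SUP_of_nat_eq_top top_unique)
qed

text \<open>
  On a compact set a zero exists if and only if the infimum of the norm is \<open>0\<close>, and by continuity
  this infimum may be taken over a countable dense subset.
\<close>

lemma sets_exists_zero_compact:
  fixes G :: "'i \<Rightarrow> 'a::euclidean_space \<Rightarrow> 'b::euclidean_space"
  assumes I: "finite I" and K: "compact K" and G: "\<And>b. b \<in> I \<Longrightarrow> continuous_on K (G b)"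
  shows "{c \<in> space (Pi\<^sub>M I (\<lambda>_. borel)). \<exists>x\<in>K. (\<Sum>b\<in>I. c b *\<^sub>R G b x) = 0} \<in> sets (Pi\<^sub>M I (\<lambda>_. borel))"
proof (cases "K = {}")
  case False
  obtain D where D: "countable D" "D \<subseteq> K" "K \<subseteq> closure D"
    using separable by blast
  have Dne: "D \<noteq> {}" using D False by auto
  define d where "d = from_nat_into D"
  have rd: "range d = D" using D Dne by (simp add: d_def range_from_nat_into)
  have cF: "continuous_on K (\<lambda>x. \<Sum>b\<in>I. c b *\<^sub>R G b x)" for c
    by (intro continuous_intros G)
  have "(\<exists>x\<in>K. (\<Sum>b\<in>I. c b *\<^sub>R G b x) = 0) \<longleftrightarrow>
        (\<forall>n. \<exists>k. norm (\<Sum>b\<in>I. c b *\<^sub>R G b (d k)) < 1 / real (Suc n))" (is "?L = ?R") for c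
  proof
    assume ?L
    then obtain x where x: "x \<in> K" "(\<Sum>b\<in>I. c b *\<^sub>R G b x) = 0" by blast
    show ?R
    proof
      fix n
      have "1 / real (Suc n) > 0" by simp
      then obtain e where e: "e > 0"
        "\<And>y. y \<in> K \<Longrightarrow> dist y x < e \<Longrightarrow> dist (\<Sum>b\<in>I. c b *\<^sub>R G b y) (\<Sum>b\<in>I. c b *\<^sub>R G b x) < 1 / real (Suc n)"
        using cF x(1) unfolding continuous_on_iff by metis
      obtain y where "y \<in> D" "dist y x < e"
        using D x(1) e(1) unfolding closure_approachable by (meson closure_approachable subsetD)
      moreover obtain k where "d k = y" using \<open>y \<in> D\<close> rd by (metis imageE)
      ultimately show "\<exists>k. norm (\<Sum>b\<in>I. c b *\<^sub>R G b (d k)) < 1 / real (Suc n)"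
        using e(2)[of y] D(2) x by (auto intro!: exI[of _ k])
    qed
  next
    assume R: ?R
    obtain x where x: "x \<in> K" "\<And>y. y \<in> K \<Longrightarrow> norm (\<Sum>b\<in>I. c b *\<^sub>R G b x) \<le> norm (\<Sum>b\<in>I. c b *\<^sub>R G b y)"
      using continuous_attains_inf[OF K False continuous_on_norm[OF cF]] by blast
    have "norm (\<Sum>b\<in>I. c b *\<^sub>R G b x) \<le> 0"
    proof (rule ccontr)
      assume "\<not> norm (\<Sum>b\<in>I. c b *\<^sub>R G b x) \<le> 0"
      then obtain n where "1 / real (Suc n) < norm (\<Sum>b\<in>I. c b *\<^sub>R G b x)"
        using nat_approx_posE not_le by metis
      moreover obtain k where "norm (\<Sum>b\<in>I. c b *\<^sub>R G b (d k)) < 1 / real (Suc n)" using R by blast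
      moreover have "d k \<in> K" using rd D(2) by auto
      ultimately show False using x(2)[of "d k"] by linarith
    qed
    then show ?L using x by auto
  qed
  moreover have "{c \<in> space (Pi\<^sub>M I (\<lambda>_. borel)). \<forall>n. \<exists>k. norm (\<Sum>b\<in>I. c b *\<^sub>R G b (d k)) < 1 / real (Suc n)}
      \<in> sets (Pi\<^sub>M I (\<lambda>_. borel))"
    by measurable
  ultimately show ?thesis by simp
qed simp

text \<open>
  The number of zeros is the supremum, over finite families of basic open sets with disjoint
  closures, of the number of closures that contain a zero: finitely many zeros are separated by
  small basic neighbourhoods.  There are countably many such families, and each closure meets the
  compact set in a compact set.
\<close>

lemma measurable_card_zeros_compact:
  fixes G :: "'i \<Rightarrow> 'a::euclidean_space \<Rightarrow> 'b::euclidean_space"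
  assumes I: "finite I" and K: "compact K" and G: "\<And>b. b \<in> I \<Longrightarrow> continuous_on K (G b)"
  shows "(\<lambda>c. emeasure (count_space UNIV) {x \<in> K. (\<Sum>b\<in>I. c b *\<^sub>R G b x) = 0})
         \<in> borel_measurable (Pi\<^sub>M I (\<lambda>_. borel))"
proof -
  obtain \<B> :: "'a set set" where B: "countable \<B>" "topological_basis \<B>"
    using ex_countable_basis by blast
  define \<F> where "\<F> = {F. finite F \<and> F \<subseteq> \<B> \<and> disjoint_family_on closure F}"
  have cF: "countable \<F>"
    by (rule countable_subset[OF _ countable_Collect_finite_subset[OF B(1)]]) (auto simp: \<F>_def)
  define Z where "Z c = {x \<in> K. (\<Sum>b\<in>I. c b *\<^sub>R G b x) = 0}" for c
  define h where "h c B = (if \<exists>x\<in>K \<inter> closure B. (\<Sum>b\<in>I. c b *\<^sub>R G b x) = 0 then 1 else 0::ennreal)" for c B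
  have hm: "(\<lambda>c. h c B) \<in> borel_measurable (Pi\<^sub>M I (\<lambda>_. borel))" for B
    unfolding h_def
    by (intro measurable_If measurable_const sets_exists_zero_compact[OF I])
       (use K in \<open>auto intro!: continuous_on_subset[OF G]\<close>)
  have "emeasure (count_space UNIV) (Z c) = (SUP F\<in>\<F>. \<Sum>B\<in>F. h c B)" for c
  proof (rule antisym)
    show "emeasure (count_space UNIV) (Z c) \<le> (SUP F\<in>\<F>. \<Sum>B\<in>F. h c B)"
    proof (rule finite_card_le_emeasure_count_space)
      fix T assume T: "finite T" "T \<subseteq> Z c"
      \<comment> \<open>The minimal distance of the given zeros, cut off at 1.\<close>
      define e where "e = Min (insert 1 ((\<lambda>(x, y). dist x y) ` {(x, y) \<in> T \<times> T. x \<noteq> y}))"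
      have fin: "finite (insert 1 ((\<lambda>(x, y). dist x y) ` {(x, y) \<in> T \<times> T. x \<noteq> y}))"
        by (intro finite.insertI finite_imageI finite_subset[OF _ finite_cartesian_product[OF T(1) T(1)]]) auto
      have e0: "e > 0" unfolding e_def using fin by (subst Min_gr_iff) auto
      have e: "e \<le> dist x y" if "x \<in> T" "y \<in> T" "x \<noteq> y" for x y
        unfolding e_def using fin that by (intro Min_le) auto
      have "\<exists>B\<in>\<B>. x \<in> B \<and> B \<subseteq> ball x (e / 3)" for x
      proof -
        have "x \<in> ball x (e / 3)" using e0 by simp
        then obtain B' where "B' \<in> \<B>" "x \<in> B'" "B' \<subseteq> ball x (e / 3)"
          by (rule topological_basisE[OF B(2) open_ball])
        then show ?thesis by blast
      qed
      then obtain b where b: "\<And>x. b x \<in> \<B>" "\<And>x. x \<in> b x" "\<And>x. b x \<subseteq> ball x (e / 3)"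
        by metis
      have cb: "closure (b x) \<subseteq> cball x (e / 3)" for x
        using b(3)[of x] by (meson closed_cball closure_minimal order_trans ball_subset_cball)
      have disj: "closure (b x) \<inter> closure (b y) = {}" if "x \<in> T" "y \<in> T" "x \<noteq> y" for x y
      proof (rule ccontr)
        assume "closure (b x) \<inter> closure (b y) \<noteq> {}"
        then obtain z where "dist x z \<le> e / 3" "dist y z \<le> e / 3" using cb by fastforce
        then have "dist x y \<le> 2 * e / 3" using dist_triangle2[of x y z] by linarith
        with e[OF that] e0 show False by linarith
      qed
      have injb: "inj_on b T"
      proof (rule inj_onI, rule ccontr)
        fix x y assume xy: "x \<in> T" "y \<in> T" "b x = b y" "x \<noteq> y"
        then have "closure (b x) = {}" using disj[of x y] by auto
        with b(2)[of x] show False by auto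
      qed
      have F: "b ` T \<in> \<F>"
      proof -
        have "disjoint_family_on closure (b ` T)"
          unfolding disjoint_family_on_def
        proof (intro ballI impI)
          fix m n assume "m \<in> b ` T" "n \<in> b ` T" "m \<noteq> n"
          then obtain x y where "x \<in> T" "y \<in> T" "m = b x" "n = b y" "x \<noteq> y" by blast
          then show "closure m \<inter> closure n = {}" using disj by simp
        qed
        then show ?thesis using T b(1) by (auto simp: \<F>_def)
      qed
      have "h c (b x) = 1" if "x \<in> T" for x
      proof -
        have "x \<in> K \<inter> closure (b x)" "(\<Sum>b\<in>I. c b *\<^sub>R G b x) = 0"
          using that T(2) b(2)[of x] closure_subset[of "b x"] by (auto simp: Z_def)
        then show ?thesis unfolding h_def by auto
      qed
      then have "(\<Sum>B\<in>b ` T. h c B) = of_nat (card T)"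
        by (simp add: sum.reindex[OF injb])
      then show "of_nat (card T) \<le> (SUP F\<in>\<F>. \<Sum>B\<in>F. h c B)"
        using SUP_upper[OF F, of "\<lambda>F. \<Sum>B\<in>F. h c B"] by simp
    qed
    show "(SUP F\<in>\<F>. \<Sum>B\<in>F. h c B) \<le> emeasure (count_space UNIV) (Z c)"
    proof (rule SUP_least)
      fix F assume F: "F \<in> \<F>"
      have "(\<Sum>B\<in>F. h c B) \<le> (\<Sum>B\<in>F. emeasure (count_space UNIV) (Z c \<inter> closure B))"
      proof (rule sum_mono)
        fix B
        show "h c B \<le> emeasure (count_space UNIV) (Z c \<inter> closure B)"
        proof (cases "\<exists>x. x \<in> Z c \<inter> closure B")
          case True
          then obtain x where "{x} \<subseteq> Z c \<inter> closure B" by auto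
          then have "emeasure (count_space UNIV) {x} \<le> emeasure (count_space UNIV) (Z c \<inter> closure B)"
            by (rule emeasure_mono) simp
          then show ?thesis by (simp add: h_def)
        qed (auto simp: h_def Z_def)
      qed
      also have "\<dots> = emeasure (count_space UNIV) (\<Union>B\<in>F. Z c \<inter> closure B)"
        using F by (intro sum_emeasure) (auto simp: \<F>_def disjoint_family_on_def)
      also have "\<dots> \<le> emeasure (count_space UNIV) (Z c)"
        by (rule emeasure_mono) auto
      finally show "(\<Sum>B\<in>F. h c B) \<le> \<dots>" .
    qed
  qed
  moreover have "(\<lambda>c. SUP F\<in>\<F>. \<Sum>B\<in>F. h c B) \<in> borel_measurable (Pi\<^sub>M I (\<lambda>_. borel))"
    using hm cF by (intro borel_measurable_SUP) auto
  ultimately show ?thesis by (simp add: Z_def)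
qed

lemma measurable_card_zeros_sigma_compact:
  fixes G :: "'i \<Rightarrow> 'a::euclidean_space \<Rightarrow> 'b::euclidean_space"
  assumes I: "finite I" and K: "\<And>n::nat. compact (K n)" "incseq K"
    and G: "\<And>b n. b \<in> I \<Longrightarrow> continuous_on (K n) (G b)"
  shows "(\<lambda>c. emeasure (count_space UNIV) {x \<in> (\<Union>n. K n). (\<Sum>b\<in>I. c b *\<^sub>R G b x) = 0})
         \<in> borel_measurable (Pi\<^sub>M I (\<lambda>_. borel))"
proof -
  have "emeasure (count_space UNIV) {x \<in> (\<Union>n. K n). (\<Sum>b\<in>I. c b *\<^sub>R G b x) = 0} =
        (SUP n. emeasure (count_space UNIV) {x \<in> K n. (\<Sum>b\<in>I. c b *\<^sub>R G b x) = 0})" for c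
  proof -
    have "{x \<in> (\<Union>n. K n). (\<Sum>b\<in>I. c b *\<^sub>R G b x) = 0} = (\<Union>n. {x \<in> K n. (\<Sum>b\<in>I. c b *\<^sub>R G b x) = 0})"
      by auto
    moreover have "incseq (\<lambda>n. {x \<in> K n. (\<Sum>b\<in>I. c b *\<^sub>R G b x) = 0})"
      using K(2) by (auto simp: incseq_def)
    ultimately show ?thesis by (simp add: SUP_emeasure_incseq)
  qed
  moreover have "(\<lambda>c. SUP n. emeasure (count_space UNIV) {x \<in> K n. (\<Sum>b\<in>I. c b *\<^sub>R G b x) = 0}) \<in> borel_measurable (Pi\<^sub>M I (\<lambda>_. borel))"
    by (intro borel_measurable_SUP measurable_card_zeros_compact I K G) auto
  ultimately show ?thesis by simp
qed

section \<open>Gaussian weights on coordinate spaces\<close>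

interpretation lborel_product: product_sigma_finite "\<lambda>_::'i. lborel :: real measure"
  by standard

abbreviation lebesgue_on_coords :: "'i set \<Rightarrow> ('i \<Rightarrow> real) measure" where
  "lebesgue_on_coords I \<equiv> Pi\<^sub>M I (\<lambda>_. lborel)"

lemma measurable_coord_lborel:
  "b \<in> I \<Longrightarrow> (\<lambda>c. c b) \<in> borel_measurable (lebesgue_on_coords I)"
  using measurable_component_singleton[of b I "\<lambda>_. lborel :: real measure"] by simp

lemma sets_coords_borel:
  "sets (lebesgue_on_coords I) = sets (Pi\<^sub>M I (\<lambda>_. borel))"
  by (intro sets_PiM_cong) auto

lemma measurable_affine_coords:
  "(\<lambda>c. \<lambda>i\<in>I. t i + (r::real) * c i) \<in> lebesgue_on_coords I \<rightarrow>\<^sub>M lebesgue_on_coords I"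
  by (intro measurable_restrict) simp

lemma measurable_compose_case_prod:
  assumes "(\<lambda>(x, y). g x y) \<in> M \<Otimes>\<^sub>M N \<rightarrow>\<^sub>M L" "F \<in> L \<rightarrow>\<^sub>M K"
  shows "(\<lambda>(x, y). F (g x y)) \<in> M \<Otimes>\<^sub>M N \<rightarrow>\<^sub>M K"
  using measurable_compose[OF assms] by (simp add: case_prod_unfold)

lemma nn_integral_swap3:
  fixes H :: "real \<Rightarrow> real \<Rightarrow> 'a \<Rightarrow> ennreal"
  assumes "sigma_finite_measure M"
    and "(\<lambda>(x, y, w). H x y w) \<in> borel_measurable (borel \<Otimes>\<^sub>M borel \<Otimes>\<^sub>M M)"
  shows "(\<integral>\<^sup>+ w. \<integral>\<^sup>+ x. \<integral>\<^sup>+ y. H x y w \<partial>lborel \<partial>lborel \<partial>M) =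
         (\<integral>\<^sup>+ x. \<integral>\<^sup>+ y. \<integral>\<^sup>+ w. H x y w \<partial>M \<partial>lborel \<partial>lborel)"
    and "(\<lambda>w. \<integral>\<^sup>+ x. \<integral>\<^sup>+ y. H x y w \<partial>lborel \<partial>lborel) \<in> borel_measurable M"
proof -
  interpret sigma_finite_measure M by fact
  interpret p: pair_sigma_finite lborel M ..
  define K where "K = (\<lambda>(x, y, w). H x y w)"
  have [measurable]: "K \<in> borel_measurable (borel \<Otimes>\<^sub>M borel \<Otimes>\<^sub>M M)" using assms(2) by (simp add: K_def)
  have KH: "H x y w = K (x, y, w)" for x y w by (simp add: K_def)
  show "(\<lambda>w. \<integral>\<^sup>+ x. \<integral>\<^sup>+ y. H x y w \<partial>lborel \<partial>lborel) \<in> borel_measurable M"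
    unfolding KH by measurable
  have "(\<integral>\<^sup>+ w. \<integral>\<^sup>+ x. \<integral>\<^sup>+ y. K (x, y, w) \<partial>lborel \<partial>lborel \<partial>M) =
    (\<integral>\<^sup>+ x. \<integral>\<^sup>+ w. \<integral>\<^sup>+ y. K (x, y, w) \<partial>lborel \<partial>M \<partial>lborel)"
    by (rule p.Fubini') measurable
  also have "\<dots> = (\<integral>\<^sup>+ x. \<integral>\<^sup>+ y. \<integral>\<^sup>+ w. K (x, y, w) \<partial>M \<partial>lborel \<partial>lborel)"
    by (intro nn_integral_cong p.Fubini') measurable
  finally show "(\<integral>\<^sup>+ w. \<integral>\<^sup>+ x. \<integral>\<^sup>+ y. H x y w \<partial>lborel \<partial>lborel \<partial>M) =
         (\<integral>\<^sup>+ x. \<integral>\<^sup>+ y. \<integral>\<^sup>+ w. H x y w \<partial>M \<partial>lborel \<partial>lborel)"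
    unfolding KH .
qed

text \<open>
  The product measure here is indexed by a set and not by a type, so that the affine change of
  variables is obtained one coordinate at a time.
\<close>

lemma nn_integral_coords_affine:
  assumes "finite I" "r \<noteq> 0" "F \<in> borel_measurable (lebesgue_on_coords I)"
  shows "(\<integral>\<^sup>+ c. F c \<partial>lebesgue_on_coords I) =
         ennreal (\<bar>r\<bar> ^ card I) * (\<integral>\<^sup>+ c. F (\<lambda>i\<in>I. t i + r * c i) \<partial>lebesgue_on_coords I)"
  using assms(1,3)
proof (induction I arbitrary: F)
  case empty
  show ?case
    by (simp only: lborel_product.nn_integral_empty[OF zero_le] restrict_def card.empty power_0 ennreal_1 mult_1 empty_iff if_False)

next
  case (insert i I)
  note F = insert.prems
  let ?T = "\<lambda>I c. \<lambda>i\<in>I. t i + r * c i"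
  have F2: "(\<lambda>c. F (?T (insert i I) c)) \<in> borel_measurable (lebesgue_on_coords (insert i I))"
    using measurable_compose[OF measurable_affine_coords[of t r "insert i I"] F] .
  have upd: "(\<lambda>(w, y). w(i := y)) \<in> (lebesgue_on_coords I \<Otimes>\<^sub>M lborel) \<rightarrow>\<^sub>M lebesgue_on_coords (insert i I)"
    by (rule measurable_add_dim)
  have F3: "(\<lambda>(w, y). F (w(i := y))) \<in> borel_measurable (lebesgue_on_coords I \<Otimes>\<^sub>M lborel)"
    by (rule measurable_compose_case_prod[OF upd F])
  have aff: "(\<lambda>(w, y). (w, t i + r * y)) \<in> (lebesgue_on_coords I \<Otimes>\<^sub>M lborel) \<rightarrow>\<^sub>M (lebesgue_on_coords I \<Otimes>\<^sub>M lborel)"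
    by measurable
  have F4: "(\<lambda>(w, y). F (w(i := t i + r * y))) \<in> borel_measurable (lebesgue_on_coords I \<Otimes>\<^sub>M lborel)"
    using measurable_compose[OF aff F3] by (simp add: case_prod_unfold del: fun_upd_apply)
  have H: "(\<lambda>w. \<integral>\<^sup>+ y. F (w(i := t i + r * y)) \<partial>lborel) \<in> borel_measurable (lebesgue_on_coords I)"
    using lborel.borel_measurable_nn_integral[OF F4] .
  have "(\<integral>\<^sup>+ c. F c \<partial>lebesgue_on_coords (insert i I)) =
        (\<integral>\<^sup>+ w. (\<integral>\<^sup>+ y. F (w(i := y)) \<partial>lborel) \<partial>lebesgue_on_coords I)"
    by (rule lborel_product.product_nn_integral_insert[OF insert.hyps F])
  also have "\<dots> = (\<integral>\<^sup>+ w. ennreal \<bar>r\<bar> * (\<integral>\<^sup>+ y. F (w(i := t i + r * y)) \<partial>lborel) \<partial>lebesgue_on_coords I)"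
  proof (rule nn_integral_cong)
    fix w assume w: "w \<in> space (lebesgue_on_coords I)"
    have "(\<lambda>y. F (w(i := y))) \<in> borel_measurable borel"
      using measurable_Pair2[OF F3 w] by simp
    then show "(\<integral>\<^sup>+ y. F (w(i := y)) \<partial>lborel) = ennreal \<bar>r\<bar> * (\<integral>\<^sup>+ y. F (w(i := t i + r * y)) \<partial>lborel)"
      by (rule nn_integral_real_affine) (rule assms)
  qed
  also have "\<dots> = ennreal \<bar>r\<bar> * (\<integral>\<^sup>+ w. (\<integral>\<^sup>+ y. F (w(i := t i + r * y)) \<partial>lborel) \<partial>lebesgue_on_coords I)"
    using H by (rule nn_integral_cmult)
  also have "(\<integral>\<^sup>+ w. (\<integral>\<^sup>+ y. F (w(i := t i + r * y)) \<partial>lborel) \<partial>lebesgue_on_coords I) =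
      ennreal (\<bar>r\<bar> ^ card I) * (\<integral>\<^sup>+ w. (\<integral>\<^sup>+ y. F ((?T I w)(i := t i + r * y)) \<partial>lborel) \<partial>lebesgue_on_coords I)"
    by (rule insert.IH[OF H])
  also have "(\<integral>\<^sup>+ w. (\<integral>\<^sup>+ y. F ((?T I w)(i := t i + r * y)) \<partial>lborel) \<partial>lebesgue_on_coords I) =
      (\<integral>\<^sup>+ w. (\<integral>\<^sup>+ y. F (?T (insert i I) (w(i := y))) \<partial>lborel) \<partial>lebesgue_on_coords I)"
  proof -
    have "(?T I w)(i := t i + r * y) = ?T (insert i I) (w(i := y))" for w y
      using insert.hyps by (auto simp: fun_eq_iff)
    then show ?thesis by simp
  qed
  also have "\<dots> = (\<integral>\<^sup>+ c. F (?T (insert i I) c) \<partial>lebesgue_on_coords (insert i I))"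
    by (rule lborel_product.product_nn_integral_insert[OF insert.hyps F2, symmetric])
  finally show ?case
    by (simp only: card_insert_disjoint[OF insert.hyps] power_Suc ennreal_mult'[OF abs_ge_zero] mult.assoc)
qed

text \<open>
  Two one-dimensional substitutions: if \<open>d\<close> is nonzero, first for \<open>y\<close> and then for \<open>x\<close> with the
  factor given by the Schur complement; otherwise the matrix is triangular after exchanging rows.
\<close>

lemma nn_integral_linear_plane:
  fixes F :: "real \<times> real \<Rightarrow> ennreal"
  assumes [measurable]: "F \<in> borel_measurable borel" and D: "a * d - b * c \<noteq> 0"
  shows "(\<integral>\<^sup>+ s. \<integral>\<^sup>+ t. F (s, t) \<partial>lborel \<partial>lborel) =
     ennreal \<bar>a * d - b * c\<bar> * (\<integral>\<^sup>+ x. \<integral>\<^sup>+ y. F (s0 + a * x + b * y, t0 + c * x + d * y) \<partial>lborel \<partial>lborel)"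
proof -
  have F[measurable]: "F \<in> borel_measurable (borel \<Otimes>\<^sub>M borel)" by (simp add: borel_prod)
  have sw: "(\<integral>\<^sup>+ s. \<integral>\<^sup>+ t. F (s, t) \<partial>lborel \<partial>lborel) = (\<integral>\<^sup>+ t. \<integral>\<^sup>+ s. F (s, t) \<partial>lborel \<partial>lborel)"
    by (rule lborel_pair.Fubini') simp
  show ?thesis
  proof (cases "d = 0")
    case False
    \<comment> \<open>The Schur complement of \<open>d\<close>.\<close>
    let ?e = "(a * d - b * c) / d"
    have e: "?e \<noteq> 0" using D False by simp
    have "(\<integral>\<^sup>+ x. \<integral>\<^sup>+ y. F (s0 + a * x + b * y, t0 + c * x + d * y) \<partial>lborel \<partial>lborel) =
          (\<integral>\<^sup>+ x. ennreal \<bar>1 / d\<bar> * (\<integral>\<^sup>+ t. F (s0 + a * x + b * ((- t0 - c * x) / d + (1 / d) * t), t) \<partial>lborel) \<partial>lborel)"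
    proof (rule nn_integral_cong)
      fix x
      have "(\<integral>\<^sup>+ y. F (s0 + a * x + b * y, t0 + c * x + d * y) \<partial>lborel) =
          ennreal \<bar>1 / d\<bar> * (\<integral>\<^sup>+ t. F (s0 + a * x + b * ((- t0 - c * x) / d + (1 / d) * t),
              t0 + c * x + d * ((- t0 - c * x) / d + (1 / d) * t)) \<partial>lborel)"
        by (rule nn_integral_real_affine) (use False in auto)
      moreover have "t0 + c * x + d * ((- t0 - c * x) / d + (1 / d) * t) = t" for t
        using False by (simp add: field_simps)
      ultimately show "(\<integral>\<^sup>+ y. F (s0 + a * x + b * y, t0 + c * x + d * y) \<partial>lborel) =
          ennreal \<bar>1 / d\<bar> * (\<integral>\<^sup>+ t. F (s0 + a * x + b * ((- t0 - c * x) / d + (1 / d) * t), t) \<partial>lborel)"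
        by simp
    qed
    also have "\<dots> = ennreal \<bar>1 / d\<bar> * (\<integral>\<^sup>+ x. (\<integral>\<^sup>+ t. F (s0 + a * x + b * ((- t0 - c * x) / d + (1 / d) * t), t) \<partial>lborel) \<partial>lborel)"
      by (rule nn_integral_cmult) measurable
    also have "(\<integral>\<^sup>+ x. (\<integral>\<^sup>+ t. F (s0 + a * x + b * ((- t0 - c * x) / d + (1 / d) * t), t) \<partial>lborel) \<partial>lborel) =
       (\<integral>\<^sup>+ t. (\<integral>\<^sup>+ x. F (s0 + a * x + b * ((- t0 - c * x) / d + (1 / d) * t), t) \<partial>lborel) \<partial>lborel)"
      by (rule lborel_pair.Fubini') measurable
    also have "\<dots> = (\<integral>\<^sup>+ t. (\<integral>\<^sup>+ x. F ((s0 + b * (t - t0) / d) + ?e * x, t) \<partial>lborel) \<partial>lborel)"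
    proof -
      have "s0 + a * x + b * ((- t0 - c * x) / d + (1 / d) * t) = (s0 + b * (t - t0) / d) + ?e * x" for x t
        using False by (simp add: field_simps)
      then show ?thesis by (simp only:)
    qed
    finally have 1: "(\<integral>\<^sup>+ x. \<integral>\<^sup>+ y. F (s0 + a * x + b * y, t0 + c * x + d * y) \<partial>lborel \<partial>lborel) =
       ennreal \<bar>1 / d\<bar> * (\<integral>\<^sup>+ t. (\<integral>\<^sup>+ x. F ((s0 + b * (t - t0) / d) + ?e * x, t) \<partial>lborel) \<partial>lborel)" .
    have "(\<integral>\<^sup>+ t. \<integral>\<^sup>+ s. F (s, t) \<partial>lborel \<partial>lborel) =
        (\<integral>\<^sup>+ t. ennreal \<bar>?e\<bar> * (\<integral>\<^sup>+ x. F ((s0 + b * (t - t0) / d) + ?e * x, t) \<partial>lborel) \<partial>lborel)"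
      by (intro nn_integral_cong nn_integral_real_affine e) measurable
    also have "\<dots> = ennreal \<bar>?e\<bar> * (\<integral>\<^sup>+ t. (\<integral>\<^sup>+ x. F ((s0 + b * (t - t0) / d) + ?e * x, t) \<partial>lborel) \<partial>lborel)"
      by (rule nn_integral_cmult) measurable
    also have "ennreal \<bar>?e\<bar> = ennreal \<bar>a * d - b * c\<bar> * ennreal \<bar>1 / d\<bar>"
      by (simp add: ennreal_mult'[symmetric] abs_mult[symmetric])
    finally show ?thesis
      unfolding sw 1 by (simp add: mult.assoc)
  next
    case True
    then have bc: "b \<noteq> 0" "c \<noteq> 0" using D by auto
    have "(\<integral>\<^sup>+ t. \<integral>\<^sup>+ s. F (s, t) \<partial>lborel \<partial>lborel) =
        ennreal \<bar>c\<bar> * (\<integral>\<^sup>+ x. \<integral>\<^sup>+ s. F (s, t0 + c * x) \<partial>lborel \<partial>lborel)"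
      by (rule nn_integral_real_affine) (use bc in measurable)
    also have "\<dots> = ennreal \<bar>c\<bar> * (\<integral>\<^sup>+ x. ennreal \<bar>b\<bar> * (\<integral>\<^sup>+ y. F ((s0 + a * x) + b * y, t0 + c * x) \<partial>lborel) \<partial>lborel)"
      by (intro arg_cong2[where f="(*)"] refl nn_integral_cong nn_integral_real_affine bc) measurable
    also have "\<dots> = ennreal \<bar>c\<bar> * (ennreal \<bar>b\<bar> * (\<integral>\<^sup>+ x. (\<integral>\<^sup>+ y. F ((s0 + a * x) + b * y, t0 + c * x) \<partial>lborel) \<partial>lborel))"
      by (intro arg_cong2[where f="(*)"] refl nn_integral_cmult) measurable
    finally show ?thesis
      unfolding sw using True by (simp add: ennreal_mult' abs_mult mult_ac)
  qed
qed

text \<open>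
  The unnormalised density of independent standard Gaussian coefficients.  All averages below are
  quotients, so that the normalising constant cancels.
\<close>

definition gauss_weight :: "'i set \<Rightarrow> ('i \<Rightarrow> real) \<Rightarrow> real" where
  "gauss_weight I c = exp (- (\<Sum>b\<in>I. (c b)\<^sup>2) / 2)"

lemma measurable_gauss_weight:
  "gauss_weight I \<in> borel_measurable (lebesgue_on_coords I)"
  unfolding gauss_weight_def
proof (rule measurable_compose[where g = exp])
  show "(\<lambda>c. - (\<Sum>b\<in>I. (c b)\<^sup>2) / 2) \<in> borel_measurable (lebesgue_on_coords I)"
    by (intro borel_measurable_divide borel_measurable_uminus borel_measurable_sum borel_measurable_power
        borel_measurable_const measurable_coord_lborel)
qed (intro borel_measurable_continuous_onI continuous_intros)

text \<open>
  The vector with coordinates \<open>w\<close> on \<open>J\<close> whose coordinates at \<open>a\<close> and \<open>b\<close> make it orthogonal to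
  \<open>u\<close> and \<open>v\<close>, by Cramer's rule.  It parametrises the orthogonal complement of the plane spanned by
  \<open>u\<close> and \<open>v\<close> by the remaining coordinates.
\<close>

definition kernel_ext ::
  "('i \<Rightarrow> real) \<Rightarrow> ('i \<Rightarrow> real) \<Rightarrow> 'i \<Rightarrow> 'i \<Rightarrow> 'i set \<Rightarrow> ('i \<Rightarrow> real) \<Rightarrow> 'i \<Rightarrow> real" where
  "kernel_ext u v a b J w =
     (let p = (\<Sum>i\<in>J. u i * w i); q = (\<Sum>i\<in>J. v i * w i); D = u a * v b - u b * v a in
      w(a := (u b * q - v b * p) / D, b := (v a * p - u a * q) / D))"

locale coords_pair =
  fixes I J :: "'i set" and a b :: 'i
  assumes J: "finite J" "a \<notin> J" "b \<notin> J" "a \<noteq> b" and I: "I = insert b (insert a J)"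
begin

lemma sum_I: "(\<Sum>i\<in>I. f i) = f a + f b + (\<Sum>i\<in>J. f i)" for f :: "'i \<Rightarrow> 'b::comm_monoid_add"
  using J unfolding I by (simp add: add.left_commute add.commute)

lemma nn_integral_coords_insert2:
  assumes F: "F \<in> borel_measurable (lebesgue_on_coords I)"
  shows "(\<integral>\<^sup>+ c. F c \<partial>lebesgue_on_coords I) =
         (\<integral>\<^sup>+ w. \<integral>\<^sup>+ s. \<integral>\<^sup>+ t. F (w(a := s, b := t)) \<partial>lborel \<partial>lborel \<partial>lebesgue_on_coords J)"
proof -
  have upd: "(\<lambda>(w, y). w(b := y)) \<in> (lebesgue_on_coords (insert a J) \<Otimes>\<^sub>M lborel) \<rightarrow>\<^sub>M lebesgue_on_coords I"
    unfolding I by (rule measurable_add_dim)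
  have F3: "(\<lambda>(w, y). F (w(b := y))) \<in> borel_measurable (lebesgue_on_coords (insert a J) \<Otimes>\<^sub>M lborel)"
    by (rule measurable_compose_case_prod[OF upd F])
  have "(\<integral>\<^sup>+ c. F c \<partial>lebesgue_on_coords I) = (\<integral>\<^sup>+ w. \<integral>\<^sup>+ t. F (w(b := t)) \<partial>lborel \<partial>lebesgue_on_coords (insert a J))"
    unfolding I by (rule lborel_product.product_nn_integral_insert) (use J F I in auto)
  also have "\<dots> = (\<integral>\<^sup>+ w. \<integral>\<^sup>+ s. \<integral>\<^sup>+ t. F (w(a := s, b := t)) \<partial>lborel \<partial>lborel \<partial>lebesgue_on_coords J)"
    by (rule lborel_product.product_nn_integral_insert) (use J lborel.borel_measurable_nn_integral[OF F3] in auto)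
  finally show ?thesis .
qed

end

locale plane_complement = coords_pair I J a b
  for I J :: "'i set" and a b :: 'i +
  fixes u v :: "'i \<Rightarrow> real" and D :: real
  assumes D: "D = u a * v b - u b * v a" "D \<noteq> 0"
begin

abbreviation "ext \<equiv> kernel_ext u v a b J"

lemma ext_simps:
  "i \<in> J \<Longrightarrow> ext w i = w i"
  "ext w a = (u b * (\<Sum>i\<in>J. v i * w i) - v b * (\<Sum>i\<in>J. u i * w i)) / D"
  "ext w b = (v a * (\<Sum>i\<in>J. u i * w i) - u a * (\<Sum>i\<in>J. v i * w i)) / D"
  using J by (auto simp: kernel_ext_def Let_def D)

lemma dot_ext: "(\<Sum>i\<in>I. u i * ext w i) = 0" "(\<Sum>i\<in>I. v i * ext w i) = 0"
proof -
  have J1: "(\<Sum>i\<in>J. u i * ext w i) = (\<Sum>i\<in>J. u i * w i)" "(\<Sum>i\<in>J. v i * ext w i) = (\<Sum>i\<in>J. v i * w i)"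
    by (auto intro!: sum.cong simp: ext_simps)
  show "(\<Sum>i\<in>I. u i * ext w i) = 0" "(\<Sum>i\<in>I. v i * ext w i) = 0"
    unfolding sum_I J1 ext_simps(2,3) using D by (auto simp: divide_simps) (auto simp: algebra_simps)
qed

lemma ext_eqI:
  assumes c: "c \<in> extensional I" and 0: "(\<Sum>i\<in>I. u i * c i) = 0" "(\<Sum>i\<in>I. v i * c i) = 0"
    and w: "w \<in> extensional J" "\<And>i. i \<in> J \<Longrightarrow> c i = w i"
  shows "c = ext w"
proof -
  have J1: "(\<Sum>i\<in>J. u i * c i) = (\<Sum>i\<in>J. u i * w i)" "(\<Sum>i\<in>J. v i * c i) = (\<Sum>i\<in>J. v i * w i)"
    by (auto intro!: sum.cong simp: w)
  define p q where "p = (\<Sum>i\<in>J. u i * w i)" and "q = (\<Sum>i\<in>J. v i * w i)"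
  have e: "u a * c a + u b * c b = - p" "v a * c a + v b * c b = - q"
    using 0 unfolding sum_I J1 p_def q_def by auto
  have "c a * D = u b * q - v b * p" "c b * D = v a * p - u a * q"
    using e unfolding D by algebra+
  then have "c a = (u b * q - v b * p) / D" "c b = (v a * p - u a * q) / D"
    using D(2) by (auto simp: field_simps)
  then have ab: "c a = ext w a" "c b = ext w b"
    unfolding ext_simps p_def q_def by auto
  show ?thesis
  proof
    fix i
    show "c i = ext w i"
    proof (cases "i \<in> I")
      case True
      then show ?thesis using ab w(2) ext_simps(1) by (auto simp: I)
    next
      case False
      then have "c i = undefined" "w i = undefined" using c w(1) by (auto simp: extensional_def I)
      then show ?thesis using False by (simp add: kernel_ext_def Let_def I)
    qed
  qed
qed

lemma ext_extensional: "w \<in> extensional J \<Longrightarrow> ext w \<in> extensional I"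
  by (auto simp: kernel_ext_def Let_def I extensional_def)

lemma measurable_ext: "ext \<in> lebesgue_on_coords J \<rightarrow>\<^sub>M lebesgue_on_coords I"
  unfolding kernel_ext_def Let_def I
  by (intro measurable_fun_upd[where J=J] measurable_fun_upd[where J="insert a J"]) measurable

end

text \<open>
  The number \<open>\<gamma>\<close> is the common \<^emph>\<open>square\<close> of the lengths of the orthogonal vectors \<open>u\<close> and \<open>v\<close>.
\<close>

locale orthogonal_plane_complement = plane_complement I J a b u v D
  for I J :: "'i set" and a b :: 'i and u v :: "'i \<Rightarrow> real" and D :: real +
  fixes \<gamma> :: real
  assumes norm_u: "(\<Sum>i\<in>I. u i * u i) = \<gamma>" and norm_v: "(\<Sum>i\<in>I. v i * v i) = \<gamma>"
    and orth: "(\<Sum>i\<in>I. u i * v i) = 0" and gamma: "\<gamma> > 0"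
begin

abbreviation "plane_shift c x y \<equiv> (\<lambda>i\<in>I. c i + x * u i + y * v i)"

lemma fin_I: "finite I" using J I by simp

lemma dot_plane_shift:
  "(\<Sum>i\<in>I. u i * plane_shift c x y i) = (\<Sum>i\<in>I. u i * c i) + \<gamma> * x"
  "(\<Sum>i\<in>I. v i * plane_shift c x y i) = (\<Sum>i\<in>I. v i * c i) + \<gamma> * y"
proof -
  have "(\<Sum>i\<in>I. u i * plane_shift c x y i) = (\<Sum>i\<in>I. u i * c i) + x * (\<Sum>i\<in>I. u i * u i) + y * (\<Sum>i\<in>I. u i * v i)"
    unfolding sum_distrib_left sum.distrib[symmetric] by (rule sum.cong) (auto simp: algebra_simps)
  then show "(\<Sum>i\<in>I. u i * plane_shift c x y i) = (\<Sum>i\<in>I. u i * c i) + \<gamma> * x"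
    using norm_u orth by (simp add: mult.commute)
  have "(\<Sum>i\<in>I. v i * plane_shift c x y i) = (\<Sum>i\<in>I. v i * c i) + x * (\<Sum>i\<in>I. u i * v i) + y * (\<Sum>i\<in>I. v i * v i)"
    unfolding sum_distrib_left sum.distrib[symmetric] by (rule sum.cong) (auto simp: algebra_simps)
  then show "(\<Sum>i\<in>I. v i * plane_shift c x y i) = (\<Sum>i\<in>I. v i * c i) + \<gamma> * y"
    using norm_v orth by (simp add: mult.commute)
qed

lemma gauss_weight_plane_shift:
  "gauss_weight I (plane_shift (ext w) x y) = gauss_weight I (ext w) * exp (- (\<gamma> * (x\<^sup>2 + y\<^sup>2)) / 2)"
proof -
  have "(\<Sum>i\<in>I. (plane_shift (ext w) x y i)\<^sup>2) = (\<Sum>i\<in>I. (ext w i)\<^sup>2) + 2 * x * (\<Sum>i\<in>I. u i * ext w i)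
     + 2 * y * (\<Sum>i\<in>I. v i * ext w i) + x * x * (\<Sum>i\<in>I. u i * u i) + y * y * (\<Sum>i\<in>I. v i * v i)
     + 2 * x * y * (\<Sum>i\<in>I. u i * v i)"
    unfolding sum_distrib_left sum.distrib[symmetric]
    by (rule sum.cong) (auto simp: algebra_simps power2_eq_square)
  then have "(\<Sum>i\<in>I. (plane_shift (ext w) x y i)\<^sup>2) = (\<Sum>i\<in>I. (ext w i)\<^sup>2) + \<gamma> * (x\<^sup>2 + y\<^sup>2)"
    unfolding dot_ext norm_u norm_v orth by (simp add: algebra_simps power2_eq_square)
  then show ?thesis
    unfolding gauss_weight_def by (simp add: exp_add[symmetric] field_simps)
qed

text \<open>
  Integration along the plane spanned by \<open>u\<close>, \<open>v\<close> and over its orthogonal complement, the latter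
  parametrised by the coordinates in \<open>J\<close>.  For fixed \<open>w\<close> the coordinates at \<open>a\<close> and \<open>b\<close> are an
  affine function of $(x, y)$ with determinant $\gamma^2/D$; after exchanging the integrals a
  translation of \<open>w\<close> that depends on $(x, y)$ turns the argument into the shifted vector.
\<close>

lemma nn_integral_split_plane:
  assumes F: "F \<in> borel_measurable (lebesgue_on_coords I)"
  shows "(\<integral>\<^sup>+ c. F c \<partial>lebesgue_on_coords I) =
         ennreal (\<gamma>\<^sup>2 / \<bar>D\<bar>) * (\<integral>\<^sup>+ x. \<integral>\<^sup>+ y. \<integral>\<^sup>+ w. F (plane_shift (ext w) x y) \<partial>lebesgue_on_coords J \<partial>lborel \<partial>lborel)"
proof -
  let ?G = "\<lambda>w x y. w(a := ext w a + \<gamma> * v b / D * x + (- \<gamma> * u b / D) * y,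
                        b := ext w b + (- \<gamma> * v a / D) * x + \<gamma> * u a / D * y)"
  have updm: "(\<lambda>(w, s, t). w(a := s, b := t)) \<in> (lebesgue_on_coords J \<Otimes>\<^sub>M borel \<Otimes>\<^sub>M borel) \<rightarrow>\<^sub>M lebesgue_on_coords I"
    unfolding I case_prod_unfold
    by (intro measurable_fun_upd[where J=J] measurable_fun_upd[where J="insert a J"]) auto
  have Fu: "(\<lambda>(w, s, t). F (w(a := s, b := t))) \<in> borel_measurable (lebesgue_on_coords J \<Otimes>\<^sub>M borel \<Otimes>\<^sub>M borel)"
    using measurable_compose[OF updm F] by (simp add: case_prod_unfold)
  have exta: "(\<lambda>w. ext w a) \<in> borel_measurable (lebesgue_on_coords J)" "(\<lambda>w. ext w b) \<in> borel_measurable (lebesgue_on_coords J)"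
    unfolding ext_simps by measurable
  have FG0: "(\<lambda>(x, y, w). F (?G w x y)) \<in> borel_measurable (borel \<Otimes>\<^sub>M borel \<Otimes>\<^sub>M lebesgue_on_coords J)"
  proof -
    define ea eb where "ea = (\<lambda>w. ext w a)" and "eb = (\<lambda>w. ext w b)"
    have [measurable]: "ea \<in> borel_measurable (lebesgue_on_coords J)" "eb \<in> borel_measurable (lebesgue_on_coords J)"
      unfolding ea_def eb_def by (rule exta)+
    have "(\<lambda>(x, y, w). (w, ea w + \<gamma> * v b / D * x + (- \<gamma> * u b / D) * y, eb w + (- \<gamma> * v a / D) * x + \<gamma> * u a / D * y))
       \<in> (borel \<Otimes>\<^sub>M borel \<Otimes>\<^sub>M lebesgue_on_coords J) \<rightarrow>\<^sub>M (lebesgue_on_coords J \<Otimes>\<^sub>M borel \<Otimes>\<^sub>M borel)"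
      unfolding case_prod_unfold
      by (intro measurable_Pair borel_measurable_add borel_measurable_times borel_measurable_const
          measurable_compose[OF _ \<open>ea \<in> _\<close>] measurable_compose[OF _ \<open>eb \<in> _\<close>]) measurable
    from measurable_compose[OF this Fu] show ?thesis unfolding ea_def eb_def by (simp add: case_prod_unfold)
  qed
  have sfJ: "sigma_finite_measure (lebesgue_on_coords J)"
    by (rule lborel_product.sigma_finite) (rule J)
  have "(\<integral>\<^sup>+ c. F c \<partial>lebesgue_on_coords I) =
         (\<integral>\<^sup>+ w. \<integral>\<^sup>+ s. \<integral>\<^sup>+ t. F (w(a := s, b := t)) \<partial>lborel \<partial>lborel \<partial>lebesgue_on_coords J)"
    by (rule nn_integral_coords_insert2[OF F])
  also have "\<dots> = (\<integral>\<^sup>+ w. ennreal (\<gamma>\<^sup>2 / \<bar>D\<bar>) * (\<integral>\<^sup>+ x. \<integral>\<^sup>+ y. F (?G w x y) \<partial>lborel \<partial>lborel) \<partial>lebesgue_on_coords J)"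
  proof (rule nn_integral_cong)
    fix w assume w: "w \<in> space (lebesgue_on_coords J)"
    let ?F = "\<lambda>(s, t). F (w(a := s, b := t))"
    have m: "?F \<in> borel_measurable borel"
      using measurable_Pair2[OF Fu w] by (simp add: borel_prod)
    have det: "(\<gamma> * v b / D) * (\<gamma> * u a / D) - (- \<gamma> * u b / D) * (- \<gamma> * v a / D) = \<gamma>\<^sup>2 / D"
      using D(2) by (simp add: field_simps power2_eq_square) (simp add: D(1) algebra_simps)
    have "(\<integral>\<^sup>+ s. \<integral>\<^sup>+ t. ?F (s, t) \<partial>lborel \<partial>lborel) =
      ennreal \<bar>\<gamma>\<^sup>2 / D\<bar> * (\<integral>\<^sup>+ x. \<integral>\<^sup>+ y. ?F (ext w a + (\<gamma> * v b / D) * x + (- \<gamma> * u b / D) * y,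
          ext w b + (- \<gamma> * v a / D) * x + (\<gamma> * u a / D) * y) \<partial>lborel \<partial>lborel)"
      unfolding det[symmetric] by (rule nn_integral_linear_plane[OF m]) (use gamma D det in auto)
    then show "(\<integral>\<^sup>+ s. \<integral>\<^sup>+ t. F (w(a := s, b := t)) \<partial>lborel \<partial>lborel) =
        ennreal (\<gamma>\<^sup>2 / \<bar>D\<bar>) * (\<integral>\<^sup>+ x. \<integral>\<^sup>+ y. F (?G w x y) \<partial>lborel \<partial>lborel)"
      by (simp add: abs_divide)
  qed
  also have "\<dots> = ennreal (\<gamma>\<^sup>2 / \<bar>D\<bar>) * (\<integral>\<^sup>+ w. (\<integral>\<^sup>+ x. \<integral>\<^sup>+ y. F (?G w x y) \<partial>lborel \<partial>lborel) \<partial>lebesgue_on_coords J)"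
    by (rule nn_integral_cmult) (rule nn_integral_swap3(2)[OF sfJ FG0])
  also have "(\<integral>\<^sup>+ w. (\<integral>\<^sup>+ x. \<integral>\<^sup>+ y. F (?G w x y) \<partial>lborel \<partial>lborel) \<partial>lebesgue_on_coords J) =
     (\<integral>\<^sup>+ x. \<integral>\<^sup>+ y. \<integral>\<^sup>+ w. F (?G w x y) \<partial>lebesgue_on_coords J \<partial>lborel \<partial>lborel)"
    by (rule nn_integral_swap3(1)[OF sfJ FG0])
  also have "\<dots> = (\<integral>\<^sup>+ x. \<integral>\<^sup>+ y. \<integral>\<^sup>+ w. F (plane_shift (ext w) x y) \<partial>lebesgue_on_coords J \<partial>lborel \<partial>lborel)"
  proof (rule nn_integral_cong, rule nn_integral_cong)
    fix x y :: real
    have "(\<lambda>w. F (?G w x y)) \<in> borel_measurable (lebesgue_on_coords J)"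
      using measurable_Pair2[OF measurable_Pair2[OF FG0, of x], of y] by simp
    then have "(\<integral>\<^sup>+ w. F (?G w x y) \<partial>lebesgue_on_coords J) =
       ennreal (\<bar>1\<bar> ^ card J) * (\<integral>\<^sup>+ w. F (?G (\<lambda>i\<in>J. (x * u i + y * v i) + 1 * w i) x y) \<partial>lebesgue_on_coords J)"
      by (intro nn_integral_coords_affine J) auto
    also have "\<dots> = (\<integral>\<^sup>+ w. F (plane_shift (ext w) x y) \<partial>lebesgue_on_coords J)"
    proof -
      have "?G (\<lambda>i\<in>J. (x * u i + y * v i) + 1 * w i) x y = plane_shift (ext w) x y" if w: "w \<in> extensional J" for w
      proof -
        define w' where "w' = (\<lambda>i\<in>J. (x * u i + y * v i) + 1 * w i)"
        define p q where "p = (\<Sum>i\<in>J. u i * w i)" and "q = (\<Sum>i\<in>J. v i * w i)"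
        define uu uv vv where "uu = (\<Sum>i\<in>J. u i * u i)" and "uv = (\<Sum>i\<in>J. u i * v i)" and "vv = (\<Sum>i\<in>J. v i * v i)"
        have s1: "(\<Sum>i\<in>J. u i * w' i) = p + x * uu + y * uv"
          unfolding p_def uu_def uv_def sum_distrib_left sum.distrib[symmetric]
          by (rule sum.cong) (auto simp: w'_def algebra_simps)
        have s2: "(\<Sum>i\<in>J. v i * w' i) = q + x * uv + y * vv"
          unfolding q_def vv_def uv_def sum_distrib_left sum.distrib[symmetric]
          by (rule sum.cong) (auto simp: w'_def algebra_simps)
        have g: "uu = \<gamma> - u a * u a - u b * u b" "vv = \<gamma> - v a * v a - v b * v b" "uv = - u a * v a - u b * v b"
          using norm_u norm_v orth unfolding sum_I uu_def vv_def uv_def by auto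
        have "(ext w' a + \<gamma> * v b / D * x + (- \<gamma> * u b / D) * y) = ext w a + x * u a + y * v a"
          unfolding ext_simps s1 s2 g p_def[symmetric] q_def[symmetric]
          using D(2) by (simp add: field_simps) (simp add: D(1) algebra_simps)
        moreover have "(ext w' b + (- \<gamma> * v a / D) * x + \<gamma> * u a / D * y) = ext w b + x * u b + y * v b"
          unfolding ext_simps s1 s2 g p_def[symmetric] q_def[symmetric]
          using D(2) by (simp add: field_simps) (simp add: D(1) algebra_simps)
        ultimately have "?G w' x y = plane_shift (ext w) x y"
          using J by (auto simp: fun_eq_iff I w'_def ext_simps)
        then show ?thesis by (simp add: w'_def)
      qed
      then have "(\<integral>\<^sup>+ w. F (?G (\<lambda>i\<in>J. (x * u i + y * v i) + 1 * w i) x y) \<partial>lebesgue_on_coords J)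
        = (\<integral>\<^sup>+ w. F (plane_shift (ext w) x y) \<partial>lebesgue_on_coords J)"
        by (intro nn_integral_cong) (auto simp: space_PiM PiE_def simp del: restrict_apply)
      then show ?thesis by simp
    qed
    finally show "(\<integral>\<^sup>+ w. F (?G w x y) \<partial>lebesgue_on_coords J) = \<dots>" .
  qed
  finally show ?thesis .
qed

end

lemma nn_integral_gauss:
  assumes "\<gamma> > 0"
  shows "(\<integral>\<^sup>+ x. ennreal (exp (- (\<gamma> * x\<^sup>2) / 2)) \<partial>lborel) = ennreal (sqrt (2 * pi / \<gamma>))"
proof -
  let ?\<sigma> = "1 / sqrt \<gamma>"
  have s: "?\<sigma> > 0" using assms by simp
  have "(\<integral>\<^sup>+ x. ennreal (normal_density 0 ?\<sigma> x) \<partial>lborel) = 1"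
    using prob_space.emeasure_space_1[OF prob_space_normal_density[OF s, of 0]]
    by (simp add: emeasure_density)
  moreover have e: "exp (- (\<gamma> * x\<^sup>2) / 2) = sqrt (2 * pi / \<gamma>) * normal_density 0 ?\<sigma> x" for x
    using assms by (simp add: normal_density_def power_divide real_sqrt_divide field_simps)
  have "(\<integral>\<^sup>+ x. ennreal (exp (- (\<gamma> * x\<^sup>2) / 2)) \<partial>lborel) =
    (\<integral>\<^sup>+ x. ennreal (sqrt (2 * pi / \<gamma>)) * ennreal (normal_density 0 ?\<sigma> x) \<partial>lborel)"
    unfolding e using assms by (intro nn_integral_cong ennreal_mult) auto
  ultimately show ?thesis
    by (simp add: nn_integral_cmult)
qed

lemma nn_integral_gauss_plane:
  assumes "\<gamma> > 0"
  shows "(\<integral>\<^sup>+ x. \<integral>\<^sup>+ y. ennreal (exp (- (\<gamma> * (x\<^sup>2 + y\<^sup>2)) / 2)) \<partial>lborel \<partial>lborel) = ennreal (2 * pi / \<gamma>)"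
proof -
  have "exp (- (\<gamma> * (x\<^sup>2 + y\<^sup>2)) / 2) = exp (- (\<gamma> * x\<^sup>2) / 2) * exp (- (\<gamma> * y\<^sup>2) / 2)" for x y :: real
    by (simp add: exp_add[symmetric] field_simps)
  then have "(\<integral>\<^sup>+ x. \<integral>\<^sup>+ y. ennreal (exp (- (\<gamma> * (x\<^sup>2 + y\<^sup>2)) / 2)) \<partial>lborel \<partial>lborel) =
     ennreal (sqrt (2 * pi / \<gamma>)) * ennreal (sqrt (2 * pi / \<gamma>))"
    using nn_integral_gauss[OF assms]
    by (simp add: ennreal_mult' nn_integral_cmult nn_integral_multc)
  also have "\<dots> = ennreal (2 * pi / \<gamma>)"
    using assms by (subst ennreal_mult'[symmetric]) auto
  finally show ?thesis .
qed

lemma nn_integral_cmult2: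
  fixes f :: "real \<Rightarrow> real \<Rightarrow> ennreal"
  assumes "(\<lambda>(x, y). f x y) \<in> borel_measurable (borel \<Otimes>\<^sub>M borel)"
  shows "(\<integral>\<^sup>+ x. \<integral>\<^sup>+ y. c * f x y \<partial>lborel \<partial>lborel) = c * (\<integral>\<^sup>+ x. \<integral>\<^sup>+ y. f x y \<partial>lborel \<partial>lborel)"
proof -
  define g where "g = (\<lambda>(x, y). f x y)"
  have [measurable]: "g \<in> borel_measurable (borel \<Otimes>\<^sub>M borel)" using assms by (simp add: g_def)
  have fg: "f x y = g (x, y)" for x y by (simp add: g_def)
  show ?thesis unfolding fg by (simp add: nn_integral_cmult)
qed

context orthogonal_plane_complement
begin

text \<open>
  The Gaussian weight is a product along the plane and its complement.  If the integrand does not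
  depend on the component in the plane, the plane contributes only the factor $2\pi/\gamma$.  This
  converts an integral over the complement, which conditions on a zero of two linear forms, into
  an integral over the whole space.
\<close>

lemma nn_integral_gauss_weight_invariant:
  assumes T: "T \<in> borel_measurable (lebesgue_on_coords I)"
    and inv: "\<And>c x y. c \<in> extensional I \<Longrightarrow> T (plane_shift c x y) = T c"
  shows "(\<integral>\<^sup>+ c. T c * ennreal (gauss_weight I c) \<partial>lebesgue_on_coords I) =
    ennreal (2 * pi * \<gamma> / \<bar>D\<bar>) * (\<integral>\<^sup>+ w. T (ext w) * ennreal (gauss_weight I (ext w)) \<partial>lebesgue_on_coords J)"
proof -
  let ?e = "\<lambda>x y. exp (- (\<gamma> * (x\<^sup>2 + y\<^sup>2)) / 2)"
  let ?K = "\<integral>\<^sup>+ w. T (ext w) * ennreal (gauss_weight I (ext w)) \<partial>lebesgue_on_coords J"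
  have Tm: "(\<lambda>w. T (ext w) * ennreal (gauss_weight I (ext w))) \<in> borel_measurable (lebesgue_on_coords J)"
    using measurable_compose[OF measurable_ext T] measurable_compose[OF measurable_ext measurable_gauss_weight]
    by (intro borel_measurable_times_ennreal) auto
  have "(\<integral>\<^sup>+ w. T (plane_shift (ext w) x y) * ennreal (gauss_weight I (plane_shift (ext w) x y)) \<partial>lebesgue_on_coords J)
      = ennreal (?e x y) * ?K" for x y
  proof -
    have "(\<integral>\<^sup>+ w. T (plane_shift (ext w) x y) * ennreal (gauss_weight I (plane_shift (ext w) x y)) \<partial>lebesgue_on_coords J)
      = (\<integral>\<^sup>+ w. ennreal (?e x y) * (T (ext w) * ennreal (gauss_weight I (ext w))) \<partial>lebesgue_on_coords J)"
    proof (rule nn_integral_cong)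
      fix w assume "w \<in> space (lebesgue_on_coords J)"
      then have "ext w \<in> extensional I" using ext_extensional by (simp add: space_PiM PiE_def)
      then show "T (plane_shift (ext w) x y) * ennreal (gauss_weight I (plane_shift (ext w) x y)) =
          ennreal (?e x y) * (T (ext w) * ennreal (gauss_weight I (ext w)))"
        unfolding gauss_weight_plane_shift
        by (simp only: inv ennreal_mult' gauss_weight_def exp_ge_zero mult_ac)
    qed
    also have "\<dots> = ennreal (?e x y) * ?K" by (rule nn_integral_cmult[OF Tm])
    finally show ?thesis .
  qed
  then have "(\<integral>\<^sup>+ c. T c * ennreal (gauss_weight I c) \<partial>lebesgue_on_coords I) =
     ennreal (\<gamma>\<^sup>2 / \<bar>D\<bar>) * (\<integral>\<^sup>+ x. \<integral>\<^sup>+ y. ennreal (?e x y) * ?K \<partial>lborel \<partial>lborel)"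
    by (subst nn_integral_split_plane)
       (auto intro!: borel_measurable_times_ennreal T measurable_compose[OF measurable_gauss_weight measurable_ennreal])
  also have "(\<integral>\<^sup>+ x. \<integral>\<^sup>+ y. ennreal (?e x y) * ?K \<partial>lborel \<partial>lborel) = ennreal (2 * pi / \<gamma>) * ?K"
  proof -
    have "(\<integral>\<^sup>+ x. \<integral>\<^sup>+ y. ennreal (?e x y) * ?K \<partial>lborel \<partial>lborel) = (\<integral>\<^sup>+ x. \<integral>\<^sup>+ y. ennreal (?e x y) \<partial>lborel \<partial>lborel) * ?K"
      by (simp add: nn_integral_multc)
    then show ?thesis by (simp only: nn_integral_gauss_plane[OF gamma])
  qed
  also have "ennreal (\<gamma>\<^sup>2 / \<bar>D\<bar>) * (ennreal (2 * pi / \<gamma>) * ?K) = ennreal (2 * pi * \<gamma> / \<bar>D\<bar>) * ?K"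
  proof -
    have "\<gamma>\<^sup>2 / \<bar>D\<bar> * (2 * pi / \<gamma>) = 2 * pi * \<gamma> / \<bar>D\<bar>"
      using gamma by (simp add: power2_eq_square)
    then show ?thesis using gamma by (simp add: mult.assoc[symmetric] ennreal_mult'[symmetric])
  qed
  finally show ?thesis .
qed

text \<open>
  Independence of the two linear forms \<open>u\<close>, \<open>v\<close> from everything that does not depend on the
  component in their plane: \<open>\<Psi>\<close> receives the values of the forms as separate arguments.
\<close>

lemma nn_integral_gauss_weight_independent:
  assumes g1: "\<gamma> = 1"
    and P: "(\<lambda>(x, y, c). \<Psi> x y c) \<in> borel_measurable (borel \<Otimes>\<^sub>M borel \<Otimes>\<^sub>M lebesgue_on_coords I)"
    and inv: "\<And>x y c x' y'. c \<in> extensional I \<Longrightarrow> \<Psi> x y (plane_shift c x' y') = \<Psi> x y c"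
  shows "(\<integral>\<^sup>+ c. \<Psi> (\<Sum>i\<in>I. u i * c i) (\<Sum>i\<in>I. v i * c i) c * ennreal (gauss_weight I c) \<partial>lebesgue_on_coords I) =
    ennreal (1 / (2 * pi)) * (\<integral>\<^sup>+ x. \<integral>\<^sup>+ y. ennreal (exp (- (x\<^sup>2 + y\<^sup>2) / 2)) *
      (\<integral>\<^sup>+ c. \<Psi> x y c * ennreal (gauss_weight I c) \<partial>lebesgue_on_coords I) \<partial>lborel \<partial>lborel)"
proof -
  have abs_D_pos: "\<bar>D\<bar> > 0" using D(2) by (simp only: zero_less_abs_iff not_False_eq_True)
  let ?e = "\<lambda>x y. exp (- (x\<^sup>2 + y\<^sup>2) / 2)"
  let ?K = "\<lambda>x y. \<integral>\<^sup>+ w. \<Psi> x y (ext w) * ennreal (gauss_weight I (ext w)) \<partial>lebesgue_on_coords J"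
  let ?L = "\<lambda>x y. \<integral>\<^sup>+ c. \<Psi> x y c * ennreal (gauss_weight I c) \<partial>lebesgue_on_coords I"
  have Pm: "\<Psi> x y \<in> borel_measurable (lebesgue_on_coords I)" for x y
    using measurable_Pair2[OF measurable_Pair2[OF P, of x], of y] by simp
  define K where "K = (\<lambda>(x, y, c). \<Psi> x y c)"
  have Km: "K \<in> borel_measurable (borel \<Otimes>\<^sub>M borel \<Otimes>\<^sub>M lebesgue_on_coords I)" using P by (simp add: K_def)
  have KP: "\<Psi> x y c = K (x, y, c)" for x y c by (simp add: K_def)
  have Km2: "(\<lambda>c. K (\<Sum>i\<in>I. u i * c i, \<Sum>i\<in>I. v i * c i, c)) \<in> borel_measurable (lebesgue_on_coords I)"
    by (rule measurable_compose[OF _ Km]) measurable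
  note sf = lborel_product.sigma_finite[OF fin_I]
  have Lm: "(\<lambda>(x, y). ennreal (?e x y) * ?L x y) \<in> borel_measurable (borel \<Otimes>\<^sub>M borel)"
  proof -
    have g: "gauss_weight I \<in> borel_measurable (lebesgue_on_coords I)" by (rule measurable_gauss_weight)
    have "(\<lambda>z. ennreal (?e (fst z) (snd z)) * (\<integral>\<^sup>+ c. K (fst z, snd z, c) * ennreal (gauss_weight I c) \<partial>lebesgue_on_coords I))
        \<in> borel_measurable (borel \<Otimes>\<^sub>M borel)"
    proof (rule borel_measurable_times_ennreal)
      have "(\<lambda>(z, c). K (fst z, snd z, c) * ennreal (gauss_weight I c)) \<in> borel_measurable ((borel \<Otimes>\<^sub>M borel) \<Otimes>\<^sub>M lebesgue_on_coords I)"
      proof -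
        have m1: "(\<lambda>z. K (fst (fst z), snd (fst z), snd z)) \<in> borel_measurable ((borel \<Otimes>\<^sub>M borel) \<Otimes>\<^sub>M lebesgue_on_coords I)"
          by (rule measurable_compose[OF _ Km])
             (intro measurable_Pair measurable_snd measurable_compose[OF measurable_fst measurable_fst] measurable_compose[OF measurable_fst measurable_snd])
        have m2: "(\<lambda>z. ennreal (gauss_weight I (snd z))) \<in> borel_measurable ((borel \<Otimes>\<^sub>M borel) \<Otimes>\<^sub>M lebesgue_on_coords I)"
          by (intro measurable_compose[OF measurable_compose[OF measurable_snd g] measurable_ennreal])
        show ?thesis unfolding case_prod_unfold using m1 m2 by (rule borel_measurable_times_ennreal)
      qed
      from sigma_finite_measure.borel_measurable_nn_integral[OF sf this]
      show "(\<lambda>z. \<integral>\<^sup>+ c. K (fst z, snd z, c) * ennreal (gauss_weight I c) \<partial>lebesgue_on_coords I) \<in> borel_measurable (borel \<Otimes>\<^sub>M borel)"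
        by simp
      show "(\<lambda>z :: real \<times> real. ennreal (?e (fst z) (snd z))) \<in> borel_measurable (borel \<Otimes>\<^sub>M borel)"
        unfolding borel_prod
        by (intro measurable_compose[OF _ measurable_ennreal] borel_measurable_continuous_onI continuous_intros) simp
    qed
    then show ?thesis by (simp only: KP case_prod_unfold)
  qed
  have K: "?K x y = ennreal (\<bar>D\<bar> / (2 * pi)) * ?L x y" for x y
  proof -
    have inverse: "k = ennreal (\<bar>D\<bar> / (2 * pi)) * l" if "l = ennreal (2 * pi * 1 / \<bar>D\<bar>) * k" for k l
    proof -
      have "ennreal (\<bar>D\<bar> / (2 * pi)) * ennreal (2 * pi * 1 / \<bar>D\<bar>) = 1"
      proof -
        have "\<And>d::real. d > 0 \<Longrightarrow> d / (2 * pi) * (2 * pi * 1 / d) = 1" by simp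
        from this[OF abs_D_pos] have "\<bar>D\<bar> / (2 * pi) * (2 * pi * 1 / \<bar>D\<bar>) = 1" .
        moreover have "ennreal (\<bar>D\<bar> / (2 * pi)) * ennreal (2 * pi * 1 / \<bar>D\<bar>) = ennreal (\<bar>D\<bar> / (2 * pi) * (2 * pi * 1 / \<bar>D\<bar>))"
          by (rule ennreal_mult'[symmetric]) simp
        ultimately show ?thesis by (simp only: ennreal_1)
      qed
      then show ?thesis unfolding that mult.assoc[symmetric] by simp
    qed
    show ?thesis
      by (rule inverse[OF nn_integral_gauss_weight_invariant[of "\<Psi> x y", OF Pm[of x y] inv[of _ x y], unfolded g1]])
  qed
  have "(\<integral>\<^sup>+ c. \<Psi> (\<Sum>i\<in>I. u i * c i) (\<Sum>i\<in>I. v i * c i) c * ennreal (gauss_weight I c) \<partial>lebesgue_on_coords I) =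
     ennreal (1 / \<bar>D\<bar>) * (\<integral>\<^sup>+ x. \<integral>\<^sup>+ y. ennreal (?e x y) * ?K x y \<partial>lborel \<partial>lborel)"
  proof -
    have "(\<integral>\<^sup>+ w. \<Psi> (\<Sum>i\<in>I. u i * plane_shift (ext w) x y i) (\<Sum>i\<in>I. v i * plane_shift (ext w) x y i) (plane_shift (ext w) x y)
          * ennreal (gauss_weight I (plane_shift (ext w) x y)) \<partial>lebesgue_on_coords J) = ennreal (?e x y) * ?K x y" for x y
    proof -
      have "(\<integral>\<^sup>+ w. \<Psi> (\<Sum>i\<in>I. u i * plane_shift (ext w) x y i) (\<Sum>i\<in>I. v i * plane_shift (ext w) x y i) (plane_shift (ext w) x y)
          * ennreal (gauss_weight I (plane_shift (ext w) x y)) \<partial>lebesgue_on_coords J) =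
        (\<integral>\<^sup>+ w. ennreal (?e x y) * (\<Psi> x y (ext w) * ennreal (gauss_weight I (ext w))) \<partial>lebesgue_on_coords J)"
      proof (rule nn_integral_cong)
        fix w assume "w \<in> space (lebesgue_on_coords J)"
        then have "ext w \<in> extensional I" using ext_extensional by (simp add: space_PiM PiE_def)
        then show "\<Psi> (\<Sum>i\<in>I. u i * plane_shift (ext w) x y i) (\<Sum>i\<in>I. v i * plane_shift (ext w) x y i) (plane_shift (ext w) x y)
          * ennreal (gauss_weight I (plane_shift (ext w) x y)) = ennreal (?e x y) * (\<Psi> x y (ext w) * ennreal (gauss_weight I (ext w)))"
        proof -
          assume e: "ext w \<in> extensional I"
          have "ennreal (gauss_weight I (ext w) * ?e x y) = ennreal (gauss_weight I (ext w)) * ennreal (?e x y)"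
            by (rule ennreal_mult') (simp add: gauss_weight_def)
          then show ?thesis
            unfolding gauss_weight_plane_shift dot_plane_shift dot_ext inv[OF e] g1 mult_1 add_0
            by (simp only: mult_ac)
        qed
      qed
      also have "\<dots> = ennreal (?e x y) * ?K x y"
        by (rule nn_integral_cmult, rule borel_measurable_times_ennreal[OF measurable_compose[OF measurable_ext Pm]
          measurable_compose[OF measurable_compose[OF measurable_ext measurable_gauss_weight] measurable_ennreal]])
      finally show ?thesis .
    qed
    then show ?thesis
    proof -
      have m1: "(\<lambda>c. \<Psi> (\<Sum>i\<in>I. u i * c i) (\<Sum>i\<in>I. v i * c i) c) \<in> borel_measurable (lebesgue_on_coords I)"
        using Km2 unfolding KP .
      have m: "(\<lambda>c. \<Psi> (\<Sum>i\<in>I. u i * c i) (\<Sum>i\<in>I. v i * c i) c * ennreal (gauss_weight I c)) \<in> borel_measurable (lebesgue_on_coords I)"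
        by (rule borel_measurable_times_ennreal[OF m1 measurable_compose[OF measurable_gauss_weight measurable_ennreal]])
      assume *: "\<And>x y. (\<integral>\<^sup>+ w. \<Psi> (\<Sum>i\<in>I. u i * plane_shift (ext w) x y i) (\<Sum>i\<in>I. v i * plane_shift (ext w) x y i) (plane_shift (ext w) x y)
          * ennreal (gauss_weight I (plane_shift (ext w) x y)) \<partial>lebesgue_on_coords J) = ennreal (?e x y) * ?K x y"
      show ?thesis
        unfolding nn_integral_split_plane[OF m] * by (simp only: g1 power_one)
    qed
  qed
  also have "\<dots> = ennreal (1 / \<bar>D\<bar>) * (\<integral>\<^sup>+ x. \<integral>\<^sup>+ y. ennreal (\<bar>D\<bar> / (2 * pi)) * (ennreal (?e x y) * ?L x y) \<partial>lborel \<partial>lborel)"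
    by (simp only: K mult.left_commute)
  also have "\<dots> = ennreal (1 / \<bar>D\<bar>) * (ennreal (\<bar>D\<bar> / (2 * pi)) * (\<integral>\<^sup>+ x. \<integral>\<^sup>+ y. ennreal (?e x y) * ?L x y \<partial>lborel \<partial>lborel))"
    by (simp only: nn_integral_cmult2[OF Lm])
  also have "\<dots> = ennreal (1 / (2 * pi)) * (\<integral>\<^sup>+ x. \<integral>\<^sup>+ y. ennreal (?e x y) * ?L x y \<partial>lborel \<partial>lborel)"
  proof -
    have "ennreal (1 / \<bar>D\<bar>) * ennreal (\<bar>D\<bar> / (2 * pi)) = ennreal (1 / (2 * pi))"
    proof -
      have "\<And>d::real. d > 0 \<Longrightarrow> 1 / d * (d / (2 * pi)) = 1 / (2 * pi)" by simp
      from this[OF abs_D_pos] have "1 / \<bar>D\<bar> * (\<bar>D\<bar> / (2 * pi)) = 1 / (2 * pi)" .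
      moreover have "ennreal (1 / \<bar>D\<bar>) * ennreal (\<bar>D\<bar> / (2 * pi)) = ennreal (1 / \<bar>D\<bar> * (\<bar>D\<bar> / (2 * pi)))"
        by (rule ennreal_mult'[symmetric]) simp
      ultimately show ?thesis by (simp only:)
    qed
    then show ?thesis by (simp only: mult.assoc[symmetric])
  qed
  finally show ?thesis .
qed

end

text \<open>
  By Lagrange's identity the sum of the squares of all minors is $2\gamma^2$.
\<close>

lemma exists_nonzero_minor:
  fixes u v :: "'i \<Rightarrow> real"
  assumes I: "finite I" and n: "(\<Sum>i\<in>I. u i * u i) = \<gamma>" "(\<Sum>i\<in>I. v i * v i) = \<gamma>" "(\<Sum>i\<in>I. u i * v i) = 0" "\<gamma> > 0"
  obtains a b where "a \<in> I" "b \<in> I" "a \<noteq> b" "u a * v b - u b * v a \<noteq> 0"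
proof -
  have "\<exists>a\<in>I. \<exists>b\<in>I. u a * v b - u b * v a \<noteq> 0"
  proof (rule ccontr)
    assume "\<not> ?thesis"
    then have "0 = (\<Sum>a\<in>I. \<Sum>b\<in>I. (u a * v b - u b * v a) * (u a * v b - u b * v a))" by simp
    also have "\<dots> = (\<Sum>a\<in>I. \<Sum>b\<in>I. (u a * u a) * (v b * v b) + (v a * v a) * (u b * u b) - 2 * ((u a * v a) * (u b * v b)))"
      by (intro sum.cong) (auto simp: algebra_simps)
    also have "\<dots> = \<gamma> * \<gamma> + \<gamma> * \<gamma>"
      by (simp add: sum.distrib sum_subtractf sum_distrib_left[symmetric] sum_distrib_right[symmetric] n)
    finally show False using \<open>\<gamma> > 0\<close> by (simp add: add_eq_0_iff)
  qed
  then show ?thesis using that by force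
qed

lemma orthogonal_plane_complementI:
  fixes u v :: "'i \<Rightarrow> real"
  assumes I: "finite I" "a \<in> I" "b \<in> I" "a \<noteq> b" "u a * v b - u b * v a \<noteq> 0"
    and n: "(\<Sum>i\<in>I. u i * u i) = \<gamma>" "(\<Sum>i\<in>I. v i * v i) = \<gamma>" "(\<Sum>i\<in>I. u i * v i) = 0" "\<gamma> > 0"
  shows "orthogonal_plane_complement I (I - {a, b}) a b u v (u a * v b - u b * v a) \<gamma>"
proof unfold_locales
  show "I = insert b (insert a (I - {a, b}))" using I by blast
qed (use I in blast | rule refl n I | simp add: I)+

lemma orthonormal_gauss_weight_independent:
  fixes u v :: "'i \<Rightarrow> real"
  assumes I: "finite I" and n: "(\<Sum>i\<in>I. u i * u i) = 1" "(\<Sum>i\<in>I. v i * v i) = 1" "(\<Sum>i\<in>I. u i * v i) = 0"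
    and P: "(\<lambda>(x, y, c). \<Psi> x y c) \<in> borel_measurable (borel \<Otimes>\<^sub>M borel \<Otimes>\<^sub>M lebesgue_on_coords I)"
    and inv: "\<And>x y c x' y'. c \<in> extensional I \<Longrightarrow> \<Psi> x y (\<lambda>i\<in>I. c i + x' * u i + y' * v i) = \<Psi> x y c"
  shows "(\<integral>\<^sup>+ c. \<Psi> (\<Sum>i\<in>I. u i * c i) (\<Sum>i\<in>I. v i * c i) c * ennreal (gauss_weight I c) \<partial>lebesgue_on_coords I) =
    ennreal (1 / (2 * pi)) * (\<integral>\<^sup>+ x. \<integral>\<^sup>+ y. ennreal (exp (- (x\<^sup>2 + y\<^sup>2) / 2)) *
      (\<integral>\<^sup>+ c. \<Psi> x y c * ennreal (gauss_weight I c) \<partial>lebesgue_on_coords I) \<partial>lborel \<partial>lborel)"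
proof -
  obtain a b where ab: "a \<in> I" "b \<in> I" "a \<noteq> b" "u a * v b - u b * v a \<noteq> 0"
    by (rule exists_nonzero_minor[OF I n zero_less_one])
  interpret orthogonal_plane_complement I "I - {a, b}" a b u v "u a * v b - u b * v a" 1
    by (rule orthogonal_plane_complementI[OF I ab n zero_less_one])
  show ?thesis by (rule nn_integral_gauss_weight_independent[OF refl P inv])
qed

section \<open>Ball averages as Gaussian averages\<close>

lemma gauss_tail_measurable:
  "(\<lambda>r. ennreal (r * exp (- r\<^sup>2 / 2)) * indicator {L..} r) \<in> borel_measurable lborel"
  by measurable

lemma nn_integral_gauss_tail:
  assumes "L > 0"
  shows "(\<integral>\<^sup>+ r. ennreal (r * exp (- r\<^sup>2 / 2)) * indicator {L..} r \<partial>lborel) = ennreal (exp (- L\<^sup>2 / 2))"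
proof -
  have "(\<integral>\<^sup>+ r. ennreal (r * exp (- r\<^sup>2 / 2)) * indicator {L..} r \<partial>lborel) = ennreal (0 - (- exp (- L\<^sup>2 / 2)))"
  proof (rule nn_integral_FTC_atLeast)
    show "((\<lambda>r. - exp (- r\<^sup>2 / 2)) has_real_derivative r * exp (- r\<^sup>2 / 2)) (at r)" for r :: real
      by (auto intro!: derivative_eq_intros)
    show "((\<lambda>r::real. - exp (- r\<^sup>2 / 2)) \<longlongrightarrow> 0) at_top"
    proof -
      have "filterlim (\<lambda>r::real. r\<^sup>2) at_top at_top" by (intro filterlim_pow_at_top filterlim_ident) simp
      then have "filterlim (\<lambda>r::real. r\<^sup>2 / 2) at_top at_top"
        using filterlim_tendsto_pos_mult_at_top[OF tendsto_const[of "1/2::real"], of _ at_top] by simp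
      then have "filterlim (\<lambda>r::real. - r\<^sup>2 / 2) at_bot at_top" by (simp add: filterlim_uminus_at_bot)
      then have "((\<lambda>r::real. exp (- r\<^sup>2 / 2)) \<longlongrightarrow> 0) at_top" by (rule filterlim_compose[OF exp_at_bot])
      from tendsto_minus[OF this] show ?thesis by (simp only: minus_zero)
    qed
  qed (use assms in auto)
  then show ?thesis by simp
qed

definition punctured_ball :: "'i set \<Rightarrow> real \<Rightarrow> ('i \<Rightarrow> real) set" where
  "punctured_ball I r = {c. 0 < L2_set c I \<and> L2_set c I \<le> r}"

lemma measurable_L2_set: "(\<lambda>c. L2_set c I) \<in> borel_measurable (lebesgue_on_coords I)"
  unfolding L2_set_def by measurable

lemma indicator_punctured_ball: "indicator (punctured_ball I r) c = (indicator {0<..r} (L2_set c I) :: ennreal)"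
  by (simp add: punctured_ball_def indicator_def)

lemma measurable_indicator_punctured_ball:
  "(\<lambda>c. indicator (punctured_ball I r) c :: ennreal) \<in> borel_measurable (lebesgue_on_coords I)"
  unfolding indicator_punctured_ball
  by (rule measurable_compose[OF measurable_L2_set borel_measurable_indicator]) simp

lemma L2_set_scale:
  assumes "r > 0"
  shows "L2_set (\<lambda>i\<in>I. r * c i) I = r * L2_set c I"
proof -
  have "L2_set (\<lambda>i\<in>I. r * c i) I = L2_set (\<lambda>i. r * c i) I"
    by (rule L2_set_cong) auto
  then show ?thesis using assms by (simp add: L2_set_right_distrib)
qed

lemma nn_integral_punctured_ball_scale:
  fixes m :: "('i \<Rightarrow> real) \<Rightarrow> ennreal"
  assumes I: "finite I" and m: "m \<in> borel_measurable (lebesgue_on_coords I)"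
    and hom: "\<And>r c. r > 0 \<Longrightarrow> m (\<lambda>i\<in>I. r * c i) = m c" and r: "r > 0"
  shows "(\<integral>\<^sup>+ c. m c * indicator (punctured_ball I r) c \<partial>lebesgue_on_coords I) =
         ennreal (r ^ card I) * (\<integral>\<^sup>+ c. m c * indicator (punctured_ball I 1) c \<partial>lebesgue_on_coords I)"
proof -
  have ind: "(\<lambda>c. indicator (punctured_ball I r) c :: ennreal) \<in> borel_measurable (lebesgue_on_coords I)"
    by (rule measurable_indicator_punctured_ball)
  have "(\<integral>\<^sup>+ c. m c * indicator (punctured_ball I r) c \<partial>lebesgue_on_coords I) =
     ennreal (\<bar>r\<bar> ^ card I) * (\<integral>\<^sup>+ c. m (\<lambda>i\<in>I. 0 + r * c i) * indicator (punctured_ball I r) (\<lambda>i\<in>I. 0 + r * c i) \<partial>lebesgue_on_coords I)"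
    by (rule nn_integral_coords_affine[OF I _ borel_measurable_times_ennreal[OF m ind]]) (use r in simp)
  moreover have "m (\<lambda>i\<in>I. 0 + r * c i) * indicator (punctured_ball I r) (\<lambda>i\<in>I. 0 + r * c i) = m c * indicator (punctured_ball I 1) c" for c
    using r by (simp only: add_0 hom L2_set_scale punctured_ball_def indicator_def mem_Collect_eq) (simp add: zero_less_mult_iff)
  ultimately show ?thesis using r by simp
qed

lemma gauss_weight_eq_L2_set: "gauss_weight I c = exp (- (L2_set c I)\<^sup>2 / 2)"
  by (simp add: gauss_weight_def L2_set_def sum_nonneg)

lemma AE_L2_set_pos:
  assumes I: "finite I" "I \<noteq> {}"
  shows "AE c in lebesgue_on_coords I. 0 < L2_set c I"
proof (rule AE_I)
  let ?Z = "PiE I (\<lambda>_. {0::real})"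
  show "{c \<in> space (lebesgue_on_coords I). \<not> 0 < L2_set c I} \<subseteq> ?Z"
  proof
    fix c assume "c \<in> {c \<in> space (lebesgue_on_coords I). \<not> 0 < L2_set c I}"
    then have c: "c \<in> extensional I" "L2_set c I = 0"
      using L2_set_nonneg[of c I] by (auto simp: space_PiM PiE_def)
    then have "c \<in> (\<Pi>\<^sub>E i\<in>I. {0})" using I by (simp only: L2_set_eq_0_iff PiE_iff) auto
    then show "c \<in> ?Z" .
  qed
  show "?Z \<in> sets (lebesgue_on_coords I)" by (intro sets_PiM_I_finite I) auto
  have "emeasure (lebesgue_on_coords I) ?Z = (\<Prod>i\<in>I. emeasure lborel {0::real})"
    by (rule lborel_product.emeasure_PiM) (use I in auto)
  then show "emeasure (lebesgue_on_coords I) ?Z = 0" using I by (simp add: card_gt_0_iff)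
qed

text \<open>
  Polar coordinates without spherical measure: the weight at \<open>c\<close> is the integral of
  $r e^{-r^2/2}$ over all radii \<open>r\<close> of balls containing \<open>c\<close>.  After exchanging the integrals the
  ball of radius \<open>r\<close> is rescaled to the unit ball.
\<close>

lemma nn_integral_gauss_weight_homogeneous:
  fixes m :: "('i \<Rightarrow> real) \<Rightarrow> ennreal"
  assumes I: "finite I" "I \<noteq> {}" and m: "m \<in> borel_measurable (lebesgue_on_coords I)"
    and hom: "\<And>r c. r > 0 \<Longrightarrow> m (\<lambda>i\<in>I. r * c i) = m c"
  shows "(\<integral>\<^sup>+ c. m c * ennreal (gauss_weight I c) \<partial>lebesgue_on_coords I) =
    (\<integral>\<^sup>+ r. ennreal (r * exp (- r\<^sup>2 / 2)) * indicator {0<..} r * ennreal (r ^ card I) \<partial>lborel) *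
    (\<integral>\<^sup>+ c. m c * indicator (punctured_ball I 1) c \<partial>lebesgue_on_coords I)"
proof -
  let ?L = "lebesgue_on_coords I"
  have pair: "pair_sigma_finite ?L (lborel :: real measure)"
    by (intro pair_sigma_finite.intro lborel_product.sigma_finite[OF I(1)] sigma_finite_lborel)
  define g where "g = (\<lambda>r::real. ennreal (r * exp (- r\<^sup>2 / 2)) * indicator {0<..} r)"
  have gm: "g \<in> borel_measurable borel" unfolding g_def by measurable
  define Q where "Q = {z :: real \<times> real. 0 < fst z} \<inter> {z. fst z \<le> snd z}"
  have Q: "Q \<in> sets (borel \<Otimes>\<^sub>M borel)"
    unfolding Q_def borel_prod
    by (intro sets.Int borel_open borel_closed open_Collect_less closed_Collect_le continuous_intros)
  define q :: "real \<times> real \<Rightarrow> ennreal" where "q = indicator Q"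
  have qm: "q \<in> borel_measurable (borel \<Otimes>\<^sub>M borel)"
    unfolding q_def using Q by (rule borel_measurable_indicator)
  have qi: "q (L2_set c I, r) = indicator (punctured_ball I r) c" for c r
    by (simp add: q_def Q_def punctured_ball_def indicator_def)
  have m1: "(\<lambda>z. g (snd z)) \<in> borel_measurable (?L \<Otimes>\<^sub>M lborel)"
    by (rule measurable_compose[OF measurable_snd]) (use gm in simp)
  have m2: "(\<lambda>z. m (fst z)) \<in> borel_measurable (?L \<Otimes>\<^sub>M lborel)"
    by (rule measurable_compose[OF measurable_fst m])
  have "(\<lambda>z. (L2_set (fst z) I, snd z)) \<in> (?L \<Otimes>\<^sub>M lborel) \<rightarrow>\<^sub>M (borel \<Otimes>\<^sub>M borel)"
    by (intro measurable_Pair measurable_compose[OF measurable_fst measurable_L2_set]) simp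
  then have m3: "(\<lambda>z. q (L2_set (fst z) I, snd z)) \<in> borel_measurable (?L \<Otimes>\<^sub>M lborel)"
    by (rule measurable_compose[OF _ qm])
  have mm: "(\<lambda>(c, r). g r * (m c * indicator (punctured_ball I r) c)) \<in> borel_measurable (?L \<Otimes>\<^sub>M lborel)"
    unfolding case_prod_unfold qi[symmetric]
    by (intro borel_measurable_times_ennreal m1 m2 m3)
  have bm: "(\<lambda>c. indicator (punctured_ball I r) c :: ennreal) \<in> borel_measurable ?L" for r
    by (rule measurable_indicator_punctured_ball)
  have "(\<integral>\<^sup>+ c. m c * ennreal (gauss_weight I c) \<partial>?L) = (\<integral>\<^sup>+ c. \<integral>\<^sup>+ r. g r * (m c * indicator (punctured_ball I r) c) \<partial>lborel \<partial>?L)"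
  proof (rule nn_integral_cong_AE)
    show "AE c in ?L. m c * ennreal (gauss_weight I c) = (\<integral>\<^sup>+ r. g r * (m c * indicator (punctured_ball I r) c) \<partial>lborel)"
      using AE_L2_set_pos[OF I]
    proof eventually_elim
      case (elim c)
      have "(\<integral>\<^sup>+ r. g r * (m c * indicator (punctured_ball I r) c) \<partial>lborel) =
         (\<integral>\<^sup>+ r. m c * (ennreal (r * exp (- r\<^sup>2 / 2)) * indicator {L2_set c I..} r) \<partial>lborel)"
        using elim by (intro nn_integral_cong) (auto simp: g_def punctured_ball_def indicator_def mult_ac)
      also have "\<dots> = m c * (\<integral>\<^sup>+ r. ennreal (r * exp (- r\<^sup>2 / 2)) * indicator {L2_set c I..} r \<partial>lborel)"
        by (rule nn_integral_cmult[OF gauss_tail_measurable])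
      finally show ?case by (simp only: nn_integral_gauss_tail[OF elim] gauss_weight_eq_L2_set)
    qed
  qed
  also have "\<dots> = (\<integral>\<^sup>+ r. \<integral>\<^sup>+ c. g r * (m c * indicator (punctured_ball I r) c) \<partial>?L \<partial>lborel)"
    by (rule pair_sigma_finite.Fubini'[OF pair mm, symmetric])
  also have "\<dots> = (\<integral>\<^sup>+ r. g r * ennreal (r ^ card I) * (\<integral>\<^sup>+ c. m c * indicator (punctured_ball I 1) c \<partial>?L) \<partial>lborel)"
  proof (rule nn_integral_cong)
    fix r :: real
    have "(\<integral>\<^sup>+ c. g r * (m c * indicator (punctured_ball I r) c) \<partial>?L) = g r * (\<integral>\<^sup>+ c. m c * indicator (punctured_ball I r) c \<partial>?L)"
      by (rule nn_integral_cmult[OF borel_measurable_times_ennreal[OF m bm]])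
    also have "\<dots> = g r * (ennreal (r ^ card I) * (\<integral>\<^sup>+ c. m c * indicator (punctured_ball I 1) c \<partial>?L))"
    proof (cases "r > 0")
      case True
      show ?thesis by (simp only: nn_integral_punctured_ball_scale[OF I(1) m hom True])
    qed (simp add: g_def)
    finally show "(\<integral>\<^sup>+ c. g r * (m c * indicator (punctured_ball I r) c) \<partial>?L) =
       g r * ennreal (r ^ card I) * (\<integral>\<^sup>+ c. m c * indicator (punctured_ball I 1) c \<partial>?L)"
      by (simp only: mult.assoc)
  qed
  also have "\<dots> = (\<integral>\<^sup>+ r. g r * ennreal (r ^ card I) \<partial>lborel) * (\<integral>\<^sup>+ c. m c * indicator (punctured_ball I 1) c \<partial>?L)"
    by (rule nn_integral_multc, rule borel_measurable_times_ennreal)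
       (use gm in simp, intro measurable_compose[OF _ measurable_ennreal] borel_measurable_power, simp)
  finally show ?thesis by (simp only: g_def)
qed

lemma nn_integral_gauss_weight_finite:
  fixes I :: "'i set"
  assumes I: "finite I"
  shows "(\<integral>\<^sup>+ c. ennreal (gauss_weight I c) \<partial>lebesgue_on_coords I) = ennreal (sqrt (2 * pi) ^ card I)"
proof -
  have g1: "(\<integral>\<^sup>+ x. ennreal (exp (- x\<^sup>2 / 2)) \<partial>lborel) = ennreal (sqrt (2 * pi))"
    using nn_integral_gauss[of 1] by simp
  have "ennreal (gauss_weight I c) = (\<Prod>i\<in>I. ennreal (exp (- (c i)\<^sup>2 / 2)))" for c
  proof -
    have "gauss_weight I c = (\<Prod>i\<in>I. exp (- (c i)\<^sup>2 / 2))"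
      unfolding gauss_weight_def exp_sum[OF I, symmetric] by (simp add: sum_negf sum_divide_distrib)
    then show ?thesis by (simp add: prod_ennreal)
  qed
  then have "(\<integral>\<^sup>+ c. ennreal (gauss_weight I c) \<partial>lebesgue_on_coords I) = (\<Prod>i\<in>I. \<integral>\<^sup>+ x. ennreal (exp (- x\<^sup>2 / 2)) \<partial>lborel)"
    using lborel_product.product_nn_integral_prod[OF I, of "\<lambda>_ x. ennreal (exp (- x\<^sup>2 / 2))"] by simp
  then show ?thesis unfolding g1 by (simp add: ennreal_power)
qed

text \<open>
  The radial factor in \<open>nn_integral_gauss_weight_homogeneous\<close> is the same for \<open>m\<close> and for the constant \<open>1\<close>; it is
  finite and nonzero because the total Gaussian mass is.
\<close>

lemma ball_average_eq_gauss_average: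
  fixes m :: "('i \<Rightarrow> real) \<Rightarrow> ennreal"
  assumes I: "finite I" "I \<noteq> {}" and m: "m \<in> borel_measurable (lebesgue_on_coords I)"
    and hom: "\<And>r c. r > 0 \<Longrightarrow> m (\<lambda>i\<in>I. r * c i) = m c"
  shows "(\<integral>\<^sup>+ c. m c * indicator (punctured_ball I 1) c \<partial>lebesgue_on_coords I) /
         (\<integral>\<^sup>+ c. indicator (punctured_ball I 1) c \<partial>lebesgue_on_coords I) =
         (\<integral>\<^sup>+ c. m c * ennreal (gauss_weight I c) \<partial>lebesgue_on_coords I) /
         (\<integral>\<^sup>+ c. ennreal (gauss_weight I c) \<partial>lebesgue_on_coords I)"
    (is "?Bm / ?B = ?Gm / ?G")
proof -
  let ?k = "\<integral>\<^sup>+ r. ennreal (r * exp (- r\<^sup>2 / 2)) * indicator {0<..} r * ennreal (r ^ card I) \<partial>lborel"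
  have 1: "?Gm = ?k * ?Bm" by (rule nn_integral_gauss_weight_homogeneous[OF I m hom])
  have 2: "?G = ?k * ?B"
    using nn_integral_gauss_weight_homogeneous[OF I, of "\<lambda>_. 1"] by simp
  have G: "?G \<noteq> 0" "?G \<noteq> \<infinity>"
    unfolding nn_integral_gauss_weight_finite[OF I(1)] by auto
  have k: "?k \<noteq> 0" using G 2 by auto
  have k': "?k \<noteq> \<infinity>"
  proof
    assume k: "?k = \<infinity>"
    have "?B \<noteq> 0" using G 2 by auto
    then show False using G(2) unfolding 2 k by (simp add: ennreal_top_mult)
  qed
  have cancel: "(k * x) / (k * y) = x / y" if "k \<noteq> 0" "k \<noteq> \<infinity>" for k x y :: ennreal
    using divide_mult_eq[OF that, of x y] by (simp only: mult.commute)
  show ?thesis unfolding 1 2 by (rule cancel[OF k k', symmetric])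
qed

section \<open>A Gaussian mean of an absolute quadratic form\<close>

text \<open>
  The disc of radius $\sqrt a$ has area $\pi a$, so that the square of the norm in the plane has
  constant density \<open>\<pi>\<close>.
\<close>

lemma distr_norm_square:
  "distr (lborel \<Otimes>\<^sub>M lborel) borel (\<lambda>(y, z). y\<^sup>2 + z\<^sup>2 :: real) = density lborel (\<lambda>s. ennreal pi * indicator {0..} s)"
proof (rule measure_eqI_generator_eq[where E="range (\<lambda>a::real. {..a})" and \<Omega>=UNIV and A="\<lambda>n. {..real n}"])
  let ?f = "\<lambda>(y, z). y\<^sup>2 + z\<^sup>2 :: real"
  have c: "continuous_on UNIV ?f" unfolding case_prod_unfold by (intro continuous_intros)
  have fm: "?f \<in> (lborel \<Otimes>\<^sub>M lborel) \<rightarrow>\<^sub>M borel"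
    using borel_measurable_continuous_onI[OF c] by (simp add: borel_prod lborel_prod)
  show "Int_stable (range (\<lambda>a::real. {..a}))" by (auto simp: Int_stable_def)
  have dens: "emeasure (density lborel (\<lambda>s. ennreal pi * indicator {0..} s)) {..a} = ennreal (pi * max 0 a)" for a :: real
  proof -
    have "emeasure (density lborel (\<lambda>s. ennreal pi * indicator {0..} s)) {..a} =
        (\<integral>\<^sup>+ s. ennreal pi * indicator {0..a} s \<partial>lborel)"
      by (subst emeasure_density) (auto intro!: nn_integral_cong simp: indicator_def)
    also have "\<dots> = ennreal pi * emeasure lborel {0..a}" by (simp add: nn_integral_cmult_indicator)
    also have "\<dots> = ennreal (pi * max 0 a)"
      by (cases "a \<ge> 0") (auto simp: ennreal_mult')
    finally show ?thesis .
  qed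
  have dist: "emeasure (distr (lborel \<Otimes>\<^sub>M lborel) borel ?f) {..a} = ennreal (pi * max 0 a)" for a :: real
  proof -
    have "emeasure (distr (lborel \<Otimes>\<^sub>M lborel) borel ?f) {..a} = emeasure (lborel :: (real \<times> real) measure) (?f -` {..a})"
      by (subst emeasure_distr[OF fm]) (auto simp: lborel_prod)
    also have "\<dots> = ennreal (pi * max 0 a)"
    proof (cases "a \<ge> 0")
      case True
      have "?f -` {..a} = cball 0 (sqrt a)"
        using True by (auto simp: norm_prod_def dist_norm real_sqrt_le_iff)
      then have "emeasure lborel (?f -` {..a}) = ennreal (unit_ball_vol (real DIM(real \<times> real)) * sqrt a ^ DIM(real \<times> real))"
        using True by (simp only: emeasure_cball real_sqrt_ge_zero)
      also have "\<dots> = ennreal (pi * a)" using True by (simp add: unit_ball_vol_2)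
      finally show ?thesis using True by simp
    next
      case False
      have "?f -` {..a} = {}" using False by (auto simp: not_le) (smt (verit) zero_le_power2)
      then show ?thesis using False by simp
    qed
    finally show ?thesis .
  qed
  show "emeasure (distr (lborel \<Otimes>\<^sub>M lborel) borel ?f) X = emeasure (density lborel (\<lambda>s. ennreal pi * indicator {0..} s)) X"
    if "X \<in> range (\<lambda>a::real. {..a})" for X
    using that dens dist by auto
  show "emeasure (distr (lborel \<Otimes>\<^sub>M lborel) borel ?f) {..real n} \<noteq> \<infinity>" for n
    unfolding dist by simp
  show "sets (distr (lborel \<Otimes>\<^sub>M lborel) borel ?f) = sigma_sets UNIV (range (\<lambda>a::real. {..a}))"
    "sets (density lborel (\<lambda>s. ennreal pi * indicator {0..} s)) = sigma_sets UNIV (range (\<lambda>a::real. {..a}))"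
    by (auto simp: borel_eq_atMost)
  show "(\<Union>n. {..real n}) = UNIV" by (auto intro: real_arch_simple)
qed auto

lemma nn_integral_norm_square:
  fixes g :: "real \<Rightarrow> ennreal"
  assumes g: "g \<in> borel_measurable borel"
  shows "(\<integral>\<^sup>+ y. \<integral>\<^sup>+ z. g (y\<^sup>2 + z\<^sup>2) \<partial>lborel \<partial>lborel) = ennreal pi * (\<integral>\<^sup>+ s. g s * indicator {0..} s \<partial>lborel)"
proof -
  let ?f = "\<lambda>(y, z). y\<^sup>2 + z\<^sup>2 :: real"
  have c: "continuous_on UNIV ?f" unfolding case_prod_unfold by (intro continuous_intros)
  have fm: "?f \<in> (lborel \<Otimes>\<^sub>M lborel) \<rightarrow>\<^sub>M borel"
    using borel_measurable_continuous_onI[OF c] by (simp add: borel_prod lborel_prod)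
  have "(\<integral>\<^sup>+ y. \<integral>\<^sup>+ z. g (?f (y, z)) \<partial>lborel \<partial>lborel) = (\<integral>\<^sup>+ p. g (?f p) \<partial>(lborel \<Otimes>\<^sub>M lborel))"
    by (rule lborel.nn_integral_fst) (rule measurable_compose[OF fm g])
  also have "\<dots> = (\<integral>\<^sup>+ s. g s \<partial>distr (lborel \<Otimes>\<^sub>M lborel) borel ?f)"
    by (rule nn_integral_distr[OF fm, symmetric]) (simp add: g)
  also have "\<dots> = (\<integral>\<^sup>+ s. (ennreal pi * indicator {0..} s) * g s \<partial>lborel)"
    unfolding distr_norm_square using g by (subst nn_integral_density) auto
  also have "\<dots> = (\<integral>\<^sup>+ s. ennreal pi * (g s * indicator {0..} s) \<partial>lborel)"
    by (intro nn_integral_cong) (simp add: mult_ac)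
  also have "\<dots> = ennreal pi * (\<integral>\<^sup>+ s. g s * indicator {0..} s \<partial>lborel)"
    by (rule nn_integral_cmult) (use g in simp)
  finally show ?thesis by (simp only: prod.case)
qed

text \<open>
  The function \<open>\<lambda>s. (2 * C - a + C * s) * (2 * exp (- s / 2))\<close> is a primitive of the integrand
  without the absolute value, and the sign changes at $s = a/C$.
\<close>

lemma nn_integral_abs_affine_exp:
  fixes a C :: real
  assumes a: "a \<ge> 0" and C: "C > 0"
  shows "(\<integral>\<^sup>+ s. ennreal (exp (- s / 2) * \<bar>a - C * s\<bar>) * indicator {0..} s \<partial>lborel) =
    ennreal (2 * (a - 2 * C + 4 * C * exp (- a / (2 * C))))"
proof -
  let ?F = "\<lambda>s. (2 * C - a + C * s) * (2 * exp (- s / 2))"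
  let ?h = "\<lambda>s. exp (- s / 2) * (a - C * s)"
  define r where "r = a / C"
  have r: "r \<ge> 0" "C * r = a" using a C by (simp_all add: r_def)
  have dF: "(?F has_real_derivative ?h s) (at s)" for s
    by (auto intro!: derivative_eq_intros simp: algebra_simps)
  have limF: "(?F \<longlongrightarrow> 0) at_top"
  proof -
    have half: "filterlim (\<lambda>s::real. s / 2) at_top at_top"
      using filterlim_tendsto_pos_mult_at_top[OF tendsto_const[of "1/2::real"] _ filterlim_ident] by simp
    have l: "((\<lambda>s::real. (s / 2) ^ k / exp (s / 2)) \<longlongrightarrow> 0) at_top" for k
      by (rule filterlim_compose[OF tendsto_power_div_exp_0 half])
    have "((\<lambda>s. (4 * C - 2 * a) * ((s / 2) ^ 0 / exp (s / 2)) + 4 * C * ((s / 2) ^ 1 / exp (s / 2))) \<longlongrightarrow> (4 * C - 2 * a) * 0 + 4 * C * 0) at_top"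
      by (intro tendsto_intros l)
    moreover have "(\<lambda>s. (4 * C - 2 * a) * ((s / 2) ^ 0 / exp (s / 2)) + 4 * C * ((s / 2) ^ 1 / exp (s / 2))) = ?F"
      by (rule ext) (simp add: exp_minus field_simps)
    ultimately show ?thesis by simp
  qed
  have 1: "(\<integral>\<^sup>+ s. ennreal (?h s) * indicator {0..r} s \<partial>lborel) = ennreal (?F r - ?F 0)"
  proof (rule nn_integral_FTC_Icc)
    show "?h \<in> borel_measurable borel" by (intro borel_measurable_continuous_onI continuous_intros) simp
    show "0 \<le> ?h s" if "s \<in> {0..r}" for s
      using that mult_left_mono[of s r C] C r by (intro mult_nonneg_nonneg) auto
    show "(?F has_real_derivative ?h s) (at s)" if "s \<in> {0..r}" for s
      by (rule dF)
  qed (use r in simp_all)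
  have 2: "(\<integral>\<^sup>+ s. ennreal (- ?h s) * indicator {r..} s \<partial>lborel) = ennreal (0 - (- ?F r))"
  proof (rule nn_integral_FTC_atLeast)
    show "(\<lambda>s. - ?h s) \<in> borel_measurable borel" by (intro borel_measurable_continuous_onI continuous_intros) simp
    show "0 \<le> - ?h s" if "r \<le> s" for s
      using that mult_left_mono[of r s C] C r by (simp add: mult_le_0_iff)
    show "((\<lambda>s. - ?F s) has_real_derivative - ?h s) (at s)" for s
      using DERIV_minus[OF dF] .
    show "((\<lambda>s. - ?F s) \<longlongrightarrow> 0) at_top"
      using tendsto_minus[OF limF] by (simp only: minus_zero)
  qed
  have "(\<integral>\<^sup>+ s. ennreal (exp (- s / 2) * \<bar>a - C * s\<bar>) * indicator {0..} s \<partial>lborel) =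
    (\<integral>\<^sup>+ s. (ennreal (?h s) * indicator {0..r} s + ennreal (- ?h s) * indicator {r..} s) \<partial>lborel)"
  proof (rule nn_integral_cong_AE)
    show "AE s in lborel. ennreal (exp (- s / 2) * \<bar>a - C * s\<bar>) * indicator {0..} s =
        ennreal (?h s) * indicator {0..r} s + ennreal (- ?h s) * indicator {r..} s"
      using AE_lborel_singleton[of r]
    proof eventually_elim
      case (elim s)
      consider "s < 0" | "0 \<le> s" "s < r" | "r < s" using elim by linarith
      then show ?case
      proof cases
        case 2
        then have "C * s \<le> a" using mult_left_mono[of s r C] C r by simp
        then show ?thesis using 2 by simp
      next
        case 3
        then have "a \<le> C * s" using mult_left_mono[of r s C] C r by simp
        then show ?thesis using 3 r by (simp add: algebra_simps)
      qed (use r in simp)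
    qed
  qed
  also have "\<dots> = ennreal (?F r - ?F 0) + ennreal (0 - (- ?F r))"
    unfolding 1[symmetric] 2[symmetric]
    by (rule nn_integral_add)
       (auto intro!: borel_measurable_times_ennreal measurable_compose[OF _ measurable_ennreal] borel_measurable_continuous_onI continuous_intros)
  also have "\<dots> = ennreal (2 * (a - 2 * C + 4 * C * exp (- a / (2 * C))))"
  proof -
    have e: "- a / (2 * C) = - r / 2" using C by (simp add: r_def)
    have "1 + - r / 2 \<le> exp (- r / 2)" by (rule exp_ge_add_one_self)
    then have "C * (1 + - r / 2) \<le> C * exp (- r / 2)" using C by (intro mult_left_mono) auto
    then have p: "0 \<le> ?F r - ?F 0" using r(2) by (simp add: algebra_simps)
    have q: "0 \<le> 0 - (- ?F r)" using C r by simp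
    show ?thesis
      unfolding ennreal_plus[OF p q, symmetric] e using r(2) by (simp add: algebra_simps)
  qed
  finally show ?thesis .
qed

text \<open>
  The exponential only changes the variance: its product with the standard normal density is a
  multiple of the normal density with variance $C/(A+C)$.
\<close>

lemma gauss_expectation_quadratic_exp:
  fixes A C :: real
  assumes A: "A > 0" and C: "C > 0"
  shows "(\<integral>\<^sup>+ x. ennreal (std_normal_density x * (A * x\<^sup>2 - 2 * C + 4 * C * exp (- (A * x\<^sup>2) / (2 * C)))) \<partial>lborel) =
    ennreal (A - 2 * C + 4 * C * sqrt (C / (A + C)))"
proof -
  define \<sigma> where "\<sigma> = sqrt (C / (A + C))"
  have s: "\<sigma> > 0" "\<sigma>\<^sup>2 = C / (A + C)" using A C by (simp_all add: \<sigma>_def)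
  have n: "std_normal_density x * exp (- (A * x\<^sup>2) / (2 * C)) = \<sigma> * normal_density 0 \<sigma> x" for x
  proof -
    have "- x\<^sup>2 / (2 * \<sigma>\<^sup>2) = - x\<^sup>2 / 2 + - (A * x\<^sup>2) / (2 * C)"
      unfolding s(2) using A C by (simp add: field_simps)
    then have "exp (- x\<^sup>2 / 2) * exp (- (A * x\<^sup>2) / (2 * C)) = exp (- x\<^sup>2 / (2 * \<sigma>\<^sup>2))"
      by (simp only: exp_add)
    moreover have "sqrt (2 * pi * \<sigma>\<^sup>2) = sqrt (2 * pi) * \<sigma>"
      using s(1) by (simp add: real_sqrt_mult)
    ultimately show ?thesis
      unfolding std_normal_density_def normal_density_def using s(1) by simp
  qed
  have pos: "0 \<le> A * x\<^sup>2 - 2 * C + 4 * C * exp (- (A * x\<^sup>2) / (2 * C))" for x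
  proof -
    define y where "y = A * x\<^sup>2 / (2 * C)"
    have "1 + - y \<le> exp (- y)" by (rule exp_ge_add_one_self)
    moreover have "0 < exp (- y)" "y \<ge> 0" using A C by (simp_all add: y_def)
    moreover have "1 \<le> y + 2 * exp (- y)" using calculation by (smt (verit))
    then have "2 * C * 1 \<le> 2 * C * (y + 2 * exp (- y))" using C by (intro mult_left_mono) auto
    moreover have "2 * C * y = A * x\<^sup>2" using C by (simp add: y_def)
    moreover have "- (A * x\<^sup>2) / (2 * C) = - y" by (simp add: y_def)
    ultimately show ?thesis by (simp add: algebra_simps)
  qed
  have m2: "has_bochner_integral lborel (\<lambda>x. std_normal_density x * x\<^sup>2) 1"
    using std_normal_moment_even[of 1] by (simp add: fact_numeral)
  have m0: "has_bochner_integral lborel std_normal_density 1"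
    using std_normal_moment_even[of 0] by simp
  have me: "has_bochner_integral lborel (normal_density 0 \<sigma>) 1"
    using s(1) by (simp add: has_bochner_integral_iff integral_normal_density integrable_normal_density)
  have "has_bochner_integral lborel (\<lambda>x. A * (std_normal_density x * x\<^sup>2) - 2 * C * std_normal_density x + 4 * C * \<sigma> * normal_density 0 \<sigma> x)
     (A * 1 - 2 * C * 1 + 4 * C * \<sigma> * 1)"
    by (intro has_bochner_integral_add has_bochner_integral_diff has_bochner_integral_mult_right m2 m0 me)
  moreover have "(\<lambda>x. A * (std_normal_density x * x\<^sup>2) - 2 * C * std_normal_density x + 4 * C * \<sigma> * normal_density 0 \<sigma> x) =
    (\<lambda>x. std_normal_density x * (A * x\<^sup>2 - 2 * C + 4 * C * exp (- (A * x\<^sup>2) / (2 * C))))"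
  proof
    fix x
    have "4 * C * \<sigma> * normal_density 0 \<sigma> x = 4 * C * (\<sigma> * normal_density 0 \<sigma> x)" by simp
    also have "\<dots> = 4 * C * (std_normal_density x * exp (- (A * x\<^sup>2) / (2 * C)))" by (simp only: n)
    finally show "A * (std_normal_density x * x\<^sup>2) - 2 * C * std_normal_density x + 4 * C * \<sigma> * normal_density 0 \<sigma> x =
        std_normal_density x * (A * x\<^sup>2 - 2 * C + 4 * C * exp (- (A * x\<^sup>2) / (2 * C)))"
      by (simp only: distrib_left right_diff_distrib mult_ac)
  qed
  ultimately have hb: "has_bochner_integral lborel (\<lambda>x. std_normal_density x * (A * x\<^sup>2 - 2 * C + 4 * C * exp (- (A * x\<^sup>2) / (2 * C))))
     (A - 2 * C + 4 * C * \<sigma>)" by simp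
  show ?thesis
    unfolding \<sigma>_def[symmetric] has_bochner_integral_integral_eq[OF hb, symmetric]
    by (rule nn_integral_eq_integral[OF integrable.intros[OF hb]]) (use pos in \<open>auto intro!: AE_I2 mult_nonneg_nonneg\<close>)
qed

lemma measurable_ennreal_continuous2:
  fixes g :: "real \<times> real \<Rightarrow> real"
  assumes "continuous_on UNIV g" "sets M = sets borel" "sets N = sets borel"
  shows "(\<lambda>z. ennreal (g z)) \<in> borel_measurable (M \<Otimes>\<^sub>M N)"
proof -
  have "(\<lambda>z. ennreal (g z)) \<in> borel_measurable (borel \<Otimes>\<^sub>M borel)"
    unfolding borel_prod using borel_measurable_continuous_onI[OF assms(1)] by (rule measurable_compose[OF _ measurable_ennreal])
  then show ?thesis
    using measurable_cong_sets[OF sets_pair_measure_cong[OF assms(2,3)] refl] by blast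
qed

lemma continuous_on_std_normal_density: "continuous_on S std_normal_density"
  unfolding std_normal_density_def by (intro continuous_intros) simp_all

lemma measurable_linear_form:
  "(\<lambda>c. \<Sum>i\<in>I. l i * c i) \<in> borel_measurable (lebesgue_on_coords I)"
  by (intro borel_measurable_sum borel_measurable_times borel_measurable_const measurable_coord_lborel)

lemma sum_shift_orthogonal:
  fixes l p q :: "'i \<Rightarrow> real"
  assumes "(\<Sum>i\<in>I. l i * p i) = 0" "(\<Sum>i\<in>I. l i * q i) = 0"
  shows "(\<Sum>i\<in>I. l i * (\<lambda>i\<in>I. c i + x * p i + y * q i) i) = (\<Sum>i\<in>I. l i * c i)"
proof -
  have "(\<Sum>i\<in>I. l i * (\<lambda>i\<in>I. c i + x * p i + y * q i) i) = (\<Sum>i\<in>I. l i * c i) + x * (\<Sum>i\<in>I. l i * p i) + y * (\<Sum>i\<in>I. l i * q i)"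
    unfolding sum_distrib_left sum.distrib[symmetric] by (rule sum.cong) (auto simp: algebra_simps)
  then show ?thesis using assms by simp
qed

text \<open>
  The three forms \<open>l\<close>, \<open>p\<close>, \<open>q\<close> are independent standard Gaussians, and $p^2 + q^2$ has an
  exponential distribution; hence integrating first over $s = p^2 + q^2$ and then over the
  value \<open>x\<close> of \<open>l\<close> leads to the two preceding integrals.  The form \<open>r\<close> only serves as a second
  vector orthogonal to \<open>l\<close>, because independence was established for pairs of forms.
\<close>

lemma nn_integral_gauss_quadratic:
  fixes l p q r :: "'i \<Rightarrow> real" and A C :: real
  assumes I: "finite I" and A: "A > 0" and C: "C > 0"
    and n: "(\<Sum>i\<in>I. l i * l i) = 1" "(\<Sum>i\<in>I. p i * p i) = 1" "(\<Sum>i\<in>I. q i * q i) = 1" "(\<Sum>i\<in>I. r i * r i) = 1"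
    and o: "(\<Sum>i\<in>I. l i * p i) = 0" "(\<Sum>i\<in>I. l i * q i) = 0" "(\<Sum>i\<in>I. l i * r i) = 0" "(\<Sum>i\<in>I. p i * q i) = 0"
  shows "(\<integral>\<^sup>+ c. ennreal \<bar>A * (\<Sum>i\<in>I. l i * c i)\<^sup>2 - C * ((\<Sum>i\<in>I. p i * c i)\<^sup>2 + (\<Sum>i\<in>I. q i * c i)\<^sup>2)\<bar> *
        ennreal (gauss_weight I c) \<partial>lebesgue_on_coords I) =
    ennreal (A - 2 * C + 4 * C * sqrt (C / (A + C))) * (\<integral>\<^sup>+ c. ennreal (gauss_weight I c) \<partial>lebesgue_on_coords I)"
proof -
  let ?L = "lebesgue_on_coords I"
  let ?G = "\<integral>\<^sup>+ c. ennreal (gauss_weight I c) \<partial>?L"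
  let ?n = std_normal_density
  have gm: "(\<lambda>c. ennreal (gauss_weight I c)) \<in> borel_measurable ?L"
    by (rule measurable_compose[OF measurable_gauss_weight measurable_ennreal])
  define K where "K s = (\<integral>\<^sup>+ x. ennreal (?n x * \<bar>A * x\<^sup>2 - C * s\<bar>) \<partial>lborel)" for s
  have e2: "ennreal (1 / (2 * pi)) * ennreal (exp (- (x\<^sup>2 + y\<^sup>2) / 2)) = ennreal (?n x) * ennreal (?n y)" for x y :: real
  proof -
    have e: "exp (- (x\<^sup>2 + y\<^sup>2) / 2) = exp (- x\<^sup>2 / 2) * exp (- y\<^sup>2 / 2)"
      by (simp add: exp_add[symmetric] add_divide_distrib diff_divide_distrib)
    have "1 / sqrt (2 * pi) * (1 / sqrt (2 * pi)) = 1 / (2 * pi)" by simp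
    from this[symmetric] have "1 / (2 * pi) * exp (- (x\<^sup>2 + y\<^sup>2) / 2) = ?n x * ?n y"
      unfolding e std_normal_density_def by (simp only: mult_ac)
    then show ?thesis by (subst (1 2) ennreal_mult'[symmetric]) simp_all
  qed
  have n1: "(\<integral>\<^sup>+ y. ennreal (?n y) \<partial>lborel) = 1"
    using prob_space.emeasure_space_1[OF prob_space_normal_density[of 1 0]]
    by (simp add: emeasure_density)
  have inner: "(\<integral>\<^sup>+ c. ennreal \<bar>A * (\<Sum>i\<in>I. l i * c i)\<^sup>2 - C * s\<bar> * ennreal (gauss_weight I c) \<partial>?L) = K s * ?G" for s
  proof -
    let ?h = "\<lambda>x. ennreal \<bar>A * x\<^sup>2 - C * s\<bar>"
    have hm: "?h \<in> borel_measurable borel"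
      by (intro measurable_compose[OF _ measurable_ennreal] borel_measurable_continuous_onI continuous_intros)
    have "(\<integral>\<^sup>+ c. ?h (\<Sum>i\<in>I. l i * c i) * ennreal (gauss_weight I c) \<partial>?L) =
      ennreal (1 / (2 * pi)) * (\<integral>\<^sup>+ x. \<integral>\<^sup>+ y. ennreal (exp (- (x\<^sup>2 + y\<^sup>2) / 2)) *
        (\<integral>\<^sup>+ c. ?h x * ennreal (gauss_weight I c) \<partial>?L) \<partial>lborel \<partial>lborel)"
    proof (rule orthonormal_gauss_weight_independent[OF I n(1,4) o(3), where \<Psi> = "\<lambda>x y c. ?h x"])
      show "(\<lambda>(x, y, c). ?h x) \<in> borel_measurable (borel \<Otimes>\<^sub>M borel \<Otimes>\<^sub>M ?L)"
        unfolding case_prod_unfold by (rule measurable_compose[OF measurable_fst hm])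
    qed simp
    also have "\<dots> = ennreal (1 / (2 * pi)) * (\<integral>\<^sup>+ x. \<integral>\<^sup>+ y. ennreal (exp (- (x\<^sup>2 + y\<^sup>2) / 2)) * (?h x * ?G) \<partial>lborel \<partial>lborel)"
      by (simp only: nn_integral_cmult[OF gm])
    also have "\<dots> = (\<integral>\<^sup>+ x. \<integral>\<^sup>+ y. ennreal (1 / (2 * pi)) * (ennreal (exp (- (x\<^sup>2 + y\<^sup>2) / 2)) * (?h x * ?G)) \<partial>lborel \<partial>lborel)"
    proof (rule nn_integral_cmult2[symmetric])
      have "(\<lambda>z::real\<times>real. ennreal (exp (- ((fst z)\<^sup>2 + (snd z)\<^sup>2) / 2))) \<in> borel_measurable (borel \<Otimes>\<^sub>M borel)"
        by (rule measurable_ennreal_continuous2) (auto intro!: continuous_intros)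
      then show "(\<lambda>(x, y). ennreal (exp (- (x\<^sup>2 + y\<^sup>2) / 2)) * (?h x * ?G)) \<in> borel_measurable (borel \<Otimes>\<^sub>M borel)"
        unfolding case_prod_unfold
        by (intro borel_measurable_times_ennreal measurable_compose[OF measurable_fst hm] borel_measurable_const)
    qed
    also have "\<dots> = (\<integral>\<^sup>+ x. \<integral>\<^sup>+ y. ennreal (?n y) * (ennreal (?n x) * (?h x * ?G)) \<partial>lborel \<partial>lborel)"
      by (simp only: mult.assoc[symmetric] e2) (simp only: mult_ac)
    also have "\<dots> = (\<integral>\<^sup>+ x. ennreal (?n x) * (?h x * ?G) \<partial>lborel)"
      by (subst nn_integral_multc) (simp_all add: n1)
    also have "\<dots> = (\<integral>\<^sup>+ x. ennreal (?n x * \<bar>A * x\<^sup>2 - C * s\<bar>) * ?G \<partial>lborel)"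
      by (simp only: ennreal_mult'[OF normal_density_nonneg] mult.assoc)
    also have "\<dots> = K s * ?G"
      unfolding K_def
      by (rule nn_integral_multc)
         (auto intro!: measurable_compose[OF _ measurable_ennreal] borel_measurable_continuous_onI continuous_intros continuous_on_std_normal_density)
    finally show ?thesis .
  qed
  have Km: "K \<in> borel_measurable borel"
  proof -
    have "(\<lambda>z. ennreal (?n (snd z) * \<bar>A * (snd z)\<^sup>2 - C * fst z\<bar>)) \<in> borel_measurable (borel \<Otimes>\<^sub>M lborel)"
      by (rule measurable_ennreal_continuous2)
         (auto intro!: continuous_intros continuous_on_compose2[OF continuous_on_std_normal_density[of UNIV]])
    then have "(\<lambda>(s, x). ennreal (?n x * \<bar>A * x\<^sup>2 - C * s\<bar>)) \<in> borel_measurable (borel \<Otimes>\<^sub>M lborel)"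
      by (simp only: case_prod_unfold)
    from lborel.borel_measurable_nn_integral[OF this] show ?thesis by (simp only: K_def[abs_def])
  qed
  have "(\<integral>\<^sup>+ c. ennreal \<bar>A * (\<Sum>i\<in>I. l i * c i)\<^sup>2 - C * ((\<Sum>i\<in>I. p i * c i)\<^sup>2 + (\<Sum>i\<in>I. q i * c i)\<^sup>2)\<bar> *
        ennreal (gauss_weight I c) \<partial>?L) =
    ennreal (1 / (2 * pi)) * (\<integral>\<^sup>+ y. \<integral>\<^sup>+ z. ennreal (exp (- (y\<^sup>2 + z\<^sup>2) / 2)) * (K (y\<^sup>2 + z\<^sup>2) * ?G) \<partial>lborel \<partial>lborel)"
    unfolding inner[symmetric]
  proof (rule orthonormal_gauss_weight_independent[OF I n(2,3) o(4), where \<Psi> = "\<lambda>y z c. ennreal \<bar>A * (\<Sum>i\<in>I. l i * c i)\<^sup>2 - C * (y\<^sup>2 + z\<^sup>2)\<bar>"])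
    let ?M = "borel \<Otimes>\<^sub>M borel \<Otimes>\<^sub>M ?L :: (real \<times> real \<times> _) measure"
    have c1: "(\<lambda>w. \<Sum>i\<in>I. l i * snd (snd w) i) \<in> borel_measurable ?M"
      by (rule measurable_compose[OF measurable_snd measurable_compose[OF measurable_snd measurable_linear_form]])
    have c2: "(\<lambda>w. fst w) \<in> borel_measurable ?M" by (rule measurable_fst)
    have c3: "(\<lambda>w. fst (snd w)) \<in> borel_measurable ?M" by (rule measurable_compose[OF measurable_snd measurable_fst])
    show "(\<lambda>(y, z, c). ennreal \<bar>A * (\<Sum>i\<in>I. l i * c i)\<^sup>2 - C * (y\<^sup>2 + z\<^sup>2)\<bar>) \<in> borel_measurable ?M"
      unfolding case_prod_unfold
      by (intro measurable_compose[OF _ measurable_ennreal] borel_measurable_abs borel_measurable_diff borel_measurable_times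
          borel_measurable_add borel_measurable_power borel_measurable_const c1 c2 c3)
  qed (simp only: sum_shift_orthogonal[OF o(1,2)])
  also have "\<dots> = ennreal (1 / (2 * pi)) * (ennreal pi * (\<integral>\<^sup>+ s. ennreal (exp (- s / 2)) * (K s * ?G) * indicator {0..} s \<partial>lborel))"
    by (subst nn_integral_norm_square[symmetric]) (use Km in auto)
  also have "(\<integral>\<^sup>+ s. ennreal (exp (- s / 2)) * (K s * ?G) * indicator {0..} s \<partial>lborel) = (\<integral>\<^sup>+ s. ennreal (exp (- s / 2)) * K s * indicator {0..} s \<partial>lborel) * ?G"
  proof -
    have "(\<lambda>s. ennreal (exp (- s / 2)) * K s * indicator {0..} s) \<in> borel_measurable lborel"
      using Km by (auto intro!: borel_measurable_times_ennreal measurable_compose[OF _ measurable_ennreal] borel_measurable_continuous_onI continuous_intros)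
    from nn_integral_multc[OF this, of ?G] show ?thesis by (simp only: mult_ac)
  qed
  also have "(\<integral>\<^sup>+ s. ennreal (exp (- s / 2)) * K s * indicator {0..} s \<partial>lborel) =
     (\<integral>\<^sup>+ x. ennreal (?n x) * (\<integral>\<^sup>+ s. ennreal (exp (- s / 2) * \<bar>A * x\<^sup>2 - C * s\<bar>) * indicator {0..} s \<partial>lborel) \<partial>lborel)"
  proof -
    let ?w = "\<lambda>x s. ennreal (exp (- s / 2) * (?n x * \<bar>A * x\<^sup>2 - C * s\<bar>)) * indicator {0..} s"
    have w: "(\<lambda>(x, s). ?w x s) \<in> borel_measurable (lborel \<Otimes>\<^sub>M lborel)"
      unfolding case_prod_unfold
    proof (rule borel_measurable_times_ennreal)
      show "(\<lambda>z. ennreal (exp (- snd z / 2) * (?n (fst z) * \<bar>A * (fst z)\<^sup>2 - C * snd z\<bar>))) \<in> borel_measurable (lborel \<Otimes>\<^sub>M lborel)"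
        by (rule measurable_ennreal_continuous2)
           (auto intro!: continuous_intros continuous_on_compose2[OF continuous_on_std_normal_density[of UNIV]])
      show "(\<lambda>z. indicator {0..} (snd z) :: ennreal) \<in> borel_measurable (lborel \<Otimes>\<^sub>M (lborel :: real measure))"
        by (rule measurable_compose[OF measurable_snd borel_measurable_indicator]) simp
    qed
    have "(\<integral>\<^sup>+ s. ennreal (exp (- s / 2)) * K s * indicator {0..} s \<partial>lborel) = (\<integral>\<^sup>+ s. \<integral>\<^sup>+ x. ?w x s \<partial>lborel \<partial>lborel)"
    proof (rule nn_integral_cong)
      fix s
      have m: "(\<lambda>x. ennreal (?n x * \<bar>A * x\<^sup>2 - C * s\<bar>)) \<in> borel_measurable lborel"
        by (auto intro!: measurable_compose[OF _ measurable_ennreal] borel_measurable_continuous_onI continuous_intros continuous_on_std_normal_density)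
      have "(\<integral>\<^sup>+ x. ?w x s \<partial>lborel) = (\<integral>\<^sup>+ x. (ennreal (exp (- s / 2)) * indicator {0..} s) * ennreal (?n x * \<bar>A * x\<^sup>2 - C * s\<bar>) \<partial>lborel)"
        unfolding ennreal_mult'[OF exp_ge_zero] by (simp only: mult_ac)
      also have "\<dots> = (ennreal (exp (- s / 2)) * indicator {0..} s) * K s"
        unfolding K_def by (rule nn_integral_cmult[OF m])
      finally show "ennreal (exp (- s / 2)) * K s * indicator {0..} s = (\<integral>\<^sup>+ x. ?w x s \<partial>lborel)"
        by (simp only: mult_ac)
    qed
    also have "\<dots> = (\<integral>\<^sup>+ x. \<integral>\<^sup>+ s. ?w x s \<partial>lborel \<partial>lborel)"
      by (rule lborel_pair.Fubini'[OF w])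
    also have "\<dots> = (\<integral>\<^sup>+ x. ennreal (?n x) * (\<integral>\<^sup>+ s. ennreal (exp (- s / 2) * \<bar>A * x\<^sup>2 - C * s\<bar>) * indicator {0..} s \<partial>lborel) \<partial>lborel)"
    proof (rule nn_integral_cong)
      fix x
      have m: "(\<lambda>s. ennreal (exp (- s / 2) * \<bar>A * x\<^sup>2 - C * s\<bar>) * indicator {0..} s) \<in> borel_measurable lborel"
        by (auto intro!: borel_measurable_times_ennreal measurable_compose[OF _ measurable_ennreal] borel_measurable_continuous_onI continuous_intros)
      have "?w x s = ennreal (?n x) * (ennreal (exp (- s / 2) * \<bar>A * x\<^sup>2 - C * s\<bar>) * indicator {0..} s)" for s
        by (simp only: ennreal_mult'[OF exp_ge_zero] ennreal_mult'[OF normal_density_nonneg] mult_ac)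
      then show "(\<integral>\<^sup>+ s. ?w x s \<partial>lborel) = ennreal (?n x) * (\<integral>\<^sup>+ s. ennreal (exp (- s / 2) * \<bar>A * x\<^sup>2 - C * s\<bar>) * indicator {0..} s \<partial>lborel)"
        by (simp only: nn_integral_cmult[OF m])
    qed
    finally show ?thesis .
  qed
  also have "\<dots> = (\<integral>\<^sup>+ x. 2 * ennreal (?n x * (A * x\<^sup>2 - 2 * C + 4 * C * exp (- (A * x\<^sup>2) / (2 * C)))) \<partial>lborel)"
  proof (rule nn_integral_cong)
    fix x
    have a: "0 \<le> A * x\<^sup>2" using A by simp
    have "ennreal (?n x) * ennreal (2 * Q) = 2 * ennreal (?n x * Q)" for Q
    proof -
      have "ennreal (?n x) * ennreal (2 * Q) = ennreal (2 * (?n x * Q))"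
        by (subst ennreal_mult'[symmetric]) (simp_all add: mult_ac)
      also have "\<dots> = ennreal 2 * ennreal (?n x * Q)" by (rule ennreal_mult') simp
      finally show ?thesis by simp
    qed
    then show "ennreal (?n x) * (\<integral>\<^sup>+ s. ennreal (exp (- s / 2) * \<bar>A * x\<^sup>2 - C * s\<bar>) * indicator {0..} s \<partial>lborel) =
       2 * ennreal (?n x * (A * x\<^sup>2 - 2 * C + 4 * C * exp (- (A * x\<^sup>2) / (2 * C))))"
      unfolding nn_integral_abs_affine_exp[OF a C] .
  qed
  also have "\<dots> = 2 * ennreal (A - 2 * C + 4 * C * sqrt (C / (A + C)))"
    unfolding gauss_expectation_quadratic_exp[OF A C, symmetric]
    by (rule nn_integral_cmult) simp
  also have "ennreal (1 / (2 * pi)) * (ennreal pi * (2 * ennreal (A - 2 * C + 4 * C * sqrt (C / (A + C))) * ?G)) =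
     ennreal (A - 2 * C + 4 * C * sqrt (C / (A + C))) * ?G"
  proof -
    have "ennreal (1 / (2 * pi)) * (ennreal pi * 2) = 1"
      by (simp add: ennreal_mult'[symmetric] flip: ennreal_numeral)
    then show ?thesis by (simp only: mult.assoc[symmetric] mult_1)
  qed
  finally show ?thesis .
qed

section \<open>The mean number of zeros of a linear random field\<close>

lemma lborel_vec2: "distr (lborel \<Otimes>\<^sub>M lborel) borel (\<lambda>(s, t). s *\<^sub>R axis 1 1 + t *\<^sub>R axis 2 1 :: real^2) = lborel"
proof (rule lborel_eqI[symmetric])
  let ?f = "\<lambda>(s, t). s *\<^sub>R axis 1 1 + t *\<^sub>R axis 2 1 :: real^2"
  have comp: "?f p $ 1 = fst p" "?f p $ 2 = snd p" for p
    by (auto simp: case_prod_unfold axis_def)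
  have c: "continuous_on UNIV ?f" unfolding case_prod_unfold by (intro continuous_intros)
  have fm: "?f \<in> (lborel \<Otimes>\<^sub>M lborel) \<rightarrow>\<^sub>M borel"
    using borel_measurable_continuous_onI[OF c] by (simp add: borel_prod lborel_prod)
  fix l u :: "real^2"
  assume lu: "\<And>b. b \<in> Basis \<Longrightarrow> l \<bullet> b \<le> u \<bullet> b"
  have l: "l $ i \<le> u $ i" for i
    using lu[of "axis i 1"] by (simp add: inner_axis axis_in_Basis_iff)
  have pre: "?f -` box l u \<inter> space (lborel \<Otimes>\<^sub>M lborel) = box (l $ 1) (u $ 1) \<times> box (l $ 2) (u $ 2)"
    by (auto simp: mem_box_cart forall_2 comp space_pair_measure) (simp_all add: axis_def)
  have "emeasure (distr (lborel \<Otimes>\<^sub>M lborel) borel ?f) (box l u) = emeasure (lborel \<Otimes>\<^sub>M lborel) (box (l $ 1) (u $ 1) \<times> box (l $ 2) (u $ 2))"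
    unfolding pre[symmetric] by (rule emeasure_distr[OF fm]) simp
  also have "\<dots> = ennreal (u $ 1 - l $ 1) * ennreal (u $ 2 - l $ 2)"
    using l[of 1] l[of 2] by (subst lborel.emeasure_pair_measure_Times) auto
  also have "\<dots> = ennreal ((u $ 1 - l $ 1) * (u $ 2 - l $ 2))"
    using l by (simp add: ennreal_mult'')
  also have "(u $ 1 - l $ 1) * (u $ 2 - l $ 2) = (\<Prod>b\<in>Basis. (u - l) \<bullet> b)"
  proof -
    have B: "(Basis :: (real^2) set) = {axis 1 1, axis 2 1}"
      by (auto simp: Basis_vec_def UNIV_2)
    have ne: "(axis 1 1 :: real^2) \<noteq> axis 2 1" by (simp add: axis_eq_axis)
    show ?thesis unfolding B using ne by (simp add: inner_axis)
  qed
  finally show "emeasure (distr (lborel \<Otimes>\<^sub>M lborel) borel ?f) (box l u) = ennreal (\<Prod>b\<in>Basis. (u - l) \<bullet> b)" .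
qed simp

lemma nn_integral_vec2:
  assumes F: "F \<in> borel_measurable borel"
  shows "(\<integral>\<^sup>+ y. F y \<partial>(lborel :: (real^2) measure)) = (\<integral>\<^sup>+ s. \<integral>\<^sup>+ t. F (s *\<^sub>R axis 1 1 + t *\<^sub>R axis 2 1) \<partial>lborel \<partial>lborel)"
proof -
  let ?f = "\<lambda>(s, t). s *\<^sub>R axis 1 1 + t *\<^sub>R axis 2 1 :: real^2"
  have c: "continuous_on UNIV ?f" unfolding case_prod_unfold by (intro continuous_intros)
  have fm: "?f \<in> (lborel \<Otimes>\<^sub>M lborel) \<rightarrow>\<^sub>M borel"
    using borel_measurable_continuous_onI[OF c] by (simp add: borel_prod lborel_prod)
  have "(\<integral>\<^sup>+ y. F y \<partial>(lborel :: (real^2) measure)) = (\<integral>\<^sup>+ p. F (?f p) \<partial>(lborel \<Otimes>\<^sub>M lborel))"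
    unfolding lborel_vec2[symmetric] by (rule nn_integral_distr[OF fm]) (simp add: F)
  also have "\<dots> = (\<integral>\<^sup>+ s. \<integral>\<^sup>+ t. F (?f (s, t)) \<partial>lborel \<partial>lborel)"
    by (rule lborel.nn_integral_fst[symmetric]) (rule measurable_compose[OF fm F])
  finally show ?thesis by (simp only: prod.case)
qed

text \<open>
  A random planar vector field \<open>\<Sum>b\<in>I. c b *\<^sub>R G b x\<close> with Gaussian coefficients \<open>c\<close>.
\<close>

locale linear_field =
  fixes I :: "'i set" and G :: "'i \<Rightarrow> real^2 \<Rightarrow> real^2" and G' :: "'i \<Rightarrow> real^2 \<Rightarrow> real^2 \<Rightarrow> real^2"
  assumes fin: "finite I"
    and der: "\<And>b x. b \<in> I \<Longrightarrow> (G b has_derivative G' b x) (at x)"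
    and cont: "\<And>b e. b \<in> I \<Longrightarrow> continuous_on UNIV (\<lambda>x. G' b x e)"
begin

definition F where "F c x = (\<Sum>b\<in>I. c b *\<^sub>R G b x)"
definition F' where "F' c x e = (\<Sum>b\<in>I. c b *\<^sub>R G' b x e)"
definition zeros where "zeros c U = emeasure (count_space UNIV) {x \<in> U. F c x = 0}"
definition minor where "minor a b x = G a x $ 1 * G b x $ 2 - G b x $ 1 * G a x $ 2"

abbreviation "crit a b x \<equiv> kernel_ext (\<lambda>i. G i x $ 1) (\<lambda>i. G i x $ 2) a b (I - {a, b})"

lemma contG: "b \<in> I \<Longrightarrow> continuous_on S (G b)"
  by (meson continuous_at_imp_continuous_on der has_derivative_continuous)

lemma cont_minor: "a \<in> I \<Longrightarrow> b \<in> I \<Longrightarrow> continuous_on S (minor a b)"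
  unfolding minor_def by (intro continuous_intros contG)

lemma F_component: "F c x $ i = (\<Sum>b\<in>I. G b x $ i * c b)"
  by (simp add: F_def mult.commute)

lemma plane_complement_at:
  assumes "a \<in> I" "b \<in> I" "a \<noteq> b" "minor a b x \<noteq> 0"
  shows "plane_complement I (I - {a, b}) a b (\<lambda>i. G i x $ 1) (\<lambda>i. G i x $ 2) (minor a b x)"
proof unfold_locales
  show "I = insert b (insert a (I - {a, b}))" using assms by blast
qed (use assms fin in \<open>simp_all add: minor_def\<close>)

lemma F_ext:
  assumes "a \<in> I" "b \<in> I" "a \<noteq> b" "minor a b x \<noteq> 0"
  shows "F (crit a b x w) x = 0"
proof -
  interpret plane_complement I "I - {a, b}" a b "\<lambda>i. G i x $ 1" "\<lambda>i. G i x $ 2" "minor a b x"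
    by (rule plane_complement_at[OF assms])
  show ?thesis
    using dot_ext[of w] by (simp add: vec_eq_iff forall_2 F_component)
qed

lemma F_eq_0_iff:
  assumes ab: "a \<in> I" "b \<in> I" "a \<noteq> b" "minor a b x \<noteq> 0" and w: "w \<in> extensional (I - {a, b})"
  shows "F (w(a := s, b := t)) x = 0 \<longleftrightarrow> s = crit a b x w a \<and> t = crit a b x w b"
proof -
  interpret plane_complement I "I - {a, b}" a b "\<lambda>i. G i x $ 1" "\<lambda>i. G i x $ 2" "minor a b x"
    by (rule plane_complement_at[OF ab])
  show ?thesis
  proof
    assume 0: "F (w(a := s, b := t)) x = 0"
    have "w(a := s, b := t) = crit a b x w"
    proof (rule ext_eqI)
      show "w(a := s, b := t) \<in> extensional I" using w ab by (auto simp: extensional_def)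
      show "(\<Sum>i\<in>I. G i x $ 1 * (w(a := s, b := t)) i) = 0" "(\<Sum>i\<in>I. G i x $ 2 * (w(a := s, b := t)) i) = 0"
        by (simp_all only: F_component[symmetric] 0 zero_index)
    qed (use w in auto)
    then have "(w(a := s, b := t)) a = crit a b x w a" "(w(a := s, b := t)) b = crit a b x w b" by auto
    then show "s = crit a b x w a \<and> t = crit a b x w b" using ab by simp
  next
    assume st: "s = crit a b x w a \<and> t = crit a b x w b"
    have "crit a b x w = w(a := s, b := t)"
      using st unfolding kernel_ext_def Let_def by (auto simp: fun_eq_iff)
    then show "F (w(a := s, b := t)) x = 0" using F_ext[OF ab, of w] by simp
  qed
qed

text \<open>
  The values of the coordinates \<open>a\<close> and \<open>b\<close> for which the field with the other coordinates \<open>w\<close>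
  vanishes at \<open>x\<close>.  Zeros of the field are preimages under this map.
\<close>

definition solution where
  "solution a b w x = crit a b x w a *\<^sub>R axis 1 1 + crit a b x w b *\<^sub>R (axis 2 1 :: real^2)"

text \<open>
  Implicit differentiation of \<open>F c x = 0\<close> with respect to \<open>x\<close>, where \<open>c\<close> solves for the two
  coordinates.
\<close>

definition solution' where
  "solution' a b w x e = (let h = F' (crit a b x w) x e in
     ((G b x $ 1 * h $ 2 - G b x $ 2 * h $ 1) / minor a b x) *\<^sub>R axis 1 1 +
     ((G a x $ 2 * h $ 1 - G a x $ 1 * h $ 2) / minor a b x) *\<^sub>R (axis 2 1 :: real^2))"

lemma ext_pair:
  assumes "a \<noteq> b"
  shows "crit a b x w a = (G b x $ 1 * (\<Sum>i\<in>I - {a, b}. G i x $ 2 * w i) - G b x $ 2 * (\<Sum>i\<in>I - {a, b}. G i x $ 1 * w i)) / minor a b x"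
    "crit a b x w b = (G a x $ 2 * (\<Sum>i\<in>I - {a, b}. G i x $ 1 * w i) - G a x $ 1 * (\<Sum>i\<in>I - {a, b}. G i x $ 2 * w i)) / minor a b x"
  using assms by (simp_all add: kernel_ext_def Let_def minor_def)

lemma ext_other: "i \<noteq> a \<Longrightarrow> i \<noteq> b \<Longrightarrow> crit a b x w i = w i"
  by (simp add: kernel_ext_def Let_def)

text \<open>
  Cramer's rule shows that the solution is differentiable; its derivative is then determined by
  differentiating the identity that the field vanishes along the solution.
\<close>

lemma solution_has_derivative:
  assumes ab: "a \<in> I" "b \<in> I" "a \<noteq> b" "minor a b x \<noteq> 0"
  shows "(solution a b w has_derivative solution' a b w x) (at x)"
proof -
  have dG: "(\<lambda>x. G i x $ k) differentiable (at x)" if "i \<in> I" for i k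
    using der[OF that] bounded_linear.has_derivative[OF bounded_linear_vec_nth] unfolding differentiable_def by blast
  have dm: "minor a b differentiable (at x)"
    unfolding minor_def using dG ab by (intro derivative_intros) auto
  have ds: "(\<lambda>x. \<Sum>i\<in>I - {a, b}. G i x $ k * w i) differentiable (at x)" for k
    using fin dG by (intro differentiable_sum differentiable_mult differentiable_const) auto
  have dext: "(\<lambda>x. crit a b x w a) differentiable (at x)" "(\<lambda>x. crit a b x w b) differentiable (at x)"
    unfolding ext_pair[OF ab(3)] using dG ab dm ds by (auto intro!: differentiable_divide differentiable_diff differentiable_mult)
  then obtain s' t' where st: "((\<lambda>x. crit a b x w a) has_derivative s') (at x)" "((\<lambda>x. crit a b x w b) has_derivative t') (at x)"
    unfolding differentiable_def by blast
  have sol: "(solution a b w has_derivative (\<lambda>e. s' e *\<^sub>R axis 1 1 + t' e *\<^sub>R axis 2 1)) (at x)"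
    unfolding solution_def by (auto intro!: derivative_eq_intros st)
  have pc: "coords_pair I (I - {a, b}) a b"
    by unfold_locales (use fin ab in auto)
  have Fx: "F (crit a b y w) y = crit a b y w a *\<^sub>R G a y + crit a b y w b *\<^sub>R G b y + (\<Sum>i\<in>I - {a, b}. w i *\<^sub>R G i y)" for y
    unfolding F_def coords_pair.sum_I[OF pc] by (auto intro!: arg_cong2[where f="(+)"] sum.cong simp: ext_other)
  have Fx': "F' (crit a b y w) y e = crit a b y w a *\<^sub>R G' a y e + crit a b y w b *\<^sub>R G' b y e + (\<Sum>i\<in>I - {a, b}. w i *\<^sub>R G' i y e)" for y e
    unfolding F'_def coords_pair.sum_I[OF pc] by (auto intro!: arg_cong2[where f="(+)"] sum.cong simp: ext_other)
  have d1: "((\<lambda>y. F (crit a b y w) y) has_derivative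
     (\<lambda>e. s' e *\<^sub>R G a x + t' e *\<^sub>R G b x + F' (crit a b x w) x e)) (at x)"
    unfolding Fx Fx' by (rule derivative_eq_intros st der ab refl | simp)+ (auto simp: algebra_simps)
  have "open {y. minor a b y \<noteq> 0}"
    by (rule open_Collect_neq[OF cont_minor[OF ab(1,2)] continuous_on_const])
  then have d2: "((\<lambda>y. F (crit a b y w) y) has_derivative (\<lambda>e. 0)) (at x)"
    using F_ext[OF ab(1-3)] ab(4) by (intro has_derivative_transform_within_open[OF has_derivative_const[of 0]]) auto
  have z: "s' e *\<^sub>R G a x + t' e *\<^sub>R G b x + F' (crit a b x w) x e = 0" for e
    using fun_cong[OF has_derivative_unique[OF d1 d2], of e] by simp
  have "(\<lambda>e. s' e *\<^sub>R axis 1 1 + t' e *\<^sub>R axis 2 1) = solution' a b w x"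
  proof
    fix e
    let ?h = "F' (crit a b x w) x e"
    have e: "s' e * G a x $ 1 + t' e * G b x $ 1 + ?h $ 1 = 0" "s' e * G a x $ 2 + t' e * G b x $ 2 + ?h $ 2 = 0"
      using z[of e] by (simp_all add: vec_eq_iff forall_2)
    have "s' e * minor a b x = G b x $ 1 * ?h $ 2 - G b x $ 2 * ?h $ 1" "t' e * minor a b x = G a x $ 2 * ?h $ 1 - G a x $ 1 * ?h $ 2"
      using e unfolding minor_def by algebra+
    then have "s' e = (G b x $ 1 * ?h $ 2 - G b x $ 2 * ?h $ 1) / minor a b x" "t' e = (G a x $ 2 * ?h $ 1 - G a x $ 1 * ?h $ 2) / minor a b x"
      using ab(4) by (simp_all add: nonzero_eq_divide_eq)
    then show "s' e *\<^sub>R axis 1 1 + t' e *\<^sub>R axis 2 1 = solution' a b w x e"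
      by (simp add: solution'_def Let_def)
  qed
  then show ?thesis using sol by simp
qed

lemma det_solution':
  assumes "minor a b x \<noteq> 0"
  shows "det (matrix (solution' a b w x)) = det (matrix (F' (crit a b x w) x)) / minor a b x"
proof -
  define P where "P k j = F' (crit a b x w) x (axis j 1) $ k" for k j :: 2
  have "det (matrix (solution' a b w x)) =
    ((G b x $ 1 * P 2 1 - G b x $ 2 * P 1 1) / minor a b x) * ((G a x $ 2 * P 1 2 - G a x $ 1 * P 2 2) / minor a b x)
    - ((G b x $ 1 * P 2 2 - G b x $ 2 * P 1 2) / minor a b x) * ((G a x $ 2 * P 1 1 - G a x $ 1 * P 2 1) / minor a b x)"
    unfolding det_2 matrix_def solution'_def Let_def P_def[symmetric] by (simp add: axis_def)
  also have "\<dots> = (P 1 1 * P 2 2 - P 1 2 * P 2 1) * minor a b x / (minor a b x * minor a b x)"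
    unfolding times_divide_times_eq diff_divide_distrib[symmetric]
    by (rule arg_cong2[where f="(/)"], unfold minor_def) (simp_all add: algebra_simps)
  also have "\<dots> = (P 1 1 * P 2 2 - P 1 2 * P 2 1) / minor a b x" using assms by simp
  also have "P 1 1 * P 2 2 - P 1 2 * P 2 1 = det (matrix (F' (crit a b x w) x))"
    by (simp add: det_2 matrix_def P_def)
  finally show ?thesis .
qed

lemma crit_extensional:
  "a \<in> I \<Longrightarrow> b \<in> I \<Longrightarrow> w \<in> extensional (I - {a, b}) \<Longrightarrow> crit a b x w \<in> extensional I"
  by (auto simp: kernel_ext_def Let_def extensional_def)

lemma continuous_on_solution':
  assumes ab: "a \<in> I" "b \<in> I" "a \<noteq> b" and W: "\<And>x. x \<in> W \<Longrightarrow> minor a b x \<noteq> 0"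
  shows "continuous_on W (\<lambda>x. solution' a b w x e)"
proof -
  have cc: "continuous_on W (\<lambda>x. crit a b x w i)" if i: "i \<in> I" for i
  proof -
    consider "i = a" | "i = b" | "i \<noteq> a" "i \<noteq> b" by blast
    then show ?thesis
    proof cases
      case 1
      then show ?thesis using W ab
        by (simp only: ext_pair[OF ab(3)]) (intro continuous_intros contG cont_minor; auto)
    next
      case 2
      then show ?thesis using W ab
        by (simp only: ext_pair[OF ab(3)]) (intro continuous_intros contG cont_minor; auto)
    next
      case 3
      then show ?thesis by (simp add: ext_other)
    qed
  qed
  have ch: "continuous_on W (\<lambda>x. F' (crit a b x w) x e)"
    unfolding F'_def by (intro continuous_intros cc continuous_on_subset[OF cont]) auto
  show ?thesis
    unfolding solution'_def Let_def using W ab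
    by (intro continuous_intros contG cont_minor ch) auto
qed

lemma zeros_eq_card_preimage:
  assumes ab: "a \<in> I" "b \<in> I" "a \<noteq> b" and U: "\<And>x. x \<in> U \<Longrightarrow> minor a b x \<noteq> 0" and w: "w \<in> extensional (I - {a, b})"
  shows "zeros (w(a := y $ 1, b := y $ 2)) U = emeasure (count_space UNIV) {x \<in> U. solution a b w x = y}"
proof -
  have "solution a b w x = y \<longleftrightarrow> y $ 1 = crit a b x w a \<and> y $ 2 = crit a b x w b" for x
    by (auto simp: solution_def vec_eq_iff forall_2 axis_def)
  then show ?thesis
    unfolding zeros_def using F_eq_0_iff[OF ab _ w] U by (intro arg_cong[where f="emeasure _"]) auto
qed

text \<open>
  The density of the zeros at \<open>x\<close>, written with the coordinates other than \<open>a\<close> and \<open>b\<close>.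
\<close>

definition density_at where
  "density_at a b x = ennreal (1 / \<bar>minor a b x\<bar>) *
     (\<integral>\<^sup>+ w. ennreal (\<bar>det (matrix (F' (crit a b x w) x))\<bar> * gauss_weight I (crit a b x w)) \<partial>lebesgue_on_coords (I - {a, b}))"

lemma integrable_gauss_vec2: "integrable lborel (\<lambda>y::real^2. exp (- ((y $ 1)\<^sup>2 + (y $ 2)\<^sup>2) / 2))"
proof (rule integrableI_nonneg)
  have c: "continuous_on UNIV (\<lambda>y::real^2. exp (- ((y $ 1)\<^sup>2 + (y $ 2)\<^sup>2) / 2))" by (intro continuous_intros) simp
  then show m: "(\<lambda>y::real^2. exp (- ((y $ 1)\<^sup>2 + (y $ 2)\<^sup>2) / 2)) \<in> borel_measurable lborel"
    using borel_measurable_continuous_onI by simp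
  have "(\<integral>\<^sup>+ y. ennreal (exp (- (((y::real^2) $ 1)\<^sup>2 + (y $ 2)\<^sup>2) / 2)) \<partial>lborel) = ennreal (2 * pi / 1)"
    using nn_integral_gauss_plane[of 1] m by (subst nn_integral_vec2) (simp_all add: axis_def)
  then show "(\<integral>\<^sup>+ y. ennreal (exp (- (((y::real^2) $ 1)\<^sup>2 + (y $ 2)\<^sup>2) / 2)) \<partial>lborel) < \<infinity>" by simp
qed simp

lemma gauss_weight_pair:
  assumes ab: "a \<in> I" "b \<in> I" "a \<noteq> b"
  shows "gauss_weight I (w(a := s, b := t)) = gauss_weight (I - {a, b}) w * exp (- (s\<^sup>2 + t\<^sup>2) / 2)"
proof -
  have pc: "coords_pair I (I - {a, b}) a b"
    by unfold_locales (use fin ab in auto)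
  have "(\<Sum>i\<in>I. ((w(a := s, b := t)) i)\<^sup>2) = s\<^sup>2 + t\<^sup>2 + (\<Sum>i\<in>I - {a, b}. (w i)\<^sup>2)"
    unfolding coords_pair.sum_I[OF pc] using ab by (auto intro!: sum.cong)
  then show ?thesis
    unfolding gauss_weight_def by (simp add: exp_add[symmetric] add_divide_distrib diff_divide_distrib)
qed

lemma gauss_weight_pos: "gauss_weight K c > 0"
  by (simp add: gauss_weight_def)

lemma measurable_density_integrand:
  assumes ab: "a \<in> I" "b \<in> I" "a \<noteq> b"
  shows "(\<lambda>(w, x). ennreal (\<bar>det (matrix (F' (crit a b x w) x))\<bar> / \<bar>minor a b x\<bar> * gauss_weight I (crit a b x w)))
    \<in> borel_measurable (lebesgue_on_coords (I - {a, b}) \<Otimes>\<^sub>M borel)"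
proof -
  let ?M = "lebesgue_on_coords (I - {a, b}) \<Otimes>\<^sub>M (borel :: (real^2) measure)"
  have mx: "(\<lambda>z. h (snd z)) \<in> borel_measurable ?M" if "continuous_on UNIV h" for h :: "real^2 \<Rightarrow> real"
    using borel_measurable_continuous_onI[OF that] by (rule measurable_compose[OF measurable_snd])
  have mG: "(\<lambda>z. G i (snd z) $ k) \<in> borel_measurable ?M" if "i \<in> I" for i k
    using that by (intro mx continuous_intros contG)
  have mD: "(\<lambda>z. minor a b (snd z)) \<in> borel_measurable ?M"
    using ab by (intro mx cont_minor)
  have mG': "(\<lambda>z. G' i (snd z) e $ k) \<in> borel_measurable ?M" if "i \<in> I" for i k e
    using that by (intro mx continuous_intros cont)
  have mw: "(\<lambda>z. fst z i) \<in> borel_measurable ?M" if "i \<in> I - {a, b}" for i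
    by (rule measurable_compose[OF measurable_fst measurable_coord_lborel[OF that]])
  have mc: "(\<lambda>z. crit a b (snd z) (fst z) i) \<in> borel_measurable ?M" if i: "i \<in> I" for i
  proof -
    consider "i = a" | "i = b" | "i \<noteq> a" "i \<noteq> b" by blast
    then show ?thesis
    proof cases
      case 1
      show ?thesis unfolding 1 ext_pair[OF ab(3)]
        by (intro borel_measurable_divide borel_measurable_diff borel_measurable_times borel_measurable_sum mG mD mw) (use ab in auto)
    next
      case 2
      show ?thesis unfolding 2 ext_pair[OF ab(3)]
        by (intro borel_measurable_divide borel_measurable_diff borel_measurable_times borel_measurable_sum mG mD mw) (use ab in auto)
    next
      case 3
      then show ?thesis using mw[of i] i by (simp add: ext_other)
    qed
  qed
  have mF: "(\<lambda>z. F' (crit a b (snd z) (fst z)) (snd z) e $ k) \<in> borel_measurable ?M" for e k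
    unfolding F'_def sum_component vector_scaleR_component real_scaleR_def
    by (intro borel_measurable_sum borel_measurable_times mc mG')
  have mdet: "(\<lambda>z. det (matrix (F' (crit a b (snd z) (fst z)) (snd z)))) \<in> borel_measurable ?M"
    unfolding det_2 matrix_def vec_lambda_beta by (intro borel_measurable_diff borel_measurable_times mF)
  have mg: "(\<lambda>z. gauss_weight I (crit a b (snd z) (fst z))) \<in> borel_measurable ?M"
    unfolding gauss_weight_def
  proof (rule measurable_compose[where g=exp and N=borel])
    show "(\<lambda>z. - (\<Sum>i\<in>I. (crit a b (snd z) (fst z) i)\<^sup>2) / 2) \<in> borel_measurable ?M"
      by (intro borel_measurable_divide borel_measurable_uminus borel_measurable_sum borel_measurable_power borel_measurable_const mc)
  qed (intro borel_measurable_continuous_onI continuous_intros)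
  show ?thesis
    unfolding case_prod_unfold
    by (intro measurable_compose[OF _ measurable_ennreal] borel_measurable_times borel_measurable_divide borel_measurable_abs mdet mD mg)
qed

text \<open>
  With the other coordinates fixed, the count of zeros as a function of the coordinates at \<open>a\<close>
  and \<open>b\<close> is the number of preimages under the solution map, so that the area formula applies; its
  test function is the Gaussian weight of the two coordinates.  Tonelli's theorem then exchanges
  the integrals over the position \<open>x\<close> and over the remaining coordinates.
\<close>

lemma nn_integral_zeros_pair:
  assumes ab: "a \<in> I" "b \<in> I" "a \<noteq> b" and U: "U \<in> sets borel" "\<And>x. x \<in> U \<Longrightarrow> minor a b x \<noteq> 0"
    and meas: "(\<lambda>c. zeros c U) \<in> borel_measurable (lebesgue_on_coords I)"
  shows "(\<integral>\<^sup>+ c. zeros c U * ennreal (gauss_weight I c) \<partial>lebesgue_on_coords I) =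
    (\<integral>\<^sup>+ x. density_at a b x * indicator U x \<partial>lborel)"
proof -
  let ?J = "I - {a, b}"
  let ?e = "\<lambda>y::real^2. exp (- ((y $ 1)\<^sup>2 + (y $ 2)\<^sup>2) / 2)"
  have pc: "coords_pair I ?J a b" by unfold_locales (use fin ab in auto)
  define W where "W = {x. minor a b x \<noteq> 0}"
  have W: "open W" unfolding W_def by (rule open_Collect_neq[OF cont_minor[OF ab(1,2)] continuous_on_const])
  have UW: "U \<subseteq> W" using U(2) by (auto simp: W_def)
  let ?f = "\<lambda>w x. ennreal (\<bar>det (matrix (F' (crit a b x w) x))\<bar> / \<bar>minor a b x\<bar> * gauss_weight I (crit a b x w))"
  have zm: "(\<lambda>c. zeros c U * ennreal (gauss_weight I c)) \<in> borel_measurable (lebesgue_on_coords I)"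
    by (rule borel_measurable_times_ennreal[OF meas measurable_compose[OF measurable_gauss_weight measurable_ennreal]])
  have sf: "sigma_finite_measure (lebesgue_on_coords ?J)" by (rule lborel_product.sigma_finite) (use fin in simp)
  have pair: "pair_sigma_finite (lebesgue_on_coords ?J) (lborel :: (real^2) measure)"
    by (intro pair_sigma_finite.intro sf sigma_finite_lborel)
  have fm: "(\<lambda>(w, x). ?f w x) \<in> borel_measurable (lebesgue_on_coords ?J \<Otimes>\<^sub>M lborel)"
    using measurable_density_integrand[OF ab] by (simp cong: measurable_cong_sets sets_pair_measure_cong)
  have fi: "(\<lambda>(w, x). ?f w x * indicator U x) \<in> borel_measurable (lebesgue_on_coords ?J \<Otimes>\<^sub>M lborel)"
    using borel_measurable_times_ennreal[OF fm measurable_compose[OF measurable_snd borel_measurable_indicator[of U lborel]]] U(1)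
    by (simp add: case_prod_unfold)
  have step: "(\<integral>\<^sup>+ s. \<integral>\<^sup>+ t. zeros (w(a := s, b := t)) U * ennreal (gauss_weight I (w(a := s, b := t))) \<partial>lborel \<partial>lborel) =
     (\<integral>\<^sup>+ x. ?f w x * indicator U x \<partial>lborel)" if w: "w \<in> space (lebesgue_on_coords ?J)" for w
  proof -
    have we: "w \<in> extensional ?J" using w by (simp add: space_PiM PiE_def)
    have zc: "zeros (w(a := y $ 1, b := y $ 2)) U = emeasure (count_space UNIV) {x \<in> U. solution a b w x = y}" for y
      by (rule zeros_eq_card_preimage[OF ab U(2) we])
    define H where "H y = zeros (w(a := y $ 1, b := y $ 2)) U * ennreal (gauss_weight I (w(a := y $ 1, b := y $ 2)))" for y :: "real^2"
    have upd: "(\<lambda>y::real^2. w(a := y $ 1, b := y $ 2)) \<in> borel \<rightarrow>\<^sub>M lebesgue_on_coords I"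
    proof (rule measurable_fun_upd[where J="insert a ?J"])
      show "(\<lambda>y::real^2. w(a := y $ 1)) \<in> borel \<rightarrow>\<^sub>M lebesgue_on_coords (insert a ?J)"
        by (rule measurable_fun_upd[where J="?J"]) (use w in \<open>auto intro!: borel_measurable_continuous_onI continuous_intros\<close>)
      show "(\<lambda>y::real^2. y $ 2) \<in> borel \<rightarrow>\<^sub>M lborel"
        by (auto intro!: borel_measurable_continuous_onI continuous_intros)
    qed (use ab in auto)
    have Hm: "H \<in> borel_measurable borel"
      unfolding H_def by (rule measurable_compose[OF upd zm])
    have "(\<integral>\<^sup>+ s. \<integral>\<^sup>+ t. zeros (w(a := s, b := t)) U * ennreal (gauss_weight I (w(a := s, b := t))) \<partial>lborel \<partial>lborel) = (\<integral>\<^sup>+ y. H y \<partial>lborel)"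
      by (subst nn_integral_vec2[OF Hm]) (simp add: H_def axis_def)
    also have "\<dots> = (\<integral>\<^sup>+ y. ennreal (gauss_weight ?J w) * (emeasure (count_space UNIV) {x \<in> U. solution a b w x = y} * ennreal (?e y)) \<partial>lborel)"
      unfolding H_def zc gauss_weight_pair[OF ab]
      by (simp only: ennreal_mult'[OF less_imp_le[OF gauss_weight_pos]] mult_ac)
    also have "\<dots> = ennreal (gauss_weight ?J w) * (\<integral>\<^sup>+ y. emeasure (count_space UNIV) {x \<in> U. solution a b w x = y} * ennreal (?e y) \<partial>lborel)"
    proof (rule nn_integral_cmult)
      have "(\<lambda>y::real^2. zeros (w(a := y $ 1, b := y $ 2)) U) \<in> borel_measurable borel"
        by (rule measurable_compose[OF upd meas])
      then have m: "(\<lambda>y::real^2. emeasure (count_space UNIV) {x \<in> U. solution a b w x = y}) \<in> borel_measurable lborel"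
        unfolding zc by simp
      show "(\<lambda>y. emeasure (count_space UNIV) {x \<in> U. solution a b w x = y} * ennreal (?e y)) \<in> borel_measurable lborel"
        by (rule borel_measurable_times_ennreal[OF m measurable_compose[OF borel_measurable_integrable[OF integrable_gauss_vec2] measurable_ennreal]])
    qed
    also have "(\<integral>\<^sup>+ y. emeasure (count_space UNIV) {x \<in> U. solution a b w x = y} * ennreal (?e y) \<partial>lborel) =
      (\<integral>\<^sup>+ x. ennreal (\<bar>det (matrix (solution' a b w x))\<bar> * ?e (solution a b w x)) * indicator U x \<partial>lborel)"
    proof (rule nn_integral_card_preimage[OF W U(1) UW])
      show "(solution a b w has_derivative solution' a b w x) (at x)" if "x \<in> W" for x
        using that unfolding W_def by (intro solution_has_derivative[OF ab]) simp
      show "continuous_on W (\<lambda>x. solution' a b w x e)" for e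
        by (rule continuous_on_solution'[OF ab]) (simp add: W_def)
    qed (rule exp_ge_zero integrable_gauss_vec2)+
    also have "\<dots> = ennreal (1 / gauss_weight ?J w) * (\<integral>\<^sup>+ x. ?f w x * indicator U x \<partial>lborel)"
    proof -
      have "ennreal (\<bar>det (matrix (solution' a b w x))\<bar> * ?e (solution a b w x)) * indicator U x =
          ennreal (1 / gauss_weight ?J w) * (?f w x * indicator U x)" for x
      proof (cases "x \<in> U")
        case True
        have c: "crit a b x w = w(a := crit a b x w a, b := crit a b x w b)"
          by (auto simp: fun_eq_iff ext_other)
        have g: "gauss_weight I (crit a b x w) = gauss_weight ?J w * ?e (solution a b w x)"
          by (subst c, subst gauss_weight_pair[OF ab]) (simp add: solution_def axis_def)
        have "\<bar>det (matrix (solution' a b w x))\<bar> * ?e (solution a b w x) =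
          (1 / gauss_weight ?J w) * (\<bar>det (matrix (F' (crit a b x w) x))\<bar> / \<bar>minor a b x\<bar> * gauss_weight I (crit a b x w))"
          using gauss_weight_pos[of ?J w] unfolding g det_solution'[OF U(2)[OF True]] abs_divide by simp
        then show ?thesis
          using True gauss_weight_pos[of ?J w] by (simp add: ennreal_mult'[symmetric] less_imp_le)
      qed simp
      then show ?thesis using measurable_Pair2[OF fi w] by (simp only: nn_integral_cmult prod.case)
    qed
    also have "ennreal (gauss_weight ?J w) * \<dots> = (\<integral>\<^sup>+ x. ?f w x * indicator U x \<partial>lborel)"
    proof -
      have "ennreal (gauss_weight ?J w) * ennreal (1 / gauss_weight ?J w) = 1"
        using gauss_weight_pos[of ?J w] by (subst ennreal_mult'[symmetric]) auto
      then show ?thesis by (simp only: mult.assoc[symmetric] mult_1)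
    qed
    finally show ?thesis .
  qed
  have "(\<integral>\<^sup>+ c. zeros c U * ennreal (gauss_weight I c) \<partial>lebesgue_on_coords I) =
    (\<integral>\<^sup>+ w. \<integral>\<^sup>+ s. \<integral>\<^sup>+ t. zeros (w(a := s, b := t)) U * ennreal (gauss_weight I (w(a := s, b := t))) \<partial>lborel \<partial>lborel \<partial>lebesgue_on_coords ?J)"
    by (rule coords_pair.nn_integral_coords_insert2[OF pc zm])
  also have "\<dots> = (\<integral>\<^sup>+ w. \<integral>\<^sup>+ x. ?f w x * indicator U x \<partial>lborel \<partial>lebesgue_on_coords ?J)"
    by (rule nn_integral_cong) (rule step)
  also have "\<dots> = (\<integral>\<^sup>+ x. \<integral>\<^sup>+ w. ?f w x * indicator U x \<partial>lebesgue_on_coords ?J \<partial>lborel)"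
    by (rule pair_sigma_finite.Fubini'[OF pair fi, symmetric])
  also have "\<dots> = (\<integral>\<^sup>+ x. density_at a b x * indicator U x \<partial>lborel)"
  proof (rule nn_integral_cong)
    fix x :: "real^2"
    have m1: "(\<lambda>w. ?f w x) \<in> borel_measurable (lebesgue_on_coords ?J)"
      using measurable_Pair1[OF fm, of x] by simp
    show "(\<integral>\<^sup>+ w. ?f w x * indicator U x \<partial>lebesgue_on_coords ?J) = density_at a b x * indicator U x"
    proof (cases "x \<in> U")
      case True
      let ?g = "\<lambda>w. ennreal (\<bar>det (matrix (F' (crit a b x w) x))\<bar> * gauss_weight I (crit a b x w))"
      have d: "minor a b x \<noteq> 0" using U(2) True .
      have e: "?f w x = ennreal (1 / \<bar>minor a b x\<bar>) * ?g w" for w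
        by (simp add: ennreal_mult'[symmetric])
      have cancel: "\<And>d r::real. d > 0 \<Longrightarrow> r = d * (r / d)" by simp
      have "?g w = ennreal \<bar>minor a b x\<bar> * ?f w x" for w
        using cancel[of "\<bar>minor a b x\<bar>" "\<bar>det (matrix (F' (crit a b x w) x))\<bar> * gauss_weight I (crit a b x w)"] d
        by (simp only: ennreal_mult'[symmetric] abs_ge_zero zero_less_abs_iff times_divide_eq_left not_False_eq_True)
      then have "?g \<in> borel_measurable (lebesgue_on_coords ?J)"
        using borel_measurable_times_ennreal[OF borel_measurable_const m1] by presburger
      then show ?thesis unfolding density_at_def e using True by (simp add: nn_integral_cmult)
    qed simp
  qed
  finally show ?thesis .
qed

text \<open>
  A difference of open sets is an increasing union of compact sets.
\<close>

lemma measurable_zeros: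
  assumes "open A" "open B"
  shows "(\<lambda>c. zeros c (A - B)) \<in> borel_measurable (lebesgue_on_coords I)"
proof -
  obtain C where C: "\<And>n::nat. compact (C n)" "\<And>n. C n \<subseteq> A" "\<And>n. C n \<subseteq> interior (C (Suc n))" "\<Union>(range C) = A"
    using open_Union_compact_subsets[OF assms(1)] by metis
  define K where "K n = C n - B" for n
  have "C n \<subseteq> C (Suc n)" for n using C(3)[of n] interior_subset by blast
  then have "incseq K" unfolding K_def by (intro incseq_SucI) blast
  moreover have "compact (K n)" for n
    unfolding K_def using C(1) assms(2) by (rule compact_diff)
  moreover have "(\<Union>n. K n) = A - B" using C(4) by (auto simp: K_def)
  ultimately have "(\<lambda>c. emeasure (count_space UNIV) {x \<in> A - B. (\<Sum>b\<in>I. c b *\<^sub>R G b x) = 0}) \<in> borel_measurable (Pi\<^sub>M I (\<lambda>_. borel))"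
    using measurable_card_zeros_sigma_compact[OF fin, of K G] contG by simp
  then show ?thesis
    unfolding zeros_def F_def using measurable_cong_sets[OF sets_coords_borel refl] by blast
qed

text \<open>
  The Kac--Rice formula.  The function \<open>T x\<close> extends the absolute Jacobian from the coefficients for
  which \<open>x\<close> is a zero to all coefficients, as a function independent of the value of the field at
  \<open>x\<close>; the conditional mean of the Jacobian is then an unconditional mean of \<open>T x\<close>.  In particular
  the density does not depend on the pair of coordinates that is solved for, and the plane can be
  divided into countably many pieces on each of which one minor does not vanish.
\<close>

lemma expected_zeros:
  assumes \<gamma>: "\<And>x. \<gamma> x > 0"
    and n1: "\<And>x. (\<Sum>i\<in>I. G i x $ 1 * G i x $ 1) = \<gamma> x"
    and n2: "\<And>x. (\<Sum>i\<in>I. G i x $ 2 * G i x $ 2) = \<gamma> x"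
    and n12: "\<And>x. (\<Sum>i\<in>I. G i x $ 1 * G i x $ 2) = 0"
    and T: "\<And>x. T x \<in> borel_measurable (lebesgue_on_coords I)"
    and inv: "\<And>x c s t. c \<in> extensional I \<Longrightarrow> T x (\<lambda>i\<in>I. c i + s * G i x $ 1 + t * G i x $ 2) = T x c"
    and val: "\<And>x c. c \<in> extensional I \<Longrightarrow> F c x = 0 \<Longrightarrow> T x c = ennreal \<bar>det (matrix (F' c x))\<bar>"
    and h: "\<And>x. h x = ennreal (1 / (2 * pi * \<gamma> x)) * (\<integral>\<^sup>+ c. T x c * ennreal (gauss_weight I c) \<partial>lebesgue_on_coords I)"
    and hm: "h \<in> borel_measurable borel"
  shows "(\<integral>\<^sup>+ c. zeros c UNIV * ennreal (gauss_weight I c) \<partial>lebesgue_on_coords I) = (\<integral>\<^sup>+ x. h x \<partial>lborel)"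
proof -
  have dens: "density_at a b x = h x" if ab: "a \<in> I" "b \<in> I" "a \<noteq> b" and Dn: "minor a b x \<noteq> 0" for a b x
  proof -
    have D': "G a x $ 1 * G b x $ 2 - G b x $ 1 * G a x $ 2 \<noteq> 0" using Dn by (simp add: minor_def)
    interpret orthogonal_plane_complement I "I - {a, b}" a b "\<lambda>i. G i x $ 1" "\<lambda>i. G i x $ 2" "minor a b x" "\<gamma> x"
      using orthogonal_plane_complementI[OF fin ab, of "\<lambda>i. G i x $ 1" "\<lambda>i. G i x $ 2", OF D' n1 n2 n12 \<gamma>]
      by (simp only: minor_def)
    let ?j = "\<integral>\<^sup>+ w. T x (crit a b x w) * ennreal (gauss_weight I (crit a b x w)) \<partial>lebesgue_on_coords (I - {a, b})"
    have "h x = ennreal (1 / (2 * pi * \<gamma> x)) * (ennreal (2 * pi * \<gamma> x / \<bar>minor a b x\<bar>) * ?j)"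
      unfolding h by (subst nn_integral_gauss_weight_invariant[of "T x", OF T[of x] inv[of _ x]]) simp_all
    also have "\<dots> = ennreal (1 / \<bar>minor a b x\<bar>) * ?j"
    proof -
      have "1 / (2 * pi * \<gamma> x) * (2 * pi * \<gamma> x / \<bar>minor a b x\<bar>) = 1 / \<bar>minor a b x\<bar>"
        using \<gamma>[of x] by simp
      then have "ennreal (1 / (2 * pi * \<gamma> x)) * ennreal (2 * pi * \<gamma> x / \<bar>minor a b x\<bar>) = ennreal (1 / \<bar>minor a b x\<bar>)"
        using \<gamma>[of x] by (subst ennreal_mult'[symmetric]) (simp_all only: divide_nonneg_nonneg zero_le_one, simp)
      then show ?thesis by (simp only: mult.assoc[symmetric])
    qed
    also have "?j = (\<integral>\<^sup>+ w. ennreal (\<bar>det (matrix (F' (crit a b x w) x))\<bar> * gauss_weight I (crit a b x w)) \<partial>lebesgue_on_coords (I - {a, b}))"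
    proof (rule nn_integral_cong)
      fix w assume "w \<in> space (lebesgue_on_coords (I - {a, b}))"
      then have "crit a b x w \<in> extensional I" using ab by (intro crit_extensional) (auto simp: space_PiM PiE_def)
      from val[OF this F_ext[OF ab Dn]]
      show "T x (crit a b x w) * ennreal (gauss_weight I (crit a b x w)) = ennreal (\<bar>det (matrix (F' (crit a b x w) x))\<bar> * gauss_weight I (crit a b x w))"
        by (simp only: ennreal_mult'[OF abs_ge_zero])
    qed
    finally show ?thesis by (simp only: density_at_def)
  qed
  define P where "P = {p \<in> I \<times> I. fst p \<noteq> snd p}"
  have minor: "\<exists>p\<in>P. minor (fst p) (snd p) x \<noteq> 0" for x
  proof -
    obtain a b where "a \<in> I" "b \<in> I" "a \<noteq> b" "G a x $ 1 * G b x $ 2 - G b x $ 1 * G a x $ 2 \<noteq> 0"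
      by (rule exists_nonzero_minor[OF fin n1 n2 n12 \<gamma>])
    then show ?thesis by (intro bexI[of _ "(a, b)"]) (auto simp: P_def minor_def)
  qed
  have "finite P" unfolding P_def using fin by (auto intro: finite_subset[of _ "I \<times> I"])
  moreover have "P \<noteq> {}" using minor[of 0] by auto
  ultimately have rp: "range (from_nat_into P) = P" by (simp add: range_from_nat_into countable_finite)
  define a b where "a k = fst (from_nat_into P k)" and "b k = snd (from_nat_into P k)" for k
  have pk: "from_nat_into P k \<in> P" for k using rp by auto
  have ab: "a k \<in> I" "b k \<in> I" "a k \<noteq> b k" for k
    using pk[of k] by (auto simp: P_def a_def b_def)
  define W where "W k = {x. minor (a k) (b k) x \<noteq> 0}" for k
  have W: "open (W k)" for k
    unfolding W_def by (rule open_Collect_neq[OF cont_minor[OF ab(1,2)] continuous_on_const])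
  have UW: "(\<Union>k. W k) = UNIV"
  proof -
    have "x \<in> (\<Union>k. W k)" for x
    proof -
      obtain p where p: "p \<in> P" "minor (fst p) (snd p) x \<noteq> 0" using minor by blast
      then obtain k where "p = from_nat_into P k" using rp by blast
      with p show ?thesis by (auto simp: W_def a_def b_def)
    qed
    then show ?thesis by blast
  qed
  \<comment> \<open>On the \<open>k\<close>-th piece the \<open>k\<close>-th minor does not vanish.\<close>
  define V where "V = disjointed W"
  have V: "V k = W k - (\<Union>i\<in>{0..<k}. W i)" for k by (simp add: V_def disjointed_def)
  have Vb: "V k \<in> sets borel" for k unfolding V using W by auto
  have disj: "disjoint_family V" unfolding V_def by (rule disjoint_family_disjointed)
  have UV: "(\<Union>k. V k) = UNIV" unfolding V_def UN_disjointed_eq by (rule UW)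
  have zm: "(\<lambda>c. zeros c (V k)) \<in> borel_measurable (lebesgue_on_coords I)" for k
    unfolding V by (intro measurable_zeros W open_UN ballI)
  have zsum: "zeros c UNIV = (\<Sum>k. zeros c (V k))" for c
  proof -
    have "(\<Sum>k. zeros c (V k)) = emeasure (count_space UNIV) (\<Union>k. {x \<in> V k. F c x = 0})"
      unfolding zeros_def using disj by (intro suminf_emeasure) (auto simp: disjoint_family_on_def)
    also have "(\<Union>k. {x \<in> V k. F c x = 0}) = {x \<in> UNIV. F c x = 0}" using UV by auto
    finally show ?thesis unfolding zeros_def by simp
  qed
  have "(\<integral>\<^sup>+ c. zeros c UNIV * ennreal (gauss_weight I c) \<partial>lebesgue_on_coords I) =
    (\<integral>\<^sup>+ c. (\<Sum>k. zeros c (V k) * ennreal (gauss_weight I c)) \<partial>lebesgue_on_coords I)"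
    unfolding zsum by (simp only: ennreal_suminf_multc)
  also have "\<dots> = (\<Sum>k. \<integral>\<^sup>+ c. zeros c (V k) * ennreal (gauss_weight I c) \<partial>lebesgue_on_coords I)"
    by (rule nn_integral_suminf, rule borel_measurable_times_ennreal[OF zm measurable_compose[OF measurable_gauss_weight measurable_ennreal]])
  also have "\<dots> = (\<Sum>k. \<integral>\<^sup>+ x. h x * indicator (V k) x \<partial>lborel)"
  proof (rule suminf_cong)
    fix k
    have "(\<integral>\<^sup>+ c. zeros c (V k) * ennreal (gauss_weight I c) \<partial>lebesgue_on_coords I) =
      (\<integral>\<^sup>+ x. density_at (a k) (b k) x * indicator (V k) x \<partial>lborel)"
      by (rule nn_integral_zeros_pair[OF ab Vb _ zm]) (auto simp: V W_def)
    also have "\<dots> = (\<integral>\<^sup>+ x. h x * indicator (V k) x \<partial>lborel)"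
      using dens[OF ab] by (intro nn_integral_cong) (auto simp: V W_def indicator_def)
    finally show "(\<integral>\<^sup>+ c. zeros c (V k) * ennreal (gauss_weight I c) \<partial>lebesgue_on_coords I) = \<dots>" .
  qed
  also have "\<dots> = (\<integral>\<^sup>+ x. (\<Sum>k. h x * indicator (V k) x) \<partial>lborel)"
    using hm Vb by (intro nn_integral_suminf[symmetric] borel_measurable_times_ennreal) auto
  also have "\<dots> = (\<integral>\<^sup>+ x. h x \<partial>lborel)"
    using suminf_indicator[OF disj] UV by (simp add: ennreal_suminf_cmult)
  finally show ?thesis .
qed

end

section \<open>Second derivatives and traces\<close>

text \<open>
  The second difference of \<open>F\<close> over a small parallelogram is symmetric in the two directions, and by
  two applications of the mean value theorem it is $t^2$ times a value of either mixed derivative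
  at a nearby point.
\<close>

lemma symmetric_second_derivative:
  fixes F :: "'a::real_normed_vector \<Rightarrow> real"
  assumes U: "open U" "x \<in> U"
    and F1: "\<And>y. y \<in> U \<Longrightarrow> (F has_derivative F1 y) (at y)"
    and F2: "\<And>y e. y \<in> U \<Longrightarrow> ((\<lambda>z. F1 z e) has_derivative F2 e y) (at y)"
    and cont: "\<And>e h. continuous_on U (\<lambda>y. F2 e y h)"
  shows "F2 e x h = F2 h x e"
proof -
  obtain r where r: "r > 0" "ball x r \<subseteq> U" using U openE by blast
  \<comment> \<open>The second difference is a mixed derivative at a nearby point.\<close>
  have key: "\<exists>p. dist p x \<le> t * (norm e + norm h) \<and>
      F (x + t *\<^sub>R e + t *\<^sub>R h) - F (x + t *\<^sub>R e) - F (x + t *\<^sub>R h) + F x = t * t * F2 e p h"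
    if t: "t > 0" "t * (norm e + norm h) < r" for t e h
  proof -
    have inU: "x + s *\<^sub>R e + s' *\<^sub>R h \<in> U" if "0 \<le> s" "s \<le> t" "0 \<le> s'" "s' \<le> t" for s s'
    proof -
      have "norm (s *\<^sub>R e + s' *\<^sub>R h) \<le> s * norm e + s' * norm h"
        using that norm_triangle_ineq[of "s *\<^sub>R e" "s' *\<^sub>R h"] by simp
      also have "\<dots> \<le> t * norm e + t * norm h" using that by (intro add_mono mult_right_mono) auto
      also have "\<dots> < r" using t by (simp add: distrib_left)
      finally have n: "norm (s *\<^sub>R e + s' *\<^sub>R h) < r" .
      have "x - (x + s *\<^sub>R e + s' *\<^sub>R h) = - (s *\<^sub>R e + s' *\<^sub>R h)" by simp
      then have "x + s *\<^sub>R e + s' *\<^sub>R h \<in> ball x r" using n by (simp only: mem_ball dist_norm norm_minus_cancel)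
      then show ?thesis using r by blast
    qed
    define \<phi> where "\<phi> s = F (x + s *\<^sub>R e + t *\<^sub>R h) - F (x + s *\<^sub>R e)" for s
    have d\<phi>: "(\<phi> has_real_derivative F1 (x + s *\<^sub>R e + t *\<^sub>R h) e - F1 (x + s *\<^sub>R e) e) (at s)"
      if s: "0 \<le> s" "s \<le> t" for s
    proof -
      have u1: "x + s *\<^sub>R e + t *\<^sub>R h \<in> U" using inU[of s t] s t by auto
      have u2: "x + s *\<^sub>R e \<in> U" using inU[of s 0] s t by auto
      have l1: "F1 (x + s *\<^sub>R e + t *\<^sub>R h) (d *\<^sub>R e) = d * F1 (x + s *\<^sub>R e + t *\<^sub>R h) e" for d
        using linear_cmul[OF has_derivative_linear[OF F1[OF u1]]] by simp
      have l2: "F1 (x + s *\<^sub>R e) (d *\<^sub>R e) = d * F1 (x + s *\<^sub>R e) e" for d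
        using linear_cmul[OF has_derivative_linear[OF F1[OF u2]]] by simp
      have g: "((\<lambda>s. x + s *\<^sub>R e + t *\<^sub>R h) has_derivative (\<lambda>d. d *\<^sub>R e)) (at s)" "((\<lambda>s. x + s *\<^sub>R e) has_derivative (\<lambda>d. d *\<^sub>R e)) (at s)"
        by (auto intro!: derivative_eq_intros)
      have "(\<phi> has_derivative (\<lambda>d. F1 (x + s *\<^sub>R e + t *\<^sub>R h) (d *\<^sub>R e) - F1 (x + s *\<^sub>R e) (d *\<^sub>R e))) (at s)"
        unfolding \<phi>_def
        by (intro has_derivative_diff has_derivative_compose[OF g(1) F1[OF u1]] has_derivative_compose[OF g(2) F1[OF u2]])
      then show ?thesis
        unfolding has_field_derivative_def l1 l2 by (rule has_derivative_eq_rhs) (simp add: fun_eq_iff algebra_simps)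
    qed
    obtain \<xi> where xi: "0 < \<xi>" "\<xi> < t" "\<phi> t - \<phi> 0 = (t - 0) * (F1 (x + \<xi> *\<^sub>R e + t *\<^sub>R h) e - F1 (x + \<xi> *\<^sub>R e) e)"
      using MVT2[of 0 t \<phi> "\<lambda>s. F1 (x + s *\<^sub>R e + t *\<^sub>R h) e - F1 (x + s *\<^sub>R e) e"] t d\<phi> by auto
    have d\<psi>: "((\<lambda>s. F1 (x + \<xi> *\<^sub>R e + s *\<^sub>R h) e) has_real_derivative F2 e (x + \<xi> *\<^sub>R e + s *\<^sub>R h) h) (at s)"
      if s: "0 \<le> s" "s \<le> t" for s
    proof -
      have u: "x + \<xi> *\<^sub>R e + s *\<^sub>R h \<in> U" using inU[of \<xi> s] s xi by auto
      have l: "F2 e (x + \<xi> *\<^sub>R e + s *\<^sub>R h) (d *\<^sub>R h) = d * F2 e (x + \<xi> *\<^sub>R e + s *\<^sub>R h) h" for d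
        using linear_cmul[OF has_derivative_linear[OF F2[OF u]]] by simp
      have g: "((\<lambda>s. x + \<xi> *\<^sub>R e + s *\<^sub>R h) has_derivative (\<lambda>d. d *\<^sub>R h)) (at s)"
        by (auto intro!: derivative_eq_intros)
      have "((\<lambda>s. F1 (x + \<xi> *\<^sub>R e + s *\<^sub>R h) e) has_derivative (\<lambda>d. F2 e (x + \<xi> *\<^sub>R e + s *\<^sub>R h) (d *\<^sub>R h))) (at s)"
        by (rule has_derivative_compose[OF g F2[OF u]])
      then show ?thesis unfolding has_field_derivative_def l by (rule has_derivative_eq_rhs) (simp add: fun_eq_iff algebra_simps)
    qed
    obtain \<eta> where eta: "0 < \<eta>" "\<eta> < t"
      "F1 (x + \<xi> *\<^sub>R e + t *\<^sub>R h) e - F1 (x + \<xi> *\<^sub>R e + 0 *\<^sub>R h) e = (t - 0) * F2 e (x + \<xi> *\<^sub>R e + \<eta> *\<^sub>R h) h"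
      using MVT2[of 0 t "\<lambda>s. F1 (x + \<xi> *\<^sub>R e + s *\<^sub>R h) e" "\<lambda>s. F2 e (x + \<xi> *\<^sub>R e + s *\<^sub>R h) h"] t d\<psi> by auto
    have "dist (x + \<xi> *\<^sub>R e + \<eta> *\<^sub>R h) x \<le> t * (norm e + norm h)"
    proof -
      have "norm (\<xi> *\<^sub>R e + \<eta> *\<^sub>R h) \<le> \<xi> * norm e + \<eta> * norm h"
        using xi eta norm_triangle_ineq[of "\<xi> *\<^sub>R e" "\<eta> *\<^sub>R h"] by simp
      also have "\<dots> \<le> t * norm e + t * norm h" using xi eta by (intro add_mono mult_right_mono) auto
      finally show ?thesis by (simp add: dist_norm add.assoc distrib_left)
    qed
    moreover have "F (x + t *\<^sub>R e + t *\<^sub>R h) - F (x + t *\<^sub>R e) - F (x + t *\<^sub>R h) + F x = t * t * F2 e (x + \<xi> *\<^sub>R e + \<eta> *\<^sub>R h) h"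
      using xi(3) eta(3) by (simp add: \<phi>_def)
    ultimately show ?thesis by blast
  qed
  show ?thesis
  proof (rule ccontr)
    assume ne: "F2 e x h \<noteq> F2 h x e"
    define \<epsilon> where "\<epsilon> = \<bar>F2 e x h - F2 h x e\<bar> / 2"
    have e0: "\<epsilon> > 0" unfolding \<epsilon>_def using ne by (intro divide_pos_pos) auto
    have c: "\<exists>d>0. \<forall>y. dist y x < d \<longrightarrow> dist (F2 a y b) (F2 a x b) < \<epsilon>" for a b
    proof -
      have "isCont (\<lambda>y. F2 a y b) x" using cont U by (simp add: continuous_on_eq_continuous_at)
      then show ?thesis using e0 unfolding continuous_at_eps_delta dist_real_def dist_norm by (simp add: norm_minus_commute)
    qed
    obtain d1 d2 where d: "d1 > 0" "\<And>y. dist y x < d1 \<Longrightarrow> dist (F2 e y h) (F2 e x h) < \<epsilon>"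
      "d2 > 0" "\<And>y. dist y x < d2 \<Longrightarrow> dist (F2 h y e) (F2 h x e) < \<epsilon>"
      using c[of e h] c[of h e] by blast
    define m where "m = min r (min d1 d2)"
    define N where "N = norm e + norm h + 1"
    have m: "m > 0" using r d by (simp add: m_def)
    have N: "N > 0" unfolding N_def by (smt (verit) norm_ge_zero)
    define t where "t = m / (2 * N)"
    have t: "t > 0" using m N by (simp add: t_def)
    have "t * (norm e + norm h) \<le> t * N" using t by (intro mult_left_mono) (auto simp: N_def)
    also have "t * N = m / 2" using N by (simp add: t_def)
    also have "\<dots> < m" using m by simp
    finally have tm: "t * (norm e + norm h) < m" .
    obtain p where p: "dist p x \<le> t * (norm e + norm h)"
      "F (x + t *\<^sub>R e + t *\<^sub>R h) - F (x + t *\<^sub>R e) - F (x + t *\<^sub>R h) + F x = t * t * F2 e p h"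
      using key[of t e h] t tm by (auto simp: m_def)
    obtain q where q: "dist q x \<le> t * (norm h + norm e)"
      "F (x + t *\<^sub>R h + t *\<^sub>R e) - F (x + t *\<^sub>R h) - F (x + t *\<^sub>R e) + F x = t * t * F2 h q e"
      using key[of t h e] t tm by (auto simp: m_def add.commute)
    have eq: "x + t *\<^sub>R h + t *\<^sub>R e = x + t *\<^sub>R e + t *\<^sub>R h" by simp
    have "t * t * F2 e p h = t * t * F2 h q e" using p(2) q(2) unfolding eq by linarith
    then have "F2 e p h = F2 h q e" using t by simp
    moreover have "dist (F2 e p h) (F2 e x h) < \<epsilon>" using p(1) tm by (intro d(2)) (simp add: m_def)
    moreover have "dist (F2 h q e) (F2 h x e) < \<epsilon>" using q(1) tm by (intro d(4)) (simp add: m_def add.commute)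
    ultimately have "\<bar>F2 e x h - F2 h x e\<bar> < 2 * \<epsilon>" unfolding dist_real_def by linarith
    moreover have "2 * \<epsilon> = \<bar>F2 e x h - F2 h x e\<bar>"
    proof -
      have "\<And>r::real. 2 * (r / 2) = r" by simp
      then show ?thesis unfolding \<epsilon>_def .
    qed
    ultimately show False by linarith
  qed
qed

lemma frechet_derivative_transform_open:
  assumes "open U" "x \<in> U" "\<And>y. y \<in> U \<Longrightarrow> F y = G y" "F differentiable (at x)"
  shows "G differentiable (at x)" "frechet_derivative G (at x) = frechet_derivative F (at x)"
proof -
  have "(F has_derivative frechet_derivative F (at x)) (at x)" using assms(4) frechet_derivative_works by blast
  then have *: "(G has_derivative frechet_derivative F (at x)) (at x)"
    by (rule has_derivative_transform_within_open[OF _ assms(1,2)]) (rule assms(3))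
  then show "G differentiable (at x)" by (auto simp: differentiable_def)
  show "frechet_derivative G (at x) = frechet_derivative F (at x)" using frechet_derivative_at[OF *] by simp
qed

lemma C_k_on_cong:
  assumes "open U" "\<And>x. x \<in> U \<Longrightarrow> F x = G x"
  shows "C_k_on k U F \<longleftrightarrow> C_k_on k U G"
  using assms(2)
proof (induction k arbitrary: F G)
  case 0
  then show ?case by (auto intro: continuous_on_eq)
next
  case (Suc k)
  have d: "F differentiable (at x) \<longleftrightarrow> G differentiable (at x)" if "x \<in> U" for x
    using frechet_derivative_transform_open(1)[OF assms(1) that, of F G] frechet_derivative_transform_open(1)[OF assms(1) that, of G F] Suc.prems
    by auto
  have "C_k_on k U (\<lambda>x. frechet_derivative F (at x) e) \<longleftrightarrow> C_k_on k U (\<lambda>x. frechet_derivative G (at x) e)"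
    if "\<forall>x\<in>U. F differentiable (at x)" for e
  proof (rule Suc.IH)
    fix x assume x: "x \<in> U"
    show "frechet_derivative F (at x) e = frechet_derivative G (at x) e"
      using frechet_derivative_transform_open(2)[OF assms(1) x Suc.prems] that x by simp
  qed
  then show ?case using d by auto
qed

lemma C_k_on_lincomb:
  assumes "open U" "C_k_on k U F" "C_k_on k U G"
  shows "C_k_on k U (\<lambda>x. a * F x + b * G x)"
  using assms(2,3)
proof (induction k arbitrary: F G)
  case 0
  then show ?case by (auto intro!: continuous_intros)
next
  case (Suc k)
  have d: "((\<lambda>x. a * F x + b * G x) has_derivative (\<lambda>e. a * frechet_derivative F (at x) e + b * frechet_derivative G (at x) e)) (at x)"
    if "x \<in> U" for x
  proof -
    have "(F has_derivative frechet_derivative F (at x)) (at x)" "(G has_derivative frechet_derivative G (at x)) (at x)"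
      using Suc.prems that by (simp_all add: frechet_derivative_works[symmetric])
    then show ?thesis by (intro has_derivative_add has_derivative_mult_right)
  qed
  have "C_k_on k U (\<lambda>x. frechet_derivative (\<lambda>x. a * F x + b * G x) (at x) e)" for e
  proof -
    have "C_k_on k U (\<lambda>x. a * frechet_derivative F (at x) e + b * frechet_derivative G (at x) e)"
      using Suc.prems by (intro Suc.IH) auto
    moreover have e: "frechet_derivative (\<lambda>x. a * F x + b * G x) (at x) e = a * frechet_derivative F (at x) e + b * frechet_derivative G (at x) e"
      if "x \<in> U" for x
      using fun_cong[OF frechet_derivative_at[OF d[OF that]], of e] by simp
    ultimately show ?thesis by (subst C_k_on_cong[OF assms(1) e])
  qed
  then show ?case using d by (auto simp: differentiable_def)
qed

lemma C_k_on_compose_linear: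
  assumes R: "linear R" "\<And>x. R x = 0 \<longleftrightarrow> x = 0" and F: "C_k_on k (- {0}) F"
  shows "C_k_on k (- {0}) (\<lambda>x. F (R x))"
  using F
proof (induction k arbitrary: F)
  case 0
  have "continuous_on (- {0}) R" using R(1) by (simp add: linear_continuous_on linear_conv_bounded_linear)
  then show ?case using 0 R(2) by (auto intro!: continuous_on_compose2[of "- {0}" F])
next
  case (Suc k)
  have dR: "(R has_derivative R) (at x)" for x using R(1) by (rule linear_imp_has_derivative)
  have d: "((\<lambda>x. F (R x)) has_derivative (\<lambda>e. frechet_derivative F (at (R x)) (R e))) (at x)" if "x \<in> - {0}" for x
    using Suc.prems that R(2)[of x] by (intro has_derivative_compose[OF dR]) (auto simp: frechet_derivative_works[symmetric])
  have "C_k_on k (- {0}) (\<lambda>x. frechet_derivative (\<lambda>x. F (R x)) (at x) e)" for e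
  proof -
    have "C_k_on k (- {0}) (\<lambda>x. frechet_derivative F (at (R x)) (R e))"
      using Suc.prems by (intro Suc.IH[of "\<lambda>y. frechet_derivative F (at y) (R e)"]) auto
    moreover have e: "frechet_derivative (\<lambda>x. F (R x)) (at x) e = frechet_derivative F (at (R x)) (R e)" if "x \<in> - {0}" for x
      using fun_cong[OF frechet_derivative_at[OF d[OF that]], of e] by simp
    ultimately show ?thesis by (subst C_k_on_cong[OF _ e]) auto
  qed
  then show ?case using d by (auto simp: differentiable_def)
qed

text \<open>
  The expansion of each basis vector in the rotated orthonormal basis reduces the trace to the
  Gram matrix of that basis, which is the identity.
\<close>

lemma trace_orthogonal_invariant:
  fixes B :: "'a::euclidean_space \<Rightarrow> 'a \<Rightarrow> real" and R :: "'a \<Rightarrow> 'a"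
  assumes R: "orthogonal_transformation R" and B: "bilinear B"
  shows "(\<Sum>e\<in>Basis. B (R e) (R e)) = (\<Sum>e\<in>Basis. B e e)"
proof -
  have lin: "linear R" using R by (rule orthogonal_transformation_linear)
  have surj: "surj R"
    using R by (rule orthogonal_transformation_surj)
  have expand: "v = (\<Sum>e\<in>Basis. (v \<bullet> R e) *\<^sub>R R e)" for v
  proof -
    obtain w where w: "v = R w" using surj by blast
    have "R w = R (\<Sum>e\<in>Basis. (w \<bullet> e) *\<^sub>R e)" by (simp add: euclidean_representation)
    also have "\<dots> = (\<Sum>e\<in>Basis. (w \<bullet> e) *\<^sub>R R e)" using lin by (simp add: linear_sum linear_cmul o_def)
    finally have Rw: "R w = (\<Sum>e\<in>Basis. (w \<bullet> e) *\<^sub>R R e)" .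
    have "v \<bullet> R e = w \<bullet> e" for e using R w by (simp add: orthogonal_transformation_def)
    then show ?thesis using Rw w by (simp only:)
  qed
  have "B e e = (\<Sum>k\<in>Basis. \<Sum>l\<in>Basis. (e \<bullet> R k) * (e \<bullet> R l) * B (R k) (R l))" for e
  proof -
    have "B e e = B (\<Sum>k\<in>Basis. (e \<bullet> R k) *\<^sub>R R k) (\<Sum>l\<in>Basis. (e \<bullet> R l) *\<^sub>R R l)"
      by (simp only: expand[symmetric])
    also have "\<dots> = (\<Sum>(k, l)\<in>Basis \<times> Basis. B ((e \<bullet> R k) *\<^sub>R R k) ((e \<bullet> R l) *\<^sub>R R l))"
      by (rule bilinear_sum[OF B])
    finally show ?thesis
      by (simp add: sum.cartesian_product bilinear_lmul[OF B] bilinear_rmul[OF B] mult.assoc mult.left_commute)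
  qed
  then have "(\<Sum>e\<in>Basis. B e e) = (\<Sum>e\<in>Basis. \<Sum>k\<in>Basis. \<Sum>l\<in>Basis. (e \<bullet> R k) * (e \<bullet> R l) * B (R k) (R l))"
    by simp
  also have "\<dots> = (\<Sum>k\<in>Basis. \<Sum>e\<in>Basis. \<Sum>l\<in>Basis. (e \<bullet> R k) * (e \<bullet> R l) * B (R k) (R l))"
    by (rule sum.swap)
  also have "\<dots> = (\<Sum>k\<in>Basis. \<Sum>l\<in>Basis. \<Sum>e\<in>Basis. (e \<bullet> R k) * (e \<bullet> R l) * B (R k) (R l))"
    by (intro sum.cong refl sum.swap)
  also have "\<dots> = (\<Sum>k\<in>Basis. \<Sum>l\<in>Basis. (R k \<bullet> R l) * B (R k) (R l))"
  proof (intro sum.cong refl)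
    fix k l
    have "R k \<bullet> R l = (\<Sum>e\<in>Basis. (e \<bullet> R k) * (e \<bullet> R l))"
      using euclidean_inner[of "R k" "R l"] by (simp add: inner_commute)
    then show "(\<Sum>e\<in>Basis. (e \<bullet> R k) * (e \<bullet> R l) * B (R k) (R l)) = (R k \<bullet> R l) * B (R k) (R l)"
      by (simp only: sum_distrib_right)
  qed
  also have "\<dots> = (\<Sum>k\<in>Basis. \<Sum>l\<in>Basis. (if l = k then B (R k) (R l) else 0))"
    using R by (intro sum.cong refl) (auto simp: orthogonal_transformation_def inner_Basis)
  also have "\<dots> = (\<Sum>k\<in>Basis. B (R k) (R k))" by simp
  finally show ?thesis ..
qed

section \<open>Functions on the sphere and their radial extensions\<close>

abbreviation d1 :: "(real^3 \<Rightarrow> real) \<Rightarrow> real^3 \<Rightarrow> real^3 \<Rightarrow> real" where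
  "d1 f x \<equiv> frechet_derivative (radial_ext f) (at x)"

text \<open>
  Here and in \<open>d1\<close> the derivatives are those of the radially constant extension, taken at
  arbitrary nonzero points of the ambient space.  They are homogeneous of degrees \<open>-2\<close> and \<open>-1\<close>.
\<close>

definition d2 :: "(real^3 \<Rightarrow> real) \<Rightarrow> real^3 \<Rightarrow> real^3 \<Rightarrow> real^3 \<Rightarrow> real" where
  "d2 f x e h = frechet_derivative (\<lambda>y. d1 f y e) (at x) h"

lemma radial_ext_sphere: "norm p = 1 \<Longrightarrow> radial_ext f p = f p"
  by (simp add: radial_ext_def sgn_div_norm)

lemma radial_ext_scale: "t > 0 \<Longrightarrow> radial_ext f (t *\<^sub>R x) = radial_ext f x"
  by (simp add: radial_ext_def sgn_scaleR)

context
  fixes f :: "real^3 \<Rightarrow> real"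
  assumes f: "smooth_on_S2 f"
begin

lemma C_k: "C_k_on k (- {0}) (radial_ext f)" using f by (simp add: smooth_on_S2_def)

lemma has_d1: "x \<noteq> 0 \<Longrightarrow> (radial_ext f has_derivative d1 f x) (at x)"
  using C_k[of 1] by (simp add: frechet_derivative_works[symmetric])

lemma has_d2: "x \<noteq> 0 \<Longrightarrow> ((\<lambda>y. d1 f y e) has_derivative d2 f x e) (at x)"
  using C_k[of "Suc (Suc 0)"] unfolding d2_def by (simp add: frechet_derivative_works[symmetric])

lemma continuous_d2: "continuous_on (- {0}) (\<lambda>x. d2 f x e h)"
  using C_k[of "Suc (Suc 0)"] unfolding d2_def by simp

lemma continuous_d1: "continuous_on (- {0}) (\<lambda>x. d1 f x e)"
  using has_d2 has_derivative_continuous by (blast intro: continuous_at_imp_continuous_on)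

lemma continuous_radial_ext: "continuous_on (- {0}) (radial_ext f)"
  using has_d1 has_derivative_continuous by (blast intro: continuous_at_imp_continuous_on)

lemma linear_d1: "x \<noteq> 0 \<Longrightarrow> linear (d1 f x)"
  using has_d1 has_derivative_linear by blast

lemma linear_d2: "x \<noteq> 0 \<Longrightarrow> linear (d2 f x e)"
  using has_d2 has_derivative_linear by blast

lemma d2_symmetric:
  assumes "x \<noteq> 0"
  shows "d2 f x e h = d2 f x h e"
  by (rule symmetric_second_derivative[of "- {0}" x "radial_ext f" "d1 f" "\<lambda>e x. d2 f x e"])
     (use assms in \<open>auto intro: has_d1 has_d2 continuous_d2\<close>)

lemma bilinear_d2: "x \<noteq> 0 \<Longrightarrow> bilinear (d2 f x)"
  unfolding bilinear_def using linear_d2 d2_symmetric by (metis (no_types, lifting) ext)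

lemma d1_radial:
  assumes "x \<noteq> 0"
  shows "d1 f x x = 0"
proof -
  have g: "((\<lambda>t. t *\<^sub>R x) has_derivative (\<lambda>d. d *\<^sub>R x)) (at 1)" by (auto intro!: derivative_eq_intros)
  have "((\<lambda>t::real. radial_ext f (t *\<^sub>R x)) has_derivative (\<lambda>d. d1 f x (d *\<^sub>R x))) (at 1)"
    by (rule has_derivative_compose[OF g]) (use has_d1[OF assms] in simp)
  moreover have "((\<lambda>t::real. radial_ext f (t *\<^sub>R x)) has_derivative (\<lambda>d. 0)) (at 1)"
    by (rule has_derivative_transform_within_open[of "\<lambda>_. radial_ext f x" _ _ _ "{0<..}"])
       (auto simp: radial_ext_scale)
  ultimately have "(\<lambda>d. d1 f x (d *\<^sub>R x)) = (\<lambda>d. 0)" by (rule has_derivative_unique)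
  from fun_cong[OF this, of 1] show ?thesis by simp
qed

lemma d1_scale:
  assumes x: "x \<noteq> 0" and t: "t > 0"
  shows "d1 f (t *\<^sub>R x) h = d1 f x h / t"
proof -
  have g: "((\<lambda>y. t *\<^sub>R y) has_derivative (\<lambda>d. t *\<^sub>R d)) (at x)" by (auto intro!: derivative_eq_intros)
  have "((\<lambda>y. radial_ext f (t *\<^sub>R y)) has_derivative (\<lambda>d. d1 f (t *\<^sub>R x) (t *\<^sub>R d))) (at x)"
    by (rule has_derivative_compose[OF g]) (use has_d1 x t in simp)
  moreover have "((\<lambda>y. radial_ext f (t *\<^sub>R y)) has_derivative d1 f x) (at x)"
    using has_d1[OF x] t by (simp add: radial_ext_scale)
  ultimately have "(\<lambda>d. d1 f (t *\<^sub>R x) (t *\<^sub>R d)) = d1 f x" by (rule has_derivative_unique)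
  from fun_cong[OF this, of h] show ?thesis
    using linear_cmul[OF linear_d1] x t by (simp add: field_simps)
qed

lemma d2_scale:
  assumes x: "x \<noteq> 0" and t: "t > 0"
  shows "d2 f (t *\<^sub>R x) e h = d2 f x e h / t\<^sup>2"
proof -
  have g: "((\<lambda>y. t *\<^sub>R y) has_derivative (\<lambda>d. t *\<^sub>R d)) (at x)" by (auto intro!: derivative_eq_intros)
  have "((\<lambda>y. d1 f (t *\<^sub>R y) e) has_derivative (\<lambda>d. d2 f (t *\<^sub>R x) e (t *\<^sub>R d))) (at x)"
    by (rule has_derivative_compose[OF g]) (use has_d2 x t in simp)
  moreover have "((\<lambda>y. d1 f (t *\<^sub>R y) e) has_derivative (\<lambda>d. d2 f x e d / t)) (at x)"
  proof (rule has_derivative_transform_within_open[of "\<lambda>y. d1 f y e / t" _ _ _ "- {0}"])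
    show "((\<lambda>y. d1 f y e / t) has_derivative (\<lambda>d. d2 f x e d / t)) (at x)"
      using has_derivative_mult_right[OF has_d2[OF x], of "1 / t"] by simp
    show "d1 f y e / t = d1 f (t *\<^sub>R y) e" if "y \<in> - {0}" for y
      using d1_scale[OF _ t, of y e] that by simp
  qed (use x in auto)
  ultimately have "(\<lambda>d. d2 f (t *\<^sub>R x) e (t *\<^sub>R d)) = (\<lambda>d. d2 f x e d / t)" by (rule has_derivative_unique)
  from fun_cong[OF this, of h] show ?thesis
    using linear_cmul[OF linear_d2] x t by (simp add: field_simps power2_eq_square)
qed

text \<open>
  The first derivative is homogeneous of degree \<open>-1\<close>; this is Euler's relation for it.  The radial
  second derivatives therefore vanish at critical points.
\<close>

lemma d2_radial:
  assumes x: "x \<noteq> 0"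
  shows "d2 f x h x = - d1 f x h"
proof -
  have g: "((\<lambda>t. t *\<^sub>R x) has_derivative (\<lambda>d. d *\<^sub>R x)) (at 1)" by (auto intro!: derivative_eq_intros)
  have "((\<lambda>t::real. d1 f (t *\<^sub>R x) h) has_derivative (\<lambda>d. d2 f x h (d *\<^sub>R x))) (at 1)"
    by (rule has_derivative_compose[OF g]) (use has_d2[OF x] in simp)
  moreover have "((\<lambda>t::real. d1 f (t *\<^sub>R x) h) has_derivative (\<lambda>d. - d1 f x h * d)) (at 1)"
  proof (rule has_derivative_transform_within_open[of "\<lambda>t. d1 f x h / t" _ _ _ "{0<..}"])
    show "((\<lambda>t::real. d1 f x h / t) has_derivative (\<lambda>d. - d1 f x h * d)) (at 1)"
      by (auto intro!: derivative_eq_intros)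
    show "d1 f x h / t = d1 f (t *\<^sub>R x) h" if "t \<in> {0<..}" for t
      using d1_scale[OF x, of t h] that by simp
  qed simp_all
  ultimately have "(\<lambda>d. d2 f x h (d *\<^sub>R x)) = (\<lambda>d. - d1 f x h * d)" by (rule has_derivative_unique)
  from fun_cong[OF this, of 1] show ?thesis by simp
qed

lemma d2_radial2: "x \<noteq> 0 \<Longrightarrow> d2 f x x x = 0"
  using d2_radial[of x x] d1_radial by simp

lemma grad_S2_inner: "p \<noteq> 0 \<Longrightarrow> grad_S2 f p \<bullet> h = d1 f p h"
proof -
  assume p: "p \<noteq> 0"
  have "d1 f p h = d1 f p (\<Sum>e\<in>Basis. (h \<bullet> e) *\<^sub>R e)" by (simp only: euclidean_representation)
  also have "\<dots> = (\<Sum>e\<in>Basis. (h \<bullet> e) * d1 f p e)"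
    by (simp add: linear_sum[OF linear_d1[OF p]] linear_cmul[OF linear_d1[OF p]])
  also have "\<dots> = grad_S2 f p \<bullet> h"
    unfolding grad_S2_def inner_sum_left inner_scaleR_left by (intro sum.cong refl) (simp add: inner_commute)
  finally show ?thesis ..
qed

lemma grad_S2_eq_0_iff: "p \<noteq> 0 \<Longrightarrow> grad_S2 f p = 0 \<longleftrightarrow> (\<forall>h. d1 f p h = 0)"
  using grad_S2_inner[of p "grad_S2 f p"] by (auto simp: grad_S2_inner[symmetric])

text \<open>
  The gradient on the sphere extends radially as $|x|$ times the ambient gradient.  The factor
  $|x|$ contributes the radial derivative to the divergence, which is zero.
\<close>

lemma laplacian_S2_eq:
  assumes p: "norm p = 1"
  shows "laplacian_S2 f p = - (\<Sum>e\<in>Basis. d2 f p e e)"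
proof -
  have p0: "p \<noteq> 0" using p by auto
  have re: "radial_ext (grad_S2 f) x = norm x *\<^sub>R (\<Sum>e\<in>Basis. d1 f x e *\<^sub>R e)" if x: "x \<noteq> 0" for x
  proof -
    have "d1 f (sgn x) e = norm x * d1 f x e" for e
      using d1_scale[OF x, of "inverse (norm x)" e] x by (simp add: sgn_div_norm field_simps)
    then show ?thesis unfolding radial_ext_def[of "grad_S2 f"] grad_S2_def by (simp add: scaleR_sum_right)
  qed
  have "((\<lambda>x. norm x *\<^sub>R (\<Sum>e\<in>Basis. d1 f x e *\<^sub>R e)) has_derivative
      (\<lambda>h. norm p *\<^sub>R (\<Sum>e\<in>Basis. d2 f p e h *\<^sub>R e) + (h \<bullet> sgn p) *\<^sub>R (\<Sum>e\<in>Basis. d1 f p e *\<^sub>R e))) (at p)"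
    using p0 by (auto intro!: has_derivative_scaleR has_derivative_norm has_derivative_sum has_derivative_scaleR_left has_d2)
  then have "(radial_ext (grad_S2 f) has_derivative
      (\<lambda>h. norm p *\<^sub>R (\<Sum>e\<in>Basis. d2 f p e h *\<^sub>R e) + (h \<bullet> sgn p) *\<^sub>R (\<Sum>e\<in>Basis. d1 f p e *\<^sub>R e))) (at p)"
    by (rule has_derivative_transform_within_open[of _ _ _ _ "- {0}"]) (use p0 re in auto)
  from frechet_derivative_at[OF this]
  have fd: "frechet_derivative (radial_ext (grad_S2 f)) (at p) h = (\<Sum>e\<in>Basis. d2 f p e h *\<^sub>R e) + (h \<bullet> p) *\<^sub>R grad_S2 f p" for h
    using p by (simp add: grad_S2_def sgn_div_norm fun_eq_iff)
  have "div_S2 (grad_S2 f) p = (\<Sum>h\<in>Basis. (\<Sum>e\<in>Basis. d2 f p e h *\<^sub>R e) \<bullet> h + (h \<bullet> p) * (grad_S2 f p \<bullet> h))"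
    unfolding div_S2_def fd by (simp add: inner_add_left)
  also have "\<dots> = (\<Sum>h\<in>Basis. d2 f p h h) + grad_S2 f p \<bullet> p"
  proof -
    have "(\<Sum>e\<in>Basis. d2 f p e h *\<^sub>R e) \<bullet> h = d2 f p h h" if "h \<in> Basis" for h
      using that by (simp add: inner_sum_left inner_Basis if_distrib sum.delta cong: if_cong)
    then show ?thesis
      unfolding sum.distrib euclidean_inner[of "grad_S2 f p" p] by (simp add: mult.commute inner_commute)
  qed
  finally show ?thesis using grad_S2_inner[OF p0, of p] d1_radial[OF p0] by (simp add: laplacian_S2_def)
qed

end

lemma smooth_on_S2_lincomb:
  assumes "smooth_on_S2 f" "smooth_on_S2 g"
  shows "smooth_on_S2 (\<lambda>x. a * f x + b * g x)"
proof -
  have "radial_ext (\<lambda>x. a * f x + b * g x) = (\<lambda>x. a * radial_ext f x + b * radial_ext g x)"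
    by (simp add: radial_ext_def)
  then show ?thesis using assms by (auto simp: smooth_on_S2_def intro!: C_k_on_lincomb)
qed

lemma d1_lincomb:
  assumes f: "smooth_on_S2 f" and g: "smooth_on_S2 g" and x: "x \<noteq> 0"
  shows "d1 (\<lambda>x. a * f x + b * g x) x h = a * d1 f x h + b * d1 g x h"
proof -
  have e: "radial_ext (\<lambda>x. a * f x + b * g x) = (\<lambda>x. a * radial_ext f x + b * radial_ext g x)"
    by (simp add: radial_ext_def)
  have "((\<lambda>x. a * radial_ext f x + b * radial_ext g x) has_derivative (\<lambda>h. a * d1 f x h + b * d1 g x h)) (at x)"
    by (intro has_derivative_add has_derivative_mult_right has_d1 f g x)
  from fun_cong[OF frechet_derivative_at[OF this], of h] show ?thesis unfolding e by simp
qed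

lemma d2_lincomb:
  assumes f: "smooth_on_S2 f" and g: "smooth_on_S2 g" and x: "x \<noteq> 0"
  shows "d2 (\<lambda>x. a * f x + b * g x) x e h = a * d2 f x e h + b * d2 g x e h"
proof -
  have "((\<lambda>y. a * d1 f y e + b * d1 g y e) has_derivative (\<lambda>h. a * d2 f x e h + b * d2 g x e h)) (at x)"
    by (intro has_derivative_add has_derivative_mult_right has_d2 f g x)
  then have "((\<lambda>y. d1 (\<lambda>x. a * f x + b * g x) y e) has_derivative (\<lambda>h. a * d2 f x e h + b * d2 g x e h)) (at x)"
    by (rule has_derivative_transform_within_open[of _ _ _ _ "- {0}"]) (use x d1_lincomb[OF f g] in auto)
  from fun_cong[OF frechet_derivative_at[OF this], of h] show ?thesis unfolding d2_def by simp
qed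

lemma laplace_eigenspace_iff:
  "f \<in> laplace_eigenspace l \<longleftrightarrow> smooth_on_S2 f \<and> (\<forall>x. norm x \<noteq> 1 \<longrightarrow> f x = 0) \<and>
     (\<forall>p. norm p = 1 \<longrightarrow> (\<Sum>e\<in>Basis. d2 f p e e) = - l * f p)"
  unfolding laplace_eigenspace_def using laplacian_S2_eq[of f] by (auto simp: equation_minus_iff)

lemma laplace_eigenspace_lincomb:
  assumes "f \<in> laplace_eigenspace l" "g \<in> laplace_eigenspace l"
  shows "(\<lambda>x. a * f x + b * g x) \<in> laplace_eigenspace l"
  unfolding laplace_eigenspace_iff
proof (intro conjI allI impI)
  have s: "smooth_on_S2 f" "smooth_on_S2 g" using assms by (auto simp: laplace_eigenspace_iff)
  show "smooth_on_S2 (\<lambda>x. a * f x + b * g x)" by (rule smooth_on_S2_lincomb[OF s])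
  show "a * f x + b * g x = 0" if "norm x \<noteq> 1" for x using that assms by (simp add: laplace_eigenspace_iff)
  show "(\<Sum>e\<in>Basis. d2 (\<lambda>x. a * f x + b * g x) p e e) = - l * (a * f p + b * g p)" if p: "norm p = 1" for p
  proof -
    have p0: "p \<noteq> 0" using p by auto
    have "(\<Sum>e\<in>Basis. d2 (\<lambda>x. a * f x + b * g x) p e e) = a * (\<Sum>e\<in>Basis. d2 f p e e) + b * (\<Sum>e\<in>Basis. d2 g p e e)"
      by (simp add: d2_lincomb[OF s p0] sum.distrib sum_distrib_left)
    then show ?thesis using assms p by (simp add: laplace_eigenspace_iff algebra_simps)
  qed
qed

lemma laplace_eigenspace_sum:
  assumes "finite B" "\<And>b. b \<in> B \<Longrightarrow> b \<in> laplace_eigenspace l"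
  shows "(\<lambda>x. \<Sum>b\<in>B. c b * b x) \<in> laplace_eigenspace l"
  using assms
proof (induction B rule: finite_induct)
  case empty
  have z: "radial_ext (\<lambda>x. 0) = (\<lambda>x. 0)" by (simp add: radial_ext_def)
  have "C_k_on k (- {0}) (\<lambda>x. 0)" for k by (induction k) (auto simp: frechet_derivative_const)
  then have "smooth_on_S2 (\<lambda>x. 0)" by (simp add: smooth_on_S2_def z)
  moreover have "d2 (\<lambda>x. 0) p e e = 0" for p e by (simp add: d2_def z frechet_derivative_const)
  ultimately show ?case by (simp add: laplace_eigenspace_iff)
next
  case (insert b B)
  then have "(\<lambda>x. c b * b x + 1 * (\<Sum>b\<in>B. c b * b x)) \<in> laplace_eigenspace l"
    by (intro laplace_eigenspace_lincomb) auto
  then show ?case using insert.hyps by simp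
qed

lemma sgn_orthogonal: "orthogonal_transformation R \<Longrightarrow> sgn (R x) = R (sgn x)"
  by (simp add: sgn_div_norm orthogonal_transformation_norm orthogonal_transformation_scaleR)

text \<open>
  Both derivatives of \<open>f \<circ> R\<close> are those of \<open>f\<close> with rotated arguments, and the trace is invariant.
\<close>

lemma laplace_eigenspace_rotate:
  assumes f: "f \<in> laplace_eigenspace l" and R: "orthogonal_transformation R"
  shows "(\<lambda>x. f (R x)) \<in> laplace_eigenspace l"
  unfolding laplace_eigenspace_iff
proof (intro conjI allI impI)
  have s: "smooth_on_S2 f" using f by (simp add: laplace_eigenspace_iff)
  have lin: "linear R" using R by (rule orthogonal_transformation_linear)
  have R0: "R x = 0 \<longleftrightarrow> x = 0" for x
    using orthogonal_transformation_norm[OF R, of x] norm_eq_zero[of x] norm_eq_zero[of "R x"] by linarith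
  have e: "radial_ext (\<lambda>x. f (R x)) = (\<lambda>x. radial_ext f (R x))"
    by (simp add: radial_ext_def sgn_orthogonal[OF R])
  show s': "smooth_on_S2 (\<lambda>x. f (R x))"
    unfolding smooth_on_S2_def e
    by (rule allI, rule C_k_on_compose_linear[OF lin R0 C_k[OF s]])
  show "f (R x) = 0" if "norm x \<noteq> 1" for x
    using that f orthogonal_transformation_norm[OF R, of x] by (simp add: laplace_eigenspace_iff)
  have dR: "(R has_derivative R) (at x)" for x using lin by (rule linear_imp_has_derivative)
  have d1R: "d1 (\<lambda>x. f (R x)) x h = d1 f (R x) (R h)" if "x \<noteq> 0" for x h
  proof -
    have "((\<lambda>x. radial_ext f (R x)) has_derivative (\<lambda>h. d1 f (R x) (R h))) (at x)"
      by (rule has_derivative_compose[OF dR has_d1[OF s]]) (unfold R0, rule that)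
    from fun_cong[OF frechet_derivative_at[OF this], of h] show ?thesis unfolding e by simp
  qed
  have d2R: "d2 (\<lambda>x. f (R x)) x e h = d2 f (R x) (R e) (R h)" if "x \<noteq> 0" for x e h
  proof -
    have "((\<lambda>y. d1 f (R y) (R e)) has_derivative (\<lambda>h. d2 f (R x) (R e) (R h))) (at x)"
      by (rule has_derivative_compose[OF dR has_d2[OF s]]) (unfold R0, rule that)
    then have "((\<lambda>y. d1 (\<lambda>x. f (R x)) y e) has_derivative (\<lambda>h. d2 f (R x) (R e) (R h))) (at x)"
    proof (rule has_derivative_transform_within_open[of _ _ _ _ "- {0}"])
      show "d1 f (R y) (R e) = d1 (\<lambda>x. f (R x)) y e" if "y \<in> - {0}" for y
        by (rule d1R[symmetric]) (use that in blast)
    qed (simp_all add: that open_Compl)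
    from fun_cong[OF frechet_derivative_at[OF this], of h] show ?thesis unfolding d2_def by simp
  qed
  show "(\<Sum>e\<in>Basis. d2 (\<lambda>x. f (R x)) p e e) = - l * f (R p)" if p: "norm p = 1" for p
  proof -
    have p0: "p \<noteq> 0" "R p \<noteq> 0" using p unfolding R0 by auto
    have "(\<Sum>e\<in>Basis. d2 (\<lambda>x. f (R x)) p e e) = (\<Sum>e\<in>Basis. d2 f (R p) e e)"
      unfolding d2R[OF p0(1)] by (rule trace_orthogonal_invariant[OF R bilinear_d2[OF s p0(2)]])
    also have "\<dots> = - l * f (R p)"
      using f p orthogonal_transformation_norm[OF R, of p] by (simp add: laplace_eigenspace_iff)
    finally show ?thesis .
  qed
qed

section \<open>The inner product of functions on the sphere\<close>

lemma lborel_orthogonal_image: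
  fixes R :: "real^'n::{finite,wellorder} \<Rightarrow> real^'n::{finite,wellorder}"
  assumes R: "orthogonal_transformation R"
  shows "distr lborel borel R = lborel"
proof (rule lborel_eqI[symmetric])
  have lin: "linear R" using R by (rule orthogonal_transformation_linear)
  have Rm: "R \<in> borel_measurable borel"
    using lin by (intro borel_measurable_continuous_onI) (simp add: linear_continuous_on linear_conv_bounded_linear)
  have bij: "bij R" using R by (rule orthogonal_transformation_bij)
  have R': "orthogonal_transformation (inv R)" using R by (rule orthogonal_transformation_inv)
  fix l u :: "real^'n::{finite,wellorder}"
  assume lu: "\<And>b. b \<in> Basis \<Longrightarrow> l \<bullet> b \<le> u \<bullet> b"
  have pre: "R -` box l u = inv R ` box l u" using bij by (simp add: bij_vimage_eq_inv_image)
  have lm: "inv R ` box l u \<in> lmeasurable" by (rule measurable_orthogonal_image[OF R']) simp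
  have "emeasure (distr lborel borel R) (box l u) = emeasure lborel (R -` box l u)"
    using Rm by (subst emeasure_distr) auto
  also have "\<dots> = emeasure lebesgue (inv R ` box l u)"
    using measurable_sets[OF Rm, of "box l u"] unfolding pre[symmetric] by simp
  also have "\<dots> = ennreal (measure lebesgue (inv R ` box l u))"
    using lm by (simp add: emeasure_eq_measure2)
  also have "measure lebesgue (inv R ` box l u) = measure lebesgue (box l u)"
    by (rule measure_orthogonal_image[OF R']) simp
  also have "ennreal (measure lebesgue (box l u)) = ennreal (\<Prod>b\<in>Basis. (u - l) \<bullet> b)"
    using lu by (simp add: measure_lborel_box_eq inner_diff_left)
  finally show "emeasure (distr lborel borel R) (box l u) = ennreal (\<Prod>b\<in>Basis. (u - l) \<bullet> b)" .
qed simp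

definition cont_S2 :: "(real^3 \<Rightarrow> real) \<Rightarrow> bool" where
  "cont_S2 h \<longleftrightarrow> continuous_on (- {0}) (radial_ext h)"

text \<open>
  A third of the integral over the sphere, as the area measure is three times the image of the
  volume of the ball.
\<close>

definition solid_integral :: "(real^3 \<Rightarrow> real) \<Rightarrow> real" where
  "solid_integral h = (LINT x|lborel. indicator (cball 0 1 - {0}) x * radial_ext h x)"

lemma cont_S2_lincomb: "cont_S2 f \<Longrightarrow> cont_S2 g \<Longrightarrow> cont_S2 (\<lambda>x. a * f x + b * g x)"
  unfolding cont_S2_def radial_ext_def by (intro continuous_intros)

lemma cont_S2_mult: "cont_S2 f \<Longrightarrow> cont_S2 g \<Longrightarrow> cont_S2 (\<lambda>x. f x * g x)"
  unfolding cont_S2_def radial_ext_def by (intro continuous_intros)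

lemma cont_S2_smooth: "smooth_on_S2 f \<Longrightarrow> cont_S2 f"
  by (simp add: cont_S2_def continuous_radial_ext)

lemma cont_S2_bounded:
  assumes "cont_S2 h"
  obtains M where "M \<ge> 0" "\<And>x. x \<noteq> 0 \<Longrightarrow> \<bar>radial_ext h x\<bar> \<le> M"
proof -
  have c: "continuous_on (sphere 0 1) (radial_ext h)"
    using assms unfolding cont_S2_def by (rule continuous_on_subset) auto
  then have "bounded (radial_ext h ` sphere 0 1)"
    by (intro compact_imp_bounded compact_continuous_image) auto
  then obtain M where M: "\<And>p. p \<in> sphere 0 1 \<Longrightarrow> \<bar>radial_ext h p\<bar> \<le> M"
    unfolding bounded_iff by (metis imageI real_norm_def)
  have "\<bar>radial_ext h x\<bar> \<le> M" if "x \<noteq> 0" for x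
  proof -
    have n: "norm (sgn x) = 1" using that by (simp add: norm_sgn)
    then have "radial_ext h x = radial_ext h (sgn x)" by (simp add: radial_ext_sphere) (simp add: radial_ext_def)
    then show ?thesis using M[of "sgn x"] n by simp
  qed
  then have "\<bar>radial_ext h x\<bar> \<le> max 0 M" if "x \<noteq> 0" for x
    using that by (meson max.cobounded2 order_trans)
  then show ?thesis by (rule that[OF max.cobounded1])
qed

lemma measurable_solid:
  assumes "cont_S2 h"
  shows "(\<lambda>x. indicator (cball 0 1 - {0}) x * radial_ext h x) \<in> borel_measurable borel"
proof -
  have "radial_ext h \<in> borel_measurable (restrict_space borel (cball 0 1 - {0}))"
    using assms unfolding cont_S2_def
    by (rule borel_measurable_continuous_on_restrict[OF continuous_on_subset]) auto
  then have "(\<lambda>x. indicator (cball 0 1 - {0}) x *\<^sub>R radial_ext h x) \<in> borel_measurable borel"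
    by (subst (asm) borel_measurable_restrict_space_iff) auto
  then show ?thesis by simp
qed

lemma integrable_solid:
  assumes "cont_S2 h"
  shows "integrable lborel (\<lambda>x. indicator (cball 0 1 - {0}) x * radial_ext h x)"
proof -
  obtain M where M: "M \<ge> 0" "\<And>x. x \<noteq> 0 \<Longrightarrow> \<bar>radial_ext h x\<bar> \<le> M" by (rule cont_S2_bounded[OF assms]) blast
  have i: "integrable lborel (\<lambda>x::real^3. indicator (cball 0 1) x * M)"
    by (rule integrable_mult_left) (simp add: emeasure_cball)
  show ?thesis
    by (rule Bochner_Integration.integrable_bound[OF i]) (use measurable_solid[OF assms] M in \<open>auto simp: indicator_def\<close>)
qed

lemma sgn_measurable: "sgn \<in> borel_measurable (borel :: (real^3) measure)"
  unfolding sgn_div_norm[abs_def] by measurable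

lemma measurable_sgn_area:
  "sgn \<in> restrict_space lborel (cball 0 1 - {0}) \<rightarrow>\<^sub>M restrict_space borel (sphere (0::real^3) 1)"
proof (rule measurable_restrict_space2)
  show "sgn \<in> space (restrict_space lborel (cball 0 1 - {0})) \<rightarrow> sphere (0::real^3) 1"
    by (auto simp: space_restrict_space norm_sgn)
  show "sgn \<in> restrict_space lborel (cball 0 1 - {0}) \<rightarrow>\<^sub>M (borel :: (real^3) measure)"
    using sgn_measurable by (intro measurable_restrict_space1) simp
qed

lemma integral_area_S2:
  assumes h: "cont_S2 h"
  shows "(\<integral>p. h p \<partial>area_S2) = 3 * solid_integral h"
proof -
  let ?D = "distr (restrict_space lborel (cball 0 1 - {0})) (restrict_space borel (sphere (0::real^3) 1)) sgn"
  have hm: "h \<in> borel_measurable (restrict_space borel (sphere 0 1))"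
  proof -
    have "radial_ext h \<in> borel_measurable (restrict_space borel (sphere 0 1))"
      using h unfolding cont_S2_def by (rule borel_measurable_continuous_on_restrict[OF continuous_on_subset]) auto
    then show ?thesis
      by (subst measurable_cong[where g="radial_ext h"]) (auto simp: space_restrict_space radial_ext_sphere)
  qed
  have "(\<integral>p. h p \<partial>area_S2) = 3 * (\<integral>p. h p \<partial>?D)"
  proof -
    have m: "h \<in> borel_measurable ?D" using hm by simp
    have "area_S2 = density ?D (\<lambda>_. ennreal 3)"
      unfolding area_S2_def by (rule measure_eqI) (auto simp: emeasure_density nn_integral_cmult_indicator)
    then show ?thesis using integral_density[OF m, of "\<lambda>_. 3"] by simp
  qed
  also have "(\<integral>p. h p \<partial>?D) = (\<integral>x. h (sgn x) \<partial>restrict_space lborel (cball 0 1 - {0}))"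
    by (rule integral_distr[OF measurable_sgn_area hm])
  also have "\<dots> = solid_integral h"
    unfolding solid_integral_def radial_ext_def by (subst integral_restrict_space) (auto simp: set_lebesgue_integral_def)
  finally show ?thesis .
qed

lemma inner_S2_eq: "cont_S2 f \<Longrightarrow> cont_S2 g \<Longrightarrow> inner_S2 f g = 3 * solid_integral (\<lambda>x. f x * g x)"
  unfolding inner_S2_def by (rule integral_area_S2[OF cont_S2_mult])

lemma solid_integral_lincomb:
  assumes "cont_S2 f" "cont_S2 g"
  shows "solid_integral (\<lambda>x. a * f x + b * g x) = a * solid_integral f + b * solid_integral g"
proof -
  have "solid_integral (\<lambda>x. a * f x + b * g x) = (LINT x|lborel. a * (indicator (cball 0 1 - {0}) x * radial_ext f x)
      + b * (indicator (cball 0 1 - {0}) x * radial_ext g x))"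
    unfolding solid_integral_def by (intro Bochner_Integration.integral_cong) (auto simp: radial_ext_def algebra_simps)
  then show ?thesis
    unfolding solid_integral_def using integrable_solid[OF assms(1)] integrable_solid[OF assms(2)] by simp
qed

lemma inner_S2_commute: "inner_S2 f g = inner_S2 g f"
  by (simp add: inner_S2_def mult.commute)

lemma inner_S2_lincomb_left:
  assumes "cont_S2 f" "cont_S2 g" "cont_S2 h"
  shows "inner_S2 (\<lambda>x. a * f x + b * g x) h = a * inner_S2 f h + b * inner_S2 g h"
proof -
  have "(\<lambda>x. (a * f x + b * g x) * h x) = (\<lambda>x. a * (f x * h x) + b * (g x * h x))" by (auto simp: algebra_simps)
  then show ?thesis
    using assms by (simp add: inner_S2_eq cont_S2_lincomb solid_integral_lincomb cont_S2_mult)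
qed

lemma inner_S2_sum_left:
  assumes "finite B" "\<And>b. b \<in> B \<Longrightarrow> cont_S2 b" "cont_S2 h"
  shows "cont_S2 (\<lambda>x. \<Sum>b\<in>B. c b * b x)" "inner_S2 (\<lambda>x. \<Sum>b\<in>B. c b * b x) h = (\<Sum>b\<in>B. c b * inner_S2 b h)"
proof -
  have "cont_S2 (\<lambda>x. \<Sum>b\<in>B. c b * b x) \<and> inner_S2 (\<lambda>x. \<Sum>b\<in>B. c b * b x) h = (\<Sum>b\<in>B. c b * inner_S2 b h)"
    using assms(1,2)
  proof (induction B rule: finite_induct)
    case empty
    have "cont_S2 (\<lambda>x. 0)" by (simp add: cont_S2_def radial_ext_def)
    then show ?case by (simp add: inner_S2_def)
  next
    case (insert b B)
    have "cont_S2 (\<lambda>x. c b * b x + 1 * (\<Sum>b\<in>B. c b * b x))"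
      using insert by (intro cont_S2_lincomb) auto
    moreover have "inner_S2 (\<lambda>x. c b * b x + 1 * (\<Sum>b\<in>B. c b * b x)) h = c b * inner_S2 b h + 1 * (\<Sum>b\<in>B. c b * inner_S2 b h)"
      using insert assms(3) by (subst inner_S2_lincomb_left) auto
    ultimately show ?case using insert.hyps by simp
  qed
  then show "cont_S2 (\<lambda>x. \<Sum>b\<in>B. c b * b x)" "inner_S2 (\<lambda>x. \<Sum>b\<in>B. c b * b x) h = (\<Sum>b\<in>B. c b * inner_S2 b h)" by auto
qed

lemma inner_S2_nonneg: "inner_S2 f f \<ge> 0"
  unfolding inner_S2_def by (intro Bochner_Integration.integral_nonneg) simp

text \<open>
  If \<open>f p\<close> is nonzero, the radial extension is nonzero on a nonempty open subset of the ball.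
\<close>

lemma inner_S2_eq_0:
  assumes f: "cont_S2 f" and 0: "inner_S2 f f = 0" and p: "norm p = 1"
  shows "f p = 0"
proof (rule ccontr)
  assume fp: "f p \<noteq> 0"
  let ?W = "ball 0 1 - {0} :: (real^3) set"
  have W: "open ?W" by auto
  have c: "continuous_on ?W (radial_ext f)" using f unfolding cont_S2_def by (rule continuous_on_subset) auto
  have op: "open (?W \<inter> radial_ext f -` (- {0}))" using continuous_open_preimage[OF c W, of "- {0}"] by auto
  let ?N = "?W \<inter> radial_ext f -` (- {0})"
  have "(1/2) *\<^sub>R p \<in> ?N" using p fp by (auto simp: radial_ext_scale radial_ext_sphere)
  then have "\<not> negligible ?N" using open_not_negligible[OF op] by blast
  moreover have "?N \<in> null_sets lborel"
  proof -
    have ae: "AE x in lborel. indicator (cball 0 1 - {0}) x * radial_ext (\<lambda>x. f x * f x) x = 0"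
      using 0 integrable_solid[OF cont_S2_mult[OF f f]] unfolding inner_S2_eq[OF f f] solid_integral_def
      by (subst integral_nonneg_eq_0_iff_AE[symmetric]) (auto simp: radial_ext_def)
    have "AE x in lborel. x \<notin> ?N"
      using ae
    proof eventually_elim
      case (elim x)
      show ?case
      proof
        assume x: "x \<in> ?N"
        then have "radial_ext f x * radial_ext f x = 0" using elim by (simp add: radial_ext_def)
        then show False using x by simp
      qed
    qed
    then show ?thesis using op by (simp add: AE_iff_null_sets)
  qed
  ultimately show False
    by (simp add: negligible_iff_null_sets null_sets_completionI)
qed

lemma radial_ext_orthogonal: "orthogonal_transformation R \<Longrightarrow> radial_ext (\<lambda>x. h (R x)) x = radial_ext h (R x)"
  by (simp add: radial_ext_def sgn_orthogonal)

lemma cont_S2_orthogonal: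
  assumes R: "orthogonal_transformation R" and f: "cont_S2 f"
  shows "cont_S2 (\<lambda>x. f (R x))"
proof -
  have R0: "R x \<noteq> 0" if "x \<noteq> 0" for x using that orthogonal_transformation_norm[OF R, of x] by (metis norm_eq_zero)
  have "continuous_on (- {0}) R"
    using orthogonal_transformation_linear[OF R] by (simp add: linear_continuous_on linear_conv_bounded_linear)
  then show ?thesis
    using f R0 unfolding cont_S2_def radial_ext_orthogonal[OF R] by (auto intro!: continuous_on_compose2[of "- {0}" "radial_ext f"])
qed

lemma inner_S2_orthogonal:
  assumes R: "orthogonal_transformation R" and f: "cont_S2 f" and g: "cont_S2 g"
  shows "inner_S2 (\<lambda>x. f (R x)) (\<lambda>x. g (R x)) = inner_S2 f g"
proof -
  let ?h = "\<lambda>x. f x * g x"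
  let ?k = "\<lambda>x. indicator (cball 0 1 - {0}) x * radial_ext ?h x"
  have Rm: "R \<in> borel_measurable borel"
    using orthogonal_transformation_linear[OF R] by (intro borel_measurable_continuous_onI) (simp add: linear_continuous_on linear_conv_bounded_linear)
  have R0: "R x = 0 \<longleftrightarrow> x = 0" for x using orthogonal_transformation_norm[OF R, of x] by (metis norm_eq_zero)
  have "solid_integral (\<lambda>x. f (R x) * g (R x)) = (LINT x|lborel. ?k (R x))"
    unfolding solid_integral_def radial_ext_orthogonal[OF R, of ?h]
    using orthogonal_transformation_norm[OF R] R0 by (intro Bochner_Integration.integral_cong) (auto simp: indicator_def)
  also have "\<dots> = (LINT x|distr lborel borel R. ?k x)"
    using measurable_solid[OF cont_S2_mult[OF f g]] Rm by (subst integral_distr) auto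
  also have "\<dots> = solid_integral ?h" unfolding lborel_orthogonal_image[OF R] solid_integral_def ..
  finally show ?thesis
    using f g R by (simp add: inner_S2_eq cont_S2_orthogonal)
qed

section \<open>Harmonic extension and the bound on point evaluations\<close>

text \<open>
  The integral of a compactly supported function does not change under translations, so that its
  derivative in the direction of translation integrates to zero.
\<close>

lemma integral_directional_derivative_eq_0:
  fixes G :: "'a::euclidean_space \<Rightarrow> real"
  assumes der: "\<And>z. (G has_derivative G' z) (at z)" and cont: "continuous_on UNIV (\<lambda>z. G' z e)"
    and supp: "\<And>z. r \<le> norm z \<Longrightarrow> G z = 0"
    and Q: "ball 0 (r + norm e) \<subseteq> cbox a b"
  shows "integral (cbox a b) (\<lambda>z. G' z e) = 0"
proof -
  have cG: "continuous_on S G" for S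
    by (meson continuous_at_imp_continuous_on der has_derivative_continuous)
  have intG: "integrable lborel (\<lambda>z. G (z + t *\<^sub>R e))"
    and I: "integral (cbox a b) (\<lambda>z. G (z + t *\<^sub>R e)) = (LINT z|lborel. G z)" if t: "\<bar>t\<bar> < 1" for t
  proof -
    have out: "G (z + t *\<^sub>R e) = 0" if "z \<notin> cbox a b" for z
    proof (rule supp)
      have "r + norm e \<le> norm z" using Q that by (force simp: subset_iff)
      also have "norm z \<le> norm (z + t *\<^sub>R e) + \<bar>t\<bar> * norm e"
        using norm_triangle_ineq4[of "z + t *\<^sub>R e" "t *\<^sub>R e"] by simp
      also have "\<bar>t\<bar> * norm e \<le> norm e" using t mult_right_mono[of "\<bar>t\<bar>" 1 "norm e"] by simp
      finally show "r \<le> norm (z + t *\<^sub>R e)" by simp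
    qed
    have eq: "(\<lambda>z. indicator (cbox a b) z *\<^sub>R G (z + t *\<^sub>R e)) = (\<lambda>z. G (z + t *\<^sub>R e))"
      using out by (auto simp: indicator_def fun_eq_iff)
    have c: "continuous_on (cbox a b) (\<lambda>z. G (z + t *\<^sub>R e))"
      by (rule continuous_on_compose2[OF cG[of UNIV]]) (auto intro!: continuous_intros)
    have i: "integrable lborel (\<lambda>z. indicator (cbox a b) z *\<^sub>R G (z + t *\<^sub>R e))"
      by (rule borel_integrable_compact[OF compact_cbox c])
    then show "integrable lborel (\<lambda>z. G (z + t *\<^sub>R e))" unfolding eq .
    have "integral (cbox a b) (\<lambda>z. G (z + t *\<^sub>R e)) = (LINT z:cbox a b|lborel. G (z + t *\<^sub>R e))"
      using i by (intro set_borel_integral_eq_integral(2)[symmetric]) (simp add: set_integrable_def)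
    also have "\<dots> = (LINT z|lborel. G (z + t *\<^sub>R e))" unfolding set_lebesgue_integral_def eq ..
    also have "\<dots> = (LINT z|distr lborel borel (\<lambda>z. t *\<^sub>R e + z). G z)"
      using borel_measurable_continuous_onI[OF cG] by (subst integral_distr) (auto simp: add.commute)
    also have "distr lborel borel (\<lambda>z. t *\<^sub>R e + z) = lborel" by (rule lborel_distr_plus)
    finally show "integral (cbox a b) (\<lambda>z. G (z + t *\<^sub>R e)) = (LINT z|lborel. G z)" .
  qed
  let ?U = "{-1<..<1::real}"
  have "((\<lambda>t. integral (cbox a b) (\<lambda>z. G (z + t *\<^sub>R e))) has_field_derivative integral (cbox a b) (\<lambda>z. G' (z + 0 *\<^sub>R e) e)) (at 0 within ?U)"
  proof (rule leibniz_rule_field_derivative)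
    show "((\<lambda>t. G (z + t *\<^sub>R e)) has_field_derivative G' (z + t *\<^sub>R e) e) (at t within ?U)" for t z
    proof -
      have g: "((\<lambda>t. z + t *\<^sub>R e) has_derivative (\<lambda>d. d *\<^sub>R e)) (at t within ?U)" by (auto intro!: derivative_eq_intros)
      have "((\<lambda>t. G (z + t *\<^sub>R e)) has_derivative (\<lambda>d. G' (z + t *\<^sub>R e) (d *\<^sub>R e))) (at t within ?U)"
        by (rule has_derivative_compose[OF g der])
      then show ?thesis unfolding has_field_derivative_def
        by (rule has_derivative_eq_rhs) (simp add: fun_eq_iff linear_cmul[OF has_derivative_linear[OF der]])
    qed
    show "(\<lambda>z. G (z + t *\<^sub>R e)) integrable_on cbox a b" for t
      by (intro integrable_continuous continuous_on_compose2[OF cG[of UNIV]]) (auto intro!: continuous_intros)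
    show "continuous_on (?U \<times> cbox a b) (\<lambda>(t, z). G' (z + t *\<^sub>R e) e)"
      unfolding case_prod_unfold
      by (rule continuous_on_compose2[OF cont]) (auto intro!: continuous_intros)
  qed auto
  moreover have "((\<lambda>t. integral (cbox a b) (\<lambda>z. G (z + t *\<^sub>R e))) has_field_derivative 0) (at 0 within ?U)"
    by (rule has_field_derivative_transform_within[of "\<lambda>_. LINT z|lborel. G z" _ _ _ 1])
       (auto simp: I intro!: derivative_eq_intros)
  ultimately show ?thesis
  proof -
    have "at 0 within ?U = at 0" by (rule at_within_open) auto
    moreover assume "((\<lambda>t. integral (cbox a b) (\<lambda>z. G (z + t *\<^sub>R e))) has_field_derivative integral (cbox a b) (\<lambda>z. G' (z + 0 *\<^sub>R e) e)) (at 0 within ?U)"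
      "((\<lambda>t. integral (cbox a b) (\<lambda>z. G (z + t *\<^sub>R e))) has_field_derivative 0) (at 0 within ?U)"
    ultimately have "integral (cbox a b) (\<lambda>z. G' (z + 0 *\<^sub>R e) e) = 0"
      using DERIV_unique by metis
    then show ?thesis by simp
  qed
qed

text \<open>
  The positive part itself has a corner at the origin; the cube is smooth enough for the potential
  below to be continuously differentiable.
\<close>

lemma has_derivative_pos_part_cube:
  "((\<lambda>y::real. (max 0 y) ^ 3) has_real_derivative 3 * (max 0 y)\<^sup>2) (at y)"
proof -
  consider "y > 0" | "y < 0" | "y = 0" by linarith
  then show ?thesis
  proof cases
    case 1
    have "((\<lambda>y. y ^ 3) has_real_derivative 3 * (max 0 y)\<^sup>2) (at y)" using 1 by (auto intro!: derivative_eq_intros)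
    then show ?thesis
      by (rule DERIV_cong_ev[THEN iffD1, rotated -1])
         (use 1 in \<open>auto intro!: eventually_mono[OF eventually_nhds_in_open[of "{0<..}"]]\<close>)
  next
    case 2
    have "((\<lambda>y. 0) has_real_derivative 3 * (max 0 y)\<^sup>2) (at y)" using 2 by simp
    then show ?thesis
      by (rule DERIV_cong_ev[THEN iffD1, rotated -1])
         (use 2 in \<open>auto intro!: eventually_mono[OF eventually_nhds_in_open[of "{..<0}"]]\<close>)
  next
    case 3
    have "((\<lambda>h::real. (max 0 h) ^ 3 / h) \<longlongrightarrow> 0) (at 0)"
    proof (rule Lim_null_comparison)
      show "\<forall>\<^sub>F h::real in at 0. norm ((max 0 h) ^ 3 / h) \<le> h\<^sup>2"
        by (rule always_eventually) (auto simp: max_def power3_eq_cube power2_eq_square)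
      show "((\<lambda>h::real. h\<^sup>2) \<longlongrightarrow> 0) (at 0)" by (auto intro!: tendsto_eq_intros)
    qed
    then show ?thesis unfolding 3 by (simp add: DERIV_def)
  qed
qed

text \<open>
  A weight with compact support for which the next function is an explicit potential:
  the gradient of \<open>bump_potential r\<close> at \<open>z\<close> is $-6\,\mathrm{bump}_r(z)\,z$.  Averages with respect to
  this weight replace averages over balls and avoid boundary terms.
\<close>

definition bump :: "real \<Rightarrow> 'a::euclidean_space \<Rightarrow> real" where
  "bump r z = (max 0 (r\<^sup>2 - z \<bullet> z))\<^sup>2"

definition bump_potential :: "real \<Rightarrow> 'a::euclidean_space \<Rightarrow> real" where
  "bump_potential r z = (max 0 (r\<^sup>2 - z \<bullet> z)) ^ 3"

lemma bump_outside:
  assumes "r \<ge> 0" "r \<le> norm z"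
  shows "bump r z = 0" "bump_potential r z = 0"
proof -
  have "r\<^sup>2 \<le> z \<bullet> z" using assms by (simp add: dot_square_norm power_mono)
  then have "max 0 (r\<^sup>2 - z \<bullet> z) = 0" by simp
  then show "bump r z = 0" "bump_potential r z = 0" by (simp_all only: bump_def bump_potential_def) simp_all
qed

lemma continuous_on_bump: "continuous_on S (bump r)" "continuous_on S (bump_potential r)"
  unfolding bump_def bump_potential_def by (intro continuous_intros)+

lemma bump_potential_has_derivative:
  "(bump_potential r has_derivative (\<lambda>h. - 6 * (z \<bullet> h) * bump r z)) (at z)"
proof -
  have g: "((\<lambda>z. r\<^sup>2 - z \<bullet> z) has_derivative (\<lambda>h. - 2 * (z \<bullet> h))) (at z)"
    by (auto intro!: derivative_eq_intros simp: inner_commute)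
  have "((\<lambda>z. (max 0 (r\<^sup>2 - z \<bullet> z)) ^ 3) has_derivative (\<lambda>h. 3 * (max 0 (r\<^sup>2 - z \<bullet> z))\<^sup>2 * (- 2 * (z \<bullet> h)))) (at z)"
    by (rule has_derivative_compose[OF g has_derivative_pos_part_cube[unfolded has_field_derivative_def]])
  then show ?thesis
    unfolding bump_potential_def bump_def by (rule has_derivative_eq_rhs) (simp add: fun_eq_iff)
qed

text \<open>
  Continuity of functions that are cut off outside a ball, where they have already reached a
  constant value at the boundary.
\<close>

lemma continuous_on_norm_cases:
  fixes f :: "'a::topological_space \<Rightarrow> 'b::topological_space" and g :: "'a \<Rightarrow> real"
  assumes g: "continuous_on S g" and f: "continuous_on {x \<in> S. g x \<le> r} f" and c: "\<And>x. x \<in> S \<Longrightarrow> r \<le> g x \<Longrightarrow> f x = k"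
  shows "continuous_on S f"
proof -
  have "continuous_on ({x \<in> S. g x \<le> r} \<union> {x \<in> S. r \<le> g x}) f"
  proof (rule continuous_on_Un_local)
    have "{x \<in> S. g x \<le> r} \<union> {x \<in> S. r \<le> g x} = S" by auto
    then show "closedin (top_of_set ({x \<in> S. g x \<le> r} \<union> {x \<in> S. r \<le> g x})) {x \<in> S. g x \<le> r}"
      "closedin (top_of_set ({x \<in> S. g x \<le> r} \<union> {x \<in> S. r \<le> g x})) {x \<in> S. r \<le> g x}"
      using continuous_closedin_preimage[OF g, of "{..r}"] continuous_closedin_preimage[OF g, of "{r..}"]
      by (simp_all add: Int_def vimage_def)
    show "continuous_on {x \<in> S. r \<le> g x} f"
      by (rule continuous_on_eq[OF continuous_on_const[of _ k]]) (simp add: c)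
  qed (rule f)
  moreover have "{x \<in> S. g x \<le> r} \<union> {x \<in> S. r \<le> g x} = S" by auto
  ultimately show ?thesis by simp
qed

text \<open>
  Let $I(s)$ be the integral of \<open>F (x0 + s *\<^sub>R z) * bump r z\<close> over \<open>z\<close>.  Its derivative integrates
  the radial derivative of \<open>F\<close> against the weight.  As the weight times \<open>z\<close> is a gradient and
  \<open>F\<close> is harmonic, the integrand is a divergence of a compactly supported field (\<open>H0\<close> below).
  Hence $I(0) = I(1)$.
\<close>

lemma mean_value_harmonic:
  fixes F :: "'a::euclidean_space \<Rightarrow> real"
  assumes U: "open U" "cball x0 r \<subseteq> U" and r: "r > 0" and Q: "ball 0 (r + 1) \<subseteq> cbox a b"
    and F1: "\<And>y. y \<in> U \<Longrightarrow> (F has_derivative F1 y) (at y)"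
    and F2: "\<And>y e. y \<in> U \<Longrightarrow> ((\<lambda>z. F1 z e) has_derivative F2 y e) (at y)"
    and cont: "\<And>e h. continuous_on U (\<lambda>y. F2 y e h)"
    and harmonic: "\<And>y. y \<in> U \<Longrightarrow> (\<Sum>e\<in>Basis. F2 y e e) = 0"
  shows "F x0 * integral (cbox a b) (bump r) = integral (cbox a b) (\<lambda>z. F (x0 + z) * bump r z)"
proof -
  have inU: "x0 + s *\<^sub>R z \<in> U" if "norm z \<le> r" "0 \<le> s" "s \<le> 1" for s z
  proof -
    have "norm (s *\<^sub>R z) \<le> r" using that mult_mono[of s 1 "norm z" r] by simp
    then have "x0 + s *\<^sub>R z \<in> cball x0 r" by (simp add: dist_norm)
    then show ?thesis using U(2) by blast
  qed
  have cF1: "continuous_on U (\<lambda>y. F1 y e)" for e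
    by (rule continuous_at_imp_continuous_on, rule ballI, rule has_derivative_continuous[OF F2])
  have cF: "continuous_on U F"
    by (rule continuous_at_imp_continuous_on, rule ballI, rule has_derivative_continuous[OF F1])
  have lin: "linear (F1 y)" if "y \<in> U" for y using F1[OF that] has_derivative_linear by blast
  define f where "f s z = F (x0 + s *\<^sub>R z) * bump r z" for s z
  define fx where "fx s z = F1 (x0 + s *\<^sub>R z) z * bump r z" for s z
  have rep: "F1 y z = (\<Sum>e\<in>Basis. (z \<bullet> e) * F1 y e)" if "y \<in> U" for y z
  proof -
    have "F1 y z = F1 y (\<Sum>e\<in>Basis. (z \<bullet> e) *\<^sub>R e)" by (simp only: euclidean_representation)
    then show ?thesis by (simp add: linear_sum[OF lin[OF that]] linear_cmul[OF lin[OF that]])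
  qed
  \<comment> \<open>The derivative of the weighted mean is the integral of a divergence.\<close>
  have H0: "integral (cbox a b) (fx s) = 0" if s: "0 \<le> s" "s \<le> 1" for s
  proof -
    define G where "G e z = F1 (x0 + s *\<^sub>R z) e * bump_potential r z" for e z
    define G' where "G' e z h = (if norm z \<le> r then s * F2 (x0 + s *\<^sub>R z) e h * bump_potential r z
        + F1 (x0 + s *\<^sub>R z) e * (- 6 * (z \<bullet> h) * bump r z) else 0)" for e z h
    have dG: "(G e has_derivative G' e z) (at z)" for e z
    proof (cases "norm z \<le> r")
      case True
      have u: "x0 + s *\<^sub>R z \<in> U" using inU[OF True s] .
      have g: "((\<lambda>z. x0 + s *\<^sub>R z) has_derivative (\<lambda>h. s *\<^sub>R h)) (at z)" by (auto intro!: derivative_eq_intros)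
      have "(G e has_derivative (\<lambda>h. F1 (x0 + s *\<^sub>R z) e * (- 6 * (z \<bullet> h) * bump r z) + F2 (x0 + s *\<^sub>R z) e (s *\<^sub>R h) * bump_potential r z)) (at z)"
        unfolding G_def by (rule has_derivative_mult[OF has_derivative_compose[OF g F2[OF u]] bump_potential_has_derivative])
      then show ?thesis
        by (rule has_derivative_eq_rhs) (use True linear_cmul[OF has_derivative_linear[OF F2[OF u]]] in \<open>simp add: G'_def fun_eq_iff\<close>)
    next
      case False
      have "((\<lambda>z. 0) has_derivative (\<lambda>h. 0 :: real)) (at z)" by simp
      then have "(G e has_derivative (\<lambda>h. 0)) (at z)"
      proof (rule has_derivative_transform_within_open)
        show "open (- cball (0::'a) r)" by auto
        show "z \<in> - cball 0 r" using False by simp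
        show "0 = G e y" if "y \<in> - cball 0 r" for y
          using bump_outside(2)[of r y] that r by (simp add: G_def)
      qed
      moreover have "G' e z = (\<lambda>h. 0)" using False by (simp add: G'_def fun_eq_iff)
      ultimately show ?thesis by simp
    qed
    have cG': "continuous_on UNIV (\<lambda>z. G' e z h)" for e h
    proof (rule continuous_on_norm_cases[where g=norm and r=r and k=0])
      have c1: "continuous_on {z. norm z \<le> r} (\<lambda>z. F2 (x0 + s *\<^sub>R z) e h)"
        by (rule continuous_on_compose2[OF cont]) (use inU[OF _ s] in \<open>auto intro!: continuous_intros\<close>)
      have c2: "continuous_on {z. norm z \<le> r} (\<lambda>z. F1 (x0 + s *\<^sub>R z) e)"
        by (rule continuous_on_compose2[OF cF1]) (use inU[OF _ s] in \<open>auto intro!: continuous_intros\<close>)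
      have "continuous_on {z. norm z \<le> r} (\<lambda>z. s * F2 (x0 + s *\<^sub>R z) e h * bump_potential r z
        + F1 (x0 + s *\<^sub>R z) e * (- 6 * (z \<bullet> h) * bump r z))"
        by (intro continuous_intros c1 c2 continuous_on_bump)
      then have "continuous_on {z. norm z \<le> r} (\<lambda>z. G' e z h)"
        by (rule continuous_on_eq) (simp add: G'_def)
      then show "continuous_on {z \<in> UNIV. norm z \<le> r} (\<lambda>z. G' e z h)" by simp
      show "G' e z h = 0" if "r \<le> norm z" for z
        using bump_outside[of r z] r that by (simp add: G'_def)
    qed (auto intro!: continuous_intros)
    have z: "integral (cbox a b) (\<lambda>z. G' e z e) = 0" if "e \<in> Basis" for e
    proof (rule integral_directional_derivative_eq_0[where G="G e" and G'="G' e" and e=e and r=r])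
      show "(G e has_derivative G' e z) (at z)" for z by (rule dG)
      show "continuous_on UNIV (\<lambda>z. G' e z e)" by (rule cG')
      show "G e z = 0" if "r \<le> norm z" for z using bump_outside(2)[of r z] r that by (simp add: G_def)
      show "ball 0 (r + norm e) \<subseteq> cbox a b" using Q that by simp
    qed
    have "fx s z = - (1/6) * (\<Sum>e\<in>Basis. G' e z e)" for z
    proof (cases "norm z \<le> r")
      case True
      have u: "x0 + s *\<^sub>R z \<in> U" using inU[OF True s] .
      have g: "G' e z e = s * bump_potential r z * F2 (x0 + s *\<^sub>R z) e e - 6 * bump r z * ((z \<bullet> e) * F1 (x0 + s *\<^sub>R z) e)" for e
        using True by (simp add: G'_def)
      have "(\<Sum>e\<in>Basis. G' e z e) = s * bump_potential r z * (\<Sum>e\<in>Basis. F2 (x0 + s *\<^sub>R z) e e)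
        - 6 * bump r z * (\<Sum>e\<in>Basis. (z \<bullet> e) * F1 (x0 + s *\<^sub>R z) e)"
        unfolding g sum_subtractf sum_distrib_left ..
      then have "(\<Sum>e\<in>Basis. G' e z e) = - 6 * bump r z * F1 (x0 + s *\<^sub>R z) z"
        using harmonic[OF u] rep[OF u, of z] by simp
      then show ?thesis by (simp add: fx_def)
    next
      case False
      then show ?thesis using bump_outside(1)[of r z] r by (simp add: fx_def G'_def)
    qed
    then have "fx s = (\<lambda>z. - (1/6) * (\<Sum>e\<in>Basis. G' e z e))" by (rule ext)
    then have "integral (cbox a b) (fx s) = integral (cbox a b) (\<lambda>z. - (1/6) * (\<Sum>e\<in>Basis. G' e z e))"
      by (rule arg_cong)
    also have "\<dots> = - (1/6) * integral (cbox a b) (\<lambda>z. \<Sum>e\<in>Basis. G' e z e)"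
      by (rule integral_mult_right)
    also have "integral (cbox a b) (\<lambda>z. \<Sum>e\<in>Basis. G' e z e) = (\<Sum>e\<in>Basis. integral (cbox a b) (\<lambda>z. G' e z e))"
      by (rule integral_sum) (simp, rule integrable_continuous[OF continuous_on_subset[OF cG' subset_UNIV]])
    finally show ?thesis by (simp add: z)
  qed
  let ?U = "{0..1::real}"
  have cfx: "continuous_on (?U \<times> cbox a b) (\<lambda>(s, z). fx s z)"
  proof (rule continuous_on_norm_cases[where g="\<lambda>p. norm (snd p)" and r=r and k=0])
    let ?S = "{p \<in> ?U \<times> cbox a b. norm (snd p) \<le> r}"
    have c1: "continuous_on ?S (\<lambda>p. F1 (x0 + fst p *\<^sub>R snd p) e)" for e
      by (rule continuous_on_compose2[OF cF1]) (use inU in \<open>auto intro!: continuous_intros\<close>)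
    have "continuous_on ?S (\<lambda>p. (\<Sum>e\<in>Basis. (snd p \<bullet> e) * F1 (x0 + fst p *\<^sub>R snd p) e) * bump r (snd p))"
      by (intro continuous_intros c1 continuous_on_compose2[OF continuous_on_bump(1)[of UNIV]]) auto
    then show "continuous_on ?S (\<lambda>(s, z). fx s z)"
      by (rule continuous_on_eq) (use inU in \<open>auto simp: fx_def rep\<close>)
    show "(case p of (s, z) \<Rightarrow> fx s z) = 0" if "r \<le> norm (snd p)" for p
      using bump_outside(1)[of r "snd p"] r that by (auto simp: fx_def split_beta)
  qed (auto intro!: continuous_intros)
  have cf: "continuous_on (cbox a b) (f s)" if s: "s \<in> ?U" for s
  proof (rule continuous_on_norm_cases[where g=norm and r=r and k=0])
    have "continuous_on {z \<in> cbox a b. norm z \<le> r} (\<lambda>z. F (x0 + s *\<^sub>R z))"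
      by (rule continuous_on_compose2[OF cF]) (use inU s in \<open>auto intro!: continuous_intros\<close>)
    then show "continuous_on {z \<in> cbox a b. norm z \<le> r} (f s)"
      unfolding f_def by (intro continuous_intros continuous_on_bump)
    show "f s z = 0" if "r \<le> norm z" for z using bump_outside(1)[of r z] r that by (simp add: f_def)
  qed (auto intro!: continuous_intros)
  have "((\<lambda>s. integral (cbox a b) (f s)) has_field_derivative 0) (at s within ?U)" if s: "s \<in> ?U" for s
  proof -
    have "((\<lambda>s. integral (cbox a b) (f s)) has_field_derivative integral (cbox a b) (fx s)) (at s within ?U)"
    proof (rule leibniz_rule_field_derivative[OF _ _ cfx s])
      show "((\<lambda>s. f s z) has_field_derivative fx s z) (at s within ?U)" if s: "s \<in> ?U" for s z
      proof (cases "norm z \<le> r")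
        case True
        have u: "x0 + s *\<^sub>R z \<in> U" using inU[OF True] s by simp
        have g: "((\<lambda>s. x0 + s *\<^sub>R z) has_derivative (\<lambda>d. d *\<^sub>R z)) (at s within ?U)" by (auto intro!: derivative_eq_intros)
        have "((\<lambda>s. f s z) has_derivative (\<lambda>d. F1 (x0 + s *\<^sub>R z) (d *\<^sub>R z) * bump r z)) (at s within ?U)"
          unfolding f_def by (rule has_derivative_mult_left[OF has_derivative_compose[OF g F1[OF u]]])
        then show ?thesis unfolding has_field_derivative_def
          by (rule has_derivative_eq_rhs) (simp add: fun_eq_iff fx_def linear_cmul[OF lin[OF u]])
      next
        case False
        then show ?thesis using bump_outside(1)[of r z] r by (simp add: f_def fx_def)
      qed
      show "f s integrable_on cbox a b" if "s \<in> ?U" for s by (rule integrable_continuous[OF cf[OF that]])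
    qed simp
    then show ?thesis using H0[of s] s by simp
  qed
  then obtain c where c: "\<And>s. s \<in> ?U \<Longrightarrow> integral (cbox a b) (f s) = c"
    using has_field_derivative_zero_constant[of ?U "\<lambda>s. integral (cbox a b) (f s)"] by auto
  have "integral (cbox a b) (f 0) = integral (cbox a b) (f 1)" using c[of 0] c[of 1] by simp
  moreover have "f 0 = (\<lambda>z. F x0 * bump r z)" "f 1 = (\<lambda>z. F (x0 + z) * bump r z)" by (simp_all add: f_def fun_eq_iff)
  ultimately show ?thesis by simp
qed

lemma powr_norm_has_derivative:
  fixes y :: "'a::euclidean_space"
  assumes "y \<noteq> 0"
  shows "((\<lambda>y. (y \<bullet> y) powr \<alpha>) has_derivative (\<lambda>h. 2 * \<alpha> * (y \<bullet> h) * (y \<bullet> y) powr (\<alpha> - 1))) (at y)"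
proof -
  have g: "((\<lambda>z. z \<bullet> z) has_derivative (\<lambda>h. 2 * (y \<bullet> h))) (at y)"
    by (auto intro!: derivative_eq_intros simp: inner_commute)
  have p: "((\<lambda>t. t powr \<alpha>) has_real_derivative \<alpha> * (y \<bullet> y) powr (\<alpha> - 1)) (at (y \<bullet> y))"
    by (rule has_real_derivative_powr) (use assms in simp)
  have "((\<lambda>y. (y \<bullet> y) powr \<alpha>) has_derivative (\<lambda>h. \<alpha> * (y \<bullet> y) powr (\<alpha> - 1) * (2 * (y \<bullet> h)))) (at y)"
    by (rule has_derivative_compose[OF g p[unfolded has_field_derivative_def]])
  then show ?thesis by (rule has_derivative_eq_rhs) (simp add: fun_eq_iff mult_ac)
qed

text \<open>
  The Hessian of the function \<open>\<lambda>y. (y \<bullet> y) powr \<alpha>\<close>.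
\<close>

definition powr_norm2 where
  "powr_norm2 \<alpha> y e h = 2 * \<alpha> * (e \<bullet> h) * (y \<bullet> y) powr (\<alpha> - 1) + 4 * \<alpha> * (\<alpha> - 1) * (y \<bullet> e) * (y \<bullet> h) * (y \<bullet> y) powr (\<alpha> - 2)"

lemma powr_norm_has_derivative2:
  fixes y :: "'a::euclidean_space"
  assumes "y \<noteq> 0"
  shows "((\<lambda>y. 2 * \<alpha> * (y \<bullet> e) * (y \<bullet> y) powr (\<alpha> - 1)) has_derivative powr_norm2 \<alpha> y e) (at y)"
proof -
  have g: "((\<lambda>y. 2 * \<alpha> * (y \<bullet> e)) has_derivative (\<lambda>h. 2 * \<alpha> * (h \<bullet> e))) (at y)"
    by (auto intro!: derivative_eq_intros)
  have "((\<lambda>y. 2 * \<alpha> * (y \<bullet> e) * (y \<bullet> y) powr (\<alpha> - 1)) has_derivative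
     (\<lambda>h. 2 * \<alpha> * (y \<bullet> e) * (2 * (\<alpha> - 1) * (y \<bullet> h) * (y \<bullet> y) powr (\<alpha> - 1 - 1)) + 2 * \<alpha> * (h \<bullet> e) * (y \<bullet> y) powr (\<alpha> - 1))) (at y)"
    by (rule has_derivative_mult[OF g powr_norm_has_derivative[OF assms]])
  then show ?thesis
    by (rule has_derivative_eq_rhs) (simp add: fun_eq_iff powr_norm2_def inner_commute algebra_simps)
qed

lemma laplacian_powr_norm:
  fixes y :: "'a::euclidean_space" and \<alpha> :: real
  assumes "y \<noteq> 0"
  shows "(\<Sum>e\<in>Basis. powr_norm2 \<alpha> y e e) = 2 * \<alpha> * (DIM('a) + 2 * (\<alpha> - 1)) * (y \<bullet> y) powr (\<alpha> - 1)"
proof -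
  have y: "y \<bullet> y > 0" using assms by simp
  have "(\<Sum>e\<in>Basis. powr_norm2 \<alpha> y e e) = 2 * \<alpha> * (y \<bullet> y) powr (\<alpha> - 1) * (\<Sum>e\<in>(Basis::'a set). e \<bullet> e)
      + 4 * \<alpha> * (\<alpha> - 1) * (y \<bullet> y) powr (\<alpha> - 2) * (\<Sum>e\<in>Basis. (y \<bullet> e) * (y \<bullet> e))"
    unfolding powr_norm2_def sum.distrib sum_distrib_left by (intro arg_cong2[where f="(+)"] sum.cong refl) (simp_all add: mult_ac)
  also have "(\<Sum>e\<in>(Basis::'a set). e \<bullet> e) = DIM('a)" by (simp add: inner_Basis)
  also have "(\<Sum>e\<in>Basis. (y \<bullet> e) * (y \<bullet> e)) = y \<bullet> y" by (rule euclidean_inner[symmetric])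
  also have "(y \<bullet> y) powr (\<alpha> - 2) = (y \<bullet> y) powr (\<alpha> - 1) / (y \<bullet> y)"
    using powr_diff[of "y \<bullet> y" "\<alpha> - 1" 1] y by simp
  finally show ?thesis using y by (simp add: algebra_simps)
qed

lemma eigenspace_laplacian:
  assumes f: "f \<in> laplace_eigenspace l" and y: "y \<noteq> 0"
  shows "(\<Sum>e\<in>Basis. d2 f y e e) = - l * radial_ext f y / (y \<bullet> y)"
proof -
  have s: "smooth_on_S2 f" using f by (simp add: laplace_eigenspace_iff)
  have n: "norm (sgn y) = 1" and y': "y = norm y *\<^sub>R sgn y" "sgn y \<noteq> 0" using y by (simp_all add: norm_sgn sgn_div_norm)
  have "(\<Sum>e\<in>Basis. d2 f y e e) = (\<Sum>e\<in>Basis. d2 f (sgn y) e e) / (norm y)\<^sup>2"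
    using d2_scale[OF s y'(2), of "norm y"] y y'(1) by (simp add: sum_divide_distrib)
  then show ?thesis using f n by (simp add: laplace_eigenspace_iff radial_ext_def dot_square_norm)
qed

text \<open>
  The function $F(y) = |y|^n f(y/|y|)$ is harmonic away from the origin, as
  $\Delta |y|^n = n(n+1)|y|^{n-2}$ and the radial derivative of the second factor vanishes.  The mean
  value property on the ball of radius $1/4$ around $p/2$, which lies in the punctured unit ball,
  bounds $f(p)$ by the integral of $|f|$ and thus by that of $1 + f^2$.
\<close>

lemma eigenspace_sup_bound:
  obtains C where "C \<ge> 0" "\<And>f p. f \<in> laplace_eigenspace (real n * (real n + 1)) \<Longrightarrow> norm p = 1 \<Longrightarrow> inner_S2 f f \<le> 1 \<Longrightarrow> \<bar>f p\<bar> \<le> C"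
proof -
  define r :: real where "r = 1 / 4"
  define a b :: "real^3" where "a = (\<Sum>e\<in>Basis. (- 2) *\<^sub>R e)" and "b = (\<Sum>e\<in>Basis. 2 *\<^sub>R e)"
  have ab: "a \<bullet> e = - 2" "b \<bullet> e = 2" if "e \<in> Basis" for e
    using that by (simp_all add: a_def b_def inner_sum_left inner_Basis if_distrib sum.delta cong: if_cong)
  have Q: "ball 0 (r + 1) \<subseteq> cbox a b"
  proof
    fix z :: "real^3" assume "z \<in> ball 0 (r + 1)"
    then have nz: "norm z < 2" by (simp add: r_def)
    have "\<bar>z \<bullet> e\<bar> < 2" if "e \<in> Basis" for e using Basis_le_norm[OF that, of z] nz by linarith
    then show "z \<in> cbox a b" by (force simp: mem_box ab)
  qed
  define \<kappa> where "\<kappa> = integral (cbox a b) (bump r)"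
  have r0: "r > 0" by (simp add: r_def)
  have bn: "0 \<le> bump r z" "bump r z \<le> 1" for z :: "real^3"
  proof -
    show "0 \<le> bump r z" by (simp add: bump_def)
    have "z \<bullet> z \<ge> 0" by simp
    moreover have "r\<^sup>2 \<le> 1" by (simp add: r_def power2_eq_square)
    ultimately have "max 0 (r\<^sup>2 - z \<bullet> z) \<le> 1" by linarith
    then have "(max 0 (r\<^sup>2 - z \<bullet> z))\<^sup>2 \<le> 1\<^sup>2" by (intro power_mono) auto
    then show "bump r z \<le> 1" by (simp add: bump_def)
  qed
  have bi: "bump r integrable_on cbox a b" by (rule integrable_continuous[OF continuous_on_bump(1)])
  have \<kappa>0: "\<kappa> > 0"
  proof -
    have "\<kappa> \<ge> 0" unfolding \<kappa>_def by (rule integral_nonneg[OF bi]) (rule bn)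
    moreover have "\<kappa> \<noteq> 0"
    proof
      assume "\<kappa> = 0"
      then have hi: "(bump r has_integral 0) (cbox a b)" using bi by (simp add: \<kappa>_def has_integral_iff)
      have "bump r (0 :: real^3) = 0"
        by (rule has_integral_0_cbox_imp_0[OF continuous_on_bump(1) _ hi]) (auto simp: bn mem_box ab box_ne_empty)
      then show False using r0 by (simp add: bump_def)
    qed
    ultimately show ?thesis by simp
  qed
  define A where "A = solid_integral (\<lambda>x. 1)"
  have c1: "cont_S2 (\<lambda>x. 1)" by (simp add: cont_S2_def radial_ext_def)
  have A0: "A \<ge> 0" unfolding A_def solid_integral_def radial_ext_def by (intro Bochner_Integration.integral_nonneg) simp
  define C where "C = 2 ^ n * ((A + 1) / 2) / \<kappa>"
  have "\<bar>f p\<bar> \<le> C" if f: "f \<in> laplace_eigenspace (real n * (real n + 1))" and p: "norm p = 1" and f1: "inner_S2 f f \<le> 1" for f p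
  proof -
    let ?u = "radial_ext f"
    define \<alpha> where "\<alpha> = real n / 2"
    define F where "F y = (y \<bullet> y) powr \<alpha> * ?u y" for y
    define p1 where "p1 y h = 2 * \<alpha> * (y \<bullet> h) * (y \<bullet> y) powr (\<alpha> - 1)" for y h :: "real^3"
    define F1 where "F1 y h = (y \<bullet> y) powr \<alpha> * d1 f y h + p1 y h * ?u y" for y h
    define F2 where "F2 y e h = ((y \<bullet> y) powr \<alpha> * d2 f y e h + p1 y h * d1 f y e) + (p1 y e * d1 f y h + powr_norm2 \<alpha> y e h * ?u y)" for y e h
    have s: "smooth_on_S2 f" using f by (simp add: laplace_eigenspace_iff)
    define U where "U = (- {0} :: (real^3) set)"
    define x0 where "x0 = (1/2) *\<^sub>R p"
    have x0: "x0 \<noteq> 0" "norm x0 = 1/2" using p by (auto simp: x0_def)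
    have U: "open U" "cball x0 r \<subseteq> U"
    proof -
      show "open U" by (simp add: U_def open_Compl)
      show "cball x0 r \<subseteq> U" using x0(2) by (auto simp: U_def r_def)
    qed
    have dF1: "(F has_derivative F1 y) (at y)" if "y \<in> U" for y
      unfolding F_def F1_def p1_def
      by (rule has_derivative_mult[OF powr_norm_has_derivative has_d1[OF s]]) (use that U_def in auto)
    have dF2: "((\<lambda>z. F1 z e) has_derivative F2 y e) (at y)" if "y \<in> U" for y e
      unfolding F1_def F2_def p1_def
      by (rule has_derivative_add[OF has_derivative_mult[OF powr_norm_has_derivative has_d2[OF s]]
            has_derivative_mult[OF powr_norm_has_derivative2 has_d1[OF s]]]) (use that U_def in auto)
    have cF2: "continuous_on U (\<lambda>y. F2 y e h)" for e h
      unfolding F2_def p1_def powr_norm2_def U_def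
      by (intro continuous_on_add continuous_on_mult continuous_on_const continuous_on_inner continuous_on_id continuous_on_powr
          continuous_d2[OF s] continuous_d1[OF s] continuous_radial_ext[OF s]) auto
    \<comment> \<open>The terms are $|y|^n\Delta u$, a multiple of the radial derivative of $u$, and $u\,\Delta|y|^n$.\<close>
    have harm: "(\<Sum>e\<in>Basis. F2 y e e) = 0" if "y \<in> U" for y
    proof -
      have y: "y \<noteq> 0" "y \<bullet> y > 0" using that by (auto simp: U_def)
      have "(\<Sum>e\<in>Basis. F2 y e e) = (y \<bullet> y) powr \<alpha> * (\<Sum>e\<in>Basis. d2 f y e e) + 2 * (\<Sum>e\<in>Basis. p1 y e * d1 f y e)
          + (\<Sum>e\<in>Basis. powr_norm2 \<alpha> y e e) * ?u y"
        unfolding F2_def sum.distrib by (simp add: sum_distrib_left[symmetric] sum_distrib_right[symmetric] mult.commute[of "d1 f y _"])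
      also have "(\<Sum>e\<in>Basis. p1 y e * d1 f y e) = 2 * \<alpha> * (y \<bullet> y) powr (\<alpha> - 1) * d1 f y y"
      proof -
        have "d1 f y y = d1 f y (\<Sum>e\<in>Basis. (y \<bullet> e) *\<^sub>R e)" by (simp only: euclidean_representation)
        also have "\<dots> = (\<Sum>e\<in>Basis. (y \<bullet> e) * d1 f y e)"
          by (simp add: linear_sum[OF linear_d1[OF s y(1)]] linear_cmul[OF linear_d1[OF s y(1)]])
        finally show ?thesis unfolding p1_def by (simp add: sum_distrib_left mult_ac)
      qed
      also have "d1 f y y = 0" by (rule d1_radial[OF s y(1)])
      also have "(y \<bullet> y) powr \<alpha> = (y \<bullet> y) powr (\<alpha> - 1) * (y \<bullet> y)"
        using powr_add[of "y \<bullet> y" "\<alpha> - 1" 1] y by simp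
      finally show ?thesis
        unfolding eigenspace_laplacian[OF f y(1)] laplacian_powr_norm[OF y(1)] using y(2)
        by (simp add: \<alpha>_def)
    qed
    have mv: "F x0 * \<kappa> = integral (cbox a b) (\<lambda>z. F (x0 + z) * bump r z)"
      unfolding \<kappa>_def by (rule mean_value_harmonic[OF U r0 Q dF1 dF2 cF2 harm])
    let ?g = "\<lambda>z. F (x0 + z) * bump r z"
    have zU: "x0 + z \<in> cball 0 1 - {0}" if "norm z < r" for z
    proof -
      have "norm (x0 + z) \<le> 1" using norm_triangle_ineq[of x0 z] that x0 by (simp add: r_def)
      moreover have "x0 + z \<noteq> 0"
      proof
        assume "x0 + z = 0"
        then have "x0 = - z" by (simp add: add_eq_0_iff)
        then show False using that x0(2) by (simp add: r_def)
      qed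
      ultimately show ?thesis by simp
    qed
    \<comment> \<open>Pointwise $2|u| \le 1 + u^2$, supported in the punctured unit ball.\<close>
    have gb: "\<bar>?g z\<bar> \<le> (1/2) * (indicator (cball 0 1 - {0}) (x0 + z) * 1 + indicator (cball 0 1 - {0}) (x0 + z) * radial_ext (\<lambda>x. f x * f x) (x0 + z))" for z
    proof (cases "norm z < r")
      case True
      let ?y = "x0 + z"
      have y: "norm ?y \<le> 1" "?y \<noteq> 0" using zU[OF True] by auto
      have "?y \<bullet> ?y \<le> 1" using y by (simp add: dot_square_norm power_le_one)
      then have pw: "(?y \<bullet> ?y) powr \<alpha> \<le> 1" using powr_mono2[of \<alpha> "?y \<bullet> ?y" 1] by (simp add: \<alpha>_def)
      have "\<bar>?g z\<bar> = (?y \<bullet> ?y) powr \<alpha> * (\<bar>?u ?y\<bar> * bump r z)" using bn(1)[of z] by (simp add: F_def abs_mult)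
      also have "\<dots> \<le> 1 * (\<bar>?u ?y\<bar> * 1)" using pw bn[of z] by (intro mult_mono) auto
      also have "\<dots> \<le> (1/2) * (1 + ?u ?y * ?u ?y)"
        using zero_le_square[of "\<bar>?u ?y\<bar> - 1"] by (simp add: algebra_simps)
      finally show ?thesis using zU[OF True] by (simp add: radial_ext_def)
    next
      case False
      then have "?g z = 0" using bump_outside(1)[of r z] r0 by simp
      then have "\<bar>?g z\<bar> = 0" by simp
      moreover have "0 \<le> (1/2) * (indicator (cball 0 1 - {0}) (x0 + z) * 1 + indicator (cball 0 1 - {0}) (x0 + z) * radial_ext (\<lambda>x. f x * f x) (x0 + z))"
        by (simp add: radial_ext_def indicator_def)
      ultimately show ?thesis by linarith
    qed
    have cg: "continuous_on (cbox a b) ?g"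
    proof (rule continuous_on_norm_cases[where g=norm and r=r and k=0])
      have cF: "continuous_on U F"
        by (rule continuous_at_imp_continuous_on, rule ballI, rule has_derivative_continuous[OF dF1])
      have "continuous_on {z \<in> cbox a b. norm z \<le> r} (\<lambda>z. F (x0 + z))"
        by (rule continuous_on_compose2[OF cF]) (use U(2) in \<open>auto intro!: continuous_intros simp: subset_iff dist_norm\<close>)
      then show "continuous_on {z \<in> cbox a b. norm z \<le> r} ?g" by (intro continuous_intros continuous_on_bump)
      show "?g z = 0" if "r \<le> norm z" for z using bump_outside(1)[of r z] r0 that by simp
    qed (auto intro!: continuous_intros)
    have gQ: "(\<lambda>z. indicator (cbox a b) z *\<^sub>R ?g z) = ?g"
    proof
      fix z
      show "indicator (cbox a b) z *\<^sub>R ?g z = ?g z"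
      proof (cases "z \<in> cbox a b")
        case False
        then have "r \<le> norm z" using Q by (force simp: subset_iff)
        then show ?thesis using bump_outside(1)[of r z] r0 by simp
      qed simp
    qed
    have gi: "integrable lborel ?g"
      using borel_integrable_compact[OF compact_cbox cg] unfolding gQ .
    have "integral (cbox a b) ?g = (LINT z:cbox a b|lborel. ?g z)"
      by (rule set_borel_integral_eq_integral(2)[symmetric]) (unfold set_integrable_def gQ, rule gi)
    then have Ig: "integral (cbox a b) ?g = (LINT z|lborel. ?g z)" unfolding set_lebesgue_integral_def gQ .
    have tr: "integrable lborel (\<lambda>z. indicator (cball 0 1 - {0}) (x0 + z) * radial_ext h (x0 + z))"
      "(LINT z|lborel. indicator (cball 0 1 - {0}) (x0 + z) * radial_ext h (x0 + z)) = solid_integral h" if h: "cont_S2 h" for h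
    proof -
      let ?k = "\<lambda>y. indicator (cball 0 1 - {0}) y * radial_ext h y"
      have d: "distr lborel borel (\<lambda>z. x0 + z) = lborel" by (rule lborel_distr_plus)
      show "integrable lborel (\<lambda>z. ?k (x0 + z))"
        using integrable_solid[OF h] measurable_solid[OF h] by (subst integrable_distr_eq[symmetric, where N=borel]) (auto simp: d)
      show "(LINT z|lborel. ?k (x0 + z)) = solid_integral h"
        unfolding solid_integral_def using measurable_solid[OF h]
        by (subst integral_distr[symmetric, where N=borel]) (auto simp: d)
    qed
    have tr1: "integrable lborel (\<lambda>z. indicator (cball 0 1 - {0}) (x0 + z) * 1 :: real)"
      "(LINT z|lborel. indicator (cball 0 1 - {0}) (x0 + z) * 1) = A"
      using tr[OF c1] by (simp_all add: radial_ext_def A_def)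
    have cff: "cont_S2 (\<lambda>x. f x * f x)" by (intro cont_S2_mult cont_S2_smooth s)
    have "\<bar>F x0 * \<kappa>\<bar> \<le> (LINT z|lborel. \<bar>?g z\<bar>)" unfolding mv Ig by (rule integral_abs_bound)
    also have "\<dots> \<le> (LINT z|lborel. (1/2) * (indicator (cball 0 1 - {0}) (x0 + z) * 1 + indicator (cball 0 1 - {0}) (x0 + z) * radial_ext (\<lambda>x. f x * f x) (x0 + z)))"
      using tr1(1) tr(1)[OF cff] gi gb by (intro integral_mono) auto
    also have "\<dots> = (1/2) * (A + solid_integral (\<lambda>x. f x * f x))"
      using tr1 tr[OF cff] by simp
    also have "\<dots> \<le> (A + 1) / 2"
      using f1 inner_S2_eq[OF cont_S2_smooth[OF s] cont_S2_smooth[OF s]] inner_S2_nonneg[of f] by simp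
    finally have "\<bar>F x0\<bar> * \<kappa> \<le> (A + 1) / 2" using \<kappa>0 by (simp add: abs_mult)
    moreover have "F x0 = f p / 2 ^ n"
    proof -
      have "x0 \<bullet> x0 = (1/2) powr 2" unfolding dot_square_norm x0(2) by (simp add: powr_numeral)
      then have "(x0 \<bullet> x0) powr \<alpha> = (1/2) powr (2 * \<alpha>)" by (simp only: powr_powr)
      also have "\<dots> = (1/2) ^ n" by (simp add: \<alpha>_def powr_realpow)
      finally show ?thesis using p by (simp add: F_def x0_def radial_ext_scale radial_ext_sphere power_divide)
    qed
    ultimately show ?thesis using \<kappa>0 by (simp add: C_def field_simps abs_divide)
  qed
  moreover have "C \<ge> 0" using A0 \<kappa>0 by (simp add: C_def)
  ultimately show ?thesis using that by blast
qed

section \<open>Orthonormal bases and infinitesimal rotations\<close>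

lemma eigenspace_cont: "f \<in> laplace_eigenspace l \<Longrightarrow> cont_S2 f"
  by (rule cont_S2_smooth) (simp add: laplace_eigenspace_iff)

definition orthonormal_S2 :: "(real^3 \<Rightarrow> real) set \<Rightarrow> bool" where
  "orthonormal_S2 B \<longleftrightarrow> (\<forall>b\<in>B. \<forall>b'\<in>B. inner_S2 b b' = (if b = b' then 1 else 0))"

lemma orthonormal_coefficient:
  assumes B: "finite B" "orthonormal_S2 B" "\<And>b. b \<in> B \<Longrightarrow> cont_S2 b" and b: "b \<in> B"
  shows "inner_S2 (\<lambda>x. \<Sum>b\<in>B. c b * b x) b = c b"
proof -
  have "inner_S2 (\<lambda>x. \<Sum>b\<in>B. c b * b x) b = (\<Sum>b'\<in>B. c b' * inner_S2 b' b)"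
    by (rule inner_S2_sum_left(2)[OF B(1) B(3) B(3)[OF b]])
  also have "\<dots> = (\<Sum>b'\<in>B. if b' = b then c b else 0)"
    using B(2) b by (intro sum.cong) (auto simp: orthonormal_S2_def)
  finally show ?thesis using B(1) b by simp
qed

text \<open>
  Bessel's argument: at each point \<open>p\<close> the combination of the basis functions with coefficients
  proportional to their values at \<open>p\<close> has norm \<open>1\<close> and value $\sqrt{\sum_b b(p)^2}$, so that
  $\sum_b b(p)^2 \le C^2$.  Integrating over the sphere gives the number of functions on the left.
\<close>

lemma orthonormal_eigenfunctions_bounded:
  obtains N :: nat where "\<And>B. finite B \<Longrightarrow> B \<subseteq> laplace_eigenspace (real n * (real n + 1)) \<Longrightarrow> orthonormal_S2 B \<Longrightarrow> card B \<le> N"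
proof -
  let ?V = "laplace_eigenspace (real n * (real n + 1))"
  obtain C where C: "C \<ge> 0" "\<And>f p. f \<in> ?V \<Longrightarrow> norm p = 1 \<Longrightarrow> inner_S2 f f \<le> 1 \<Longrightarrow> \<bar>f p\<bar> \<le> C"
    using eigenspace_sup_bound[of n] by metis
  have c1: "cont_S2 (\<lambda>x. 1)" by (simp add: cont_S2_def radial_ext_def)
  have bound: "real (card B) \<le> 3 * C\<^sup>2 * solid_integral (\<lambda>x. 1)"
    if B: "finite B" "B \<subseteq> ?V" "orthonormal_S2 B" for B
  proof -
    have cB: "cont_S2 b" if "b \<in> B" for b using that B(2) eigenspace_cont by blast
    have S: "(\<Sum>b\<in>B. b p * b p) \<le> C\<^sup>2" if p: "norm p = 1" for p
    proof (cases "(\<Sum>b\<in>B. b p * b p) = 0")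
      case False
      define S where "S = (\<Sum>b\<in>B. b p * b p)"
      have S0: "S > 0" using False sum_nonneg[of B "\<lambda>b. b p * b p"] by (simp add: S_def less_le)
      define g where "g = (\<lambda>x. \<Sum>b\<in>B. (b p / sqrt S) * b x)"
      have gV: "g \<in> ?V" unfolding g_def by (rule laplace_eigenspace_sum[OF B(1)]) (use B(2) in auto)
      have "inner_S2 g g = (\<Sum>b\<in>B. (b p / sqrt S) * inner_S2 b g)"
        using inner_S2_sum_left(2)[OF B(1) cB eigenspace_cont[OF gV], of "\<lambda>b. b p / sqrt S"] unfolding g_def .
      also have "\<dots> = (\<Sum>b\<in>B. (b p * b p) / S)"
      proof (rule sum.cong)
        fix b assume b: "b \<in> B"
        have "inner_S2 b g = b p / sqrt S"
          using orthonormal_coefficient[OF B(1,3) cB b, of "\<lambda>b. b p / sqrt S"] unfolding g_def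
          by (simp add: inner_S2_commute[of b])
        then show "(b p / sqrt S) * inner_S2 b g = (b p * b p) / S" using S0 by simp
      qed simp
      also have "\<dots> = 1" using S0 by (simp add: S_def sum_divide_distrib[symmetric])
      finally have "\<bar>g p\<bar> \<le> C" using C(2)[OF gV p] by simp
      moreover have "g p = sqrt S"
      proof -
        have "g p = S / sqrt S" by (simp add: g_def S_def sum_divide_distrib)
        then show ?thesis using S0 by (simp add: real_div_sqrt)
      qed
      ultimately have "sqrt S \<le> C" by simp
      then have "(sqrt S)\<^sup>2 \<le> C\<^sup>2" using S0 by (intro power_mono) auto
      then show ?thesis using S0 by (simp add: S_def)
    qed simp
    have cs: "cont_S2 (\<lambda>x. \<Sum>b\<in>B. b x * b x)"
      unfolding cont_S2_def radial_ext_def using cB[unfolded cont_S2_def radial_ext_def]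
      by (intro continuous_on_sum continuous_on_mult)
    have "real (card B) = (\<Sum>b\<in>B. inner_S2 b b)" using B(3) by (simp add: orthonormal_S2_def)
    also have "\<dots> = (\<Sum>b\<in>B. 3 * solid_integral (\<lambda>x. b x * b x))"
      by (intro sum.cong refl inner_S2_eq cB)
    also have "\<dots> = 3 * solid_integral (\<lambda>x. \<Sum>b\<in>B. b x * b x)"
    proof -
      have "solid_integral (\<lambda>x. \<Sum>b\<in>B. b x * b x) = (\<Sum>b\<in>B. solid_integral (\<lambda>x. b x * b x))"
        unfolding solid_integral_def radial_ext_def sum_distrib_left
        using integrable_solid[OF cont_S2_mult[OF cB cB]]
        by (intro Bochner_Integration.integral_sum) (auto simp: radial_ext_def)
      then show ?thesis by (simp add: sum_distrib_left)
    qed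
    also have "solid_integral (\<lambda>x. \<Sum>b\<in>B. b x * b x) \<le> solid_integral (\<lambda>x. C\<^sup>2 * 1 + 0 * 1)"
      unfolding solid_integral_def
    proof (rule integral_mono[OF integrable_solid[OF cs] integrable_solid[OF cont_S2_lincomb[OF c1 c1]]])
      fix x :: "real^3"
      show "indicator (cball 0 1 - {0}) x * radial_ext (\<lambda>x. \<Sum>b\<in>B. b x * b x) x
        \<le> indicator (cball 0 1 - {0}) x * radial_ext (\<lambda>x. C\<^sup>2 * 1 + 0 * 1) x"
        using S[of "sgn x"] by (cases "x = 0") (auto simp: radial_ext_def norm_sgn indicator_def)
    qed
    also have "\<dots> = C\<^sup>2 * solid_integral (\<lambda>x. 1)" using solid_integral_lincomb[OF c1 c1, of "C\<^sup>2" 0] by simp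
    finally show ?thesis by simp
  qed
  have "card B \<le> nat \<lceil>3 * C\<^sup>2 * solid_integral (\<lambda>x. 1)\<rceil>"
    if "finite B" "B \<subseteq> ?V" "orthonormal_S2 B" for B
  proof -
    have "real (card B) \<le> real (nat \<lceil>3 * C\<^sup>2 * solid_integral (\<lambda>x. 1)\<rceil>)"
      using that by (intro order_trans[OF bound real_nat_ceiling_ge])
    then show ?thesis by simp
  qed
  then show ?thesis using that by blast
qed

text \<open>
  An orthonormal set of maximal size spans: otherwise the normalised component of an eigenfunction
  orthogonal to the set could be added.
\<close>

lemma orthonormal_basis_eigenspace_exists:
  "\<exists>B. orthonormal_basis (laplace_eigenspace (real n * (real n + 1))) B"
proof -
  let ?V = "laplace_eigenspace (real n * (real n + 1))"
  let ?P = "\<lambda>B. finite B \<and> B \<subseteq> ?V \<and> orthonormal_S2 B"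
  obtain N where N: "\<And>B. finite B \<Longrightarrow> B \<subseteq> ?V \<Longrightarrow> orthonormal_S2 B \<Longrightarrow> card B \<le> N"
    using orthonormal_eigenfunctions_bounded[of n] by metis
  have "?P {}" by (simp add: orthonormal_S2_def)
  moreover have "\<forall>B. ?P B \<longrightarrow> card B < Suc N" using N by (simp add: less_Suc_eq_le)
  ultimately obtain B where B: "?P B" and max: "\<And>B'. ?P B' \<Longrightarrow> card B' \<le> card B"
    using ex_has_greatest_nat[of ?P "{}" card "Suc N"] by blast
  have fin: "finite B" and BV: "B \<subseteq> ?V" and ON: "orthonormal_S2 B" using B by auto
  have cB: "cont_S2 b" if "b \<in> B" for b using that BV eigenspace_cont by blast
  have "f \<in> range (lin_comb B)" if f: "f \<in> ?V" for f
  proof -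
    define s where "s = (\<lambda>x. \<Sum>b\<in>B. inner_S2 f b * b x)"
    define g where "g = (\<lambda>x. 1 * f x + (-1) * s x)"
    have sV: "s \<in> ?V" unfolding s_def by (rule laplace_eigenspace_sum[OF fin]) (use BV in auto)
    have gV: "g \<in> ?V" unfolding g_def by (rule laplace_eigenspace_lincomb[OF f sV])
    have go: "inner_S2 g b = 0" if "b \<in> B" for b
      using orthonormal_coefficient[OF fin ON cB that, of "inner_S2 f"]
      unfolding g_def inner_S2_lincomb_left[OF eigenspace_cont[OF f] eigenspace_cont[OF sV] cB[OF that]]
      by (simp add: s_def)
    have "inner_S2 g g = 0"
    proof (rule ccontr)
      assume ne: "inner_S2 g g \<noteq> 0"
      then have pos: "inner_S2 g g > 0" using inner_S2_nonneg[of g] by simp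
      define \<nu> where "\<nu> = sqrt (inner_S2 g g)"
      have \<nu>: "\<nu> > 0" "\<nu> * \<nu> = inner_S2 g g" using pos by (simp_all add: \<nu>_def)
      define h where "h = (\<lambda>x. (1 / \<nu>) * g x + 0 * g x)"
      have hV: "h \<in> ?V" unfolding h_def by (rule laplace_eigenspace_lincomb[OF gV gV])
      have hb: "inner_S2 h k = inner_S2 g k / \<nu>" if "cont_S2 k" for k
        unfolding h_def inner_S2_lincomb_left[OF eigenspace_cont[OF gV] eigenspace_cont[OF gV] that] by simp
      have hB: "inner_S2 h b = 0" "inner_S2 b h = 0" if "b \<in> B" for b
        using go[OF that] hb[OF cB[OF that]] by (simp_all add: inner_S2_commute[of b])
      have hh: "inner_S2 h h = 1"
      proof -
        have "inner_S2 g h = inner_S2 g g / \<nu>"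
          unfolding inner_S2_commute[of g h] by (rule hb[OF eigenspace_cont[OF gV]])
        then have "inner_S2 h h = (\<nu> * \<nu>) / \<nu> / \<nu>" using hb[OF eigenspace_cont[OF hV]] \<nu>(2) by simp
        then show ?thesis using \<nu>(1) by simp
      qed
      have "h \<notin> B" using hB(1)[of h] hh by auto
      moreover have "?P (insert h B)" using B hV hB hh by (auto simp: orthonormal_S2_def)
      ultimately show False using max[of "insert h B"] fin by simp
    qed
    then have g0: "g x = 0" if "norm x = 1" for x by (rule inner_S2_eq_0[OF eigenspace_cont[OF gV] _ that])
    have "f = lin_comb B (inner_S2 f)"
    proof
      fix x
      have "g x = 0" using g0[of x] gV by (cases "norm x = 1") (auto simp: laplace_eigenspace_iff)
      then show "f x = lin_comb B (inner_S2 f) x" by (simp add: g_def s_def lin_comb_def)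
    qed
    then show ?thesis by blast
  qed
  moreover have "lin_comb B c \<in> ?V" for c
    unfolding lin_comb_def by (rule laplace_eigenspace_sum[OF fin]) (use BV in auto)
  ultimately have "orthonormal_basis ?V B"
    using fin ON unfolding orthonormal_basis_def orthonormal_S2_def by blast
  then show ?thesis by blast
qed

text \<open>
  Rodrigues' formula for the rotation by the angle \<open>t\<close> about the unit vector \<open>a\<close>.
\<close>

definition axis_rotation :: "real^3 \<Rightarrow> real \<Rightarrow> real^3 \<Rightarrow> real^3" where
  "axis_rotation a t x = cos t *\<^sub>R x + sin t *\<^sub>R cross3 a x + ((1 - cos t) * (a \<bullet> x)) *\<^sub>R a"

lemma axis_rotation_orthogonal:
  assumes a: "norm a = 1"
  shows "orthogonal_transformation (axis_rotation a t)"
proof -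
  have aa: "a \<bullet> a = 1" using a by (simp add: dot_square_norm)
  have "axis_rotation a t x \<bullet> axis_rotation a t x = x \<bullet> x" for x
  proof -
    have c: "cross3 a x \<bullet> cross3 a x = x \<bullet> x - (a \<bullet> x)\<^sup>2"
      using norm_cross[of a x] aa unfolding power2_norm_eq_inner by simp
    have z: "cross3 a x \<bullet> a = 0" "cross3 a x \<bullet> x = 0" "a \<bullet> cross3 a x = 0" "x \<bullet> cross3 a x = 0"
      by (simp_all add: dot_cross_self)
    have "axis_rotation a t x \<bullet> axis_rotation a t x = (cos t)\<^sup>2 * (x \<bullet> x) + (sin t)\<^sup>2 * (x \<bullet> x - (a \<bullet> x)\<^sup>2)
      + ((1 - cos t) * (a \<bullet> x))\<^sup>2 + 2 * cos t * ((1 - cos t) * (a \<bullet> x)) * (a \<bullet> x)"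
      unfolding axis_rotation_def by (simp add: inner_add_left inner_add_right z c aa inner_commute[of x a] power2_eq_square algebra_simps)
    also have "(sin t)\<^sup>2 = 1 - (cos t)\<^sup>2" by (simp add: sin_squared_eq)
    finally show ?thesis by (simp add: power2_eq_square algebra_simps)
  qed
  then have "norm (axis_rotation a t x) = norm x" for x by (simp add: norm_eq_sqrt_inner)
  moreover have "linear (axis_rotation a t)"
    unfolding axis_rotation_def by (rule linearI) (simp_all add: cross_add_right cross_mult_right inner_add_right algebra_simps)
  ultimately show ?thesis by (simp add: orthogonal_transformation)
qed

lemma axis_rotation_derivative:
  "((\<lambda>t. axis_rotation a t x) has_derivative (\<lambda>t. t *\<^sub>R cross3 a x)) (at 0)" "axis_rotation a 0 x = x"
  unfolding axis_rotation_def
  by (rule has_derivative_eq_rhs, (rule derivative_intros)+) (auto intro!: derivative_eq_intros)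

lemma d1_expand:
  assumes "smooth_on_S2 f" "x \<noteq> 0"
  shows "d1 f x h = (\<Sum>e\<in>Basis. (h \<bullet> e) * d1 f x e)"
proof -
  have "d1 f x h = d1 f x (\<Sum>e\<in>Basis. (h \<bullet> e) *\<^sub>R e)" by (simp only: euclidean_representation)
  then show ?thesis
    by (simp add: linear_sum[OF linear_d1[OF assms]] linear_cmul[OF linear_d1[OF assms]])
qed

text \<open>
  The product rule for the bilinear expression \<open>d1 f (\<phi> y) (w y)\<close>, by expanding \<open>w y\<close> in a basis.
\<close>

lemma has_derivative_d1_along:
  assumes f: "smooth_on_S2 f" and \<phi>: "(\<phi> has_derivative \<phi>') (at x)" and w: "(w has_derivative w') (at x)"
    and S: "open S" "x \<in> S" "\<And>y. y \<in> S \<Longrightarrow> \<phi> y \<noteq> 0"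
  shows "((\<lambda>y. d1 f (\<phi> y) (w y)) has_derivative (\<lambda>h. d2 f (\<phi> x) (w x) (\<phi>' h) + d1 f (\<phi> x) (w' h))) (at x)"
proof -
  have p: "\<phi> x \<noteq> 0" using S by blast
  have "((\<lambda>y. \<Sum>e\<in>Basis. (w y \<bullet> e) * d1 f (\<phi> y) e) has_derivative
     (\<lambda>h. \<Sum>e\<in>Basis. (w x \<bullet> e) * d2 f (\<phi> x) e (\<phi>' h) + (w' h \<bullet> e) * d1 f (\<phi> x) e)) (at x)"
    by (rule has_derivative_sum, rule has_derivative_mult[OF has_derivative_inner_left[OF w] has_derivative_compose[OF \<phi> has_d2[OF f p]]])
  moreover have "(\<Sum>e\<in>Basis. (w x \<bullet> e) * d2 f (\<phi> x) e (\<phi>' h) + (w' h \<bullet> e) * d1 f (\<phi> x) e) = d2 f (\<phi> x) (w x) (\<phi>' h) + d1 f (\<phi> x) (w' h)" for h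
  proof -
    have l: "linear (\<lambda>e. d2 f (\<phi> x) e (\<phi>' h))" using bilinear_d2[OF f p] by (simp add: bilinear_def)
    have "d2 f (\<phi> x) (w x) (\<phi>' h) = d2 f (\<phi> x) (\<Sum>e\<in>Basis. (w x \<bullet> e) *\<^sub>R e) (\<phi>' h)" by (simp only: euclidean_representation)
    also have "\<dots> = (\<Sum>e\<in>Basis. (w x \<bullet> e) * d2 f (\<phi> x) e (\<phi>' h))"
      by (simp add: linear_sum[OF l] linear_cmul[OF l])
    finally show ?thesis by (simp add: sum.distrib d1_expand[OF f p, of "w' h"])
  qed
  ultimately have "((\<lambda>y. \<Sum>e\<in>Basis. (w y \<bullet> e) * d1 f (\<phi> y) e) has_derivative
     (\<lambda>h. d2 f (\<phi> x) (w x) (\<phi>' h) + d1 f (\<phi> x) (w' h))) (at x)" by simp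
  then show ?thesis
    by (rule has_derivative_transform_within_open[OF _ S(1,2)]) (simp add: d1_expand[OF f S(3)])
qed

lemma has_derivative_angular:
  assumes f: "smooth_on_S2 f" and p: "p \<noteq> 0"
  shows "((\<lambda>x. d1 f x (cross3 a x)) has_derivative (\<lambda>h. d2 f p (cross3 a p) h + d1 f p (cross3 a h))) (at p)"
proof -
  have "bounded_linear (cross3 a)"
    unfolding linear_conv_bounded_linear[symmetric]
    by (rule linearI) (simp_all add: cross_add_right cross_mult_right)
  then have "(cross3 a has_derivative cross3 a) (at p)" by (rule bounded_linear_imp_has_derivative)
  from has_derivative_d1_along[OF f has_derivative_ident this, of "- {0}"] p show ?thesis by auto
qed

text \<open>
  The derivative of \<open>f\<close> along the flow of rotations about the axis \<open>a\<close>.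
\<close>

definition angular :: "real^3 \<Rightarrow> (real^3 \<Rightarrow> real) \<Rightarrow> real^3 \<Rightarrow> real" where
  "angular a f x = d1 f x (cross3 a x)"

lemma angular_radial:
  assumes f: "smooth_on_S2 f" and x: "x \<noteq> 0"
  shows "radial_ext (angular a f) x = d1 f x (cross3 a x)"
proof -
  have "d1 f (sgn x) (cross3 a (sgn x)) = d1 f (inverse (norm x) *\<^sub>R x) (inverse (norm x) *\<^sub>R cross3 a x)"
    by (simp add: sgn_div_norm cross_mult_right)
  also have "\<dots> = d1 f x (cross3 a x)"
    using x d1_scale[OF f x, of "inverse (norm x)"] linear_cmul[OF linear_d1[OF f x]] by simp
  finally show ?thesis by (simp add: radial_ext_def angular_def)
qed

lemma cont_S2_angular:
  assumes f: "smooth_on_S2 f"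
  shows "cont_S2 (angular a f)"
proof -
  have "continuous_on (- {0}) (\<lambda>x. d1 f x (cross3 a x))"
    by (rule continuous_at_imp_continuous_on, rule ballI, rule has_derivative_continuous[OF has_derivative_angular[OF f]]) simp
  then show ?thesis unfolding cont_S2_def by (rule continuous_on_eq) (simp add: angular_radial[OF f])
qed

locale eigenbasis =
  fixes l :: real and B :: "(real^3 \<Rightarrow> real) set"
  assumes basis: "orthonormal_basis (laplace_eigenspace l) B"
begin

lemma fin: "finite B" using basis by (simp add: orthonormal_basis_def)

lemma orthonormal: "orthonormal_S2 B" using basis by (simp add: orthonormal_basis_def orthonormal_S2_def)

lemma in_eigenspace:
  assumes "b \<in> B"
  shows "b \<in> laplace_eigenspace l"
proof -
  have "lin_comb B (\<lambda>b'. if b' = b then 1 else 0) = b"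
  proof
    fix x
    have "lin_comb B (\<lambda>b'. if b' = b then 1 else 0) x = (\<Sum>b'\<in>B. if b' = b then b x else 0)"
      unfolding lin_comb_def by (rule sum.cong) auto
    then show "lin_comb B (\<lambda>b'. if b' = b then 1 else 0) x = b x" using fin assms by simp
  qed
  then show ?thesis using basis unfolding orthonormal_basis_def by (metis rangeI)
qed

lemma smooth: "b \<in> B \<Longrightarrow> smooth_on_S2 b"
  using in_eigenspace by (simp add: laplace_eigenspace_iff)

lemma cont: "b \<in> B \<Longrightarrow> cont_S2 b"
  by (rule eigenspace_cont[OF in_eigenspace])

lemma expand:
  assumes "f \<in> laplace_eigenspace l"
  shows "f x = (\<Sum>b\<in>B. inner_S2 f b * b x)"
proof -
  obtain c where f: "f = lin_comb B c" using assms basis unfolding orthonormal_basis_def by blast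
  have "inner_S2 f b = c b" if "b \<in> B" for b
    unfolding f lin_comb_def by (rule orthonormal_coefficient[OF fin orthonormal cont that])
  then show ?thesis unfolding f by (simp add: lin_comb_def)
qed

lemma independent:
  assumes "\<And>p. norm p = 1 \<Longrightarrow> (\<Sum>b\<in>B. c b * b p) = 0" "b \<in> B"
  shows "c b = 0"
proof -
  have "(\<Sum>b\<in>B. c b * b p) = 0" for p
    using assms(1)[of p] in_eigenspace by (cases "norm p = 1") (auto simp: laplace_eigenspace_iff intro!: sum.neutral)
  then have "inner_S2 (\<lambda>x. \<Sum>b\<in>B. c b * b x) b = inner_S2 (\<lambda>x. 0) b" by simp
  then show ?thesis
    using orthonormal_coefficient[OF fin orthonormal cont assms(2), of c] by (simp add: inner_S2_def)
qed

text \<open>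
  The kernel is the reproducing kernel of the eigenspace, which is rotation invariant: the inner
  product of the rotated kernel function with each basis element \<open>b\<close> is \<open>b p\<close>.
\<close>

lemma kernel_rotation_invariant:
  assumes R: "orthogonal_transformation R"
  shows "(\<Sum>b\<in>B. b (R p) * b (R q)) = (\<Sum>b\<in>B. b p * b q)"
proof -
  let ?R' = "inv R"
  have R': "orthogonal_transformation ?R'" by (rule orthogonal_transformation_inv[OF R])
  have RR: "R (?R' x) = x" "?R' (R x) = x" for x
    using orthogonal_transformation_bij[OF R] by (simp_all add: bij_is_surj surj_f_inv_f bij_is_inj)
  define K where "K = (\<lambda>x. \<Sum>b\<in>B. b (R p) * b x)"
  have KV: "K \<in> laplace_eigenspace l" unfolding K_def by (rule laplace_eigenspace_sum[OF fin in_eigenspace])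
  have KR: "(\<lambda>x. K (R x)) \<in> laplace_eigenspace l" by (rule laplace_eigenspace_rotate[OF KV R])
  have "inner_S2 (\<lambda>x. K (R x)) b = b p" if b: "b \<in> B" for b
  proof -
    have bR: "(\<lambda>x. b (?R' x)) \<in> laplace_eigenspace l" by (rule laplace_eigenspace_rotate[OF in_eigenspace[OF b] R'])
    have "inner_S2 (\<lambda>x. K (R x)) b = inner_S2 (\<lambda>x. (\<lambda>x. K x) (R x)) (\<lambda>x. (\<lambda>x. b (?R' x)) (R x))" by (simp add: RR)
    also have "\<dots> = inner_S2 K (\<lambda>x. b (?R' x))"
      by (rule inner_S2_orthogonal[OF R eigenspace_cont[OF KV] eigenspace_cont[OF bR]])
    also have "\<dots> = (\<Sum>b'\<in>B. b' (R p) * inner_S2 b' (\<lambda>x. b (?R' x)))"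
      unfolding K_def by (rule inner_S2_sum_left(2)[OF fin cont eigenspace_cont[OF bR]])
    also have "\<dots> = (\<lambda>x. b (?R' x)) (R p)"
      unfolding expand[OF bR, of "R p"] by (simp add: inner_S2_commute mult.commute)
    finally show ?thesis by (simp add: RR)
  qed
  then show ?thesis using expand[OF KR, of q] by (simp add: K_def)
qed

text \<open>
  The derivative of the invariance of the kernel along a one-parameter group of rotations.
\<close>

lemma kernel_angular:
  assumes p: "norm p = 1" and q: "norm q = 1"
  shows "(\<Sum>b\<in>B. angular a b p * b q + b p * angular a b q) = 0"
proof -
  have pq: "p \<noteq> 0" "q \<noteq> 0" using p q by auto
  have unit: "(\<Sum>b\<in>B. d1 b p (cross3 a p) * b q + b p * d1 b q (cross3 a q)) = 0" if a: "norm a = 1" for a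
  proof -
    have R: "orthogonal_transformation (axis_rotation a t)" for t by (rule axis_rotation_orthogonal[OF a])
    have n: "norm (axis_rotation a t x) = norm x" for t x using R[of t] by (simp add: orthogonal_transformation)
    have d: "((\<lambda>t. radial_ext b (axis_rotation a t x)) has_derivative (\<lambda>t. t * d1 b x (cross3 a x))) (at 0)"
      if "b \<in> B" "x \<noteq> 0" for b x
    proof -
      have "((\<lambda>t. radial_ext b (axis_rotation a t x)) has_derivative (\<lambda>t. d1 b x (t *\<^sub>R cross3 a x))) (at 0)"
        by (rule has_derivative_compose[OF axis_rotation_derivative(1)])
           (simp add: axis_rotation_derivative(2) has_d1[OF smooth[OF that(1)] that(2)])
      then show ?thesis
        by (rule has_derivative_eq_rhs) (simp add: fun_eq_iff linear_cmul[OF linear_d1[OF smooth[OF that(1)] that(2)]])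
    qed
    have "((\<lambda>t. \<Sum>b\<in>B. radial_ext b (axis_rotation a t p) * radial_ext b (axis_rotation a t q)) has_derivative
      (\<lambda>t. \<Sum>b\<in>B. radial_ext b (axis_rotation a 0 p) * (t * d1 b q (cross3 a q)) + (t * d1 b p (cross3 a p)) * radial_ext b (axis_rotation a 0 q))) (at 0)"
      by (rule has_derivative_sum, rule has_derivative_mult[OF d d]) (use pq in auto)
    moreover have "(\<lambda>t. \<Sum>b\<in>B. radial_ext b (axis_rotation a t p) * radial_ext b (axis_rotation a t q)) = (\<lambda>t. \<Sum>b\<in>B. b p * b q)"
      using kernel_rotation_invariant[OF R] n p q by (simp add: radial_ext_sphere)
    ultimately have "((\<lambda>t. \<Sum>b\<in>B. b p * b q) has_derivative
      (\<lambda>t. \<Sum>b\<in>B. b p * (t * d1 b q (cross3 a q)) + (t * d1 b p (cross3 a p)) * b q)) (at 0)"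
      using p q by (simp add: axis_rotation_derivative(2) radial_ext_sphere)
    from has_derivative_unique[OF this has_derivative_const]
    have "(\<Sum>b\<in>B. b p * (1 * d1 b q (cross3 a q)) + (1 * d1 b p (cross3 a p)) * b q) = 0" by meson
    then show ?thesis by (simp add: add.commute)
  qed
  show ?thesis
  proof (cases "a = 0")
    case True
    have "angular a b x = 0" if "b \<in> B" "x \<noteq> 0" for b x
      using True linear_0[OF linear_d1[OF smooth[OF that(1)] that(2)]] by (simp add: angular_def)
    then show ?thesis using pq by (intro sum.neutral) auto
  next
    case False
    have s: "angular a b x = norm a * d1 b x (cross3 (sgn a) x)" if "b \<in> B" "x \<noteq> 0" for b x
    proof -
      have "cross3 a x = norm a *\<^sub>R cross3 (sgn a) x" using False by (simp add: sgn_div_norm cross_mult_left)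
      then show ?thesis using linear_cmul[OF linear_d1[OF smooth[OF that(1)] that(2)]] by (simp add: angular_def)
    qed
    have "(\<Sum>b\<in>B. angular a b p * b q + b p * angular a b q) =
        (\<Sum>b\<in>B. norm a * (d1 b p (cross3 (sgn a) p) * b q + b p * d1 b q (cross3 (sgn a) q)))"
      using pq by (intro sum.cong refl) (simp add: s algebra_simps)
    also have "\<dots> = 0" unfolding sum_distrib_left[symmetric] using unit[of "sgn a"] False by (simp add: norm_sgn)
    finally show ?thesis .
  qed
qed

text \<open>
  The matrix of the infinitesimal rotation in the orthonormal basis.  That the rotated function
  is again a combination of the basis is the content of \<open>angular_minus\<close>.
\<close>

definition angular_matrix :: "real^3 \<Rightarrow> (real^3 \<Rightarrow> real) \<Rightarrow> (real^3 \<Rightarrow> real) \<Rightarrow> real" where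
  "angular_matrix a b b' = inner_S2 (angular a b) b'"

lemma cont_angular: "b \<in> B \<Longrightarrow> cont_S2 (angular a b)"
  by (rule cont_S2_angular[OF smooth])

lemma inner_S2_cong: "(\<And>p. norm p = 1 \<Longrightarrow> f p = f' p) \<Longrightarrow> inner_S2 f g = inner_S2 f' g"
  unfolding inner_S2_def area_S2_def
  by (rule Bochner_Integration.integral_cong) (auto simp: space_scale_measure space_restrict_space)

text \<open>
  Pairing \<open>kernel_angular\<close> with \<open>b\<close> in the variable \<open>q\<close>.
\<close>

lemma angular_minus:
  assumes p: "norm p = 1" and b: "b \<in> B"
  shows "angular a b p = - (\<Sum>b'\<in>B. angular_matrix a b' b * b' p)"
proof -
  have "(\<Sum>b'\<in>B. angular a b' p * b' q) + (\<Sum>b'\<in>B. b' p * angular a b' q) = 0" if "norm q = 1" for q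
    using kernel_angular[OF p that, of a] by (simp add: sum.distrib)
  note eq = this
  have eq: "(\<Sum>b'\<in>B. angular a b' p * b' q) = (\<Sum>b'\<in>B. (- b' p) * angular a b' q)" if "norm q = 1" for q
    using eq[OF that] by (simp only: sum_negf mult_minus_left)
  have "angular a b p = inner_S2 (\<lambda>q. \<Sum>b'\<in>B. angular a b' p * b' q) b"
    by (rule orthonormal_coefficient[OF fin orthonormal cont b, symmetric])
  also have "\<dots> = inner_S2 (\<lambda>q. \<Sum>b'\<in>B. (- b' p) * angular a b' q) b" by (rule inner_S2_cong[OF eq])
  also have "\<dots> = (\<Sum>b'\<in>B. (- b' p) * inner_S2 (angular a b') b)"
  proof -
    have cs: "cont_S2 (\<lambda>q. \<Sum>b'\<in>F. (- b' p) * angular a b' q) \<and>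
       inner_S2 (\<lambda>q. \<Sum>b'\<in>F. (- b' p) * angular a b' q) b = (\<Sum>b'\<in>F. (- b' p) * inner_S2 (angular a b') b)"
      if "finite F" "F \<subseteq> B" for F using that
    proof (induction F)
      case empty then show ?case by (simp add: cont_S2_def radial_ext_def inner_S2_def)
    next
      case (insert x F)
      let ?g = "\<lambda>q. \<Sum>b'\<in>F. (- b' p) * angular a b' q"
      have IH: "cont_S2 ?g" "inner_S2 ?g b = (\<Sum>b'\<in>F. (- b' p) * inner_S2 (angular a b') b)"
        using insert.IH insert.prems by auto
      have x: "cont_S2 (angular a x)" using insert.prems cont_angular by blast
      have e: "(\<lambda>q. \<Sum>b'\<in>insert x F. (- b' p) * angular a b' q) = (\<lambda>q. (- x p) * angular a x q + 1 * ?g q)"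
        using insert.hyps by simp
      show ?case unfolding e
        using cont_S2_lincomb[OF x IH(1), of "- x p" 1] inner_S2_lincomb_left[OF x IH(1) cont[OF b], of "- x p" 1] IH(2) insert.hyps
        by (simp only: sum.insert simp_thms)
    qed
    show ?thesis using cs[OF fin] by blast
  qed
  finally show ?thesis by (simp add: angular_matrix_def sum_negf mult.commute)
qed

text \<open>
  The expansion of \<open>angular a b\<close> in \<open>angular_minus\<close> has the negative transpose of the matrix as
  coefficients, while the definition of the matrix reads them off directly.
\<close>

lemma angular_matrix_antisymmetric:
  assumes b: "b \<in> B" "b' \<in> B"
  shows "angular_matrix a b b' = - angular_matrix a b' b"
proof -
  have "angular_matrix a b b' = inner_S2 (\<lambda>p. \<Sum>b''\<in>B. (- angular_matrix a b'' b) * b'' p) b'"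
    unfolding angular_matrix_def by (rule inner_S2_cong) (simp add: angular_minus[OF _ b(1)] angular_matrix_def sum_negf)
  also have "\<dots> = - angular_matrix a b' b" by (rule orthonormal_coefficient[OF fin orthonormal cont b(2)])
  finally show ?thesis .
qed

lemma angular_expand:
  assumes "norm p = 1" "b \<in> B"
  shows "angular a b p = (\<Sum>b'\<in>B. angular_matrix a b b' * b' p)"
  unfolding angular_minus[OF assms] using angular_matrix_antisymmetric[OF assms(2)] by (simp add: sum_negf[symmetric])

lemma angular_matrix_derivative:
  assumes p: "p \<noteq> 0" and b: "b \<in> B"
  shows "(\<Sum>b'\<in>B. angular_matrix a b b' * d1 b' p h) = d2 b p (cross3 a p) h + d1 b p (cross3 a h)"
proof -
  have eq: "d1 b x (cross3 a x) = (\<Sum>b'\<in>B. angular_matrix a b b' * radial_ext b' x)" if "x \<noteq> 0" for x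
    using angular_expand[OF _ b, of "sgn x" a] angular_radial[OF smooth[OF b] that, of a] that
    by (simp only: radial_ext_def norm_sgn) simp
  have "((\<lambda>x. \<Sum>b'\<in>B. angular_matrix a b b' * radial_ext b' x) has_derivative (\<lambda>h. \<Sum>b'\<in>B. angular_matrix a b b' * d1 b' p h)) (at p)"
    by (rule has_derivative_sum, rule has_derivative_mult_right[OF has_d1[OF smooth p]])
  then have "((\<lambda>x. d1 b x (cross3 a x)) has_derivative (\<lambda>h. \<Sum>b'\<in>B. angular_matrix a b b' * d1 b' p h)) (at p)"
    by (rule has_derivative_transform_within_open[of _ _ _ _ "- {0}"]) (use p eq in auto)
  from has_derivative_unique[OF this has_derivative_angular[OF smooth[OF b] p]]
  show ?thesis by meson
qed

lemma jacobi_cross3: "cross3 a (cross3 c p) - cross3 c (cross3 a p) = cross3 (cross3 a c) p"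
  using cross_triple[of a c p] by (simp add: cross3_simps forall_3 vec_eq_iff cross3_def)

text \<open>
  Two infinitesimal rotations in succession are a second derivative along two tangent vectors and
  a correction from the motion of the first one.
\<close>

lemma angular_matrix_product:
  assumes p: "norm p = 1" and b: "b \<in> B"
  shows "(\<Sum>b'\<in>B. angular_matrix a b b' * (\<Sum>b''\<in>B. angular_matrix c b' b'' * b'' p)) = d2 b p (cross3 a p) (cross3 c p) + d1 b p (cross3 a (cross3 c p))"
proof -
  have "p \<noteq> 0" using p by auto
  have "(\<Sum>b'\<in>B. angular_matrix a b b' * (\<Sum>b''\<in>B. angular_matrix c b' b'' * b'' p)) = (\<Sum>b'\<in>B. angular_matrix a b b' * d1 b' p (cross3 c p))"
    by (intro sum.cong refl arg_cong2[where f="(*)"]) (simp add: angular_expand[OF p, symmetric] angular_def)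
  then show ?thesis using angular_matrix_derivative[OF \<open>p \<noteq> 0\<close> b] by simp
qed

text \<open>
  In the commutator the symmetric second derivatives cancel and Jacobi's identity evaluates
  the corrections.  An identity between vectors of values at all points is an identity between
  matrices because the basis is linearly independent.
\<close>

lemma angular_matrix_commutator:
  assumes b: "b \<in> B" "b'' \<in> B"
  shows "(\<Sum>b'\<in>B. angular_matrix a b b' * angular_matrix c b' b'') - (\<Sum>b'\<in>B. angular_matrix c b b' * angular_matrix a b' b'') = angular_matrix (cross3 a c) b b''"
proof -
  let ?N = "\<lambda>b''. ((\<Sum>b'\<in>B. angular_matrix a b b' * angular_matrix c b' b'') - (\<Sum>b'\<in>B. angular_matrix c b b' * angular_matrix a b' b'')) - angular_matrix (cross3 a c) b b''"
  have s: "(\<Sum>b''\<in>B. (\<Sum>b'\<in>B. angular_matrix a b b' * angular_matrix c b' b'') * b'' p) = (\<Sum>b'\<in>B. angular_matrix a b b' * (\<Sum>b''\<in>B. angular_matrix c b' b'' * b'' p))" for p a c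
    unfolding sum_distrib_left sum_distrib_right by (subst sum.swap) (simp add: mult_ac)
  have "?N b'' = 0"
  proof (rule independent[OF _ b(2)])
    fix p :: "real^3" assume p: "norm p = 1"
    then have p0: "p \<noteq> 0" by auto
    have "(\<Sum>b''\<in>B. ?N b'' * b'' p) = (\<Sum>b'\<in>B. angular_matrix a b b' * (\<Sum>b''\<in>B. angular_matrix c b' b'' * b'' p))
      - (\<Sum>b'\<in>B. angular_matrix c b b' * (\<Sum>b''\<in>B. angular_matrix a b' b'' * b'' p)) - (\<Sum>b''\<in>B. angular_matrix (cross3 a c) b b'' * b'' p)"
      unfolding s[symmetric] by (simp add: sum_subtractf left_diff_distrib)
    also have "\<dots> = d1 b p (cross3 a (cross3 c p)) - d1 b p (cross3 c (cross3 a p)) - d1 b p (cross3 (cross3 a c) p)"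
      unfolding angular_matrix_product[OF p b(1)] angular_expand[OF p b(1), symmetric] angular_def
      using d2_symmetric[OF smooth[OF b(1)] p0, of "cross3 a p" "cross3 c p"] by simp
    also have "\<dots> = 0"
      using linear_diff[OF linear_d1[OF smooth[OF b(1)] p0], of "cross3 a (cross3 c p)" "cross3 c (cross3 a p)"]
      by (simp add: jacobi_cross3)
    finally show "(\<Sum>b''\<in>B. ?N b'' * b'' p) = 0" .
  qed
  then show ?thesis by simp
qed

end

section \<open>Covariances of the second-order jet\<close>

text \<open>
  The Euclidean inner product of coefficient vectors.  For Gaussian coefficients it is the
  covariance of the two linear forms.
\<close>

definition ip :: "'i set \<Rightarrow> ('i \<Rightarrow> real) \<Rightarrow> ('i \<Rightarrow> real) \<Rightarrow> real" where
  "ip I u v = (\<Sum>i\<in>I. u i * v i)"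

lemma ip_commute: "ip I u v = ip I v u" by (simp add: ip_def mult.commute)

lemma ip_lincomb:
  "ip I (\<lambda>i. a * u i + b * v i) w = a * ip I u w + b * ip I v w"
  "ip I w (\<lambda>i. a * u i + b * v i) = a * ip I w u + b * ip I w v"
  unfolding ip_def by (simp_all add: sum.distrib sum_distrib_left algebra_simps)

text \<open>
  Three antisymmetric operators with the commutation relations of infinitesimal rotations about
  the axes of an oriented orthonormal frame.
\<close>

locale so3_action =
  fixes I :: "'i set" and X Y Z :: "('i \<Rightarrow> real) \<Rightarrow> 'i \<Rightarrow> real"
  assumes linX: "\<And>a b u v. X (\<lambda>i. a * u i + b * v i) = (\<lambda>i. a * X u i + b * X v i)"
    and linZ: "\<And>a b u v. Z (\<lambda>i. a * u i + b * v i) = (\<lambda>i. a * Z u i + b * Z v i)"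
    and antiX: "\<And>u v. ip I (X u) v = - ip I u (X v)"
    and antiY: "\<And>u v. ip I (Y u) v = - ip I u (Y v)"
    and antiZ: "\<And>u v. ip I (Z u) v = - ip I u (Z v)"
    and XY: "\<And>u. X (Y u) = (\<lambda>i. 1 * Y (X u) i + 1 * Z u i)"
    and YZ: "\<And>u. Y (Z u) = (\<lambda>i. 1 * Z (Y u) i + 1 * X u i)"
    and ZX: "\<And>u. Z (X u) = (\<lambda>i. 1 * X (Z u) i + 1 * Y u i)"
begin

lemma linY0: "Z k = (\<lambda>i. 0) \<Longrightarrow> Y (Z k) = (\<lambda>i. 0) \<Longrightarrow> Z (Y k) = (\<lambda>i. - X k i)"
  using YZ[of k] by (simp add: fun_eq_iff eq_neg_iff_add_eq_0)

text \<open>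
  The vector \<open>k\<close> is fixed by the rotations about the third axis, and $X^2 + Y^2$ acts on it as $-l$.
  Then $Z$ rotates the plane of $Xk$, $Yk$ with speed one and that of $P$, $Q$ with speed two.
  As $Z$ is antisymmetric, the vectors in each plane are orthogonal of equal length, and the
  remaining orthogonality relations come from antisymmetry of $X$ and $Y$.  The length of $Xk$
  follows from $|Xk|^2 + |Yk|^2 = l |k|^2$.  For the length of $P$, the inner product of
  $X^2 k$ and $Y^2 k$ is rewritten with the commutator of $X$ and $Y$ as $|XYk|^2 + |Xk|^2$.
\<close>

lemma zonal_vector_gram:
  fixes l :: real
  assumes k: "Z k = (\<lambda>i. 0)" and Y0: "Y (\<lambda>i. 0) = (\<lambda>i. 0)" and lap: "\<And>i. X (X k) i + Y (Y k) i = - l * k i"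
  defines "\<tau> \<equiv> ip I k k" and "P \<equiv> \<lambda>i. 1 * X (X k) i + (-1) * Y (Y k) i" and "Q \<equiv> \<lambda>i. 2 * X (Y k) i + 0 * k i"
  shows "ip I (X k) (X k) = l * \<tau> / 2" "ip I (Y k) (Y k) = l * \<tau> / 2" "ip I (X k) (Y k) = 0"
    "ip I k (X k) = 0" "ip I k (Y k) = 0" "ip I k P = 0" "ip I k Q = 0"
    "ip I (X k) P = 0" "ip I (X k) Q = 0" "ip I (Y k) P = 0" "ip I (Y k) Q = 0" "ip I P Q = 0"
    "ip I P P = l * (l - 2) * \<tau> / 2" "ip I Q Q = l * (l - 2) * \<tau> / 2"
proof -
  have X0: "X (\<lambda>i. 0) = (\<lambda>i. 0)" using linX[of 0 "\<lambda>i. 0" 0 "\<lambda>i. 0"] by simp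
  have Xm: "X (\<lambda>i. - u i) = (\<lambda>i. - X u i)" for u using linX[of "-1" u 0 u] by simp
  have Zy: "Z (Y k) = (\<lambda>i. - X k i)" by (rule linY0[OF k]) (simp add: k Y0)
  have Zx: "Z (X k) = Y k" using ZX[of k] by (simp add: k X0)
  have YX: "Y (X k) = X (Y k)" using XY[of k] by (simp add: k)
  have w: "Y (Y k) = (\<lambda>i. (- l) * k i + (-1) * X (X k) i)" using lap by (simp add: fun_eq_iff algebra_simps eq_diff_eq)
  have self: "ip I u (X u) = 0" "ip I u (Y u) = 0" "ip I u (Z u) = 0" for u
    using antiX[of u u] antiY[of u u] antiZ[of u u] by (simp_all add: ip_commute[of I "X u"] ip_commute[of I "Y u"] ip_commute[of I "Z u"])
  have neg: "ip I u (\<lambda>i. - v i) = - ip I u v" "ip I (\<lambda>i. - v i) u = - ip I v u" for u v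
    by (simp_all add: ip_def sum_negf)
  have Pu: "P = (\<lambda>i. 2 * X (X k) i + l * k i)" unfolding P_def w by (simp add: fun_eq_iff)
  have Pw: "P = (\<lambda>i. (-2) * Y (Y k) i + (-l) * k i)" unfolding P_def w by (simp add: fun_eq_iff algebra_simps)
  have sum: "ip I (X k) (X k) + ip I (Y k) (Y k) = l * \<tau>"
    unfolding antiX antiY w ip_lincomb by (simp add: \<tau>_def)
  have eq: "ip I (X k) (X k) = ip I (Y k) (Y k)"
    using antiZ[of "X k" "Y k"] by (simp add: Zx Zy neg)
  show x: "ip I (X k) (X k) = l * \<tau> / 2" and y: "ip I (Y k) (Y k) = l * \<tau> / 2" using sum eq by simp_all
  show xy: "ip I (X k) (Y k) = 0" using self(3)[of "X k"] by (simp add: Zx)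
  show kx: "ip I k (X k) = 0" and ky: "ip I k (Y k) = 0" by (rule self)+
  show kP: "ip I k P = 0" unfolding Pu ip_lincomb using x antiX[of k "X k"] by (simp add: \<tau>_def)
  show kQ: "ip I k Q = 0" unfolding Q_def ip_lincomb using xy antiX[of k "Y k"] by simp
  show xP: "ip I (X k) P = 0" unfolding Pu ip_lincomb by (simp add: self kx ip_commute[of I "X k" k])
  show xQ: "ip I (X k) Q = 0" unfolding Q_def ip_lincomb YX[symmetric] by (simp add: self kx ip_commute[of I "X k" k])
  show yP: "ip I (Y k) P = 0" unfolding Pw ip_lincomb by (simp add: self ky ip_commute[of I "Y k" k])
  show yQ: "ip I (Y k) Q = 0" unfolding Q_def ip_lincomb by (simp add: self ky ip_commute[of I "Y k" k])
  have ZP: "Z P = (\<lambda>i. 2 * Q i + 0 * k i)"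
  proof -
    have "Z (X (X k)) = (\<lambda>i. 2 * X (Y k) i)" using ZX[of "X k"] by (simp add: Zx YX fun_eq_iff)
    then show ?thesis unfolding Pu linZ by (simp add: k Q_def)
  qed
  have ZQ: "Z Q = (\<lambda>i. (-2) * P i + 0 * k i)"
  proof -
    have "Z (X (Y k)) = (\<lambda>i. - P i)" using ZX[of "Y k"] by (simp add: Zy Xm P_def fun_eq_iff)
    then show ?thesis unfolding Q_def linZ by (simp add: k)
  qed
  show PQ: "ip I P Q = 0" using self(3)[of P] unfolding ZP ip_lincomb by simp
  have PPQQ: "ip I P P = ip I Q Q"
    using antiZ[of P Q] unfolding ZP ZQ ip_lincomb by simp
  have uw: "ip I (X (X k)) (Y (Y k)) = ip I (X (Y k)) (X (Y k)) + ip I (X k) (X k)"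
  proof -
    have "ip I (X (X k)) (Y (Y k)) = - ip I (X k) (X (Y (Y k)))" by (rule antiX)
    also have "\<dots> = - (ip I (X k) (Y (X (Y k))) + ip I (X k) (Z (Y k)))"
      unfolding XY[of "Y k"] ip_lincomb by simp
    also have "ip I (X k) (Y (X (Y k))) = - ip I (Y (X k)) (X (Y k))" using antiY[of "X k" "X (Y k)"] by simp
    finally show ?thesis by (simp add: YX Zy neg)
  qed
  have PP: "ip I P P = l\<^sup>2 * \<tau> - 4 * ip I (X (X k)) (Y (Y k))"
  proof -
    define s where "s = (\<lambda>i. 1 * X (X k) i + 1 * Y (Y k) i)"
    have "s = (\<lambda>i. (- l) * k i + 0 * k i)" using lap by (simp add: s_def fun_eq_iff)
    then have "ip I s s = l\<^sup>2 * \<tau>" by (simp only: ip_lincomb) (simp add: \<tau>_def power2_eq_square)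
    moreover have "ip I s s = ip I P P + 4 * ip I (X (X k)) (Y (Y k))"
      unfolding s_def P_def ip_lincomb by (simp add: ip_commute[of I "Y (Y k)" "X (X k)"])
    ultimately show ?thesis by simp
  qed
  have "ip I Q Q = 4 * ip I (X (Y k)) (X (Y k))" unfolding Q_def ip_lincomb by simp
  then have "ip I P P = l\<^sup>2 * \<tau> - (ip I P P + 4 * (l * \<tau> / 2))" using PP uw x PPQQ by simp
  then show "ip I P P = l * (l - 2) * \<tau> / 2" by (simp add: power2_eq_square algebra_simps)
  then show "ip I Q Q = l * (l - 2) * \<tau> / 2" using PPQQ by simp
qed

end

context eigenbasis begin

text \<open>
  The coefficient outside \<open>B\<close> is set to zero so that the operator relations are equalities of
  functions.
\<close>

definition angular_op :: "real^3 \<Rightarrow> ((real^3 \<Rightarrow> real) \<Rightarrow> real) \<Rightarrow> (real^3 \<Rightarrow> real) \<Rightarrow> real" where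
  "angular_op a w b = (if b \<in> B then \<Sum>b'\<in>B. angular_matrix a b b' * w b' else 0)"

lemma angular_op_commutator: "angular_op a (angular_op c u) = (\<lambda>b. 1 * angular_op c (angular_op a u) b + 1 * angular_op (cross3 a c) u b)"
proof
  fix b
  have prod: "angular_op a (angular_op c u) b = (\<Sum>b''\<in>B. (\<Sum>b'\<in>B. angular_matrix a b b' * angular_matrix c b' b'') * u b'')" if "b \<in> B" for a c
  proof -
    have "angular_op a (angular_op c u) b = (\<Sum>b'\<in>B. angular_matrix a b b' * (\<Sum>b''\<in>B. angular_matrix c b' b'' * u b''))"
      unfolding angular_op_def using that by (auto intro!: sum.cong)
    also have "\<dots> = (\<Sum>b''\<in>B. \<Sum>b'\<in>B. angular_matrix a b b' * angular_matrix c b' b'' * u b'')"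
      unfolding sum_distrib_left by (subst sum.swap) (simp add: mult.assoc)
    finally show ?thesis by (simp add: sum_distrib_right)
  qed
  show "angular_op a (angular_op c u) b = 1 * angular_op c (angular_op a u) b + 1 * angular_op (cross3 a c) u b"
  proof (cases "b \<in> B")
    case True
    have "angular_op a (angular_op c u) b - angular_op c (angular_op a u) b = (\<Sum>b''\<in>B. angular_matrix (cross3 a c) b b'' * u b'')"
      unfolding prod[OF True] sum_subtractf[symmetric] left_diff_distrib[symmetric]
      by (intro sum.cong refl arg_cong2[where f="(*)"]) (simp only: sum_subtractf angular_matrix_commutator[OF True])
    then show ?thesis using True by (simp add: angular_op_def[of "cross3 a c"])
  qed (simp add: angular_op_def)
qed

lemma angular_op_antisymmetric: "ip B (angular_op a u) v = - ip B u (angular_op a v)"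
proof -
  have "ip B (angular_op a u) v = (\<Sum>b\<in>B. \<Sum>b'\<in>B. angular_matrix a b b' * u b' * v b)"
    unfolding ip_def angular_op_def by (intro sum.cong) (auto simp: sum_distrib_right)
  also have "\<dots> = (\<Sum>b'\<in>B. \<Sum>b\<in>B. angular_matrix a b b' * u b' * v b)" by (rule sum.swap)
  also have "\<dots> = (\<Sum>b'\<in>B. \<Sum>b\<in>B. - (u b' * (angular_matrix a b' b * v b)))"
    by (intro sum.cong refl) (subst angular_matrix_antisymmetric, auto)
  also have "\<dots> = - ip B u (angular_op a v)"
    unfolding ip_def angular_op_def by (simp add: sum_negf sum_distrib_left)
  finally show ?thesis .
qed

lemma angular_op_lin: "angular_op a (\<lambda>i. s * u i + t * v i) = (\<lambda>i. s * angular_op a u i + t * angular_op a v i)"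
  by (auto simp: angular_op_def fun_eq_iff sum.distrib sum_distrib_left algebra_simps)

lemma so3_action: "cross3 a1 a2 = a3 \<Longrightarrow> cross3 a2 a3 = a1 \<Longrightarrow> cross3 a3 a1 = a2 \<Longrightarrow> so3_action B (angular_op a1) (angular_op a2) (angular_op a3)"
  using angular_op_commutator[of a1 a2] angular_op_commutator[of a2 a3] angular_op_commutator[of a3 a1]
  by unfold_locales (simp_all only: angular_op_lin angular_op_antisymmetric)

definition oriented_frame :: "real^3 \<Rightarrow> real^3 \<Rightarrow> real^3 \<Rightarrow> bool" where
  "oriented_frame e1 e2 p \<longleftrightarrow> norm e1 = 1 \<and> norm e2 = 1 \<and> norm p = 1 \<and> e1 \<bullet> e2 = 0 \<and> e1 \<bullet> p = 0 \<and> e2 \<bullet> p = 0 \<and>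
     cross3 e1 e2 = p \<and> cross3 e2 p = e1 \<and> cross3 p e1 = e2"

text \<open>
  The rotation taking the standard basis to the given frame.
\<close>

definition frame_map :: "real^3 \<Rightarrow> real^3 \<Rightarrow> real^3 \<Rightarrow> real^3 \<Rightarrow> real^3" where
  "frame_map e1 e2 p x = x $ 1 *\<^sub>R e1 + x $ 2 *\<^sub>R e2 + x $ 3 *\<^sub>R p"

lemma frame_map_orthogonal:
  assumes f: "oriented_frame e1 e2 p"
  shows "orthogonal_transformation (frame_map e1 e2 p)"
proof -
  have "linear (frame_map e1 e2 p)" unfolding frame_map_def by (rule linearI) (simp_all add: algebra_simps)
  moreover have "norm (frame_map e1 e2 p x) = norm x" for x
  proof -
    have "frame_map e1 e2 p x \<bullet> frame_map e1 e2 p x = x $ 1 * x $ 1 + x $ 2 * x $ 2 + x $ 3 * x $ 3"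
      using f unfolding frame_map_def oriented_frame_def
      by (simp add: inner_add_left inner_add_right inner_commute[of p e1] inner_commute[of p e2] inner_commute[of e2 e1]
          norm_eq_1)
    then show ?thesis by (simp add: norm_eq_sqrt_inner inner_vec_def sum_3)
  qed
  ultimately show ?thesis by (simp add: orthogonal_transformation)
qed

lemma frame_coordinates:
  assumes f: "oriented_frame e1 e2 p"
  obtains s t u where "h = s *\<^sub>R e1 + t *\<^sub>R e2 + u *\<^sub>R p"
proof -
  obtain x where "h = frame_map e1 e2 p x"
    using orthogonal_transformation_surj[OF frame_map_orthogonal[OF f]] by (metis surjD)
  then show ?thesis using that by (simp add: frame_map_def)
qed

text \<open>
  The trace of the second derivative may be taken in any orthonormal frame, and the radial
  direction does not contribute.
\<close>

lemma trace_frame: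
  assumes f: "oriented_frame e1 e2 p" and b: "b \<in> B"
  shows "d2 b p e1 e1 + d2 b p e2 e2 = - l * b p"
proof -
  let ?R = "frame_map e1 e2 p"
  have p: "norm p = 1" "p \<noteq> 0" using f by (auto simp: oriented_frame_def)
  have Basis3: "(Basis :: (real^3) set) = {axis 1 1, axis 2 1, axis 3 1}"
    by (auto simp: Basis_vec_def UNIV_3)
  have Ra: "?R (axis 1 1) = e1" "?R (axis 2 1) = e2" "?R (axis 3 1) = p" by (simp_all add: frame_map_def axis_def)
  have "(\<Sum>e\<in>Basis. d2 b p (?R e) (?R e)) = - l * b p"
    unfolding trace_orthogonal_invariant[OF frame_map_orthogonal[OF f] bilinear_d2[OF smooth[OF b] p(2)]]
    using in_eigenspace[OF b] p(1) by (simp add: laplace_eigenspace_iff)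
  moreover have "(\<Sum>e\<in>Basis. d2 b p (?R e) (?R e)) = d2 b p e1 e1 + d2 b p e2 e2 + d2 b p p p"
    unfolding Basis3 by (simp add: Ra axis_eq_axis)
  ultimately show ?thesis using d2_radial2[OF smooth[OF b] p(2)] by simp
qed

definition variance :: "real^3 \<Rightarrow> real" where
  "variance p = (\<Sum>b\<in>B. b p * b p)"

text \<open>
  With rotation axes \<open>e2\<close>, \<open>- e1\<close> and \<open>p\<close>, the velocities at \<open>p\<close> are \<open>e1\<close>, \<open>e2\<close> and \<open>0\<close>.  The
  vector of values at \<open>p\<close> is therefore fixed by the third rotation, and the first two map it to
  the gradient; applied twice they yield the Hessian because the corrections are radial.
\<close>

lemma jet_gram:
  assumes f: "oriented_frame e1 e2 p"
  defines "P \<equiv> \<lambda>b. d2 b p e1 e1 - d2 b p e2 e2" and "Q \<equiv> \<lambda>b. 2 * d2 b p e1 e2"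
    and "x \<equiv> \<lambda>b. d1 b p e1" and "y \<equiv> \<lambda>b. d1 b p e2"
  shows "ip B x x = l * variance p / 2" "ip B y y = l * variance p / 2" "ip B x y = 0"
    "ip B (\<lambda>b. b p) x = 0" "ip B (\<lambda>b. b p) y = 0" "ip B (\<lambda>b. b p) P = 0" "ip B (\<lambda>b. b p) Q = 0"
    "ip B x P = 0" "ip B x Q = 0" "ip B y P = 0" "ip B y Q = 0" "ip B P Q = 0"
    "ip B P P = l * (l - 2) * variance p / 2" "ip B Q Q = l * (l - 2) * variance p / 2"
proof -
  have p: "norm p = 1" "p \<noteq> 0" using f by (auto simp: oriented_frame_def)
  have c: "cross3 e1 e2 = p" "cross3 e2 p = e1" "cross3 p e1 = e2" using f by (auto simp: oriented_frame_def)
  have c': "cross3 e2 e1 = - p" "cross3 e1 p = - e2" "cross3 p e2 = - e1"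
    using c by (simp_all add: cross_skew[of e2 e1] cross_skew[of e1 p] cross_skew[of p e2])
  interpret so3_action B "angular_op e2" "angular_op (- e1)" "angular_op p"
    by (rule so3_action) (simp_all add: c c' cross_minus_left cross_minus_right)
  define k where "k b = (if b \<in> B then b p else 0)" for b :: "real^3 \<Rightarrow> real"
  have op1: "angular_op a k b = d1 b p (cross3 a p)" if "b \<in> B" for a b
    unfolding angular_op_def k_def using that angular_expand[OF p(1) that, of a] by (simp add: angular_def)
  have op2: "angular_op a (angular_op c k) b = d2 b p (cross3 a p) (cross3 c p) + d1 b p (cross3 a (cross3 c p))" if "b \<in> B" for a c b
  proof -
    have "angular_op a (angular_op c k) b = (\<Sum>b'\<in>B. angular_matrix a b b' * (\<Sum>b''\<in>B. angular_matrix c b' b'' * b'' p))"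
      unfolding angular_op_def k_def using that by (auto intro!: sum.cong)
    then show ?thesis using angular_matrix_product[OF p(1) that] by simp
  qed
  have lin: "d1 b p (- h) = - d1 b p h" "d1 b p 0 = 0" "d2 b p (- h) g = - d2 b p h g" "d2 b p g (- h) = - d2 b p g h" if "b \<in> B" for b h g
    using linear_neg[OF linear_d1[OF smooth[OF that] p(2)]] linear_0[OF linear_d1[OF smooth[OF that] p(2)]]
      bilinear_lneg[OF bilinear_d2[OF smooth[OF that] p(2)]] bilinear_rneg[OF bilinear_d2[OF smooth[OF that] p(2)]] by auto
  have rad: "d1 b p p = 0" if "b \<in> B" for b by (rule d1_radial[OF smooth[OF that] p(2)])
  have X: "angular_op e2 k b = x b" and Y: "angular_op (- e1) k b = y b" if "b \<in> B" for b
    using that by (simp_all add: op1 x_def y_def c c' cross_minus_left lin)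
  have XX: "angular_op e2 (angular_op e2 k) b = d2 b p e1 e1" and YY: "angular_op (- e1) (angular_op (- e1) k) b = d2 b p e2 e2"
    and XY: "angular_op e2 (angular_op (- e1) k) b = d2 b p e1 e2" if "b \<in> B" for b
    using that by (simp_all add: op2 c c' cross_minus_left cross_minus_right lin rad)
  have Zk: "angular_op p k = (\<lambda>i. 0)"
  proof
    fix b show "angular_op p k b = 0" by (cases "b \<in> B") (simp_all add: op1 lin, simp add: angular_op_def)
  qed
  have Y0: "angular_op (- e1) (\<lambda>i. 0) = (\<lambda>i. 0)" by (simp add: angular_op_def fun_eq_iff)
  have lap: "angular_op e2 (angular_op e2 k) b + angular_op (- e1) (angular_op (- e1) k) b = - l * k b" for b
    using trace_frame[OF f, of b] by (cases "b \<in> B") (simp_all add: XX YY k_def, simp add: angular_op_def)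
  have \<tau>: "ip B k k = variance p" by (simp add: ip_def k_def variance_def)
  have cong: "ip B u v = ip B u' v'" if "\<And>b. b \<in> B \<Longrightarrow> u b = u' b" "\<And>b. b \<in> B \<Longrightarrow> v b = v' b" for u v u' v'
    using that by (simp add: ip_def)
  note G = zonal_vector_gram[OF Zk Y0 lap, unfolded \<tau>]
  have kk: "k b = b p" if "b \<in> B" for b using that by (simp add: k_def)
  have PP: "1 * angular_op e2 (angular_op e2 k) b + (-1) * angular_op (- e1) (angular_op (- e1) k) b = P b" if "b \<in> B" for b
    using that by (simp add: XX YY P_def)
  have QQ: "2 * angular_op e2 (angular_op (- e1) k) b + 0 * k b = Q b" if "b \<in> B" for b
    using that by (simp add: XY Q_def)
  have QQ': "2 * angular_op e2 (angular_op (- e1) k) b + 0 * b p = Q b" if "b \<in> B" for b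
    using that by (simp add: XY Q_def)
  show "ip B x x = l * variance p / 2" by (rule trans[OF cong G(1)]) (simp_all add: X)
  show "ip B y y = l * variance p / 2" by (rule trans[OF cong G(2)]) (simp_all add: Y)
  show "ip B x y = 0" by (rule trans[OF cong G(3)]) (simp_all add: X Y)
  show "ip B (\<lambda>b. b p) x = 0" by (rule trans[OF cong G(4)]) (simp_all add: X kk)
  show "ip B (\<lambda>b. b p) y = 0" by (rule trans[OF cong G(5)]) (simp_all add: Y kk)
  show "ip B (\<lambda>b. b p) P = 0" by (rule trans[OF cong G(6)]) (simp_all only: PP kk)
  show "ip B (\<lambda>b. b p) Q = 0" by (rule trans[OF cong G(7)]) (simp_all only: QQ' kk)
  show "ip B x P = 0" by (rule trans[OF cong G(8)]) (simp_all only: PP X)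
  show "ip B x Q = 0" by (rule trans[OF cong G(9)]) (simp_all only: QQ X)
  show "ip B y P = 0" by (rule trans[OF cong G(10)]) (simp_all only: PP Y)
  show "ip B y Q = 0" by (rule trans[OF cong G(11)]) (simp_all only: QQ Y)
  show "ip B P Q = 0" by (rule trans[OF cong G(12)]) (simp_all only: PP QQ)
  show "ip B P P = l * (l - 2) * variance p / 2" by (rule trans[OF cong G(13)]) (simp_all only: PP)
  show "ip B Q Q = l * (l - 2) * variance p / 2" by (rule trans[OF cong G(14)]) (simp_all only: QQ)
qed

lemma variance_const:
  assumes "norm p = 1" "norm q = 1"
  shows "variance p = variance q"
proof -
  obtain R where "orthogonal_transformation R" "R q = p"
    using orthogonal_transformation_exists[of q p] assms by auto
  then show ?thesis using kernel_rotation_invariant[of R q q] by (simp add: variance_def)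
qed

lemma variance_pos:
  assumes B: "B \<noteq> {}" and p: "norm p = 1"
  shows "variance p > 0"
proof (rule ccontr)
  assume "\<not> variance p > 0"
  then have "variance p = 0" using sum_nonneg[of B "\<lambda>b. b p * b p"] by (simp add: variance_def)
  then have "(\<Sum>b\<in>B. b q * b q) = 0" if "norm q = 1" for q
    using variance_const[OF that p] by (simp add: variance_def)
  then have z: "b q = 0" if "norm q = 1" "b \<in> B" for q b
    using that fin by (subst (asm) sum_nonneg_eq_0_iff) auto
  obtain b where b: "b \<in> B" using B by auto
  have "inner_S2 b b = inner_S2 (\<lambda>x. 0) b" by (rule inner_S2_cong) (simp add: z[OF _ b])
  then show False using b orthonormal by (simp add: orthonormal_S2_def inner_S2_def)
qed

end

section \<open>The stereographic chart\<close>

text \<open>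
  The factor by which the chart scales lengths.
\<close>

definition conformal_factor :: "real^2 \<Rightarrow> real" where "conformal_factor x = 2 / (1 + x \<bullet> x)"

text \<open>
  The inverse of the stereographic projection from \<open>south\<close>, up to the positive factor that normalises the image.  As
  the functions of interest are extended constantly along rays, the polynomial representative
  can be used in place of the point of the sphere.
\<close>

definition chart :: "real^2 \<Rightarrow> real^3" where
  "chart x = vector [2 * x $ 1, 2 * x $ 2, 1 - x \<bullet> x]"

definition chart' :: "real^2 \<Rightarrow> real^2 \<Rightarrow> real^3" where
  "chart' x h = vector [2 * h $ 1, 2 * h $ 2, - 2 * (x \<bullet> h)]"

text \<open>
  Formulas in terms of the conformal factor make all relations between the chart and its frame
  consequences of the single relation \<open>conformal_factor_relation\<close>.
\<close>

definition sphere_chart :: "real^2 \<Rightarrow> real^3" where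
  "sphere_chart x = vector [x $ 1 * conformal_factor x, x $ 2 * conformal_factor x, conformal_factor x - 1]"

text \<open>
  The normalised coordinate directions of the chart, see \<open>chart'_frame\<close>.
\<close>

definition frame1 :: "real^2 \<Rightarrow> real^3" where
  "frame1 x = vector [1 - (x $ 1)\<^sup>2 * conformal_factor x, - (x $ 1 * x $ 2 * conformal_factor x), - (x $ 1 * conformal_factor x)]"

definition frame2 :: "real^2 \<Rightarrow> real^3" where
  "frame2 x = vector [- (x $ 1 * x $ 2 * conformal_factor x), 1 - (x $ 2)\<^sup>2 * conformal_factor x, - (x $ 2 * conformal_factor x)]"

lemma inner_2: "x \<bullet> y = x $ 1 * y $ 1 + x $ 2 * (y $ 2 :: real)" for x y :: "real^2"
  by (simp add: inner_vec_def sum_2)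

lemma conformal_factor_pos: "conformal_factor x > 0"
  unfolding conformal_factor_def by (intro divide_pos_pos add_pos_nonneg) auto

lemma conformal_factor_relation: "conformal_factor x * (1 + (x $ 1)\<^sup>2 + (x $ 2)\<^sup>2) = 2"
proof -
  have "1 + x \<bullet> x > 0" by (intro add_pos_nonneg) auto
  then have "1 + x \<bullet> x \<noteq> 0" by simp
  then have "conformal_factor x * (1 + x \<bullet> x) = 2" by (rule nonzero_eq_divide_eq[THEN iffD1]) (rule conformal_factor_def)
  then show ?thesis by (simp add: inner_2 power2_eq_square algebra_simps)
qed

lemma chart_scale: "chart x = (2 / conformal_factor x) *\<^sub>R sphere_chart x"
proof -
  have "1 - x \<bullet> x = 2 / conformal_factor x * (conformal_factor x - 1)"
    using conformal_factor_relation[of x] conformal_factor_pos[of x] by (simp add: inner_2 field_simps power2_eq_square)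
  then show ?thesis using conformal_factor_pos[of x]
    by (simp add: vec_eq_iff forall_3 chart_def sphere_chart_def)
qed

lemma chart'_frame:
  "chart' x (axis 1 1) = 2 *\<^sub>R frame1 x + (2 * x $ 1) *\<^sub>R sphere_chart x"
  "chart' x (axis 2 1) = 2 *\<^sub>R frame2 x + (2 * x $ 2) *\<^sub>R sphere_chart x"
  by (simp_all add: vec_eq_iff forall_3 chart'_def sphere_chart_def frame1_def frame2_def inner_2 axis_def
      power2_eq_square algebra_simps)

lemma (in eigenbasis) chart_frame: "oriented_frame (frame1 x) (frame2 x) (sphere_chart x)"
proof -
  obtain a b q where eq: "x $ 1 = a" "x $ 2 = b" "conformal_factor x = q" by blast
  have r: "q * (1 + a\<^sup>2 + b\<^sup>2) = 2" using conformal_factor_relation[of x] unfolding eq .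
  have m: "q * t + a * a * q * t + b * b * q * t = 2 * t" for t
    using arg_cong[OF r, of "\<lambda>z. z * t"] by (simp add: power2_eq_square algebra_simps)
  show ?thesis
    unfolding oriented_frame_def norm_eq_1 frame1_def frame2_def sphere_chart_def eq inner_vec_def sum_3 cross3_def vec_eq_iff forall_3
      vector_3 inner_real_def
    using m[of 1] m[of "a * a * q"] m[of "b * b * q"] m[of q] m[of "a * b * q"] m[of "a * q"] m[of "b * q"]
    by (intro conjI; simp only: power2_eq_square algebra_simps mult_minus_left mult_minus_right minus_minus mult_1_left mult_1_right; linarith)
qed

lemma norm_sphere_chart: "norm (sphere_chart x) = 1"
proof -
  obtain a b q where eq: "x $ 1 = a" "x $ 2 = b" "conformal_factor x = q" by blast
  have r: "q * (1 + a\<^sup>2 + b\<^sup>2) = 2" using conformal_factor_relation[of x] unfolding eq .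
  show ?thesis
    unfolding norm_eq_1 sphere_chart_def eq inner_vec_def sum_3 vector_3 inner_real_def
    using arg_cong[OF r, of "\<lambda>z. z * q"] by (simp only: power2_eq_square algebra_simps; linarith)
qed

lemma chart_nonzero: "chart x \<noteq> 0" "sphere_chart x \<noteq> 0"
proof -
  show s: "sphere_chart x \<noteq> 0" using norm_sphere_chart[of x] by auto
  then show "chart x \<noteq> 0" using conformal_factor_pos[of x] by (simp add: chart_scale)
qed

lemma vector3_eq: "vector [a, b, c] = a *\<^sub>R axis 1 1 + b *\<^sub>R axis 2 1 + c *\<^sub>R (axis 3 1 :: real^3)"
  by (simp add: vec_eq_iff forall_3 axis_def)

lemma chart_has_derivative: "(chart has_derivative chart' x) (at x)"
  unfolding chart_def[abs_def] chart'_def[abs_def] vector3_eq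
  by (rule has_derivative_eq_rhs, (rule derivative_intros bounded_linear_imp_has_derivative bounded_linear_vec_nth)+)
     (simp add: fun_eq_iff inner_commute)

lemma chart'_has_derivative: "((\<lambda>x. chart' x e) has_derivative (\<lambda>h. vector [0, 0, - 2 * (h \<bullet> e)])) (at x)"
  unfolding chart'_def vector3_eq
  by (rule has_derivative_eq_rhs, (rule derivative_intros)+) (simp add: fun_eq_iff)

definition south :: "real^3" where "south = vector [0, 0, - 1]"

lemma sphere_chart_inj: "inj sphere_chart"
proof (rule injI)
  fix x y assume a: "sphere_chart x = sphere_chart y"
  have eq1: "conformal_factor x = conformal_factor y" using arg_cong[OF a, of "\<lambda>v. v $ 3"] by (simp add: sphere_chart_def)
  have eq: "x $ 1 * conformal_factor x = y $ 1 * conformal_factor y" "x $ 2 * conformal_factor x = y $ 2 * conformal_factor y"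
    using arg_cong[OF a, of "\<lambda>v. v $ 1"] arg_cong[OF a, of "\<lambda>v. v $ 2"]
    unfolding sphere_chart_def vector_3 .
  have "conformal_factor y \<noteq> 0" using conformal_factor_pos[of y] by simp
  with eq have "x $ 1 = y $ 1" "x $ 2 = y $ 2" unfolding eq1 by simp_all
  then show "x = y" by (simp add: vec_eq_iff forall_2)
qed

lemma sphere_chart_range: "sphere 0 1 = insert south (range sphere_chart)" "south \<notin> range sphere_chart"
proof -
  show "south \<notin> range sphere_chart"
  proof
    assume "south \<in> range sphere_chart"
    then obtain x where "south = sphere_chart x" by auto
    then have "conformal_factor x = 0" by (simp add: south_def sphere_chart_def vec_eq_iff forall_3)
    then show False using conformal_factor_pos[of x] by simp
  qed
  have "p \<in> range sphere_chart" if p: "norm p = 1" "p \<noteq> south" for p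
  proof -
    have n: "p $ 1 * p $ 1 + p $ 2 * p $ 2 + p $ 3 * p $ 3 = 1"
      using p(1) by (simp add: norm_eq_1 inner_vec_def sum_3)
    define q where "q = 1 + p $ 3"
    have q0: "q \<noteq> 0"
    proof
      assume "q = 0"
      then have p3: "p $ 3 = - 1" by (simp add: q_def)
      then have "p $ 1 * p $ 1 + p $ 2 * p $ 2 = 0" using n by simp
      then have "p $ 1 = 0 \<and> p $ 2 = 0" using sum_squares_eq_zero_iff by blast
      then show False using p(2) p3 by (simp add: south_def vec_eq_iff forall_3)
    qed
    define x :: "real^2" where "x = vector [p $ 1 / q, p $ 2 / q]"
    have "(1 + x \<bullet> x) * (q * q) = 2 * q"
    proof -
      have "(1 + x \<bullet> x) * (q * q) = q * q + (p $ 1 * p $ 1 + p $ 2 * p $ 2)"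
        using q0 by (simp add: x_def inner_2 distrib_right)
      also have "p $ 1 * p $ 1 + p $ 2 * p $ 2 = 1 - p $ 3 * p $ 3" using n by simp
      finally show ?thesis by (simp add: q_def algebra_simps)
    qed
    then have "(1 + x \<bullet> x) * q = 2" using q0 by simp
    then have "conformal_factor x = q" unfolding conformal_factor_def using q0 by (metis mult_zero_left nonzero_mult_div_cancel_left zero_neq_numeral)
    then have "sphere_chart x = p" using q0
      by (simp add: sphere_chart_def x_def vec_eq_iff forall_3 q_def)
    then show ?thesis by auto
  qed
  moreover have "norm south = 1" by (simp add: south_def norm_eq_1 inner_vec_def sum_3)
  ultimately show "sphere 0 1 = insert south (range sphere_chart)"
    using norm_sphere_chart by (intro set_eqI iffI) (fastforce, auto)
qed

lemma measurable_conformal_factor: "(\<lambda>x. ennreal ((conformal_factor x)\<^sup>2)) \<in> borel_measurable borel"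
proof -
  have "1 + x \<bullet> x \<noteq> 0" for x :: "real^2" using inner_ge_zero[of x] by linarith
  then have "continuous_on UNIV (\<lambda>x. (conformal_factor x)\<^sup>2)" unfolding conformal_factor_def by (intro continuous_intros) auto
  from borel_measurable_continuous_onI[OF this] show ?thesis by simp
qed

text \<open>
  The area of the sphere, as the squared conformal factor is the Jacobian of the chart.
\<close>

lemma nn_integral_conformal_factor: "(\<integral>\<^sup>+ x. ennreal ((conformal_factor x)\<^sup>2) \<partial>lborel) = ennreal (4 * pi)"
proof -
  define g where "g r = ennreal (4 / (1 + r)\<^sup>2)" for r :: real
  have gm: "g \<in> borel_measurable borel" unfolding g_def by measurable
  have "(\<integral>\<^sup>+ x. ennreal ((conformal_factor x)\<^sup>2) \<partial>lborel) = (\<integral>\<^sup>+ s. \<integral>\<^sup>+ t. g (s\<^sup>2 + t\<^sup>2) \<partial>lborel \<partial>lborel)"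
  proof -
    from nn_integral_vec2[OF measurable_conformal_factor] show ?thesis
      by (simp add: conformal_factor_def g_def inner_2 axis_def power2_eq_square)
  qed
  also have "\<dots> = ennreal pi * (\<integral>\<^sup>+ r. g r * indicator {0..} r \<partial>lborel)" by (rule nn_integral_norm_square[OF gm])
  also have "(\<integral>\<^sup>+ r. g r * indicator {0..} r \<partial>lborel) = ennreal (0 - (- 4 / (1 + 0)))"
    unfolding g_def
  proof (rule nn_integral_FTC_atLeast)
    show "((\<lambda>r. - 4 / (1 + r)) has_real_derivative 4 / (1 + x)\<^sup>2) (at x)" if "0 \<le> x" for x :: real
      using that by (auto intro!: derivative_eq_intros simp: power2_eq_square)
    show "((\<lambda>r::real. - 4 / (1 + r)) \<longlongrightarrow> 0) at_top"
      by (rule tendsto_divide_0[OF tendsto_const]) (auto intro!: filterlim_at_top_imp_at_infinity filterlim_tendsto_add_at_top[OF tendsto_const] filterlim_ident)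
  qed auto
  also have "ennreal pi * ennreal (0 - (- 4 / (1 + 0))) = ennreal (pi * (0 - (- 4 / (1 + 0))))"
    by (rule ennreal_mult'[symmetric]) simp
  also have "pi * (0 - (- 4 / (1 + 0))) = 4 * pi" by simp
  finally show ?thesis .
qed

context eigenbasis begin

lemma d1_lin_comb:
  assumes "p \<noteq> 0"
  shows "d1 (lin_comb B c) p h = (\<Sum>b\<in>B. c b * d1 b p h)"
proof -
  have "(radial_ext (lin_comb B c) has_derivative (\<lambda>h. \<Sum>b\<in>B. c b * d1 b p h)) (at p)"
  proof -
    have "((\<lambda>x. \<Sum>b\<in>B. c b * radial_ext b x) has_derivative (\<lambda>h. \<Sum>b\<in>B. c b * d1 b p h)) (at p)"
      by (rule has_derivative_sum, rule has_derivative_mult_right[OF has_d1[OF smooth assms]])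
    moreover have "radial_ext (lin_comb B c) = (\<lambda>x. \<Sum>b\<in>B. c b * radial_ext b x)"
      by (simp add: radial_ext_def lin_comb_def fun_eq_iff)
    ultimately show ?thesis by simp
  qed
  from fun_cong[OF frechet_derivative_at[OF this], of h] show ?thesis by (rule sym)
qed

lemma lin_comb_critical_iff:
  assumes "p \<noteq> 0"
  shows "grad_S2 (lin_comb B c) p = 0 \<longleftrightarrow> (\<forall>h. (\<Sum>b\<in>B. c b * d1 b p h) = 0)"
proof -
  have "lin_comb B c \<in> laplace_eigenspace l" unfolding lin_comb_def by (rule laplace_eigenspace_sum[OF fin in_eigenspace])
  then have "smooth_on_S2 (lin_comb B c)" by (simp add: laplace_eigenspace_iff)
  from grad_S2_eq_0_iff[OF this assms] show ?thesis by (simp add: d1_lin_comb[OF assms])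
qed

text \<open>
  The differential of a function in the coordinates of the chart.
\<close>

definition gradient_field :: "(real^3 \<Rightarrow> real) \<Rightarrow> real^2 \<Rightarrow> real^2" where
  "gradient_field b x = (\<chi> i. d1 b (chart x) (chart' x (axis i 1)))"

definition gradient_field' :: "(real^3 \<Rightarrow> real) \<Rightarrow> real^2 \<Rightarrow> real^2 \<Rightarrow> real^2" where
  "gradient_field' b x h = (\<chi> i. d2 b (chart x) (chart' x (axis i 1)) (chart' x h) + d1 b (chart x) (vector [0, 0, - 2 * (h \<bullet> axis i 1)]))"

lemma continuous_chart: "continuous_on S chart" "continuous_on S (\<lambda>x. chart' x h)"
  by (rule continuous_at_imp_continuous_on, rule ballI, rule has_derivative_continuous[OF chart_has_derivative])
     (rule continuous_at_imp_continuous_on, rule ballI, rule has_derivative_continuous[OF chart'_has_derivative])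

sublocale linear_field B gradient_field gradient_field'
proof
  show "finite B" by (rule fin)
  show "(gradient_field b has_derivative gradient_field' b x) (at x)" if b: "b \<in> B" for b x
    unfolding has_derivative_componentwise_within[of "gradient_field b"]
  proof
    fix i :: "real^2" assume "i \<in> Basis"
    then obtain k where i: "i = axis k 1" by (auto simp: Basis_vec_def)
    have "((\<lambda>x. d1 b (chart x) (chart' x (axis k 1))) has_derivative
       (\<lambda>h. d2 b (chart x) (chart' x (axis k 1)) (chart' x h) + d1 b (chart x) (vector [0, 0, - 2 * (h \<bullet> axis k 1)]))) (at x)"
      by (rule has_derivative_d1_along[OF smooth[OF b] chart_has_derivative chart'_has_derivative, of UNIV]) (simp_all add: chart_nonzero)
    then show "((\<lambda>x. gradient_field b x \<bullet> i) has_derivative (\<lambda>h. gradient_field' b x h \<bullet> i)) (at x)"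
      unfolding i by (simp add: gradient_field_def gradient_field'_def inner_axis)
  qed
  show "continuous_on UNIV (\<lambda>x. gradient_field' b x h)" if b: "b \<in> B" for b h
    unfolding gradient_field'_def
  proof (rule continuous_on_vec_lambda)
    fix k :: 2
    have s: "smooth_on_S2 b" by (rule smooth[OF b])
    have e2: "d2 b (chart x) (chart' x (axis k 1)) (chart' x h) =
       (\<Sum>d\<in>Basis. (chart' x (axis k 1) \<bullet> d) * (\<Sum>e\<in>Basis. (chart' x h \<bullet> e) * d2 b (chart x) d e))" for x
    proof -
      have l1: "linear (\<lambda>d. d2 b (chart x) d g)" and l2: "linear (d2 b (chart x) g)" for g
        using bilinear_d2[OF s chart_nonzero(1)] by (simp_all add: bilinear_def)
      have r: "d2 b (chart x) g (chart' x h) = (\<Sum>e\<in>Basis. (chart' x h \<bullet> e) * d2 b (chart x) g e)" for g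
      proof -
        have "d2 b (chart x) g (chart' x h) = d2 b (chart x) g (\<Sum>e\<in>Basis. (chart' x h \<bullet> e) *\<^sub>R e)" by (simp only: euclidean_representation)
        then show ?thesis by (simp add: linear_sum[OF l2] linear_cmul[OF l2])
      qed
      have "d2 b (chart x) (chart' x (axis k 1)) g = (\<Sum>d\<in>Basis. (chart' x (axis k 1) \<bullet> d) * d2 b (chart x) d g)" for g
      proof -
        have "d2 b (chart x) (chart' x (axis k 1)) g = d2 b (chart x) (\<Sum>d\<in>Basis. (chart' x (axis k 1) \<bullet> d) *\<^sub>R d) g" by (simp only: euclidean_representation)
        then show ?thesis by (simp add: linear_sum[OF l1] linear_cmul[OF l1])
      qed
      from this[of "chart' x h"] show ?thesis unfolding r .
    qed
    have c2: "continuous_on UNIV (\<lambda>x. d2 b (chart x) d e)" for d e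
      by (rule continuous_on_compose2[OF continuous_d2[OF s] continuous_chart(1)]) (use chart_nonzero in auto)
    have c1: "continuous_on UNIV (\<lambda>x. d1 b (chart x) e)" for e
      by (rule continuous_on_compose2[OF continuous_d1[OF s] continuous_chart(1)]) (use chart_nonzero in auto)
    show "continuous_on UNIV (\<lambda>x. d2 b (chart x) (chart' x (axis k 1)) (chart' x h) + d1 b (chart x) (vector [0, 0, - 2 * (h \<bullet> axis k 1)]))"
      unfolding e2 by (intro continuous_intros c1 c2 continuous_chart)
  qed
qed

lemma gradient_field_frame:
  assumes "b \<in> B"
  shows "gradient_field b x $ 1 = conformal_factor x * d1 b (sphere_chart x) (frame1 x)" "gradient_field b x $ 2 = conformal_factor x * d1 b (sphere_chart x) (frame2 x)"
proof -
  let ?p = "sphere_chart x"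
  have l: "linear (d1 b ?p)" by (rule linear_d1[OF smooth[OF assms] chart_nonzero(2)])
  have s: "d1 b (chart x) h = d1 b ?p h / (2 / conformal_factor x)" for h
    unfolding chart_scale by (rule d1_scale[OF smooth[OF assms] chart_nonzero(2)]) (use conformal_factor_pos[of x] in simp)
  have "d1 b ?p (2 *\<^sub>R h + t *\<^sub>R ?p) = 2 * d1 b ?p h" for h t
    by (simp add: linear_add[OF l] linear_cmul[OF l] d1_radial[OF smooth[OF assms] chart_nonzero(2)])
  then show "gradient_field b x $ 1 = conformal_factor x * d1 b ?p (frame1 x)" "gradient_field b x $ 2 = conformal_factor x * d1 b ?p (frame2 x)"
    using conformal_factor_pos[of x] by (simp_all add: gradient_field_def s chart'_frame)
qed

lemma F_zero_iff: "F c x = 0 \<longleftrightarrow> (\<forall>h. (\<Sum>b\<in>B. c b * d1 b (sphere_chart x) h) = 0)"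
proof -
  let ?p = "sphere_chart x"
  have comp: "F c x $ 1 = conformal_factor x * (\<Sum>b\<in>B. c b * d1 b ?p (frame1 x))" "F c x $ 2 = conformal_factor x * (\<Sum>b\<in>B. c b * d1 b ?p (frame2 x))"
    unfolding F_component sum_distrib_left by (auto intro!: sum.cong simp: gradient_field_frame)
  have iff: "F c x = 0 \<longleftrightarrow> (\<Sum>b\<in>B. c b * d1 b ?p (frame1 x)) = 0 \<and> (\<Sum>b\<in>B. c b * d1 b ?p (frame2 x)) = 0"
    using conformal_factor_pos[of x] by (simp add: vec_eq_iff forall_2 comp)
  show ?thesis
  proof
    assume "F c x = 0"
    then have z: "(\<Sum>b\<in>B. c b * d1 b ?p (frame1 x)) = 0" "(\<Sum>b\<in>B. c b * d1 b ?p (frame2 x)) = 0" using iff by auto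
    show "\<forall>h. (\<Sum>b\<in>B. c b * d1 b ?p h) = 0"
    proof
      fix h
      obtain s t u where h: "h = s *\<^sub>R frame1 x + t *\<^sub>R frame2 x + u *\<^sub>R ?p" by (rule frame_coordinates[OF chart_frame])
      have "c b * d1 b ?p h = s * (c b * d1 b ?p (frame1 x)) + t * (c b * d1 b ?p (frame2 x))" if "b \<in> B" for b
        using linear_d1[OF smooth[OF that] chart_nonzero(2)[of x]] unfolding h
        by (simp add: linear_add linear_cmul d1_radial[OF smooth[OF that] chart_nonzero(2)] algebra_simps)
      then have "(\<Sum>b\<in>B. c b * d1 b ?p h) = s * (\<Sum>b\<in>B. c b * d1 b ?p (frame1 x)) + t * (\<Sum>b\<in>B. c b * d1 b ?p (frame2 x))"
        by (simp add: sum.distrib sum_distrib_left)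
      then show "(\<Sum>b\<in>B. c b * d1 b ?p h) = 0" by (simp add: z)
    qed
  next
    assume "\<forall>h. (\<Sum>b\<in>B. c b * d1 b ?p h) = 0"
    then show "F c x = 0" using iff by simp
  qed
qed

lemma num_critical_points_eq:
  "num_critical_points (lin_comb B c) = zeros c UNIV + of_bool (grad_S2 (lin_comb B c) south = 0)"
proof -
  let ?S = "{p \<in> sphere 0 1. grad_S2 (lin_comb B c) p = 0}"
  let ?A = "sphere_chart ` {x. F c x = 0}" and ?B = "if grad_S2 (lin_comb B c) south = 0 then {south} else {}"
  have "F c x = 0 \<longleftrightarrow> grad_S2 (lin_comb B c) (sphere_chart x) = 0" for x
    unfolding F_zero_iff lin_comb_critical_iff[OF chart_nonzero(2)] ..
  then have S: "?S = ?A \<union> ?B" unfolding sphere_chart_range(1) by auto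
  have "emeasure (count_space UNIV) ?S = emeasure (count_space UNIV) ?A + emeasure (count_space UNIV) ?B"
    unfolding S by (rule plus_emeasure[symmetric]) (use sphere_chart_range(2) in auto)
  also have "emeasure (count_space UNIV) ?A = zeros c UNIV"
    unfolding zeros_def using inj_on_subset[OF sphere_chart_inj subset_UNIV, of "{x. F c x = 0}"]
    by (simp add: emeasure_count_space finite_image_iff card_image)
  also have "emeasure (count_space UNIV) ?B = of_bool (grad_S2 (lin_comb B c) south = 0)" by simp
  finally show ?thesis by (simp add: num_critical_points_def)
qed

end

section \<open>The mean number of critical points\<close>

context eigenbasis begin

text \<open>
  The Jacobian of the gradient field at a critical point: the determinant of a symmetric matrix is
  a quarter of the squared trace minus a quarter of the squares of the two trace-free components,
  and the trace is \<open>- l\<close> times the value of the function.  The power of the conformal factor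
  comes from the normalisation of the frame.  This expression makes sense for all
  coefficients and is independent of the gradient.
\<close>

definition critical_hessian_det :: "real^2 \<Rightarrow> ((real^3 \<Rightarrow> real) \<Rightarrow> real) \<Rightarrow> real" where
  "critical_hessian_det x c = (conformal_factor x) ^ 4 * (l\<^sup>2 / 4 * (\<Sum>b\<in>B. b (sphere_chart x) * c b)\<^sup>2 -
     ((\<Sum>b\<in>B. (d2 b (sphere_chart x) (frame1 x) (frame1 x) - d2 b (sphere_chart x) (frame2 x) (frame2 x)) * c b)\<^sup>2 +
      (\<Sum>b\<in>B. (2 * d2 b (sphere_chart x) (frame1 x) (frame2 x)) * c b)\<^sup>2) / 4)"

text \<open>
  At a critical point the derivatives of the chart beyond the frame vectors drop out: the second
  derivatives of the chart multiply first derivatives of the function, and so do the radial parts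
  of its first derivatives.
\<close>

lemma det_at_critical_point:
  assumes z: "F c x = 0"
  shows "det (matrix (F' c x)) = critical_hessian_det x c"
proof -
  let ?p = "sphere_chart x" and ?e = "frame1 x" and ?f = "frame2 x"
  define H where "H g h = (\<Sum>b\<in>B. c b * d2 b ?p g h)" for g h
  have z1: "(\<Sum>b\<in>B. c b * d1 b ?p h) = 0" for h using z unfolding F_zero_iff by blast
  have z2: "(\<Sum>b\<in>B. c b * d1 b (chart x) h) = 0" for h
  proof -
    have "(\<Sum>b\<in>B. c b * d1 b (chart x) h) = (\<Sum>b\<in>B. c b * d1 b ?p h) / (2 / conformal_factor x)"
      unfolding chart_scale sum_divide_distrib
      by (intro sum.cong refl, subst d1_scale[OF smooth chart_nonzero(2)]) (use conformal_factor_pos[of x] in auto)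
    then show ?thesis by (simp add: z1)
  qed
  have sc: "d2 b (chart x) g h = d2 b ?p g h * (conformal_factor x)\<^sup>2 / 4" if "b \<in> B" for b g h
    unfolding chart_scale using conformal_factor_pos[of x]
    by (subst d2_scale[OF smooth[OF that] chart_nonzero(2)]) (auto simp: power_divide)
  have ent: "(\<Sum>b\<in>B. c b * d2 b (chart x) (2 *\<^sub>R g + s *\<^sub>R ?p) (2 *\<^sub>R h + t *\<^sub>R ?p)) = (conformal_factor x)\<^sup>2 * H g h" for g h s t
  proof -
    have bl: "d2 b (chart x) (2 *\<^sub>R g + s *\<^sub>R ?p) (2 *\<^sub>R h + t *\<^sub>R ?p) =
       (conformal_factor x)\<^sup>2 * d2 b ?p g h - (conformal_factor x)\<^sup>2 * t / 2 * d1 b ?p g - (conformal_factor x)\<^sup>2 * s / 2 * d1 b ?p h" if b: "b \<in> B" for b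
    proof -
      note bil = bilinear_d2[OF smooth[OF b] chart_nonzero(2)[of x]]
      have r: "d2 b ?p g ?p = - d1 b ?p g" for g by (rule d2_radial[OF smooth[OF b] chart_nonzero(2)])
      have r': "d2 b ?p ?p h = - d1 b ?p h"
        using d2_symmetric[OF smooth[OF b] chart_nonzero(2)[of x], of ?p h] r by simp
      have r'': "d1 b ?p ?p = 0" by (rule d1_radial[OF smooth[OF b] chart_nonzero(2)])
      show ?thesis unfolding sc[OF b]
        by (simp add: bilinear_ladd[OF bil] bilinear_radd[OF bil] bilinear_lmul[OF bil] bilinear_rmul[OF bil] r r' r''
            linear_add[OF linear_d1[OF smooth[OF b] chart_nonzero(2)]] linear_cmul[OF linear_d1[OF smooth[OF b] chart_nonzero(2)]])
           (simp add: algebra_simps)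
    qed
    have "(\<Sum>b\<in>B. c b * d2 b (chart x) (2 *\<^sub>R g + s *\<^sub>R ?p) (2 *\<^sub>R h + t *\<^sub>R ?p)) =
      (\<Sum>b\<in>B. (conformal_factor x)\<^sup>2 * (c b * d2 b ?p g h) - (conformal_factor x)\<^sup>2 * t / 2 * (c b * d1 b ?p g) - (conformal_factor x)\<^sup>2 * s / 2 * (c b * d1 b ?p h))"
      by (intro sum.cong refl) (simp add: bl right_diff_distrib mult_ac)
    also have "\<dots> = (conformal_factor x)\<^sup>2 * H g h - (conformal_factor x)\<^sup>2 * t / 2 * (\<Sum>b\<in>B. c b * d1 b ?p g) - (conformal_factor x)\<^sup>2 * s / 2 * (\<Sum>b\<in>B. c b * d1 b ?p h)"
      unfolding sum_subtractf sum_distrib_left[symmetric] H_def ..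
    finally show ?thesis by (simp add: z1)
  qed
  have mat: "matrix (F' c x) $ i $ j = (\<Sum>b\<in>B. c b * d2 b (chart x) (chart' x (axis i 1)) (chart' x (axis j 1)))" for i j
  proof -
    have "matrix (F' c x) $ i $ j = (\<Sum>b\<in>B. c b * d2 b (chart x) (chart' x (axis i 1)) (chart' x (axis j 1)))
        + (\<Sum>b\<in>B. c b * d1 b (chart x) (vector [0, 0, - 2 * (axis j 1 \<bullet> axis i (1::real))]))"
      unfolding sum.distrib[symmetric]
      by (simp add: matrix_def F'_def gradient_field'_def distrib_left)
    then show ?thesis by (simp only: z2 add_0_right)
  qed
  have H: "H ?f ?e = H ?e ?f"
    unfolding H_def by (intro sum.cong refl) (simp add: d2_symmetric[OF smooth chart_nonzero(2), of _ x ?f ?e])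
  have tr: "H ?e ?e + H ?f ?f = - l * (\<Sum>b\<in>B. b ?p * c b)"
    unfolding H_def sum.distrib[symmetric] sum_distrib_left
    by (intro sum.cong refl) (simp only: distrib_left[symmetric] trace_frame[OF chart_frame], simp)
  have P: "(\<Sum>b\<in>B. (d2 b ?p ?e ?e - d2 b ?p ?f ?f) * c b) = H ?e ?e - H ?f ?f"
    unfolding H_def sum_subtractf[symmetric] by (simp add: algebra_simps)
  have Q: "(\<Sum>b\<in>B. (2 * d2 b ?p ?e ?f) * c b) = 2 * H ?e ?f"
    unfolding H_def sum_distrib_left by (simp add: mult_ac)
  have v: "l\<^sup>2 * (\<Sum>b\<in>B. b ?p * c b)\<^sup>2 = (H ?e ?e + H ?f ?f)\<^sup>2" unfolding tr by (simp add: power_mult_distrib)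
  have "det (matrix (F' c x)) = ((conformal_factor x)\<^sup>2 * H ?e ?e) * ((conformal_factor x)\<^sup>2 * H ?f ?f) - ((conformal_factor x)\<^sup>2 * H ?e ?f) * ((conformal_factor x)\<^sup>2 * H ?e ?f)"
    unfolding det_2 mat chart'_frame ent H ..
  also have "\<dots> = conformal_factor x ^ 4 * (H ?e ?e * H ?f ?f - H ?e ?f * H ?e ?f)"
    by (simp add: power2_eq_square power4_eq_xxxx algebra_simps)
  also have "H ?e ?e * H ?f ?f - H ?e ?f * H ?e ?f = (H ?e ?e + H ?f ?f)\<^sup>2 / 4 - ((H ?e ?e - H ?f ?f)\<^sup>2 + (2 * H ?e ?f)\<^sup>2) / 4"
    by (simp add: power2_eq_square field_simps)
  also have "\<dots> = l\<^sup>2 / 4 * (\<Sum>b\<in>B. b ?p * c b)\<^sup>2 - ((H ?e ?e - H ?f ?f)\<^sup>2 + (2 * H ?e ?f)\<^sup>2) / 4"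
    unfolding v[symmetric] by simp
  finally show ?thesis unfolding critical_hessian_det_def P Q .
qed

text \<open>
  The determinant as a quadratic form in orthonormal Gaussian variables; \<open>r\<close> is a normalised
  gradient component.
\<close>

lemma critical_hessian_det_normalised:
  assumes \<tau>: "variance (sphere_chart x) = \<tau>" "\<tau> > 0" and l: "l > 2"
  obtains k p q r :: "(real^3 \<Rightarrow> real) \<Rightarrow> real"
  where "ip B k k = 1" "ip B p p = 1" "ip B q q = 1" "ip B r r = 1" "ip B k p = 0" "ip B k q = 0" "ip B k r = 0" "ip B p q = 0"
    "\<And>c. critical_hessian_det x c = (conformal_factor x ^ 4 * (l\<^sup>2 * \<tau> / 4)) * (\<Sum>i\<in>B. k i * c i)\<^sup>2 -
       (conformal_factor x ^ 4 * (l * (l - 2) * \<tau> / 8)) * ((\<Sum>i\<in>B. p i * c i)\<^sup>2 + (\<Sum>i\<in>B. q i * c i)\<^sup>2)"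
proof -
  let ?s = "sphere_chart x" and ?e = "frame1 x" and ?f = "frame2 x"
  define \<omega> where "\<omega> = l * (l - 2) * \<tau> / 2"
  define \<mu> where "\<mu> = l * \<tau> / 2"
  have pos: "\<omega> > 0" "\<mu> > 0" using \<tau>(2) l by (simp_all add: \<omega>_def \<mu>_def)
  note G = jet_gram[OF chart_frame[of x], unfolded \<tau>(1), folded \<omega>_def \<mu>_def]
  let ?K = "\<lambda>b. b ?s" and ?P = "\<lambda>b. d2 b ?s ?e ?e - d2 b ?s ?f ?f" and ?Q = "\<lambda>b. 2 * d2 b ?s ?e ?f" and ?R = "\<lambda>b. d1 b ?s ?e"
  define k where "k = (\<lambda>b. ?K b / sqrt \<tau>)"
  define p where "p = (\<lambda>b. ?P b / sqrt \<omega>)"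
  define q where "q = (\<lambda>b. ?Q b / sqrt \<omega>)"
  define r where "r = (\<lambda>b. ?R b / sqrt \<mu>)"
  have ipd: "ip B (\<lambda>b. u b / s) (\<lambda>b. v b / t) = ip B u v / (s * t)" for u v s t
    by (simp add: ip_def sum_divide_distrib)
  have lin: "(\<Sum>i\<in>B. u i * c i)\<^sup>2 = t * (\<Sum>i\<in>B. (u i / sqrt t) * c i)\<^sup>2" if "t > 0" for u c t
  proof -
    have "(\<Sum>i\<in>B. (u i / sqrt t) * c i) = (\<Sum>i\<in>B. u i * c i) / sqrt t" by (simp add: sum_divide_distrib)
    then show ?thesis using that by (simp add: power_divide)
  qed
  have kk: "ip B ?K ?K = \<tau>" using \<tau>(1) by (simp add: ip_def variance_def)
  have "critical_hessian_det x c = (conformal_factor x ^ 4 * (l\<^sup>2 * \<tau> / 4)) * (\<Sum>i\<in>B. k i * c i)\<^sup>2 -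
       (conformal_factor x ^ 4 * (l * (l - 2) * \<tau> / 8)) * ((\<Sum>i\<in>B. p i * c i)\<^sup>2 + (\<Sum>i\<in>B. q i * c i)\<^sup>2)" for c
  proof -
    have "critical_hessian_det x c = conformal_factor x ^ 4 * (l\<^sup>2 / 4 * (\<tau> * (\<Sum>i\<in>B. k i * c i)\<^sup>2) - (\<omega> * (\<Sum>i\<in>B. p i * c i)\<^sup>2 + \<omega> * (\<Sum>i\<in>B. q i * c i)\<^sup>2) / 4)"
      unfolding critical_hessian_det_def k_def p_def q_def lin[OF \<tau>(2), symmetric] lin[OF pos(1), symmetric] ..
    then show ?thesis by (simp add: \<omega>_def field_simps)
  qed
  moreover have "ip B k k = 1 \<and> ip B p p = 1 \<and> ip B q q = 1 \<and> ip B r r = 1 \<and> ip B k p = 0 \<and> ip B k q = 0 \<and> ip B k r = 0 \<and> ip B p q = 0"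
    unfolding k_def p_def q_def r_def ipd using G kk pos \<tau>(2) by simp
  ultimately show ?thesis using that[of k p q r] by blast
qed

definition expected_count :: real where
  "expected_count = 2 + 2 * (l - 2) * sqrt ((l - 2) / (3 * l - 2))"

lemma ennreal_mult_lin: "a \<ge> 0 \<Longrightarrow> ennreal a * (ennreal b * Z) = ennreal (a * b) * Z"
  by (simp add: ennreal_mult' mult.assoc)

text \<open>
  By rotation invariance the density of the zeros is the squared conformal factor times a constant,
  which integrates to the constant times the area $4\pi$ of the sphere.
\<close>

lemma expected_chart_zeros:
  assumes B: "B \<noteq> {}" and l: "l > 2"
  shows "(\<integral>\<^sup>+ c. zeros c UNIV * ennreal (gauss_weight B c) \<partial>lebesgue_on_coords B) =
     ennreal expected_count * (\<integral>\<^sup>+ c. ennreal (gauss_weight B c) \<partial>lebesgue_on_coords B)"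
proof -
  define \<tau> where "\<tau> = variance (sphere_chart 0)"
  have \<tau>: "variance (sphere_chart x) = \<tau>" for x unfolding \<tau>_def by (rule variance_const[OF norm_sphere_chart norm_sphere_chart])
  have \<tau>0: "\<tau> > 0" unfolding \<tau>_def by (rule variance_pos[OF B norm_sphere_chart])
  let ?Z = "\<integral>\<^sup>+ c. ennreal (gauss_weight B c) \<partial>lebesgue_on_coords B"
  \<comment> \<open>The variance of each component of the gradient field at \<open>x\<close>.\<close>
  define \<gamma> where "\<gamma> x = (conformal_factor x)\<^sup>2 * (l * \<tau> / 2)" for x
  define S where "S = sqrt ((l - 2) / (3 * l - 2))"
  define \<kappa> where "\<kappa> = expected_count / (4 * pi)"
  have mv: "expected_count \<ge> 0" unfolding expected_count_def using l by (intro add_nonneg_nonneg mult_nonneg_nonneg) auto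
  define h where "h x = ennreal ((conformal_factor x)\<^sup>2 * \<kappa>) * ?Z" for x
  note cm = measurable_conformal_factor
  have hc: "h x = ennreal ((conformal_factor x)\<^sup>2) * (ennreal \<kappa> * ?Z)" for x
    unfolding h_def by (simp add: ennreal_mult' mult.assoc)
  have hm: "h \<in> borel_measurable borel" unfolding hc[abs_def] by (rule borel_measurable_times_ennreal[OF cm borel_measurable_const])
  have sumip: "(\<Sum>i\<in>B. u i * v i) = ip B u v" for u v by (simp add: ip_def)
  have fld: "(\<Sum>i\<in>B. gradient_field i x $ 1 * w i) = conformal_factor x * ip B (\<lambda>b. d1 b (sphere_chart x) (frame1 x)) w"
    "(\<Sum>i\<in>B. gradient_field i x $ 2 * w i) = conformal_factor x * ip B (\<lambda>b. d1 b (sphere_chart x) (frame2 x)) w" for x w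
    unfolding ip_def sum_distrib_left by (auto intro!: sum.cong simp: gradient_field_frame)
  have fld2: "ip B w (\<lambda>i. gradient_field i x $ 1) = conformal_factor x * ip B (\<lambda>b. d1 b (sphere_chart x) (frame1 x)) w"
    "ip B w (\<lambda>i. gradient_field i x $ 2) = conformal_factor x * ip B (\<lambda>b. d1 b (sphere_chart x) (frame2 x)) w" for x w
    unfolding ip_commute[of B w] by (simp_all add: ip_def[of B "\<lambda>i. gradient_field i x $ _"] fld)
  have "(\<integral>\<^sup>+ c. zeros c UNIV * ennreal (gauss_weight B c) \<partial>lebesgue_on_coords B) = (\<integral>\<^sup>+ x. h x \<partial>lborel)"
  proof (rule expected_zeros[where \<gamma>=\<gamma> and T="\<lambda>x c. ennreal \<bar>critical_hessian_det x c\<bar>"])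
    fix x
    note G = jet_gram[OF chart_frame[of x], unfolded \<tau>]
    show "\<gamma> x > 0" using conformal_factor_pos[of x] \<tau>0 l by (simp add: \<gamma>_def)
    show "(\<Sum>i\<in>B. gradient_field i x $ 1 * gradient_field i x $ 1) = \<gamma> x" "(\<Sum>i\<in>B. gradient_field i x $ 2 * gradient_field i x $ 2) = \<gamma> x"
      "(\<Sum>i\<in>B. gradient_field i x $ 1 * gradient_field i x $ 2) = 0"
      unfolding fld fld2 G(1-3) ip_commute[of B "\<lambda>b. d1 b (sphere_chart x) (frame2 x)" "\<lambda>b. d1 b (sphere_chart x) (frame1 x)"]
      by (simp_all add: fld2 G(1-3) ip_commute[of B "\<lambda>b. d1 b (sphere_chart x) (frame2 x)" "\<lambda>b. d1 b (sphere_chart x) (frame1 x)"] \<gamma>_def power2_eq_square)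
    show "(\<lambda>c. ennreal \<bar>critical_hessian_det x c\<bar>) \<in> borel_measurable (lebesgue_on_coords B)"
    proof -
      have "(\<lambda>c. critical_hessian_det x c) \<in> borel_measurable (lebesgue_on_coords B)"
        unfolding critical_hessian_det_def
        by (intro borel_measurable_times borel_measurable_diff borel_measurable_add borel_measurable_divide borel_measurable_power
            borel_measurable_const measurable_linear_form)
      then show ?thesis by simp
    qed
    show "ennreal \<bar>critical_hessian_det x (\<lambda>i\<in>B. c i + s * gradient_field i x $ 1 + t * gradient_field i x $ 2)\<bar> = ennreal \<bar>critical_hessian_det x c\<bar>" for c s t
    proof -
      have shift: "(\<Sum>b\<in>B. w b * (\<lambda>i\<in>B. c i + s * gradient_field i x $ 1 + t * gradient_field i x $ 2) b) = (\<Sum>b\<in>B. w b * c b)"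
        if o: "ip B (\<lambda>b. d1 b (sphere_chart x) (frame1 x)) w = 0" "ip B (\<lambda>b. d1 b (sphere_chart x) (frame2 x)) w = 0" for w
      proof -
        have "(\<Sum>b\<in>B. w b * (\<lambda>i\<in>B. c i + s * gradient_field i x $ 1 + t * gradient_field i x $ 2) b) =
          (\<Sum>b\<in>B. w b * c b) + s * ip B w (\<lambda>i. gradient_field i x $ 1) + t * ip B w (\<lambda>i. gradient_field i x $ 2)"
          by (simp add: ip_def sum.distrib[symmetric] sum_distrib_left algebra_simps)
        then show ?thesis by (simp add: fld2 o)
      qed
      show ?thesis unfolding critical_hessian_det_def
        using G by (simp only: shift ip_commute[of B "\<lambda>b. d1 b (sphere_chart x) _" "\<lambda>b. b (sphere_chart x)"])
    qed
    show "ennreal \<bar>critical_hessian_det x c\<bar> = ennreal \<bar>det (matrix (F' c x))\<bar>" if "F c x = 0" for c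
      by (simp only: det_at_critical_point[OF that])
    show "h x = ennreal (1 / (2 * pi * \<gamma> x)) * (\<integral>\<^sup>+ c. ennreal \<bar>critical_hessian_det x c\<bar> * ennreal (gauss_weight B c) \<partial>lebesgue_on_coords B)"
    proof -
      define A where "A = conformal_factor x ^ 4 * (l\<^sup>2 * \<tau> / 4)"
      define C where "C = conformal_factor x ^ 4 * (l * (l - 2) * \<tau> / 8)"
      have AC: "A > 0" "C > 0" using conformal_factor_pos[of x] \<tau>0 l by (simp_all add: A_def C_def)
      obtain k p q r :: "(real^3 \<Rightarrow> real) \<Rightarrow> real" where n: "ip B k k = 1" "ip B p p = 1" "ip B q q = 1" "ip B r r = 1"
        and o: "ip B k p = 0" "ip B k q = 0" "ip B k r = 0" "ip B p q = 0"
        and hv: "\<And>c. critical_hessian_det x c = A * (\<Sum>i\<in>B. k i * c i)\<^sup>2 - C * ((\<Sum>i\<in>B. p i * c i)\<^sup>2 + (\<Sum>i\<in>B. q i * c i)\<^sup>2)"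
        by (rule critical_hessian_det_normalised[OF \<tau> \<tau>0 l, of x, folded A_def C_def]) (rule that, assumption+)
      have q: "C / (A + C) = (l - 2) / (3 * l - 2)"
      proof -
        \<comment> \<open>The common factor of \<open>C\<close> and \<open>A + C\<close>.\<close>
        define u where "u = conformal_factor x ^ 4 * (l * \<tau> / 8)"
        have u: "u > 0" using conformal_factor_pos[of x] \<tau>0 l by (simp add: u_def)
        have "C = u * (l - 2)" "A + C = u * (3 * l - 2)" by (simp_all add: A_def C_def u_def power2_eq_square field_simps)
        then show ?thesis using u by simp
      qed
      have I: "(\<integral>\<^sup>+ c. ennreal \<bar>critical_hessian_det x c\<bar> * ennreal (gauss_weight B c) \<partial>lebesgue_on_coords B) = ennreal (A - 2 * C + 4 * C * S) * ?Z"
        unfolding hv S_def q[symmetric]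
        by (rule nn_integral_gauss_quadratic[OF fin AC n[unfolded ip_def] o[unfolded ip_def]])
      have "1 / (2 * pi * \<gamma> x) * (A - 2 * C + 4 * C * S) = (conformal_factor x)\<^sup>2 * \<kappa>"
      proof -
        define v where "v = (conformal_factor x)\<^sup>2 * (l * \<tau> / 4)"
        have v: "v > 0" using conformal_factor_pos[of x] \<tau>0 l by (simp add: v_def)
        have "\<gamma> x = 2 * v" by (simp add: \<gamma>_def v_def)
        moreover have "A - 2 * C + 4 * C * S = v * (conformal_factor x)\<^sup>2 * expected_count"
        proof -
          have mvS: "expected_count = 2 + 2 * (l - 2) * S" by (simp add: expected_count_def S_def)
          show ?thesis unfolding mvS by (simp add: A_def C_def v_def power2_eq_square power4_eq_xxxx field_simps)
        qed
        ultimately show ?thesis using v by (simp add: \<kappa>_def)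
      qed
      moreover have "1 / (2 * pi * \<gamma> x) \<ge> 0" using conformal_factor_pos[of x] \<tau>0 l by (simp add: \<gamma>_def)
      ultimately show ?thesis unfolding I h_def by (simp only: ennreal_mult_lin)
    qed
  qed (rule hm)
  also have "\<dots> = (\<integral>\<^sup>+ x. ennreal ((conformal_factor x)\<^sup>2) * (ennreal \<kappa> * ?Z) \<partial>lborel)" by (simp only: hc)
  also have "\<dots> = ennreal (4 * pi) * (ennreal \<kappa> * ?Z)"
    using cm by (subst nn_integral_multc) (simp_all add: nn_integral_conformal_factor)
  also have "\<dots> = ennreal (4 * pi * \<kappa>) * ?Z" by (rule ennreal_mult_lin) simp
  also have "4 * pi * \<kappa> = expected_count" by (simp add: \<kappa>_def)
  finally show ?thesis .
qed

text \<open>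
  The gradient vanishes if and only if the sum of the squares of its components, a polynomial in
  the coefficients, does.
\<close>

lemma measurable_critical:
  assumes "p \<noteq> 0"
  shows "(\<lambda>c. of_bool (grad_S2 (lin_comb B c) p = 0) :: ennreal) \<in> borel_measurable (lebesgue_on_coords B)"
proof -
  have "grad_S2 (lin_comb B c) p = 0 \<longleftrightarrow> (\<Sum>e\<in>Basis. (\<Sum>b\<in>B. d1 b p e * c b)\<^sup>2) = 0" for c
  proof -
    have ex: "(\<Sum>b\<in>B. c b * d1 b p h) = (\<Sum>e\<in>Basis. (h \<bullet> e) * (\<Sum>b\<in>B. d1 b p e * c b))" for h
    proof -
      have "(\<Sum>b\<in>B. c b * d1 b p h) = (\<Sum>b\<in>B. \<Sum>e\<in>Basis. (h \<bullet> e) * (d1 b p e * c b))"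
        by (intro sum.cong refl) (simp add: d1_expand[OF smooth assms] sum_distrib_left mult_ac)
      also have "\<dots> = (\<Sum>e\<in>Basis. \<Sum>b\<in>B. (h \<bullet> e) * (d1 b p e * c b))" by (rule sum.swap)
      finally show ?thesis by (simp add: sum_distrib_left)
    qed
    have "(\<Sum>e\<in>Basis. (\<Sum>b\<in>B. d1 b p e * c b)\<^sup>2) = 0 \<longleftrightarrow> (\<forall>e\<in>Basis. (\<Sum>b\<in>B. d1 b p e * c b) = 0)"
      by (subst sum_nonneg_eq_0_iff) auto
    also have "\<dots> \<longleftrightarrow> (\<forall>h. (\<Sum>b\<in>B. c b * d1 b p h) = 0)"
    proof
      assume "\<forall>e\<in>Basis. (\<Sum>b\<in>B. d1 b p e * c b) = 0"
      then show "\<forall>h. (\<Sum>b\<in>B. c b * d1 b p h) = 0" by (simp add: ex)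
    next
      assume "\<forall>h. (\<Sum>b\<in>B. c b * d1 b p h) = 0"
      then show "\<forall>e\<in>Basis. (\<Sum>b\<in>B. d1 b p e * c b) = 0" by (simp add: mult.commute)
    qed
    finally show ?thesis using lin_comb_critical_iff[OF assms] by simp
  qed
  then have e: "(\<lambda>c. of_bool (grad_S2 (lin_comb B c) p = 0) :: ennreal) = (\<lambda>c. indicator {0} (\<Sum>e\<in>Basis. (\<Sum>b\<in>B. d1 b p e * c b)\<^sup>2))"
    by (simp add: fun_eq_iff indicator_def)
  have "(\<lambda>c. \<Sum>e\<in>Basis. (\<Sum>b\<in>B. d1 b p e * c b)\<^sup>2) \<in> borel_measurable (lebesgue_on_coords B)"
    by (intro borel_measurable_sum borel_measurable_power measurable_linear_form)
  then show ?thesis unfolding e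
    by (rule measurable_compose[OF _ borel_measurable_indicator]) simp
qed

lemma south_frame: "oriented_frame (axis 2 1) (axis 1 1) south"
  by (simp add: oriented_frame_def south_def norm_eq_1 inner_vec_def sum_3 cross3_def vec_eq_iff forall_3 axis_def)

text \<open>
  A critical point at a given position requires that a nonzero linear form of the coefficients
  vanishes.
\<close>

lemma critical_at_south_negligible:
  assumes B: "B \<noteq> {}" and l: "l > 0"
  shows "(\<integral>\<^sup>+ c. of_bool (grad_S2 (lin_comb B c) south = 0) * ennreal (gauss_weight B c) \<partial>lebesgue_on_coords B) = 0"
proof -
  have s: "norm south = 1" "south \<noteq> 0" using south_frame by (auto simp: oriented_frame_def)
  define \<mu> where "\<mu> = l * variance south / 2"
  have \<mu>: "\<mu> > 0" using variance_pos[OF B s(1)] l by (simp add: \<mu>_def)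
  define u where "u = (\<lambda>b. d1 b south (axis 2 1) / sqrt \<mu>)"
  define v where "v = (\<lambda>b. d1 b south (axis 1 1) / sqrt \<mu>)"
  have ipd: "(\<Sum>i\<in>B. (f i / a) * (g i / b)) = ip B f g / (a * b)" for f g and a b :: real
    by (simp add: ip_def sum_divide_distrib)
  note G = jet_gram(1-3)[OF south_frame, folded \<mu>_def]
  have n: "(\<Sum>i\<in>B. u i * u i) = 1" "(\<Sum>i\<in>B. v i * v i) = 1" "(\<Sum>i\<in>B. u i * v i) = 0"
    unfolding u_def v_def ipd G using \<mu> by simp_all
  define \<Psi> :: "real \<Rightarrow> real \<Rightarrow> ((real^3 \<Rightarrow> real) \<Rightarrow> real) \<Rightarrow> ennreal" where "\<Psi> x y c = indicator {0} x" for x y c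
  have \<Psi>m: "(\<lambda>(x, y, c). \<Psi> x y c) \<in> borel_measurable (borel \<Otimes>\<^sub>M borel \<Otimes>\<^sub>M lebesgue_on_coords B)"
    unfolding \<Psi>_def case_prod_unfold by (rule measurable_compose[OF measurable_fst borel_measurable_indicator]) simp
  have "(\<integral>\<^sup>+ c. of_bool (grad_S2 (lin_comb B c) south = 0) * ennreal (gauss_weight B c) \<partial>lebesgue_on_coords B)
    \<le> (\<integral>\<^sup>+ c. \<Psi> (\<Sum>i\<in>B. u i * c i) (\<Sum>i\<in>B. v i * c i) c * ennreal (gauss_weight B c) \<partial>lebesgue_on_coords B)"
  proof (rule nn_integral_mono, rule mult_right_mono)
    fix c
    have "(\<Sum>i\<in>B. u i * c i) = 0" if "grad_S2 (lin_comb B c) south = 0"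
    proof -
      have "(\<Sum>i\<in>B. c i * d1 i south (axis 2 1)) = 0" using that lin_comb_critical_iff[OF s(2)] by blast
      moreover have "(\<Sum>i\<in>B. u i * c i) = (\<Sum>i\<in>B. c i * d1 i south (axis 2 1)) / sqrt \<mu>"
        by (simp add: u_def sum_divide_distrib mult_ac)
      ultimately show ?thesis by simp
    qed
    then show "of_bool (grad_S2 (lin_comb B c) south = 0) \<le> \<Psi> (\<Sum>i\<in>B. u i * c i) (\<Sum>i\<in>B. v i * c i) c"
      by (auto simp: \<Psi>_def)
  qed simp
  also have "\<dots> = ennreal (1 / (2 * pi)) * (\<integral>\<^sup>+ x. \<integral>\<^sup>+ y. ennreal (exp (- (x\<^sup>2 + y\<^sup>2) / 2)) *
      (\<integral>\<^sup>+ c. \<Psi> x y c * ennreal (gauss_weight B c) \<partial>lebesgue_on_coords B) \<partial>lborel \<partial>lborel)"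
    by (rule orthonormal_gauss_weight_independent[OF fin n \<Psi>m]) (simp add: \<Psi>_def)
  also have "(\<integral>\<^sup>+ x. \<integral>\<^sup>+ y. ennreal (exp (- (x\<^sup>2 + y\<^sup>2) / 2)) *
      (\<integral>\<^sup>+ c. \<Psi> x y c * ennreal (gauss_weight B c) \<partial>lebesgue_on_coords B) \<partial>lborel \<partial>lborel) = (\<integral>\<^sup>+ x. 0 \<partial>(lborel :: real measure))"
  proof (rule nn_integral_cong_AE)
    have "AE x in lborel. x \<noteq> (0::real)" by (rule AE_lborel_singleton)
    then show "AE x in lborel. (\<integral>\<^sup>+ y. ennreal (exp (- (x\<^sup>2 + y\<^sup>2) / 2)) *
      (\<integral>\<^sup>+ c. \<Psi> x y c * ennreal (gauss_weight B c) \<partial>lebesgue_on_coords B) \<partial>lborel) = 0"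
      by eventually_elim (simp add: \<Psi>_def)
  qed
  finally show ?thesis by simp
qed

lemma measurable_num_critical_points:
  "(\<lambda>c. num_critical_points (lin_comb B c)) \<in> borel_measurable (lebesgue_on_coords B)"
proof -
  have "south \<noteq> 0" using south_frame by (auto simp: oriented_frame_def)
  then show ?thesis
    unfolding num_critical_points_eq using measurable_zeros[of UNIV "{}"]
    by (intro borel_measurable_add measurable_critical) auto
qed

lemma num_critical_points_scale:
  assumes "r > 0"
  shows "num_critical_points (lin_comb B (\<lambda>i\<in>B. r * c i)) = num_critical_points (lin_comb B c)"
proof -
  have "grad_S2 (lin_comb B (\<lambda>i\<in>B. r * c i)) p = 0 \<longleftrightarrow> grad_S2 (lin_comb B c) p = 0" if "norm p = 1" for p
  proof -
    have p: "p \<noteq> 0" using that by auto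
    have "(\<Sum>b\<in>B. (\<lambda>i\<in>B. r * c i) b * d1 b p h) = r * (\<Sum>b\<in>B. c b * d1 b p h)" for h
      by (simp add: sum_distrib_left mult_ac)
    then show ?thesis unfolding lin_comb_critical_iff[OF p] using assms by simp
  qed
  then have "{p \<in> sphere 0 1. grad_S2 (lin_comb B (\<lambda>i\<in>B. r * c i)) p = 0} = {p \<in> sphere 0 1. grad_S2 (lin_comb B c) p = 0}"
    by auto
  then show ?thesis by (simp add: num_critical_points_def)
qed

lemma ball_average_critical_points:
  assumes B: "B \<noteq> {}" and l: "l > 2"
  shows "(\<integral>\<^sup>+ c. num_critical_points (lin_comb B c) * indicator (punctured_ball B 1) c \<partial>lebesgue_on_coords B) /
     (\<integral>\<^sup>+ c. indicator (punctured_ball B 1) c \<partial>lebesgue_on_coords B) = ennreal expected_count"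
proof -
  let ?Z = "\<integral>\<^sup>+ c. ennreal (gauss_weight B c) \<partial>lebesgue_on_coords B"
  have s: "south \<noteq> 0" using south_frame by (auto simp: oriented_frame_def)
  have Z: "?Z \<noteq> 0" "?Z \<noteq> \<infinity>" unfolding nn_integral_gauss_weight_finite[OF fin] by simp_all
  have zm: "(\<lambda>c. zeros c UNIV) \<in> borel_measurable (lebesgue_on_coords B)" using measurable_zeros[of UNIV "{}"] by simp
  have gm: "(\<lambda>c. ennreal (gauss_weight B c)) \<in> borel_measurable (lebesgue_on_coords B)"
    by (rule measurable_compose[OF measurable_gauss_weight measurable_ennreal])
  have "(\<integral>\<^sup>+ c. num_critical_points (lin_comb B c) * ennreal (gauss_weight B c) \<partial>lebesgue_on_coords B) =
    (\<integral>\<^sup>+ c. zeros c UNIV * ennreal (gauss_weight B c) + of_bool (grad_S2 (lin_comb B c) south = 0) * ennreal (gauss_weight B c) \<partial>lebesgue_on_coords B)"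
    by (simp only: num_critical_points_eq distrib_right)
  also have "\<dots> = ennreal expected_count * ?Z"
    by (subst nn_integral_add)
       (use l in \<open>simp_all only: borel_measurable_times_ennreal[OF zm gm] borel_measurable_times_ennreal[OF measurable_critical[OF s] gm]
          expected_chart_zeros[OF B l] critical_at_south_negligible[OF B order.strict_trans[OF zero_less_numeral l]] add_0_right\<close>)
  finally have G: "(\<integral>\<^sup>+ c. num_critical_points (lin_comb B c) * ennreal (gauss_weight B c) \<partial>lebesgue_on_coords B) = ennreal expected_count * ?Z" .
  have "?thesis \<longleftrightarrow> ennreal expected_count * ?Z / ?Z = ennreal expected_count"
    using ball_average_eq_gauss_average[OF fin B measurable_num_critical_points num_critical_points_scale] by (simp only: G)
  then show ?thesis using Z by (simp add: ennreal_mult_divide_eq)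
qed

lemma lin_comb_inj: "inj_on (lin_comb B) (extensional B)"
proof (rule inj_onI)
  fix c d assume c: "c \<in> extensional B" "d \<in> extensional B" and eq: "lin_comb B c = lin_comb B d"
  have "(\<Sum>b\<in>B. (c b - d b) * b p) = 0" for p
    using fun_cong[OF eq, of p] by (simp add: lin_comb_def left_diff_distrib sum_subtractf)
  then have "c b = d b" if "b \<in> B" for b using independent[of "\<lambda>b. c b - d b" b] that by simp
  then show "c = d" using c by (intro extensionalityI)
qed

text \<open>
  The area measure of the sphere of functions is the image of the volume of the punctured unit ball
  of coefficients.  The count is constant along rays, so that its average over the sphere is that
  over the ball; the dimension, which is a factor of the area measure, cancels.
\<close>

lemma sphere_average_critical_points:
  assumes B: "B \<noteq> {}" and l: "l > 2"
  defines "M \<equiv> embed_measure (area_coord_sphere B) (lin_comb B)"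
  shows "(\<integral>\<^sup>+ v. num_critical_points v \<partial>M) / emeasure M (space M) = ennreal expected_count"
proof -
  let ?A = "area_coord_sphere B" and ?m = "\<lambda>c. num_critical_points (lin_comb B c)"
  let ?R = "restrict_space (lebesgue_on_coords B) (punctured_ball B 1)"
  let ?S = "restrict_space (PiM B (\<lambda>_. borel)) {x. L2_set x B = 1}"
  let ?f = "\<lambda>x. \<lambda>i\<in>B. x i / L2_set x B"
  have A: "?A = scale_measure (of_nat (card B)) (distr ?R ?S ?f)"
    unfolding area_coord_sphere_def punctured_ball_def ..
  have sp: "space ?A \<subseteq> extensional B"
    unfolding A by (auto simp: space_scale_measure space_restrict_space space_PiM PiE_def)
  have inj: "inj_on (lin_comb B) (space ?A)" by (rule inj_on_subset[OF lin_comb_inj sp])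
  have mS: "?m \<in> borel_measurable ?S"
    using measurable_num_critical_points unfolding measurable_cong_sets[OF sets_coords_borel refl] by (rule measurable_restrict_space1)
  have mA: "?m \<in> borel_measurable ?A" unfolding A using mS by simp
  have mM: "num_critical_points \<in> borel_measurable M"
    unfolding M_def by (rule measurable_embed_measure1[where g=num_critical_points and f="lin_comb B", OF mA])
  have pb: "punctured_ball B 1 \<inter> space (lebesgue_on_coords B) \<in> sets (lebesgue_on_coords B)"
  proof -
    have "punctured_ball B 1 \<inter> space (lebesgue_on_coords B) = (\<lambda>c. L2_set c B) -` {0<..1} \<inter> space (lebesgue_on_coords B)"
      by (auto simp: punctured_ball_def)
    then show ?thesis using measurable_sets[OF measurable_L2_set, of "{0<..1}"] by simp
  qed
  have fm: "?f \<in> ?R \<rightarrow>\<^sub>M ?S"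
  proof (rule measurable_restrict_space2)
    show "?f \<in> space ?R \<rightarrow> {x. L2_set x B = 1}"
    proof
      fix x assume "x \<in> space ?R"
      then have "L2_set x B > 0" by (simp add: space_restrict_space punctured_ball_def)
      then show "?f x \<in> {x. L2_set x B = 1}" using L2_set_scale[of "1 / L2_set x B" x B] by simp
    qed
    show "?f \<in> ?R \<rightarrow>\<^sub>M PiM B (\<lambda>_. borel)"
      by (rule measurable_restrict_space1, rule measurable_restrict, rule borel_measurable_divide[OF measurable_coord_lborel measurable_L2_set])
  qed
  have red: "(\<integral>\<^sup>+ c. g c \<partial>?A) = of_nat (card B) * (\<integral>\<^sup>+ c. g (?f c) * indicator (punctured_ball B 1) c \<partial>lebesgue_on_coords B)"
    if g: "g \<in> borel_measurable ?S" for g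
    unfolding A using g by (simp add: nn_integral_scale_measure nn_integral_distr[OF fm] nn_integral_restrict_space[OF pb])
  have hom: "?m (?f c) = ?m c" if "c \<in> punctured_ball B 1" for c
  proof -
    have "L2_set c B > 0" using that by (simp add: punctured_ball_def)
    then show ?thesis using num_critical_points_scale[of "1 / L2_set c B" c] by simp
  qed
  have num: "(\<integral>\<^sup>+ v. num_critical_points v \<partial>M) = of_nat (card B) * (\<integral>\<^sup>+ c. ?m c * indicator (punctured_ball B 1) c \<partial>lebesgue_on_coords B)"
  proof -
    have "(\<integral>\<^sup>+ v. num_critical_points v \<partial>M) = (\<integral>\<^sup>+ c. ?m c \<partial>?A)"
      unfolding M_def by (rule nn_integral_embed_measure'[OF inj mM[unfolded M_def]])
    also have "\<dots> = of_nat (card B) * (\<integral>\<^sup>+ c. ?m (?f c) * indicator (punctured_ball B 1) c \<partial>lebesgue_on_coords B)" by (rule red[OF mS])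
    also have "(\<integral>\<^sup>+ c. ?m (?f c) * indicator (punctured_ball B 1) c \<partial>lebesgue_on_coords B) = (\<integral>\<^sup>+ c. ?m c * indicator (punctured_ball B 1) c \<partial>lebesgue_on_coords B)"
      by (rule nn_integral_cong) (auto simp: hom indicator_def)
    finally show ?thesis .
  qed
  have den: "emeasure M (space M) = of_nat (card B) * (\<integral>\<^sup>+ c. indicator (punctured_ball B 1) c \<partial>lebesgue_on_coords B)"
  proof -
    have "emeasure M (space M) = (\<integral>\<^sup>+ v. 1 \<partial>M)" by simp
    also have "\<dots> = (\<integral>\<^sup>+ c. 1 \<partial>?A)"
      unfolding M_def by (rule nn_integral_embed_measure'[OF inj]) simp
    also have "\<dots> = of_nat (card B) * (\<integral>\<^sup>+ c. 1 * indicator (punctured_ball B 1) c \<partial>lebesgue_on_coords B)" by (rule red) simp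
    finally show ?thesis by simp
  qed
  have "card B > 0" using fin B by (simp add: card_gt_0_iff)
  then show ?thesis
    unfolding num den ball_average_critical_points[OF B l, symmetric]
    unfolding mult.commute[of "of_nat (card B)"] by (intro divide_mult_eq) simp_all
qed

end

section \<open>A nonzero eigenfunction\<close>

text \<open>
  A class of functions that is closed under differentiation away from the origin, so that
  differentiability once gives smoothness.
\<close>

inductive elementary :: "(real^3 \<Rightarrow> real) \<Rightarrow> bool" where
  const: "elementary (\<lambda>x. c)"
| coordinate: "elementary (\<lambda>x. x \<bullet> e)"
| norm_power: "elementary (\<lambda>x. (x \<bullet> x) powr \<alpha>)"
| add: "elementary F \<Longrightarrow> elementary G \<Longrightarrow> elementary (\<lambda>x. F x + G x)"
| mult: "elementary F \<Longrightarrow> elementary G \<Longrightarrow> elementary (\<lambda>x. F x * G x)"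

lemma elementary_derivative:
  assumes "elementary F"
  shows "\<exists>F'. (\<forall>x. x \<noteq> 0 \<longrightarrow> (F has_derivative (\<lambda>h. F' h x)) (at x)) \<and> (\<forall>h. elementary (F' h))"
  using assms
proof induction
  case (const c)
  show ?case by (rule exI[of _ "\<lambda>h x. 0"]) (simp add: elementary.const)
next
  case (coordinate e)
  have "((\<lambda>x. x \<bullet> e) has_derivative (\<lambda>h. h \<bullet> e)) (at x)" for x :: "real^3" by (auto intro!: derivative_eq_intros)
  then show ?case by (intro exI[of _ "\<lambda>h x. h \<bullet> e"]) (simp add: elementary.const)
next
  case (norm_power \<alpha>)
  have "elementary (\<lambda>x. 2 * \<alpha> * (x \<bullet> h) * (x \<bullet> x) powr (\<alpha> - 1))" for h
    by (rule elementary.mult[OF elementary.mult[OF elementary.const elementary.coordinate] elementary.norm_power])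
  then show ?case
    by (intro exI[of _ "\<lambda>h x. 2 * \<alpha> * (x \<bullet> h) * (x \<bullet> x) powr (\<alpha> - 1)"]) (simp add: powr_norm_has_derivative)
next
  case (add F G)
  then obtain F' G' where "\<forall>x. x \<noteq> 0 \<longrightarrow> (F has_derivative (\<lambda>h. F' h x)) (at x)" "\<forall>h. elementary (F' h)"
    "\<forall>x. x \<noteq> 0 \<longrightarrow> (G has_derivative (\<lambda>h. G' h x)) (at x)" "\<forall>h. elementary (G' h)" by auto
  then show ?case
    by (intro exI[of _ "\<lambda>h x. F' h x + G' h x"]) (auto intro!: has_derivative_add elementary.add)
next
  case (mult F G)
  then obtain F' G' where F: "\<forall>x. x \<noteq> 0 \<longrightarrow> (F has_derivative (\<lambda>h. F' h x)) (at x)" "\<forall>h. elementary (F' h)"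
    and G: "\<forall>x. x \<noteq> 0 \<longrightarrow> (G has_derivative (\<lambda>h. G' h x)) (at x)" "\<forall>h. elementary (G' h)" by auto
  have "elementary (\<lambda>x. F x * G' h x + F' h x * G x)" for h
    using mult.hyps F(2) G(2) by (intro elementary.add elementary.mult) auto
  moreover have "((\<lambda>x. F x * G x) has_derivative (\<lambda>h. F x * G' h x + F' h x * G x)) (at x)" if "x \<noteq> 0" for x
    by (rule has_derivative_mult) (use F(1) G(1) that in auto)
  ultimately show ?case by (intro exI[of _ "\<lambda>h x. F x * G' h x + F' h x * G x"]) simp
qed

lemma elementary_C_k: "elementary F \<Longrightarrow> C_k_on k (- {0}) F"
proof (induction k arbitrary: F)
  case (0 F)
  then obtain F' where "\<forall>x. x \<noteq> 0 \<longrightarrow> (F has_derivative (\<lambda>h. F' h x)) (at x)" using elementary_derivative by meson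
  then show ?case by (auto intro!: continuous_at_imp_continuous_on has_derivative_continuous)
next
  case (Suc k F)
  then obtain F' where F': "\<forall>x. x \<noteq> 0 \<longrightarrow> (F has_derivative (\<lambda>h. F' h x)) (at x)" "\<forall>h. elementary (F' h)"
    using elementary_derivative by meson
  have "C_k_on k (- {0}) (\<lambda>x. frechet_derivative F (at x) e)" for e
  proof -
    have "frechet_derivative F (at x) e = F' e x" if "x \<in> - {0}" for x
      using fun_cong[OF frechet_derivative_at[OF F'(1)[rule_format]], of x e] that by simp
    from C_k_on_cong[of "- {0}" "\<lambda>x. frechet_derivative F (at x) e" "F' e", OF _ this]
    show ?thesis using Suc.IH F'(2) by (simp add: open_Compl)
  qed
  then show ?case using F'(1) by (auto simp: differentiable_def)
qed

definition planar :: "real^3 \<Rightarrow> complex" where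
  "planar x = Complex (x $ 1) (x $ 2)"

text \<open>
  The sectoral spherical harmonic of degree \<open>n\<close>.
\<close>

definition sectoral :: "nat \<Rightarrow> real^3 \<Rightarrow> real" where
  "sectoral n x = (if norm x = 1 then Re (planar x ^ n) else 0)"

lemma planar_linear: "planar (x + y) = planar x + planar y" "planar (r *\<^sub>R x) = r *\<^sub>R planar x"
  by (simp_all add: planar_def complex_eq_iff)

lemma planar_power_has_derivative:
  "((\<lambda>x. Re (a * planar x ^ k)) has_derivative (\<lambda>h. Re (a * (of_nat k * planar x ^ (k - 1)) * planar h))) (at x)"
proof -
  have "bounded_linear planar"
    unfolding linear_conv_bounded_linear[symmetric]
    by (rule linearI) (simp_all only: planar_linear)
  then have p: "(planar has_derivative planar) (at x)" by (rule bounded_linear_imp_has_derivative)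
  have "((\<lambda>z. a * z ^ k) has_field_derivative a * (of_nat k * planar x ^ (k - 1))) (at (planar x))"
    by (auto intro!: derivative_eq_intros)
  from has_derivative_compose[OF p this[unfolded has_field_derivative_def]]
  show ?thesis by (rule has_derivative_Re)
qed

lemma elementary_planar_power: "elementary (\<lambda>x. Re (planar x ^ k)) \<and> elementary (\<lambda>x. Im (planar x ^ k))"
proof (induction k)
  case 0 show ?case by (simp add: elementary.const)
next
  case (Suc k)
  have c: "elementary (\<lambda>x. Re (planar x))" "elementary (\<lambda>x. Im (planar x))" "elementary (\<lambda>x. - Im (planar x))"
    using elementary.coordinate[of "axis 1 1"] elementary.coordinate[of "axis 2 1"] elementary.coordinate[of "- axis 2 1"]
    by (simp_all add: planar_def inner_axis)
  have "elementary (\<lambda>x. Re (planar x) * Re (planar x ^ k) + (- Im (planar x)) * Im (planar x ^ k))"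
    by (intro elementary.add elementary.mult) (use Suc c in auto)
  moreover have "elementary (\<lambda>x. Re (planar x) * Im (planar x ^ k) + Im (planar x) * Re (planar x ^ k))"
    by (intro elementary.add elementary.mult) (use Suc c in auto)
  ultimately show ?case by simp
qed

text \<open>
  The radial extension is $|x|^{-n}\,\mathrm{Re}(x_1 + i x_2)^n$.  The second factor is harmonic, because
  holomorphic functions of $x_1 + i x_2$ are, and homogeneous of degree \<open>n\<close>; with $\alpha = -n/2$ the
  Laplacian of the product on the unit sphere is $4\alpha n + 2\alpha(2\alpha+1) = -n(n+1)$ times the function.
\<close>

lemma sectoral_in_eigenspace:
  assumes n: "n \<ge> 1"
  shows "sectoral n \<in> laplace_eigenspace (real n * (real n + 1))"
proof -
  define \<alpha> where "\<alpha> = - real n / 2"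
  define W where "W y = Re (planar y ^ n)" for y
  define W1 where "W1 y h = Re (of_nat n * planar y ^ (n - 1) * planar h)" for y h
  define W2 where "W2 y e h = Re (of_nat n * planar e * (of_nat (n - 1) * planar y ^ (n - 1 - 1)) * planar h)" for y e h
  define p1 where "p1 y h = 2 * \<alpha> * (y \<bullet> h) * (y \<bullet> y) powr (\<alpha> - 1)" for y h :: "real^3"
  have dW: "(W has_derivative W1 y) (at y)" for y
    using planar_power_has_derivative[of 1 n y] unfolding W_def[abs_def] W1_def[abs_def] by simp
  have dW1: "((\<lambda>y. W1 y e) has_derivative W2 y e) (at y)" for y e
    using planar_power_has_derivative[of "of_nat n * planar e" "n - 1" y] unfolding W2_def[abs_def] W1_def[abs_def]
    by (simp add: mult_ac)
  have rad: "radial_ext (sectoral n) y = (y \<bullet> y) powr \<alpha> * W y" if "y \<noteq> 0" for y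
  proof -
    have ny: "norm y > 0" using that by simp
    have "y \<bullet> y = norm y powr 2" using ny by (simp add: dot_square_norm)
    then have "(y \<bullet> y) powr \<alpha> = norm y powr (2 * \<alpha>)" by (simp only: powr_powr)
    also have "\<dots> = inverse (norm y ^ n)" using ny by (simp add: \<alpha>_def powr_minus powr_realpow)
    finally have P: "(y \<bullet> y) powr \<alpha> = inverse (norm y ^ n)" .
    have "planar (sgn y) = of_real (inverse (norm y)) * planar y"
      unfolding sgn_div_norm planar_linear by (rule scaleR_conv_of_real)
    then have "planar (sgn y) ^ n = of_real (inverse (norm y) ^ n) * planar y ^ n" by (simp only: power_mult_distrib of_real_power)
    then have "Re (planar (sgn y) ^ n) = inverse (norm y) ^ n * W y" by (simp only: W_def Re_complex_of_real Im_complex_of_real times_complex.sel mult_zero_left diff_zero)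
    then show ?thesis using that by (simp add: radial_ext_def sectoral_def norm_sgn P power_inverse)
  qed
  have "elementary (\<lambda>y. (y \<bullet> y) powr \<alpha> * W y)"
    unfolding W_def using elementary_planar_power by (intro elementary.mult elementary.norm_power) auto
  then have s: "smooth_on_S2 (sectoral n)"
    unfolding smooth_on_S2_def using elementary_C_k C_k_on_cong[of "- {0}" "radial_ext (sectoral n)" "\<lambda>y. (y \<bullet> y) powr \<alpha> * W y"] rad
    by (simp add: open_Compl)
  have d1: "d1 (sectoral n) y e = (y \<bullet> y) powr \<alpha> * W1 y e + p1 y e * W y" if "y \<noteq> 0" for y e
  proof -
    have "((\<lambda>y. (y \<bullet> y) powr \<alpha> * W y) has_derivative (\<lambda>h. (y \<bullet> y) powr \<alpha> * W1 y h + p1 y h * W y)) (at y)"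
      unfolding p1_def by (rule has_derivative_mult[OF powr_norm_has_derivative[OF that] dW])
    then have "(radial_ext (sectoral n) has_derivative (\<lambda>h. (y \<bullet> y) powr \<alpha> * W1 y h + p1 y h * W y)) (at y)"
      by (rule has_derivative_transform_within_open[of _ _ _ _ "- {0}"]) (use that rad in auto)
    from fun_cong[OF frechet_derivative_at[OF this], of e] show ?thesis by (rule sym)
  qed
  have d2: "d2 (sectoral n) y e h = ((y \<bullet> y) powr \<alpha> * W2 y e h + p1 y h * W1 y e) + (p1 y e * W1 y h + powr_norm2 \<alpha> y e h * W y)"
    if "y \<noteq> 0" for y e h
  proof -
    let ?D = "\<lambda>h. ((y \<bullet> y) powr \<alpha> * W2 y e h + p1 y h * W1 y e) + (p1 y e * W1 y h + powr_norm2 \<alpha> y e h * W y)"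
    have "((\<lambda>y. (y \<bullet> y) powr \<alpha> * W1 y e + p1 y e * W y) has_derivative ?D) (at y)"
      unfolding p1_def
      by (rule has_derivative_add[OF has_derivative_mult[OF powr_norm_has_derivative[OF that] dW1]
            has_derivative_mult[OF powr_norm_has_derivative2[OF that] dW]])
    then have "((\<lambda>y. d1 (sectoral n) y e) has_derivative ?D) (at y)"
      by (rule has_derivative_transform_within_open[of _ _ _ _ "- {0}"]) (use that d1 in auto)
    from fun_cong[OF frechet_derivative_at[OF this], of h] show ?thesis unfolding d2_def by (rule sym)
  qed
  have lap: "(\<Sum>e\<in>Basis. d2 (sectoral n) p e e) = - (real n * (real n + 1)) * sectoral n p" if p: "norm p = 1" for p
  proof -
    have p0: "p \<noteq> 0" and pp: "p \<bullet> p = 1" using p by (auto simp: dot_square_norm)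
    have Basis3: "(Basis :: (real^3) set) = {axis 1 1, axis 2 1, axis 3 1}"
      by (auto simp: Basis_vec_def UNIV_3)
    have pl: "planar (axis 1 1) = 1" "planar (axis 2 1) = \<i>" "planar (axis 3 1) = 0"
      by (simp_all add: planar_def axis_def complex_eq_iff)
    have harm: "(\<Sum>e\<in>Basis. W2 p e e) = 0"
    proof -
      define a where "a = of_nat n * (of_nat (n - 1) * planar p ^ (n - 1 - 1))"
      have "W2 p e e = Re (a * (planar e * planar e))" for e by (simp only: W2_def a_def mult_ac)
      then show ?thesis unfolding Basis3 by (simp add: axis_eq_axis pl)
    qed
    have euler: "(\<Sum>e\<in>Basis. (p \<bullet> e) * W1 p e) = real n * W p"
    proof -
      have lin: "linear (W1 p)" using has_derivative_linear[OF dW] .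
      have "(\<Sum>e\<in>Basis. (p \<bullet> e) * W1 p e) = W1 p (\<Sum>e\<in>Basis. (p \<bullet> e) *\<^sub>R e)"
        by (simp add: linear_sum[OF lin] linear_cmul[OF lin])
      also have "\<dots> = Re (of_nat n * (planar p ^ (n - 1) * planar p))" by (simp add: euclidean_representation W1_def mult.assoc)
      also have "planar p ^ (n - 1) * planar p = planar p ^ n" by (rule power_minus_mult) (use n in simp)
      finally show ?thesis by (simp add: W_def)
    qed
    have "(\<Sum>e\<in>Basis. d2 (sectoral n) p e e) = (\<Sum>e\<in>Basis. W2 p e e) + 4 * \<alpha> * (\<Sum>e\<in>Basis. (p \<bullet> e) * W1 p e) + (\<Sum>e\<in>Basis. powr_norm2 \<alpha> p e e) * W p"
      unfolding d2[OF p0] p1_def sum_distrib_left sum_distrib_right sum.distrib[symmetric]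
      by (intro sum.cong refl) (simp add: pp)
    also have "\<dots> = (4 * \<alpha> * real n + 2 * \<alpha> * (3 + 2 * (\<alpha> - 1))) * W p"
      unfolding harm euler laplacian_powr_norm[OF p0] pp by (simp add: algebra_simps)
    also have "4 * \<alpha> * real n + 2 * \<alpha> * (3 + 2 * (\<alpha> - 1)) = - (real n * (real n + 1))" by (simp add: \<alpha>_def field_simps)
    also have "W p = sectoral n p" using p by (simp add: sectoral_def W_def)
    finally show ?thesis .
  qed
  have "sectoral n x = 0" if "norm x \<noteq> 1" for x using that by (simp add: sectoral_def)
  then show ?thesis using s lap by (simp add: laplace_eigenspace_iff)
qed

section \<open>The closed form of the mean and its asymptotics\<close>

text \<open>
  After division by $n^2$ the first factor tends to \<open>2\<close> and the square root to $1/\sqrt 3$.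
\<close>

lemma expected_count_asymptotics:
  "(\<lambda>n::nat. 2 + 2 * (real n * (real n + 1) - 2) * sqrt ((real n * (real n + 1) - 2) / (3 * (real n * (real n + 1)) - 2)))
     \<sim>[at_top] (\<lambda>n. 2 / sqrt 3 * (real n)\<^sup>2)"
proof (rule asymp_equivI'_const)
  let ?S = "\<lambda>n::nat. sqrt ((real n * (real n + 1) - 2) / (3 * (real n * (real n + 1)) - 2))"
  have "?S \<longlonglongrightarrow> (1 / 3) powr (1 / 2)" by real_asymp
  then have S: "?S \<longlonglongrightarrow> 1 / sqrt 3" by (simp add: powr_half_sqrt real_sqrt_divide)
  have a: "(\<lambda>n::nat. 2 / (real n)\<^sup>2) \<longlonglongrightarrow> 0" "(\<lambda>n::nat. 2 * (real n * (real n + 1) - 2) / (real n)\<^sup>2) \<longlonglongrightarrow> 2"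
    by real_asymp+
  have "(\<lambda>n. 2 / (real n)\<^sup>2 + 2 * (real n * (real n + 1) - 2) / (real n)\<^sup>2 * ?S n) \<longlonglongrightarrow> 0 + 2 * (1 / sqrt 3)"
    by (intro tendsto_add tendsto_mult a S)
  then show "(\<lambda>n::nat. (2 + 2 * (real n * (real n + 1) - 2) * ?S n) / (real n)\<^sup>2) \<longlonglongrightarrow> 2 / sqrt 3"
    by (simp add: add_divide_distrib)
qed simp

text \<open>
  The assumption ensures $n(n+1) > 2$; for $n = 1$ the trace-free Hessian vanishes identically and the
  Gaussian computation degenerates.
\<close>

lemma mean_critical_points_eigenspace:
  assumes n: "n \<ge> 2"
  shows "mean_critical_points (laplace_eigenspace (real n * (real n + 1))) =
    ennreal (2 + 2 * (real n * (real n + 1) - 2) * sqrt ((real n * (real n + 1) - 2) / (3 * (real n * (real n + 1)) - 2)))"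
proof -
  let ?V = "laplace_eigenspace (real n * (real n + 1))"
  define B where "B = (SOME B. orthonormal_basis ?V B)"
  have basis: "orthonormal_basis ?V B"
    unfolding B_def by (rule someI_ex[OF orthonormal_basis_eigenspace_exists])
  then interpret eigenbasis "real n * (real n + 1)" B by unfold_locales
  have "B \<noteq> {}"
  proof
    assume "B = {}"
    then have "sectoral n (axis 1 1) = 0"
      using sectoral_in_eigenspace[of n] n basis unfolding orthonormal_basis_def by (auto simp: lin_comb_def)
    moreover have "planar (axis 1 1) = 1" by (simp add: planar_def axis_def complex_eq_iff)
    ultimately show False by (simp add: sectoral_def norm_axis_1)
  qed
  moreover have "real n * (real n + 1) > 2"
  proof -
    have "2 * 3 \<le> real n * (real n + 1)" using n by (intro mult_mono) auto
    then show ?thesis by simp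
  qed
  moreover have "area_unit_sphere ?V = embed_measure (area_coord_sphere B) (lin_comb B)"
    by (simp add: area_unit_sphere_def B_def Let_def)
  ultimately show ?thesis
    unfolding mean_critical_points_def using sphere_average_critical_points by (simp add: expected_count_def)
qed

theorem theorem2p3:
  shows "(\<lambda>n::nat. enn2real (mean_critical_points (laplace_eigenspace (real n * (real n + 1)))))
           \<sim>[at_top] (\<lambda>n. 2 / sqrt 3 * (real n)\<^sup>2)"
proof -
  let ?m = "\<lambda>n::nat. 2 + 2 * (real n * (real n + 1) - 2) * sqrt ((real n * (real n + 1) - 2) / (3 * (real n * (real n + 1)) - 2))"
  have "enn2real (mean_critical_points (laplace_eigenspace (real n * (real n + 1)))) = ?m n" if "n \<ge> 2" for n
  proof -
    have "2 * 3 \<le> real n * (real n + 1)" using that by (intro mult_mono) auto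
    then have "?m n \<ge> 0" by (intro add_nonneg_nonneg mult_nonneg_nonneg) auto
    then show ?thesis by (simp only: mean_critical_points_eigenspace[OF that] enn2real_ennreal)
  qed
  then have "\<forall>\<^sub>F n in at_top. enn2real (mean_critical_points (laplace_eigenspace (real n * (real n + 1)))) = ?m n"
    using eventually_ge_at_top[of "2::nat"] by (rule eventually_mono[rotated])
  then have "?thesis \<longleftrightarrow> ?m \<sim>[at_top] (\<lambda>n. 2 / sqrt 3 * (real n)\<^sup>2)" by (rule asymp_equiv_cong) simp
  then show ?thesis using expected_count_asymptotics by blast
qed

end
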